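(* Let $A=KQ/I$ be a cyclic Nakayama algebra, where $Q$ has $n\ge 1$ vertices, and let $J$ be the ideal of $KQ$ generated by all arrows of $Q$. Then the following are equivalent: (i) $\operatorname{Irr}^{\tau}(A)=\operatorname{Irr}^{\tau^-}(A)$; (ii) $I=J^{(n-1)+nr}$ for some integer $r\ge 0$ (with $r\ge 1$ if $n=2$, and $r\ge 2$ if $n=1$).
   Context: $K$ is an algebraically closed field. A cyclic Nakayama algebra is $A=KQ/I$, where $Q$ is the cyclic quiver with vertices $1,\dots,n$ and arrows $1\to2\to\cdots\to n\to1$ (one loop if $n=1$), and $I$ is an ideal generated by a non-empty set of paths of length at least two. For an arrow $a$, $s(a)$ and $t(a)$ are its start and end. Modules are finite-dimensional left modules. For $\mathbf d\in\mathbb{N}^n$ let $\operatorname{rep}(Q,\mathbf d)=\prod_{a\in Q_1}\operatorname{Hom}_K(K^{d_{s(a)}},K^{d_{t(a)}})$ and $\operatorname{mod}(A,\mathbf d)=\{M\in\operatorname{rep}(Q,\mathbf d)\mid IM=0\}$, with the conjugation action of $G_{\mathbf d}=\prod_i\operatorname{GL}_{d_i}(K)$; $\mathcal O_M$ is the orbit of $M$. $\operatorname{Irr}(A)$ is the set of irreducible components of all the varieties $\operatorname{mod}(A,\mathbf d)$. For $M\in\operatorname{mod}(A,\mathbf d)$ let $\operatorname{mod}_M(A,\mathbf d)$ be the union of all irreducible components containing $M$; put $c(M)=\dim\operatorname{mod}_M(A,\mathbf d)-\dim\mathcal O_M$, $E(M)=\dim\operatorname{Hom}_A(M,\tau_A(M))$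 and $E^-(M)=\dim\operatorname{Hom}_A(\tau_A^-(M),M)$, where $\tau_A,\tau_A^-$ are the Auslander-Reiten translations. $M$ is $\tau$-regular (resp. $\tau^-$-regular) if $c(M)=E(M)$ (resp. $c(M)=E^-(M)$). $\operatorname{Irr}^{\tau}(A)$ (resp. $\operatorname{Irr}^{\tau^-}(A)$) is the set of components in $\operatorname{Irr}(A)$ containing a dense open subset of $\tau$-regular (resp. $\tau^-$-regular) modules. *)

theory Defs
  imports
    "Jordan_Normal_Form.VS_Connect"
    "HOL-Algebra.QuotRing"
    "HOL-Algebra.Ideal_Product"
    "HOL-Analysis.Abstract_Topology"
    "HOL-Library.Extended_Nat"
    "HOL-Computational_Algebra.Polynomial"
begin

section \<open>Modules over algebras that need not be commutative\<close>

text \<open>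
  An algebra over a field \<open>'k\<close> is a record \<open>A :: ('k, 'a) module\<close>, whose \<open>mult\<close> and \<open>one\<close> are the
  ring structure and whose \<open>smult\<close> is multiplication by scalars from \<open>'k\<close>.  A left module over \<open>A\<close>
  is a record \<open>M :: ('a, 'm) module\<close>, whose \<open>mult\<close> and \<open>one\<close> are meaningless.  The locale
  \<^locale>\<open>module\<close> is not applicable, since it requires a commutative ring.  Right modules are
  left modules over the opposite algebra.
\<close>

definition left_module :: "('k, 'a) module \<Rightarrow> ('a, 'm) module \<Rightarrow> bool" where
  "left_module A M \<longleftrightarrow> abelian_group M
     \<and> (\<forall>a\<in>carrier A. \<forall>x\<in>carrier M. a \<odot>\<^bsub>M\<^esub> x \<in> carrier M)
     \<and> (\<forall>a\<in>carrier A. \<forall>b\<in>carrier A. \<forall>x\<in>carrier M.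
          (a \<oplus>\<^bsub>A\<^esub> b) \<odot>\<^bsub>M\<^esub> x = a \<odot>\<^bsub>M\<^esub> x \<oplus>\<^bsub>M\<^esub> b \<odot>\<^bsub>M\<^esub> x)
     \<and> (\<forall>a\<in>carrier A. \<forall>x\<in>carrier M. \<forall>y\<in>carrier M.
          a \<odot>\<^bsub>M\<^esub> (x \<oplus>\<^bsub>M\<^esub> y) = a \<odot>\<^bsub>M\<^esub> x \<oplus>\<^bsub>M\<^esub> a \<odot>\<^bsub>M\<^esub> y)
     \<and> (\<forall>a\<in>carrier A. \<forall>b\<in>carrier A. \<forall>x\<in>carrier M.
          (a \<otimes>\<^bsub>A\<^esub> b) \<odot>\<^bsub>M\<^esub> x = a \<odot>\<^bsub>M\<^esub> (b \<odot>\<^bsub>M\<^esub> x))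
     \<and> (\<forall>x\<in>carrier M. \<one>\<^bsub>A\<^esub> \<odot>\<^bsub>M\<^esub> x = x)"

definition left_submodule :: "('k, 'a) module \<Rightarrow> 'm set \<Rightarrow> ('a, 'm) module \<Rightarrow> bool" where
  "left_submodule A L M \<longleftrightarrow> additive_subgroup L M
     \<and> (\<forall>a\<in>carrier A. \<forall>x\<in>L. a \<odot>\<^bsub>M\<^esub> x \<in> L)"

definition opposite :: "('k, 'a) module \<Rightarrow> ('k, 'a) module" where
  "opposite A = A\<lparr>mult := \<lambda>a b. b \<otimes>\<^bsub>A\<^esub> a\<rparr>"

definition Hom :: "('k, 'a) module \<Rightarrow> ('a, 'm) module \<Rightarrow> ('a, 'n) module \<Rightarrow> ('m \<Rightarrow> 'n) set" where
  "Hom A M N = LinearCombinations.module_hom A M N \<inter> extensional (carrier M)"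

definition Hom_space ::
  "('k, 'a) module \<Rightarrow> ('a, 'm) module \<Rightarrow> ('a, 'n) module \<Rightarrow> ('k, 'm \<Rightarrow> 'n) module" where
  "Hom_space A M N =
     \<lparr>carrier = Hom A M N, mult = undefined, one = undefined,
      zero = (\<lambda>x\<in>carrier M. \<zero>\<^bsub>N\<^esub>),
      add = (\<lambda>f g. \<lambda>x\<in>carrier M. f x \<oplus>\<^bsub>N\<^esub> g x),
      smult = (\<lambda>c f. \<lambda>x\<in>carrier M. (c \<odot>\<^bsub>A\<^esub> \<one>\<^bsub>A\<^esub>) \<odot>\<^bsub>N\<^esub> f x)\<rparr>"

definition dim_Hom ::
  "('k :: field, 'a) module \<Rightarrow> ('a, 'm) module \<Rightarrow> ('a, 'n) module \<Rightarrow> nat" where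
  "dim_Hom A M N = vectorspace.dim (class_ring :: 'k ring) (Hom_space A M N)"

definition quotient_module :: "('a, 'm) module \<Rightarrow> 'm set \<Rightarrow> ('a, 'm set) module" where
  "quotient_module M N =
     \<lparr>carrier = a_rcosets\<^bsub>M\<^esub> N, mult = undefined, one = undefined,
      zero = N, add = set_add M,
      smult = (\<lambda>a X. \<Union>x\<in>X. N +>\<^bsub>M\<^esub> (a \<odot>\<^bsub>M\<^esub> x))\<rparr>"

definition regular_module :: "('k, 'a) module \<Rightarrow> ('a, 'a) module" where
  "regular_module A = \<lparr>carrier = carrier A, mult = undefined, one = undefined,
     zero = \<zero>\<^bsub>A\<^esub>, add = add A, smult = mult A\<rparr>"

definition free_module :: "('k, 'a) module \<Rightarrow> nat \<Rightarrow> ('a, nat \<Rightarrow> 'a) module" where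
  "free_module A m =
     \<lparr>carrier = {..<m} \<rightarrow>\<^sub>E carrier A, mult = undefined, one = undefined,
      zero = (\<lambda>i\<in>{..<m}. \<zero>\<^bsub>A\<^esub>),
      add = (\<lambda>x y. \<lambda>i\<in>{..<m}. x i \<oplus>\<^bsub>A\<^esub> y i),
      smult = (\<lambda>a x. \<lambda>i\<in>{..<m}. a \<otimes>\<^bsub>A\<^esub> x i)\<rparr>"

section \<open>The Auslander-Reiten translations\<close>

text \<open>Finitely generated projective modules: direct summands of free modules of finite rank.\<close>

definition fg_projective :: "('k, 'a) module \<Rightarrow> ('a, 'm) module \<Rightarrow> bool" where
  "fg_projective A P \<longleftrightarrow> left_module A P \<and>
     (\<exists>m. \<exists>s\<in>Hom A P (free_module A m). \<exists>p\<in>Hom A (free_module A m) P.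
        \<forall>x\<in>carrier P. p (s x) = x)"

definition superfluous :: "('k, 'a) module \<Rightarrow> 'm set \<Rightarrow> ('a, 'm) module \<Rightarrow> bool" where
  "superfluous A N P \<longleftrightarrow>
     (\<forall>L. left_submodule A L P \<and> L <+>\<^bsub>P\<^esub> N = carrier P \<longrightarrow> L = carrier P)"

definition projective_cover ::
  "('k, 'a) module \<Rightarrow> ('a, 'p) module \<Rightarrow> ('a, 'm) module \<Rightarrow> ('p \<Rightarrow> 'm) \<Rightarrow> bool" where
  "projective_cover A P M h \<longleftrightarrow> fg_projective A P \<and> h \<in> Hom A P M
     \<and> h ` carrier P = carrier M \<and> superfluous A (a_kernel P M h) P"

text \<open>The presentation is \<open>P1 \<rightarrow> P0 \<rightarrow> M \<rightarrow> 0\<close> with maps \<open>f\<close> and \<open>g\<close>.\<close>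

definition min_proj_presentation ::
  "('k, 'a) module \<Rightarrow> ('a, 'm) module \<Rightarrow> ('a, 'p) module \<Rightarrow> ('p \<Rightarrow> 'q) \<Rightarrow>
   ('a, 'q) module \<Rightarrow> ('q \<Rightarrow> 'm) \<Rightarrow> bool" where
  "min_proj_presentation A M P1 f P0 g \<longleftrightarrow>
     projective_cover A P0 M g \<and>
     projective_cover A P1 (P0\<lparr>carrier := a_kernel P0 M g\<rparr>) f"

text \<open>\<open>Hom\<^sub>A(P, A)\<close> as a right module over \<open>A\<close>.\<close>

definition star :: "('k, 'a) module \<Rightarrow> ('a, 'm) module \<Rightarrow> ('a, 'm \<Rightarrow> 'a) module" where
  "star A P =
     \<lparr>carrier = Hom A P (regular_module A), mult = undefined, one = undefined,
      zero = (\<lambda>x\<in>carrier P. \<zero>\<^bsub>A\<^esub>),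
      add = (\<lambda>\<phi> \<psi>. \<lambda>x\<in>carrier P. \<phi> x \<oplus>\<^bsub>A\<^esub> \<psi> x),
      smult = (\<lambda>a \<phi>. \<lambda>x\<in>carrier P. \<phi> x \<otimes>\<^bsub>A\<^esub> a)\<rparr>"

text \<open>
  The transpose: the cokernel of \<open>Hom\<^sub>A(P0, A) \<rightarrow> Hom\<^sub>A(P1, A)\<close>, a module over the opposite algebra.
  It is independent of the choice of the presentation up to isomorphism.  Every finitely generated
  projective module is isomorphic to a submodule of some \<open>A\<^sup>m\<close>, hence to one with elements of type
  \<open>nat \<Rightarrow> 'a\<close>.
\<close>

definition AR_transpose ::
  "('k, 'a) module \<Rightarrow> ('a, 'm) module \<Rightarrow> ('a, ((nat \<Rightarrow> 'a) \<Rightarrow> 'a) set) module" where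
  "AR_transpose A M =
     (case (SOME (P1, f, P0, g). min_proj_presentation A M P1 f P0 g) of
        (P1 :: ('a, nat \<Rightarrow> 'a) module, f, P0 :: ('a, nat \<Rightarrow> 'a) module, g) \<Rightarrow>
          quotient_module (star A P1)
            ((\<lambda>\<phi>. compose (carrier P1) \<phi> f) ` carrier (star A P0)))"

text \<open>The \<open>'k\<close>-dual of a left module over \<open>A\<close>, a left module over the opposite algebra.\<close>

definition k_dual :: "('k :: field, 'a) module \<Rightarrow> ('a, 'm) module \<Rightarrow> ('a, 'm \<Rightarrow> 'k) module" where
  "k_dual A M =
     \<lparr>carrier = {\<phi> \<in> extensional (carrier M).
        (\<forall>x\<in>carrier M. \<forall>y\<in>carrier M. \<phi> (x \<oplus>\<^bsub>M\<^esub> y) = \<phi> x + \<phi> y) \<and>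
        (\<forall>c. \<forall>x\<in>carrier M. \<phi> ((c \<odot>\<^bsub>A\<^esub> \<one>\<^bsub>A\<^esub>) \<odot>\<^bsub>M\<^esub> x) = c * \<phi> x)},
      mult = undefined, one = undefined,
      zero = (\<lambda>x\<in>carrier M. 0),
      add = (\<lambda>\<phi> \<psi>. \<lambda>x\<in>carrier M. \<phi> x + \<psi> x),
      smult = (\<lambda>a \<phi>. \<lambda>x\<in>carrier M. \<phi> (a \<odot>\<^bsub>M\<^esub> x))\<rparr>"

definition AR_tau ::
  "('k :: field, 'a) module \<Rightarrow> ('a, 'm) module \<Rightarrow> ('a, ((nat \<Rightarrow> 'a) \<Rightarrow> 'a) set \<Rightarrow> 'k) module" where
  "AR_tau A M = k_dual (opposite A) (AR_transpose A M)"

definition AR_tau_minus ::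
  "('k :: field, 'a) module \<Rightarrow> ('a, 'm) module \<Rightarrow> ('a, ((nat \<Rightarrow> 'a) \<Rightarrow> 'a) set) module" where
  "AR_tau_minus A M = AR_transpose (opposite A) (k_dual A M)"

definition E_inv :: "('k :: field, 'a) module \<Rightarrow> ('a, 'm) module \<Rightarrow> nat" where
  "E_inv A M = dim_Hom A M (AR_tau A M)"

definition E_inv_minus :: "('k :: field, 'a) module \<Rightarrow> ('a, 'm) module \<Rightarrow> nat" where
  "E_inv_minus A M = dim_Hom A (AR_tau_minus A M) M"

section \<open>The path algebra of the cyclic quiver\<close>

text \<open>
  The vertices are \<open>0, \<dots>, n - 1\<close>, with one arrow \<open>i \<rightarrow> (i + 1) mod n\<close> for each vertex \<open>i\<close>.  The path
  of length \<open>l\<close> starting at \<open>i\<close> is the pair \<open>(i, l)\<close>; it ends at \<open>(i + l) mod n\<close>.  Elements of the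
  path algebra are finitely supported functions on paths.
\<close>

definition paths :: "nat \<Rightarrow> (nat \<times> nat) set" where
  "paths n = {..<n} \<times> UNIV"

text \<open>
  Paths are multiplied like functions, \<open>x \<otimes> y\<close> meaning first \<open>y\<close>, then \<open>x\<close>, so that left modules are
  covariant representations.
\<close>

definition path_algebra :: "nat \<Rightarrow> ('k :: field, nat \<times> nat \<Rightarrow> 'k) module" where
  "path_algebra n =
     \<lparr>carrier = {x. finite {p. x p \<noteq> 0} \<and> {p. x p \<noteq> 0} \<subseteq> paths n},
      mult = (\<lambda>x y (i, l). \<Sum>k\<le>l. x ((i + k) mod n, l - k) * y (i, k)),
      one = (\<lambda>(i, l). if i < n \<and> l = 0 then 1 else 0),
      zero = (\<lambda>_. 0),
      add = (\<lambda>x y p. x p + y p),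
      smult = (\<lambda>c x p. c * x p)\<rparr>"

definition path_elt :: "nat \<times> nat \<Rightarrow> nat \<times> nat \<Rightarrow> 'k :: field" where
  "path_elt p q = (if q = p then 1 else 0)"

definition nakayama_ideal :: "nat \<Rightarrow> (nat \<times> nat \<Rightarrow> 'k :: field) set \<Rightarrow> bool" where
  "nakayama_ideal n I \<longleftrightarrow>
     (\<exists>R \<subseteq> paths n. R \<noteq> {} \<and> (\<forall>(i, l)\<in>R. 2 \<le> l) \<and> I = Idl\<^bsub>path_algebra n\<^esub> (path_elt ` R))"

definition arrow_ideal :: "nat \<Rightarrow> (nat \<times> nat \<Rightarrow> 'k :: field) set" where
  "arrow_ideal n = Idl\<^bsub>path_algebra n\<^esub> (path_elt ` {(i, 1) | i. i < n})"

primrec ideal_power :: "('a, 'b) ring_scheme \<Rightarrow> 'a set \<Rightarrow> nat \<Rightarrow> 'a set" where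
  "ideal_power R J 0 = carrier R"
| "ideal_power R J (Suc m) = ideal_prod R (ideal_power R J m) J"

definition quotient_algebra :: "('k, 'a) module \<Rightarrow> 'a set \<Rightarrow> ('k, 'a set) module" where
  "quotient_algebra B I =
     \<lparr>carrier = carrier (B Quot I), mult = mult (B Quot I), one = one (B Quot I),
      zero = zero (B Quot I), add = add (B Quot I),
      smult = (\<lambda>c X. \<Union>x\<in>X. I +>\<^bsub>B\<^esub> (c \<odot>\<^bsub>B\<^esub> x))\<rparr>"

abbreviation nakayama_algebra ::
  "nat \<Rightarrow> (nat \<times> nat \<Rightarrow> 'k :: field) set \<Rightarrow> ('k, (nat \<times> nat \<Rightarrow> 'k) set) module" where
  "nakayama_algebra n I \<equiv> quotient_algebra (path_algebra n) I"

section \<open>Representations\<close>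

definition dim_vectors :: "nat \<Rightarrow> (nat \<Rightarrow> nat) set" where
  "dim_vectors n = {..<n} \<rightarrow>\<^sub>E UNIV"

definition rep :: "nat \<Rightarrow> (nat \<Rightarrow> nat) \<Rightarrow> (nat \<Rightarrow> 'k :: field mat) set" where
  "rep n d = (\<Pi>\<^sub>E i\<in>{..<n}. carrier_mat (d ((i + 1) mod n)) (d i))"

primrec path_mat ::
  "nat \<Rightarrow> (nat \<Rightarrow> nat) \<Rightarrow> (nat \<Rightarrow> 'k :: field mat) \<Rightarrow> nat \<Rightarrow> nat \<Rightarrow> 'k mat" where
  "path_mat n d M i 0 = 1\<^sub>m (d i)"
| "path_mat n d M i (Suc l) = M ((i + l) mod n) * path_mat n d M i l"

text \<open>The direct sum of the spaces at the vertices, and the action of the path algebra on it.\<close>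

definition rep_space :: "nat \<Rightarrow> (nat \<Rightarrow> nat) \<Rightarrow> (nat \<Rightarrow> 'k :: field vec) set" where
  "rep_space n d = (\<Pi>\<^sub>E i\<in>{..<n}. carrier_vec (d i))"

definition path_action ::
  "nat \<Rightarrow> (nat \<Rightarrow> nat) \<Rightarrow> (nat \<Rightarrow> 'k :: field mat) \<Rightarrow> (nat \<times> nat \<Rightarrow> 'k) \<Rightarrow>
   (nat \<Rightarrow> 'k vec) \<Rightarrow> nat \<Rightarrow> 'k vec" where
  "path_action n d M x v =
     (\<lambda>j\<in>{..<n}. vec (d j) (\<lambda>r.
        \<Sum>(i, l)\<in>{(i, l). x (i, l) \<noteq> 0 \<and> (i + l) mod n = j}.
          x (i, l) * (path_mat n d M i l *\<^sub>v v i) $ r))"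

definition mod_variety ::
  "nat \<Rightarrow> (nat \<times> nat \<Rightarrow> 'k :: field) set \<Rightarrow> (nat \<Rightarrow> nat) \<Rightarrow> (nat \<Rightarrow> 'k mat) set" where
  "mod_variety n I d =
     {M \<in> rep n d. \<forall>x\<in>I. \<forall>v\<in>rep_space n d. path_action n d M x v = (\<lambda>i\<in>{..<n}. 0\<^sub>v (d i))}"

text \<open>
  The module over \<open>KQ/I\<close> given by a point of \<^const>\<open>mod_variety\<close>; the action of a coset does not
  depend on the representative, as \<open>I\<close> acts by zero.
\<close>

definition rep_module ::
  "nat \<Rightarrow> (nat \<Rightarrow> nat) \<Rightarrow> (nat \<Rightarrow> 'k :: field mat) \<Rightarrow>
   ((nat \<times> nat \<Rightarrow> 'k) set, nat \<Rightarrow> 'k vec) module" where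
  "rep_module n d M =
     \<lparr>carrier = rep_space n d, mult = undefined, one = undefined,
      zero = (\<lambda>i\<in>{..<n}. 0\<^sub>v (d i)),
      add = (\<lambda>v w. \<lambda>i\<in>{..<n}. v i + w i),
      smult = (\<lambda>X v. path_action n d M (SOME x. x \<in> X) v)\<rparr>"

abbreviation GL :: "nat \<Rightarrow> 'k :: field mat set" where
  "GL m \<equiv> Units (ring_mat TYPE('k) m ())"

definition rep_orbit ::
  "nat \<Rightarrow> (nat \<Rightarrow> nat) \<Rightarrow> (nat \<Rightarrow> 'k :: field mat) \<Rightarrow> (nat \<Rightarrow> 'k mat) set" where
  "rep_orbit n d M =
     {(\<lambda>i\<in>{..<n}. g ((i + 1) mod n) * M i * inv\<^bsub>ring_mat TYPE('k) (d i) ()\<^esub> (g i)) | g.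
        g \<in> (\<Pi>\<^sub>E i\<in>{..<n}. GL (d i))}"

section \<open>The Zariski topology\<close>

inductive_set regular_functions ::
  "nat \<Rightarrow> (nat \<Rightarrow> nat) \<Rightarrow> ((nat \<Rightarrow> 'k :: field mat) \<Rightarrow> 'k) set"
  for n :: nat and d :: "nat \<Rightarrow> nat" where
  const: "(\<lambda>_. c) \<in> regular_functions n d"
| coord: "i < n \<Longrightarrow> r < d ((i + 1) mod n) \<Longrightarrow> s < d i \<Longrightarrow>
    (\<lambda>M. M i $$ (r, s)) \<in> regular_functions n d"
| add: "f \<in> regular_functions n d \<Longrightarrow> g \<in> regular_functions n d \<Longrightarrow>
    (\<lambda>M. f M + g M) \<in> regular_functions n d"
| mult: "f \<in> regular_functions n d \<Longrightarrow> g \<in> regular_functions n d \<Longrightarrow>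
    (\<lambda>M. f M * g M) \<in> regular_functions n d"

definition zero_locus ::
  "nat \<Rightarrow> (nat \<Rightarrow> nat) \<Rightarrow> ((nat \<Rightarrow> 'k :: field mat) \<Rightarrow> 'k) set \<Rightarrow> (nat \<Rightarrow> 'k mat) set" where
  "zero_locus n d F = {M \<in> rep n d. \<forall>f\<in>F. f M = 0}"

definition zariski :: "nat \<Rightarrow> (nat \<Rightarrow> nat) \<Rightarrow> (nat \<Rightarrow> 'k :: field mat) topology" where
  "zariski n d = topology (\<lambda>U. \<exists>F \<subseteq> regular_functions n d. U = rep n d - zero_locus n d F)"

lemma istopology_zariski:
  "istopology (\<lambda>U. \<exists>F \<subseteq> regular_functions n d.
     U = rep n d - zero_locus n d (F :: ((nat \<Rightarrow> 'k :: field mat) \<Rightarrow> 'k) set))"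
  unfolding istopology_def
proof (intro conjI allI impI)
  fix U V :: "(nat \<Rightarrow> 'k mat) set"
  assume "\<exists>F \<subseteq> regular_functions n d. U = rep n d - zero_locus n d F"
    and "\<exists>F \<subseteq> regular_functions n d. V = rep n d - zero_locus n d F"
  then obtain F G where FG: "F \<subseteq> regular_functions n d" "U = rep n d - zero_locus n d F"
    "G \<subseteq> regular_functions n d" "V = rep n d - zero_locus n d G"
    by blast
  let ?H = "(\<lambda>p M. fst p M * snd p M) ` (F \<times> G)"
  have "?H \<subseteq> regular_functions n d"
  proof (rule image_subsetI)
    fix p assume "p \<in> F \<times> G"
    then have "fst p \<in> regular_functions n d" "snd p \<in> regular_functions n d"
      using FG(1,3) by auto
    then show "(\<lambda>M. fst p M * snd p M) \<in> regular_functions n d"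
      by (rule regular_functions.mult)
  qed
  moreover have "zero_locus n d ?H = zero_locus n d F \<union> zero_locus n d G"
  proof (rule Set.set_eqI)
    fix M
    have "M \<in> zero_locus n d ?H \<longleftrightarrow> M \<in> rep n d \<and> (\<forall>f\<in>F. \<forall>g\<in>G. f M * g M = 0)"
      by (simp add: zero_locus_def)
    then show "M \<in> zero_locus n d ?H \<longleftrightarrow> M \<in> zero_locus n d F \<union> zero_locus n d G"
      unfolding zero_locus_def by (simp, blast)
  qed
  then have "U \<inter> V = rep n d - zero_locus n d ?H"
    unfolding FG(2,4) by (simp only: Diff_Un)
  ultimately show "\<exists>F \<subseteq> regular_functions n d. U \<inter> V = rep n d - zero_locus n d F"
    by blast
next
  fix \<U> :: "(nat \<Rightarrow> 'k mat) set set"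
  assume "\<forall>U\<in>\<U>. \<exists>F \<subseteq> regular_functions n d. U = rep n d - zero_locus n d F"
  then obtain F where F: "\<forall>U\<in>\<U>. F U \<subseteq> regular_functions n d \<and> U = rep n d - zero_locus n d (F U)"
    by (rule bchoice[THEN exE])
  let ?H = "\<Union>U\<in>\<U>. F U"
  have H: "?H \<subseteq> regular_functions n d"
    using F by blast
  have "(\<lambda>U. U) ` \<U> = (\<lambda>U. rep n d - zero_locus n d (F U)) ` \<U>"
    by (rule image_cong) (use F in blast)+
  then have "\<Union>\<U> = (\<Union>U\<in>\<U>. rep n d - zero_locus n d (F U))"
    by simp
  also have "\<dots> = rep n d - zero_locus n d ?H"
    unfolding zero_locus_def by blast
  finally show "\<exists>F \<subseteq> regular_functions n d. \<Union>\<U> = rep n d - zero_locus n d F"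
    using H by blast
qed

lemma openin_zariski:
  "openin (zariski n d) U \<longleftrightarrow> (\<exists>F \<subseteq> regular_functions n d. U = rep n d - zero_locus n d F)"
  unfolding zariski_def topology_inverse'[OF istopology_zariski] ..

definition irreducible_set :: "'a topology \<Rightarrow> 'a set \<Rightarrow> bool" where
  "irreducible_set X S \<longleftrightarrow> S \<subseteq> topspace X \<and> S \<noteq> {} \<and>
     (\<forall>A B. closedin X A \<and> closedin X B \<and> S \<subseteq> A \<union> B \<longrightarrow> S \<subseteq> A \<or> S \<subseteq> B)"

definition irreducible_components :: "'a topology \<Rightarrow> 'a set \<Rightarrow> 'a set set" where
  "irreducible_components X V =
     {C. C \<subseteq> V \<and> irreducible_set X C \<and>
         (\<forall>C'. C' \<subseteq> V \<and> irreducible_set X C' \<and> C \<subseteq> C' \<longrightarrow> C' = C)}"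

definition krull_dim :: "'a topology \<Rightarrow> 'a set \<Rightarrow> enat" where
  "krull_dim X V =
     Sup {enat m | m. \<exists>Z :: nat \<Rightarrow> 'a set.
       (\<forall>i\<le>m. irreducible_set X (Z i) \<and> closedin (subtopology X V) (Z i)) \<and>
       (\<forall>i<m. Z i \<subset> Z (Suc i))}"

section \<open>Regular components\<close>

definition mod_union ::
  "nat \<Rightarrow> (nat \<times> nat \<Rightarrow> 'k :: field) set \<Rightarrow> (nat \<Rightarrow> nat) \<Rightarrow> (nat \<Rightarrow> 'k mat) \<Rightarrow>
   (nat \<Rightarrow> 'k mat) set" where
  "mod_union n I d M =
     \<Union>{C \<in> irreducible_components (zariski n d) (mod_variety n I d). M \<in> C}"

text \<open>Both dimensions are finite, and the first one is at least the second one.\<close>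

definition c_inv ::
  "nat \<Rightarrow> (nat \<times> nat \<Rightarrow> 'k :: field) set \<Rightarrow> (nat \<Rightarrow> nat) \<Rightarrow> (nat \<Rightarrow> 'k mat) \<Rightarrow> enat" where
  "c_inv n I d M =
     krull_dim (zariski n d) (mod_union n I d M) - krull_dim (zariski n d) (rep_orbit n d M)"

definition tau_regular ::
  "nat \<Rightarrow> (nat \<times> nat \<Rightarrow> 'k :: field) set \<Rightarrow> (nat \<Rightarrow> nat) \<Rightarrow> (nat \<Rightarrow> 'k mat) \<Rightarrow> bool" where
  "tau_regular n I d M \<longleftrightarrow>
     c_inv n I d M = enat (E_inv (nakayama_algebra n I) (rep_module n d M))"

definition tau_minus_regular ::
  "nat \<Rightarrow> (nat \<times> nat \<Rightarrow> 'k :: field) set \<Rightarrow> (nat \<Rightarrow> nat) \<Rightarrow> (nat \<Rightarrow> 'k mat) \<Rightarrow> bool" where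
  "tau_minus_regular n I d M \<longleftrightarrow>
     c_inv n I d M = enat (E_inv_minus (nakayama_algebra n I) (rep_module n d M))"

text \<open>Components are recorded together with their dimension vectors.\<close>

definition Irr ::
  "nat \<Rightarrow> (nat \<times> nat \<Rightarrow> 'k :: field) set \<Rightarrow> ((nat \<Rightarrow> nat) \<times> (nat \<Rightarrow> 'k mat) set) set" where
  "Irr n I =
     (SIGMA d:dim_vectors n. irreducible_components (zariski n d) (mod_variety n I d))"

definition generically ::
  "'a topology \<Rightarrow> 'a set \<Rightarrow> ('a \<Rightarrow> bool) \<Rightarrow> bool" where
  "generically X C P \<longleftrightarrow>
     (\<exists>U. openin (subtopology X C) U \<and> Abstract_Topology.closure_of (subtopology X C) U = C \<and> (\<forall>x\<in>U. P x))"

definition Irr_tau ::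
  "nat \<Rightarrow> (nat \<times> nat \<Rightarrow> 'k :: field) set \<Rightarrow> ((nat \<Rightarrow> nat) \<times> (nat \<Rightarrow> 'k mat) set) set" where
  "Irr_tau n I = {(d, C) \<in> Irr n I. generically (zariski n d) C (tau_regular n I d)}"

definition Irr_tau_minus ::
  "nat \<Rightarrow> (nat \<times> nat \<Rightarrow> 'k :: field) set \<Rightarrow> ((nat \<Rightarrow> nat) \<times> (nat \<Rightarrow> 'k mat) set) set" where
  "Irr_tau_minus n I = {(d, C) \<in> Irr n I. generically (zariski n d) C (tau_minus_regular n I d)}"

end

theory Submission
 imports Defs
begin

text \<open>
 The ideal is spanned by the paths that start at some vertex \<open>i\<close> and have length at least \<open>c i\<close>, where
 \<open>c i \<le> c (i + 1) + 1\<close>.  Every module is a direct sum of uniserial ones, and explicit minimal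
 presentations show that \<open>E\<close> and \<open>E\<^sup>-\<close> count certain paths between pairs of summands.  If all \<open>c i\<close> are
 equal to some \<open>L\<close> such that \<open>n\<close> divides \<open>L + 1\<close>, a bijection gives \<open>E = E\<^sup>-\<close> for every module.

 If \<open>n\<close> does not divide \<open>c i + 1\<close>, add to the projective module at \<open>i\<close> the simple module at the vertex
 that follows its socle.  For this module \<open>E = 0\<close> and \<open>E\<^sup>- > 0\<close>.  Its orbit is the locus where the path of
 length \<open>c i - 1\<close> from \<open>i\<close> acts nontrivially, so it is open, and its closure is a component, of the same
 dimension as the orbit, that is generically \<open>\<tau>\<close>-regular but not \<open>\<tau>\<^sup>-\<close>-regular.  So if the two sets of
 components agree, every \<open>c i\<close> is \<open>-1\<close> modulo \<open>n\<close>, and then \<open>c\<close> is constant.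

 That an orbit and its closure have the same dimension is derived from the growth in \<open>t\<close> of the number
 of linearly independent polynomial functions of degree at most \<open>t\<close>.
\<close>

text \<open>Why the added simple module works: let \<open>w\<close> be the vertex after the socle of
  the projective \<open>P\<close> at \<open>i\<close>. Since every projective has length at least
  two, \<tau> and its inverse move a simple module one step along the cycle: the simple at
  \<open>w\<close> goes to \<open>w + 1\<close> under \<tau>, and to \<open>w - 1\<close> under the
  inverse. The latter simple is the socle of \<open>P\<close>, so \<open>E\<^sup>-\<close> is
  positive. The former is a quotient of the test module only if \<open>w + 1\<close> is
  \<open>i\<close> or \<open>w\<close>, that is, if \<open>n\<close> divides \<open>c i + 1\<close>
  or \<open>n = 1\<close>; both are excluded when \<open>n\<close> does not divide
  \<open>c i + 1\<close>. Two features of the definitions shape the proof. The translations depend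
  on an arbitrary choice of a minimal presentation, so uniqueness of projective covers precedes
  every computation. Krull dimension is given by chains only, so the dimension of an orbit is caught
  between a chain inside it and a growth bound for its closure with the same exponent. Everything
  about modules is done over an abstract algebra with a basis of paths. The opposite algebra is of
  the same kind, so \<open>E\<^sup>-\<close> is obtained as \<open>E\<close> of the dual
  module.\<close>

abbreviation smult_in ("(_ *[_] _)" [70, 0, 71] 70) where "a *[M] x \<equiv> a \<odot>\<^bsub>M\<^esub> x"
abbreviation add_in ("(_ +[_] _)" [65, 0, 66] 65) where "x +[M] y \<equiv> x \<oplus>\<^bsub>M\<^esub> y"

section \<open>Modules over unital algebras\<close>

text \<open>\<open>Hom_space\<close> and \<open>k_dual\<close> let the field act on a module only
  through the elements \<open>c \<odot> \<one>\<close>, so the axioms concern just these: they form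
  a central image of the field.\<close>

locale unital_algebra = ring A for A :: "('k :: field, 'a) module" (structure) +
 assumes scalar_closed: "c \<odot> \<one> \<in> carrier A"
  and scalar_add: "(c + d) \<odot> \<one> = c \<odot> \<one> \<oplus> d \<odot> \<one>"
  and scalar_mult: "(c * d) \<odot> \<one> = (c \<odot> \<one>) \<otimes> (d \<odot> \<one>)"
  and scalar_one: "1 \<odot> \<one> = \<one>"
  and scalar_comm: "x \<in> carrier A ==> (c \<odot> \<one>) \<otimes> x = x \<otimes> (c \<odot> \<one>)"

abbreviation scalar :: "('k, 'a) module => 'k => 'a" where
 "scalar A c \<equiv> c *[A] \<one>\<^bsub>A\<^esub>"

lemma lmod_abelian_group: "left_module A M ==> abelian_group M"
 by (simp add: left_module_def)

lemma lmod_smult_closed: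
 "left_module A M ==> a \<in> carrier A ==> x \<in> carrier M ==> a *[M] x \<in> carrier M"
 by (simp add: left_module_def)

lemma lmod_smult_l_distr:
 "left_module A M ==> a \<in> carrier A ==> b \<in> carrier A ==> x \<in> carrier M ==>
  (a +[A] b) *[M] x = a *[M] x +[M] b *[M] x"
 by (simp add: left_module_def)

lemma lmod_smult_r_distr:
 "left_module A M ==> a \<in> carrier A ==> x \<in> carrier M ==> y \<in> carrier M ==>
  a *[M] (x +[M] y) = a *[M] x +[M] a *[M] y"
 by (simp add: left_module_def)

lemma lmod_assoc:
 "left_module A M ==> a \<in> carrier A ==> b \<in> carrier A ==> x \<in> carrier M ==>
  (a \<otimes>\<^bsub>A\<^esub> b) *[M] x = a *[M] (b *[M] x)"
 by (simp add: left_module_def)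

lemma lmod_one: "left_module A M ==> x \<in> carrier M ==> \<one>\<^bsub>A\<^esub> *[M] x = x"
 by (simp add: left_module_def)

lemma abelian_group_eq_zero:
 assumes "abelian_group M" "x \<in> carrier M" "x +[M] x = x"
 shows "x = \<zero>\<^bsub>M\<^esub>"
proof -
 interpret abelian_group M by fact
 show ?thesis using assms(2,3) by (metis a_assoc a_inv_closed r_neg r_zero)
qed

lemma lmod_smult_zero:
 assumes "left_module A M" "a \<in> carrier A"
 shows "a *[M] \<zero>\<^bsub>M\<^esub> = \<zero>\<^bsub>M\<^esub>"
proof -
 interpret abelian_group M using assms by (simp add: lmod_abelian_group)
 show ?thesis
  by (rule abelian_group_eq_zero[OF abelian_group_axioms])
   (use assms lmod_smult_r_distr[OF assms(1,2) zero_closed zero_closed] in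
    \<open>auto simp: lmod_smult_closed\<close>)
qed

lemma lmod_zero_smult:
 assumes "left_module A M" "ring A" "x \<in> carrier M"
 shows "\<zero>\<^bsub>A\<^esub> *[M] x = \<zero>\<^bsub>M\<^esub>"
proof -
 interpret abelian_group M using assms by (simp add: lmod_abelian_group)
 interpret A: ring A by fact
 show ?thesis
  by (rule abelian_group_eq_zero[OF abelian_group_axioms])
   (use assms lmod_smult_l_distr[OF assms(1) A.zero_closed A.zero_closed assms(3)] in
    \<open>auto simp: lmod_smult_closed\<close>)
qed

lemma lmod_finsum_smult:
 assumes "left_module A M" "a \<in> carrier A" "finite S" "f \<in> S \<rightarrow> carrier M"
 shows "a *[M] finsum M f S = finsum M (\<lambda>i. a *[M] f i) S"
proof -
 interpret abelian_group M using assms by (simp add: lmod_abelian_group)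
 show ?thesis using assms(3,4)
 proof (induction S)
  case empty
  then show ?case by (simp add: lmod_smult_zero[OF assms(1,2)])
 next
  case (insert i S)
  then have "finsum M f S \<in> carrier M" "f i \<in> carrier M" by auto
  moreover have "finsum M (\<lambda>i. a *[M] f i) (insert i S)
    = a *[M] f i +[M] finsum M (\<lambda>i. a *[M] f i) S"
   by (rule finsum_insert) (use insert lmod_smult_closed[OF assms(1,2)] in auto)
  ultimately show ?case
   using insert by (simp add: lmod_smult_r_distr[OF assms(1,2)])
 qed
qed

lemma HomI:
 assumes "f \<in> extensional (carrier M)" "\<And>x. x \<in> carrier M ==> f x \<in> carrier N"
  "\<And>x y. x \<in> carrier M ==> y \<in> carrier M ==> f (x +[M] y) = f x +[N] f y"
  "\<And>a x. a \<in> carrier A ==> x \<in> carrier M ==> f (a *[M] x) = a *[N] f x"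
 shows "f \<in> Hom A M N"
 using assms by (auto simp: Hom_def LinearCombinations.module_hom_def)

lemma HomD:
 assumes "f \<in> Hom A M N"
 shows "f \<in> extensional (carrier M)" "\<And>x. x \<in> carrier M ==> f x \<in> carrier N"
  "\<And>x y. x \<in> carrier M ==> y \<in> carrier M ==> f (x +[M] y) = f x +[N] f y"
  "\<And>a x. a \<in> carrier A ==> x \<in> carrier M ==> f (a *[M] x) = a *[N] f x"
 using assms by (auto simp: Hom_def LinearCombinations.module_hom_def)

lemma Hom_zero:
 assumes "f \<in> Hom A M N" "abelian_group M" "abelian_group N"
 shows "f \<zero>\<^bsub>M\<^esub> = \<zero>\<^bsub>N\<^esub>"
proof -
 interpret M: abelian_group M by fact
 show ?thesis
  by (rule abelian_group_eq_zero[OF assms(3)])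
   (use HomD(3)[OF assms(1) M.zero_closed M.zero_closed] in \<open>auto simp: HomD(2)[OF assms(1)]\<close>)
qed

lemma Hom_finsum:
 assumes "f \<in> Hom A M N" "abelian_group M" "abelian_group N" "finite S" "g \<in> S \<rightarrow> carrier M"
 shows "f (finsum M g S) = finsum N (\<lambda>i. f (g i)) S"
proof -
 interpret M: abelian_group M by fact
 interpret N: abelian_group N by fact
 show ?thesis using assms(4,5)
 proof (induction S)
  case empty
  then show ?case by (simp add: Hom_zero[OF assms(1-3)])
 next
  case (insert i S)
  then have "finsum M g S \<in> carrier M" "g i \<in> carrier M" by auto
  moreover have "finsum N (\<lambda>i. f (g i)) (insert i S) = f (g i) +[N] finsum N (\<lambda>i. f (g i)) S"
   by (rule N.finsum_insert) (use insert HomD(2)[OF assms(1)] in auto)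
  ultimately show ?case
   using insert by (simp add: HomD(3)[OF assms(1)])
 qed
qed

lemma Hom_compose:
 assumes "f \<in> Hom A L M" "g \<in> Hom A M N" "left_module A L"
 shows "compose (carrier L) g f \<in> Hom A L N"
proof -
 interpret L: abelian_group L using assms by (simp add: lmod_abelian_group)
 show ?thesis
  by (rule HomI)
   (use assms(3) in \<open>auto simp: compose_def HomD[OF assms(1)] HomD[OF assms(2)] lmod_smult_closed\<close>)
qed

lemma Hom_inv_into:
 assumes f: "f \<in> Hom A M N" and b: "bij_betw f (carrier M) (carrier N)"
  and M: "left_module A M" and N: "left_module A N"
 shows "(\<lambda>y\<in>carrier N. inv_into (carrier M) f y) \<in> Hom A N M"
proof -
 interpret M: abelian_group M using M by (rule lmod_abelian_group)
 interpret N: abelian_group N using N by (rule lmod_abelian_group)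
 have i: "inj_on f (carrier M)" and s: "f ` carrier M = carrier N"
  using b by (auto simp: bij_betw_def)
 have c: "inv_into (carrier M) f y \<in> carrier M" "f (inv_into (carrier M) f y) = y"
  if "y \<in> carrier N" for y
  using that s by (auto simp: inv_into_into f_inv_into_f)
 show ?thesis
 proof (rule HomI, goal_cases)
  case (3 x y)
  then show ?case
   by (auto intro!: inv_into_f_eq[OF i] simp: c HomD(3)[OF f])
 next
  case (4 a x)
  then show ?case
   using lmod_smult_closed[OF N] lmod_smult_closed[OF M]
   by (auto intro!: inv_into_f_eq[OF i] simp: c HomD(4)[OF f])
 qed (auto simp: c)
qed

lemma left_submoduleD:
 assumes "left_submodule A L M"
 shows "L \<subseteq> carrier M" "\<zero>\<^bsub>M\<^esub> \<in> L" "\<And>x y. x \<in> L ==> y \<in> L ==> x +[M] y \<in> L"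
  "\<And>a x. a \<in> carrier A ==> x \<in> L ==> a *[M] x \<in> L"
 using assms unfolding left_submodule_def
 by (auto simp: additive_subgroup.a_subset additive_subgroup.zero_closed additive_subgroup.a_closed)

context unital_algebra
begin

lemma lmod_a_inv:
 assumes M: "left_module A M" and x: "x \<in> carrier M"
 shows "\<ominus>\<^bsub>M\<^esub> x = (\<ominus> \<one>) *[M] x"
proof -
 interpret M: abelian_group M using M by (rule lmod_abelian_group)
 have "(\<ominus> \<one>) *[M] x +[M] \<one> *[M] x = \<zero>\<^bsub>M\<^esub>"
  using x lmod_smult_l_distr[OF M, of "\<ominus> \<one>" \<one> x]
  by (simp add: l_neg lmod_zero_smult[OF M ring_axioms])
 then show ?thesis
  using x lmod_smult_closed[OF M _ x, of "\<ominus> \<one>"]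
  by (simp add: lmod_one[OF M] M.minus_equality)
qed

lemma left_submoduleI:
 assumes M: "left_module A M" and L: "L \<subseteq> carrier M" "\<zero>\<^bsub>M\<^esub> \<in> L"
  "\<And>x y. x \<in> L ==> y \<in> L ==> x +[M] y \<in> L"
  "\<And>a x. a \<in> carrier A ==> x \<in> L ==> a *[M] x \<in> L"
 shows "left_submodule A L M"
proof -
 interpret M: abelian_group M using M by (rule lmod_abelian_group)
 have "\<ominus>\<^bsub>M\<^esub> x \<in> L" if "x \<in> L" for x
  using lmod_a_inv[OF M, of x] L that by auto
 then have "additive_subgroup L M"
  using L M.a_group
  by (auto simp: additive_subgroup_def a_inv_def intro!: group.subgroupI)
 then show ?thesis using L by (simp add: left_submodule_def)
qed

lemma left_submodule_module:
 assumes M: "left_module A M" and L: "left_submodule A L M"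
 shows "left_module A (M\<lparr>carrier := L\<rparr>)"
proof -
 interpret M: abelian_group M using M by (rule lmod_abelian_group)
 note LD = left_submoduleD[OF L]
 have c: "x \<in> L ==> x \<in> carrier M" for x using LD(1) by auto
 have "abelian_group (M\<lparr>carrier := L\<rparr>)"
 proof (rule abelian_groupI)
  fix x assume "x \<in> carrier (M\<lparr>carrier := L\<rparr>)"
  then have "x \<in> L" by simp
  then have "(\<ominus> \<one>) *[M] x \<in> L" using LD(4) by simp
  moreover have "(\<ominus> \<one>) *[M] x +[M] x = \<zero>\<^bsub>M\<^esub>"
   using \<open>x \<in> L\<close> by (metis M.l_neg c lmod_a_inv[OF M])
  ultimately show "\<exists>y\<in>carrier (M\<lparr>carrier := L\<rparr>). y +[M\<lparr>carrier := L\<rparr>] x = \<zero>\<^bsub>M\<lparr>carrier := L\<rparr>\<^esub>"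
   by auto
 qed (use LD in \<open>auto simp: c M.a_assoc M.a_comm M.a_lcomm\<close>)
 then show ?thesis
  using LD unfolding left_module_def
  by (auto simp: c lmod_smult_l_distr[OF M] lmod_smult_r_distr[OF M]
    lmod_assoc[OF M] lmod_one[OF M])
qed

lemma kernel_left_submodule:
 assumes M: "left_module A M" and N: "left_module A N" and f: "f \<in> Hom A M N"
 shows "left_submodule A (a_kernel M N f) M"
proof -
 interpret M: abelian_group M using M by (rule lmod_abelian_group)
 interpret N: abelian_group N using N by (rule lmod_abelian_group)
 show ?thesis
  by (rule left_submoduleI[OF M])
   (auto simp: a_kernel_def' HomD[OF f] Hom_zero[OF f M.abelian_group_axioms N.abelian_group_axioms]
    lmod_smult_closed[OF M] lmod_smult_zero[OF N])
qed

lemma image_left_submodule: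
 assumes M: "left_module A M" and N: "left_module A N" and f: "f \<in> Hom A M N"
  and L: "left_submodule A L M"
 shows "left_submodule A (f ` L) N"
proof -
 interpret M: abelian_group M using M by (rule lmod_abelian_group)
 interpret N: abelian_group N using N by (rule lmod_abelian_group)
 note LD = left_submoduleD[OF L]
 have c: "x \<in> L ==> x \<in> carrier M" for x using LD(1) by auto
 show ?thesis
 proof (rule left_submoduleI[OF N])
  show "\<zero>\<^bsub>N\<^esub> \<in> f ` L"
   using LD(2) Hom_zero[OF f M.abelian_group_axioms N.abelian_group_axioms] by (metis imageI)
  show "x +[N] y \<in> f ` L" if xy: "x \<in> f ` L" "y \<in> f ` L" for x y
  proof -
   obtain x' y' where "x' \<in> L" "y' \<in> L" "x = f x'" "y = f y'" using xy by auto
   then show ?thesis using LD(3)[of x' y'] HomD(3)[OF f, of x' y'] c by (metis imageI)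
  qed
  show "a *[N] x \<in> f ` L" if a: "a \<in> carrier A" "x \<in> f ` L" for a x
  proof -
   obtain x' where "x' \<in> L" "x = f x'" using a by auto
   then show ?thesis using LD(4)[of a x'] HomD(4)[OF f, of a x'] c a by (metis imageI)
  qed
 qed (use HomD(2)[OF f] c in auto)
qed

lemma regular_left_module: "left_module A (regular_module A)"
proof -
 have "abelian_group (regular_module A)"
  by (rule abelian_groupI) (auto simp: regular_module_def a_assoc a_comm a_lcomm intro: l_neg a_inv_closed bexI[of _ "\<ominus> x" for x])
 then show ?thesis
  by (auto simp: left_module_def regular_module_def l_distr r_distr m_assoc)
qed

lemma free_left_module: "left_module A (free_module A m)"
proof -
 have "abelian_group (free_module A m)"
 proof (rule abelian_groupI)
  fix x assume x: "x \<in> carrier (free_module A m)"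
  show "\<exists>y\<in>carrier (free_module A m). y +[free_module A m] x = \<zero>\<^bsub>free_module A m\<^esub>"
   by (rule bexI[of _ "\<lambda>i\<in>{..<m}. \<ominus> x i"])
    (use x in \<open>auto simp: free_module_def PiE_iff l_neg fun_eq_iff\<close>)
 qed (auto simp: free_module_def PiE_iff fun_eq_iff extensional_def a_assoc a_comm a_lcomm)
 then show ?thesis
  by (auto simp: left_module_def free_module_def PiE_iff fun_eq_iff extensional_def
    l_distr r_distr m_assoc)
qed

lemma opposite_unital_algebra: "unital_algebra (opposite A)"
proof -
 have r: "ring (opposite A)"
 proof (rule ringI)
  show "abelian_group (opposite A)"
   by (rule abelian_groupI) (auto simp: opposite_def a_assoc a_comm a_lcomm intro: l_neg a_inv_closed bexI[of _ "\<ominus> x" for x])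
  show "Group.monoid (opposite A)"
   by (rule monoidI) (auto simp: opposite_def m_assoc)
 qed (auto simp: opposite_def l_distr r_distr)
 show ?thesis
 proof (intro unital_algebra.intro r unital_algebra_axioms.intro, goal_cases)
  case (3 c d)
  then show ?case
   using scalar_mult[of d c] by (simp add: opposite_def mult.commute)
 next
  case (5 x c)
  then show ?case using scalar_comm[of x c] by (simp add: opposite_def)
 qed (simp_all add: opposite_def scalar_closed scalar_add scalar_one)
qed

end

lemma opposite_opposite [simp]: "opposite (opposite A) = A"
 by (simp add: opposite_def)

lemma opposite_simps [simp]:
 "carrier (opposite A) = carrier A" "zero (opposite A) = zero A" "one (opposite A) = one A"
 "add (opposite A) = add A" "smult (opposite A) = smult A"
 "mult (opposite A) x y = y \<otimes>\<^bsub>A\<^esub> x"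
 by (simp_all add: opposite_def)

section \<open>Projective covers are unique\<close>

context unital_algebra
begin

lemma free_finsum_apply:
 assumes "finite S" "g \<in> S \<rightarrow> carrier (free_module A m)" "j < m"
 shows "finsum (free_module A m) g S j = finsum A (\<lambda>i. g i j) S"
proof -
 interpret F: abelian_group "free_module A m"
  using free_left_module by (rule lmod_abelian_group)
 show ?thesis using assms(1,2)
 proof (induction S)
  case empty
  then show ?case using assms(3) by (simp only: F.finsum_empty) (simp add: free_module_def)
 next
  case (insert i S)
  have "finsum A (\<lambda>i. g i j) (insert i S) = g i j \<oplus> finsum A (\<lambda>i. g i j) S"
   by (rule finsum_insert) (use insert assms(3) in \<open>auto simp: free_module_def PiE_iff Pi_iff\<close>)
  moreover have "finsum (free_module A m) g (insert i S)
    = g i +[free_module A m] finsum (free_module A m) g S"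
   by (rule F.finsum_insert) (use insert in auto)
  ultimately show ?case using insert assms(3) by (simp add: free_module_def)
 qed
qed

lemma free_expansion:
 assumes y: "y \<in> carrier (free_module A m)"
 shows "y = finsum (free_module A m)
  (\<lambda>i. y i *[free_module A m] (\<lambda>j\<in>{..<m}. if j = i then \<one> else \<zero>)) {..<m}"
  (is "y = ?R")
proof -
 interpret F: abelian_group "free_module A m"
  using free_left_module by (rule lmod_abelian_group)
 have c: "(\<lambda>j\<in>{..<m}. if j = i then \<one> else \<zero>) \<in> carrier (free_module A m)" for i
  by (auto simp: free_module_def)
 have yi: "y i \<in> carrier A" if "i < m" for i using y that by (auto simp: free_module_def)
 have g: "(\<lambda>i. y i *[free_module A m] (\<lambda>j\<in>{..<m}. if j = i then \<one> else \<zero>))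
   \<in> {..<m} \<rightarrow> carrier (free_module A m)"
  using lmod_smult_closed[OF free_left_module _ c] yi by auto
 then have R: "?R \<in> carrier (free_module A m)" by (rule F.finsum_closed)
 have eq: "?R j = y j" if j: "j < m" for j
 proof -
  have "?R j = finsum A (\<lambda>i. (y i *[free_module A m] (\<lambda>j\<in>{..<m}. if j = i then \<one> else \<zero>)) j) {..<m}"
   by (rule free_finsum_apply[OF _ g j]) simp
  also have "\<dots> = finsum A (\<lambda>i. if j = i then y i else \<zero>) {..<m}"
   by (rule finsum_cong') (use j yi in \<open>auto simp: free_module_def\<close>)
  also have "\<dots> = y j" by (rule finsum_singleton) (use j yi in auto)
  finally show ?thesis .
 qed
 have ext: "u = v"
  if "u \<in> carrier (free_module A m)" "v \<in> carrier (free_module A m)" "\<And>j. j < m ==> u j = v j" for u v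
  using that by (intro PiE_ext[of u "{..<m}" "\<lambda>_. carrier A" v]) (auto simp: free_module_def)
 show ?thesis by (rule ext[OF y R]) (rule eq[symmetric])
qed

text \<open>\<open>P\<close> is a retract of a free module, so preimages under \<open>h\<close> are
  chosen only for the images of the standard basis vectors; the coordinates of \<open>s x\<close>
  then combine these preimages linearly.\<close>

lemma projective_lift:
 assumes P: "fg_projective A P" and M: "left_module A M" and N: "left_module A N"
  and h: "h \<in> Hom A N M" "h ` carrier N = carrier M" and u: "u \<in> Hom A P M"
 obtains fi where "fi \<in> Hom A P N" "\<And>x. x \<in> carrier P ==> h (fi x) = u x"
proof -
 obtain m s p where LP: "left_module A P" and s: "s \<in> Hom A P (free_module A m)"
  and p: "p \<in> Hom A (free_module A m) P" and ps: "\<And>x. x \<in> carrier P ==> p (s x) = x"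
  using P unfolding fg_projective_def by blast
 let ?F = "free_module A m"
 let ?e = "\<lambda>i. (\<lambda>j\<in>{..<m}. if j = i then \<one> else \<zero>)"
 interpret F: abelian_group ?F using free_left_module by (rule lmod_abelian_group)
 interpret M: abelian_group M using M by (rule lmod_abelian_group)
 interpret N: abelian_group N using N by (rule lmod_abelian_group)
 interpret P: abelian_group P using LP by (rule lmod_abelian_group)
 have e: "?e i \<in> carrier ?F" for i by (auto simp: free_module_def)
 have "\<exists>y\<in>carrier N. h y = u (p (?e i))" for i
 proof -
  have "u (p (?e i)) \<in> h ` carrier N" using h(2) HomD(2)[OF u HomD(2)[OF p e[of i]]] by simp
  then show ?thesis by (elim imageE) (rule bexI, simp_all)
 qed
 then obtain y where y: "\<And>i. y i \<in> carrier N" "\<And>i. h (y i) = u (p (?e i))" by metis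
 have sc: "s x i \<in> carrier A" if "x \<in> carrier P" "i < m" for x i
  using HomD(2)[OF s that(1)] that(2) by (auto simp: free_module_def)
 define fi where "fi = (\<lambda>x\<in>carrier P. finsum N (\<lambda>i. s x i *[N] y i) {..<m})"
 have cl: "(\<lambda>i. s x i *[N] y i) \<in> {..<m} \<rightarrow> carrier N" if "x \<in> carrier P" for x
  using sc y lmod_smult_closed[OF N] that by auto
 have "fi \<in> Hom A P N"
 proof (rule HomI, goal_cases)
  case 1 then show ?case by (simp add: fi_def)
 next
  case (2 x) then show ?case using cl by (simp add: fi_def)
 next
  case (3 x x')
  have "finsum N (\<lambda>i. s (x +[P] x') i *[N] y i) {..<m}
    = finsum N (\<lambda>i. s x i *[N] y i +[N] s x' i *[N] y i) {..<m}"
   by (rule N.finsum_cong')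
    (use 3 sc y in \<open>auto simp: HomD(3)[OF s] free_module_def lmod_smult_l_distr[OF N]
     lmod_smult_closed[OF N]\<close>)
  then show ?case using 3 cl by (simp add: fi_def N.finsum_addf)
 next
  case (4 a x)
  have "finsum N (\<lambda>i. s (a *[P] x) i *[N] y i) {..<m}
    = finsum N (\<lambda>i. a *[N] (s x i *[N] y i)) {..<m}"
   by (rule N.finsum_cong')
    (use 4 sc y in \<open>auto simp: HomD(4)[OF s] free_module_def lmod_assoc[OF N]
     lmod_smult_closed[OF N]\<close>)
  then show ?case using 4 cl
   by (simp add: fi_def lmod_finsum_smult[OF N] lmod_smult_closed[OF LP])
 qed
 moreover have "h (fi x) = u x" if x: "x \<in> carrier P" for x
 proof -
  have up: "u (p z) \<in> carrier M" if "z \<in> carrier ?F" for z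
   using HomD(2)[OF u] HomD(2)[OF p] that by auto
  have sF: "s x \<in> carrier ?F" using HomD(2)[OF s x] .
  have c2: "(\<lambda>i. s x i *[?F] ?e i) \<in> {..<m} \<rightarrow> carrier ?F"
   using sc[OF x] lmod_smult_closed[OF free_left_module _ e] by auto
  have "h (fi x) = finsum M (\<lambda>i. h (s x i *[N] y i)) {..<m}"
   using x Hom_finsum[OF h(1) N.abelian_group_axioms M.abelian_group_axioms _ cl[OF x]]
   by (simp add: fi_def)
  also have "\<dots> = finsum M (\<lambda>i. u (p (s x i *[?F] ?e i))) {..<m}"
  proof (rule M.finsum_cong')
   fix i assume i: "i \<in> {..<m}"
   have "p (s x i *[?F] ?e i) = s x i *[P] p (?e i)"
    by (rule HomD(4)[OF p]) (use sc[OF x] i e in auto)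
   moreover have "u (s x i *[P] p (?e i)) = s x i *[M] u (p (?e i))"
    by (rule HomD(4)[OF u]) (use sc[OF x] i e HomD(2)[OF p] in auto)
   moreover have "h (s x i *[N] y i) = s x i *[M] h (y i)"
    by (rule HomD(4)[OF h(1)]) (use sc[OF x] i y in auto)
   ultimately show "h (s x i *[N] y i) = u (p (s x i *[?F] ?e i))" by (simp add: y)
  qed (use up c2 in auto)
  also have "\<dots> = u (finsum P (\<lambda>i. p (s x i *[?F] ?e i)) {..<m})"
   by (rule Hom_finsum[symmetric, OF u P.abelian_group_axioms M.abelian_group_axioms])
    (use c2 HomD(2)[OF p] in auto)
  also have "finsum P (\<lambda>i. p (s x i *[?F] ?e i)) {..<m} = p (finsum ?F (\<lambda>i. s x i *[?F] ?e i) {..<m})"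
   by (rule Hom_finsum[symmetric, OF p F.abelian_group_axioms P.abelian_group_axioms _ c2]) simp
  also have "finsum ?F (\<lambda>i. s x i *[?F] ?e i) {..<m} = s x"
   by (rule free_expansion[OF sF, symmetric])
  finally show ?thesis using ps x by simp
 qed
 ultimately show ?thesis using that by blast
qed

text \<open>Every element of \<open>Q\<close> differs from some \<open>fi x\<close> by an element of
  the kernel of \<open>h\<close>, so the image of \<open>fi\<close> and this kernel together fill
  \<open>Q\<close>; superfluity then makes the image everything.\<close>

lemma surj_of_superfluous_kernel:
 assumes P: "left_module A P" and Q: "left_module A Q" and M: "left_module A M"
  and fi: "fi \<in> Hom A P Q" and h: "h \<in> Hom A Q M" and s: "superfluous A (a_kernel Q M h) Q"
  and sur: "carrier M \<subseteq> (\<lambda>x. h (fi x)) ` carrier P"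
 shows "fi ` carrier P = carrier Q"
proof -
 interpret Q: abelian_group Q using Q by (rule lmod_abelian_group)
 interpret M: abelian_group M using M by (rule lmod_abelian_group)
 interpret P: abelian_group P using P by (rule lmod_abelian_group)
 have "left_submodule A (carrier P) P"
  by (rule left_submoduleI[OF P]) (auto simp: lmod_smult_closed[OF P])
 then have sub: "left_submodule A (fi ` carrier P) Q" by (rule image_left_submodule[OF P Q fi])
 have "fi ` carrier P <+>\<^bsub>Q\<^esub> a_kernel Q M h = carrier Q"
 proof
  show "fi ` carrier P <+>\<^bsub>Q\<^esub> a_kernel Q M h \<subseteq> carrier Q"
   using HomD(2)[OF fi] by (auto simp: set_add_def' a_kernel_def')
  show "carrier Q \<subseteq> fi ` carrier P <+>\<^bsub>Q\<^esub> a_kernel Q M h"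
  proof
   fix y assume y: "y \<in> carrier Q"
   then have "h y \<in> carrier M" using HomD(2)[OF h] by auto
   then obtain x where x: "x \<in> carrier P" "h y = h (fi x)" using sur by auto
   have c: "fi x \<in> carrier Q" using HomD(2)[OF fi x(1)] .
   have k: "y +[Q] \<ominus>\<^bsub>Q\<^esub> fi x \<in> a_kernel Q M h"
   proof -
    have "h (y +[Q] \<ominus>\<^bsub>Q\<^esub> fi x) = h (fi x +[Q] \<ominus>\<^bsub>Q\<^esub> fi x)"
     using HomD(3)[OF h] y c x by simp
    then show ?thesis
     using y c by (simp add: a_kernel_def' Q.r_neg Hom_zero[OF h Q.abelian_group_axioms M.abelian_group_axioms])
   qed
   have "y = fi x +[Q] (y +[Q] \<ominus>\<^bsub>Q\<^esub> fi x)"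
    using y c by (metis Q.a_assoc Q.a_comm Q.a_inv_closed Q.l_neg Q.r_zero)
   then show "y \<in> fi ` carrier P <+>\<^bsub>Q\<^esub> a_kernel Q M h"
    using k x(1) unfolding set_add_def' by blast
  qed
 qed
 then show ?thesis using s sub unfolding superfluous_def by blast
qed

text \<open>Lifting gives a surjection \<open>fi\<close>, and lifting the identity of
  \<open>Q\<close> along \<open>fi\<close> gives a section \<open>s\<close>. The section is again
  compatible with the covers, hence surjective by the same argument, and a map with a surjective
  section is injective.\<close>

lemma projective_cover_unique:
 assumes M: "left_module A M"
  and 1: "projective_cover A P M h" and 2: "projective_cover A Q M h'"
 obtains fi where "fi \<in> Hom A P Q" "bij_betw fi (carrier P) (carrier Q)"
  "\<And>x. x \<in> carrier P ==> h' (fi x) = h x"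
proof -
 have P: "fg_projective A P" "h \<in> Hom A P M" "h ` carrier P = carrier M"
   "superfluous A (a_kernel P M h) P"
  and Q: "fg_projective A Q" "h' \<in> Hom A Q M" "h' ` carrier Q = carrier M"
   "superfluous A (a_kernel Q M h') Q"
  using 1 2 by (auto simp: projective_cover_def)
 have LP: "left_module A P" and LQ: "left_module A Q"
  using P(1) Q(1) by (auto simp: fg_projective_def)
 interpret P: abelian_group P using LP by (rule lmod_abelian_group)
 interpret Q: abelian_group Q using LQ by (rule lmod_abelian_group)
 interpret M: abelian_group M using M by (rule lmod_abelian_group)
 obtain fi where fi: "fi \<in> Hom A P Q" "\<And>x. x \<in> carrier P ==> h' (fi x) = h x"
  using projective_lift[OF P(1) M LQ Q(2,3) P(2)] by blast
 have "carrier M \<subseteq> (\<lambda>x. h' (fi x)) ` carrier P"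
  using P(3) fi(2) by (metis (mono_tags, lifting) image_cong order_refl)
 then have sfi: "fi ` carrier P = carrier Q"
  by (rule surj_of_superfluous_kernel[OF LP LQ M fi(1) Q(2,4)])
 have idQ: "(\<lambda>x\<in>carrier Q. x) \<in> Hom A Q Q"
  by (rule HomI) (auto simp: lmod_smult_closed[OF LQ])
 obtain s where s: "s \<in> Hom A Q P" "\<And>x. x \<in> carrier Q ==> fi (s x) = x"
  using projective_lift[OF Q(1) LQ LP fi(1) sfi idQ] by auto
 have hs: "h (s x) = h' x" if "x \<in> carrier Q" for x
  using fi(2)[of "s x"] s HomD(2)[OF s(1)] that by simp
 have "carrier M \<subseteq> (\<lambda>x. h (s x)) ` carrier Q"
  using Q(3) hs by (metis (mono_tags, lifting) image_cong order_refl)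
 then have ss: "s ` carrier Q = carrier P"
  by (rule surj_of_superfluous_kernel[OF LQ LP M s(1) P(2,4)])
 have "inj_on fi (carrier P)"
 proof (rule inj_onI)
  fix x y assume "x \<in> carrier P" "y \<in> carrier P" "fi x = fi y"
  moreover then obtain x' y' where "x = s x'" "y = s y'" "x' \<in> carrier Q" "y' \<in> carrier Q"
   using ss by (metis imageE)
  ultimately show "x = y" using s(2) by auto
 qed
 then show ?thesis using that fi sfi by (auto simp: bij_betw_def)
qed

text \<open>\<open>AR_transpose\<close> rests on an arbitrary choice of a presentation, so a result
  computed from an explicit one has to be carried over. The isomorphism between the covers of
  \<open>M\<close> identifies the two kernels; composed with it, \<open>f\<close> becomes a second
  cover of the kernel in \<open>Q0\<close>, and uniqueness applies once more.\<close>

theorem min_proj_presentation_unique: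
 assumes M: "left_module A M"
  and 1: "min_proj_presentation A M P1 f P0 g" and 2: "min_proj_presentation A M Q1 f' Q0 g'"
 obtains al1 al0 where "al0 \<in> Hom A P0 Q0" "bij_betw al0 (carrier P0) (carrier Q0)"
  "al1 \<in> Hom A P1 Q1" "bij_betw al1 (carrier P1) (carrier Q1)"
  "\<And>x. x \<in> carrier P1 ==> f' (al1 x) = al0 (f x)"
proof -
 let ?K = "P0\<lparr>carrier := a_kernel P0 M g\<rparr>" and ?K' = "Q0\<lparr>carrier := a_kernel Q0 M g'\<rparr>"
 have P: "projective_cover A P0 M g" "projective_cover A P1 ?K f"
  and Q: "projective_cover A Q0 M g'" "projective_cover A Q1 ?K' f'"
  using 1 2 by (auto simp: min_proj_presentation_def)
 obtain al0 where al0: "al0 \<in> Hom A P0 Q0" "bij_betw al0 (carrier P0) (carrier Q0)"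
  "\<And>x. x \<in> carrier P0 ==> g' (al0 x) = g x"
  using projective_cover_unique[OF M P(1) Q(1)] by blast
 have LP0: "left_module A P0" and LQ0: "left_module A Q0" and LP1: "left_module A P1"
  and g: "g \<in> Hom A P0 M" and g': "g' \<in> Hom A Q0 M"
  using P Q by (auto simp: projective_cover_def fg_projective_def)
 have LK': "left_module A ?K'"
  by (rule left_submodule_module[OF LQ0 kernel_left_submodule[OF LQ0 M g']])
 interpret P0: abelian_group P0 using LP0 by (rule lmod_abelian_group)
 interpret Q0: abelian_group Q0 using LQ0 by (rule lmod_abelian_group)
 have f: "f \<in> Hom A P1 ?K" "f ` carrier P1 = a_kernel P0 M g"
   "superfluous A (a_kernel P1 ?K f) P1"
  using P(2) by (auto simp: projective_cover_def)
 have ker: "al0 ` a_kernel P0 M g = a_kernel Q0 M g'"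
 proof -
  have sur: "al0 ` carrier P0 = carrier Q0" using al0(2) by (auto simp: bij_betw_def)
  show ?thesis
  proof
   show "al0 ` a_kernel P0 M g \<subseteq> a_kernel Q0 M g'"
    using HomD(2)[OF al0(1)] al0(3) by (auto simp: a_kernel_def')
   show "a_kernel Q0 M g' \<subseteq> al0 ` a_kernel P0 M g"
   proof
    fix y assume y: "y \<in> a_kernel Q0 M g'"
    then have "y \<in> al0 ` carrier P0" using sur by (simp add: a_kernel_def')
    then obtain z where z: "z \<in> carrier P0" "y = al0 z" by blast
    then have "z \<in> a_kernel P0 M g" using y al0(3)[of z] by (simp add: a_kernel_def')
    then show "y \<in> al0 ` a_kernel P0 M g" using z(2) by blast
   qed
  qed
 qed
 let ?h = "compose (carrier P1) al0 f"
 have fP0: "f x \<in> carrier P0" if "x \<in> carrier P1" for x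
  using HomD(2)[OF f(1) that] by (simp add: a_kernel_def')
 have h: "?h \<in> Hom A P1 ?K'"
 proof (rule HomI, goal_cases)
  case (2 x)
  then show ?case using ker HomD(2)[OF f(1)] by (auto simp: compose_def)
 next
  case (3 x y)
  have "x +[P1] y \<in> carrier P1"
   using 3 lmod_abelian_group[OF LP1] by (simp add: abelian_group_def abelian_monoid.a_closed)
  then show ?case using 3 HomD(3)[OF f(1)] HomD(3)[OF al0(1)] fP0 by (auto simp: compose_def)
 next
  case (4 a x)
  then show ?case using HomD(4)[OF f(1)] HomD(4)[OF al0(1)] fP0 lmod_smult_closed[OF LP1]
   by (auto simp: compose_def)
 qed simp
 have "a_kernel P1 ?K' ?h = a_kernel P1 ?K f"
 proof -
  have "al0 z = \<zero>\<^bsub>Q0\<^esub> \<longleftrightarrow> z = \<zero>\<^bsub>P0\<^esub>" if "z \<in> carrier P0" for z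
   using al0(2) that Hom_zero[OF al0(1) P0.abelian_group_axioms Q0.abelian_group_axioms]
   by (metis P0.zero_closed bij_betw_def inj_onD)
  then show ?thesis using fP0 by (auto simp: a_kernel_def' compose_def)
 qed
 moreover have "?h ` carrier P1 = carrier ?K'"
  using ker f(2) by (simp add: compose_def image_image[symmetric] cong: image_cong_simp)
 ultimately have "projective_cover A P1 ?K' ?h"
  using h f(3) P(2) by (simp add: projective_cover_def)
 then obtain al1 where "al1 \<in> Hom A P1 Q1" "bij_betw al1 (carrier P1) (carrier Q1)"
  "\<And>x. x \<in> carrier P1 ==> f' (al1 x) = ?h x"
  using projective_cover_unique[OF LK' _ Q(2)] by blast
 then show ?thesis using that[OF al0(1,2)] by (simp add: compose_def)
qed

end

section \<open>Quotients, duals and spaces of homomorphisms\<close>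

text \<open>Each axiom is checked on elements \<open>q x\<close>, where it is the image of the same
  axiom in \<open>M\<close>. This is the form in which quotients are seen to be modules.\<close>

lemma lmod_image:
 assumes M: "left_module A M" and c: "carrier N = q ` carrier M" and z: "\<zero>\<^bsub>N\<^esub> = q \<zero>\<^bsub>M\<^esub>"
  and a: "\<And>x y. x \<in> carrier M ==> y \<in> carrier M ==> q x +[N] q y = q (x +[M] y)"
  and s: "\<And>b x. b \<in> carrier A ==> x \<in> carrier M ==> b *[N] q x = q (b *[M] x)"
  and A: "ring A"
 shows "left_module A N"
proof -
 interpret M: abelian_group M using M by (rule lmod_abelian_group)
 interpret A: ring A by (rule A)
 have "abelian_group N"
 proof (rule abelian_groupI, goal_cases)
  case (6 x)
  then obtain x' where "x' \<in> carrier M" "x = q x'" using c by auto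
  then show ?case using a[of "\<ominus>\<^bsub>M\<^esub> x'" x'] c z
   by (intro bexI[of _ "q (\<ominus>\<^bsub>M\<^esub> x')"]) (auto simp: M.l_neg)
 qed (auto simp: c z a M.a_assoc M.a_comm M.a_lcomm)
 then show ?thesis unfolding left_module_def
  by (auto simp: c a s lmod_smult_closed[OF M] lmod_smult_l_distr[OF M]
    lmod_smult_r_distr[OF M] lmod_assoc[OF M] lmod_one[OF M])
qed

lemma quotient_module_carrier:
 "carrier (quotient_module M N) = (\<lambda>x. N +>\<^bsub>M\<^esub> x) ` carrier M"
 by (auto simp: quotient_module_def A_RCOSETS_def')

context unital_algebra
begin

lemma
 assumes M: "left_module A M" and N: "left_submodule A N M"
 shows quotient_add: "x \<in> carrier M ==> y \<in> carrier M ==>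
   (N +>\<^bsub>M\<^esub> x) +[quotient_module M N] (N +>\<^bsub>M\<^esub> y) = N +>\<^bsub>M\<^esub> (x +[M] y)"
  and quotient_eq: "x \<in> carrier M ==> y \<in> carrier M ==>
   N +>\<^bsub>M\<^esub> x = N +>\<^bsub>M\<^esub> y \<longleftrightarrow> x +[M] \<ominus>\<^bsub>M\<^esub> y \<in> N"
  and quotient_zero: "\<zero>\<^bsub>quotient_module M N\<^esub> = N +>\<^bsub>M\<^esub> \<zero>\<^bsub>M\<^esub>"
  and quotient_smult: "a \<in> carrier A ==> x \<in> carrier M ==>
   a *[quotient_module M N] (N +>\<^bsub>M\<^esub> x) = N +>\<^bsub>M\<^esub> (a *[M] x)"
  and quotient_left_module: "left_module A (quotient_module M N)"
proof -
 interpret M: abelian_group M using M by (rule lmod_abelian_group)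
 interpret N: abelian_subgroup N M
  by (rule abelian_subgroupI3) (use N M.abelian_group_axioms in \<open>auto simp: left_submodule_def\<close>)
 note ND = left_submoduleD[OF N]
 show add: "(N +>\<^bsub>M\<^esub> x) +[quotient_module M N] (N +>\<^bsub>M\<^esub> y) = N +>\<^bsub>M\<^esub> (x +[M] y)"
  if "x \<in> carrier M" "y \<in> carrier M" for x y
  using N.a_rcos_sum[OF that] by (simp add: quotient_module_def)
 have eq: "N +>\<^bsub>M\<^esub> x = N +>\<^bsub>M\<^esub> y \<longleftrightarrow> x +[M] \<ominus>\<^bsub>M\<^esub> y \<in> N"
  if xy: "x \<in> carrier M" "y \<in> carrier M" for x y
 proof
  assume "N +>\<^bsub>M\<^esub> x = N +>\<^bsub>M\<^esub> y"
  then have "x \<in> N +>\<^bsub>M\<^esub> y" using N.a_rcos_self[OF xy(1)] by simp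
  then show "x +[M] \<ominus>\<^bsub>M\<^esub> y \<in> N" using N.a_rcos_module[OF xy(2,1)] by simp
 next
  assume "x +[M] \<ominus>\<^bsub>M\<^esub> y \<in> N"
  then have "x \<in> N +>\<^bsub>M\<^esub> y" using N.a_rcos_module[OF xy(2,1)] by simp
  then show "N +>\<^bsub>M\<^esub> x = N +>\<^bsub>M\<^esub> y" using N.a_repr_independence' xy by metis
 qed
 then show "N +>\<^bsub>M\<^esub> x = N +>\<^bsub>M\<^esub> y \<longleftrightarrow> x +[M] \<ominus>\<^bsub>M\<^esub> y \<in> N"
  if "x \<in> carrier M" "y \<in> carrier M" for x y using that .
 show zero: "\<zero>\<^bsub>quotient_module M N\<^esub> = N +>\<^bsub>M\<^esub> \<zero>\<^bsub>M\<^esub>"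
  using M.a_coset_add_zero[OF ND(1)] by (simp add: quotient_module_def)
 show sm: "a *[quotient_module M N] (N +>\<^bsub>M\<^esub> x) = N +>\<^bsub>M\<^esub> (a *[M] x)"
  if a: "a \<in> carrier A" and x: "x \<in> carrier M" for a x
 proof -
  \<comment> \<open>The product in the quotient is a union over all representatives \<open>y\<close>
    of the coset; it is a single coset because each of them gives the same one.\<close>
  have rep: "N +>\<^bsub>M\<^esub> (a *[M] y) = N +>\<^bsub>M\<^esub> (a *[M] x)" if y: "y \<in> N +>\<^bsub>M\<^esub> x" for y
  proof -
   obtain n where n: "n \<in> N" "y = n +[M] x" using y by (auto simp: a_r_coset_def')
   have c: "n \<in> carrier M" using n ND(1) by auto
   have "a *[M] y +[M] \<ominus>\<^bsub>M\<^esub> (a *[M] x) = a *[M] n"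
    using n(2) a x c lmod_smult_closed[OF M a]
    by (simp add: lmod_smult_r_distr[OF M] M.a_assoc M.r_neg)
   then show ?thesis
    using eq[of "a *[M] y" "a *[M] x"] ND(4)[OF a n(1)] n(2) c x lmod_smult_closed[OF M a]
    by simp
  qed
  have "(\<Union>y\<in>N +>\<^bsub>M\<^esub> x. N +>\<^bsub>M\<^esub> (a *[M] y)) = (\<Union>y\<in>N +>\<^bsub>M\<^esub> x. N +>\<^bsub>M\<^esub> (a *[M] x))"
   by (rule SUP_cong) (simp_all only: rep)
  also have "\<dots> = N +>\<^bsub>M\<^esub> (a *[M] x)"
   using N.a_rcos_self[OF x] by (auto simp only: UN_constant split: if_splits)
  finally show ?thesis by (simp add: quotient_module_def)
 qed
 show "left_module A (quotient_module M N)"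
  by (rule lmod_image[OF M quotient_module_carrier zero])
   (auto simp: add sm ring_axioms)
qed

lemma star_left_module:
 assumes P: "left_module A P"
 shows "left_module (opposite A) (star A P)"
proof -
 interpret P: abelian_group P using P by (rule lmod_abelian_group)
 let ?R = "regular_module A"
 have D: "f \<in> extensional (carrier P)" "\<And>x. x \<in> carrier P ==> f x \<in> carrier A"
  "\<And>x y. x \<in> carrier P ==> y \<in> carrier P ==> f (x +[P] y) = f x \<oplus> f y"
  "\<And>a x. a \<in> carrier A ==> x \<in> carrier P ==> f (a *[P] x) = a \<otimes> f x"
  if "f \<in> Hom A P ?R" for f
  using HomD[OF that] by (auto simp: regular_module_def)
 have I: "f \<in> Hom A P ?R" if "f \<in> extensional (carrier P)" "\<And>x. x \<in> carrier P ==> f x \<in> carrier A"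
  "\<And>x y. x \<in> carrier P ==> y \<in> carrier P ==> f (x +[P] y) = f x \<oplus> f y"
  "\<And>a x. a \<in> carrier A ==> x \<in> carrier P ==> f (a *[P] x) = a \<otimes> f x" for f
  by (rule HomI) (use that in \<open>auto simp: regular_module_def\<close>)
 note cl = lmod_smult_closed[OF P]
 have add: "(\<lambda>x\<in>carrier P. f x \<oplus> g x) \<in> Hom A P ?R" if "f \<in> Hom A P ?R" "g \<in> Hom A P ?R" for f g
  by (rule I) (auto simp: D[OF that(1)] D[OF that(2)] cl a_assoc a_comm a_lcomm r_distr)
 have sm: "(\<lambda>x\<in>carrier P. f x \<otimes> b) \<in> Hom A P ?R" if "f \<in> Hom A P ?R" "b \<in> carrier A" for f b
  by (rule I) (use that(2) in \<open>auto simp: D[OF that(1)] cl l_distr m_assoc\<close>)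
 have z: "(\<lambda>x\<in>carrier P. \<zero>) \<in> Hom A P ?R" by (rule I) (auto simp: cl)
 have ext: "f = g" if "f \<in> Hom A P ?R" "g \<in> extensional (carrier P)" "\<And>x. x \<in> carrier P ==> f x = g x" for f g
  using extensionalityI[OF D(1)[OF that(1)] that(2)] that(3) by blast
 have "abelian_group (star A P)"
 proof (rule abelian_groupI, goal_cases)
  case (6 f)
  then have f: "f \<in> Hom A P ?R" by (simp add: star_def)
  have "(\<lambda>x\<in>carrier P. f x \<otimes> (\<ominus> \<one>)) \<in> Hom A P ?R" using sm[OF f] by simp
  moreover have "(\<lambda>x\<in>carrier P. (\<lambda>x\<in>carrier P. f x \<otimes> (\<ominus> \<one>)) x \<oplus> f x) = (\<lambda>x\<in>carrier P. \<zero>)"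
   by (rule restrict_ext) (simp add: D(2)[OF f] r_minus l_neg)
  ultimately show ?case
   unfolding star_def by (simp del: restrict_apply) (rule bexI)
 next
  case (3 f g h)
  then show ?case by (auto simp: star_def D(2) a_assoc intro!: restrict_ext)
 next
  case (4 f g)
  then show ?case by (auto simp: star_def D(2) a_comm intro!: restrict_ext)
 next
  case (5 f)
  then have f: "f \<in> Hom A P ?R" by (simp add: star_def)
  show ?case using f by (auto simp: star_def D(2)[OF f] intro!: ext[OF f, symmetric])
 qed (auto simp: star_def add z)
 then show ?thesis unfolding left_module_def
 proof (intro conjI ballI, goal_cases)
  case (6 f)
  then have f: "f \<in> Hom A P ?R" by (simp add: star_def)
  show ?case using f by (auto simp: star_def D(2)[OF f] intro!: ext[OF f, symmetric])
 qed (auto simp: star_def sm D(2) r_distr l_distr m_assoc intro!: restrict_ext)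
qed

end

lemma k_dualD:
 assumes "fi \<in> carrier (k_dual A M)"
 shows "fi \<in> extensional (carrier M)"
  "\<And>x y. x \<in> carrier M ==> y \<in> carrier M ==> fi (x +[M] y) = fi x + fi y"
  "\<And>c x. x \<in> carrier M ==> fi (scalar A c *[M] x) = c * fi x"
 using assms by (auto simp: k_dual_def)

lemma k_dualI:
 assumes "fi \<in> extensional (carrier M)"
  "\<And>x y. x \<in> carrier M ==> y \<in> carrier M ==> fi (x +[M] y) = fi x + fi y"
  "\<And>c x. x \<in> carrier M ==> fi (scalar A c *[M] x) = c * fi x"
 shows "fi \<in> carrier (k_dual A M)"
 using assms by (auto simp: k_dual_def)

lemma k_dual_simps [simp]:
 "add (k_dual A M) fi si = (\<lambda>x\<in>carrier M. fi x + si x)"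
 "zero (k_dual A M) = (\<lambda>x\<in>carrier M. 0)"
 "a *[k_dual A M] fi = (\<lambda>x\<in>carrier M. fi (a *[M] x))"
 by (simp_all add: k_dual_def)

context unital_algebra
begin

lemma k_dual_left_module:
 assumes M: "left_module A M"
 shows "left_module (opposite A) (k_dual A M)"
proof -
 interpret M: abelian_group M using M by (rule lmod_abelian_group)
 note cl = lmod_smult_closed[OF M] lmod_smult_closed[OF M scalar_closed]
 have ext: "f = g" if "f \<in> carrier (k_dual A M)" "g \<in> extensional (carrier M)"
  "\<And>x. x \<in> carrier M ==> f x = g x" for f g
  using extensionalityI[OF k_dualD(1)[OF that(1)] that(2)] that(3) by blast
 have add: "(\<lambda>x\<in>carrier M. f x + g x) \<in> carrier (k_dual A M)"
  if "f \<in> carrier (k_dual A M)" "g \<in> carrier (k_dual A M)" for f g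
  by (rule k_dualI) (auto simp: k_dualD[OF that(1)] k_dualD[OF that(2)] cl algebra_simps)
 have sc: "(scalar A c \<otimes> a) *[M] x = (a \<otimes> scalar A c) *[M] x"
  if "a \<in> carrier A" "x \<in> carrier M" for a c x
  using that by (simp add: scalar_comm)
 have sm: "(\<lambda>x\<in>carrier M. f (a *[M] x)) \<in> carrier (k_dual A M)"
  if "f \<in> carrier (k_dual A M)" "a \<in> carrier A" for f a
 proof (rule k_dualI, goal_cases)
  case (3 c x)
  have "a *[M] (scalar A c *[M] x) = scalar A c *[M] (a *[M] x)"
   using sc[OF that(2) 3, of c] that(2) 3
   by (simp only: lmod_assoc[OF M] scalar_closed)
  then show ?case using that(2) 3 by (simp add: cl k_dualD(3)[OF that(1)])
 qed (use that(2) in \<open>auto simp: k_dualD[OF that(1)] cl lmod_smult_r_distr[OF M]\<close>)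
 have z: "(\<lambda>x\<in>carrier M. 0) \<in> carrier (k_dual A M)" by (rule k_dualI) (auto simp: cl)
 have "abelian_group (k_dual A M)"
 proof (rule abelian_groupI, goal_cases)
  case (6 f)
  have "(\<lambda>x\<in>carrier M. - f x) \<in> carrier (k_dual A M)"
   by (rule k_dualI) (auto simp: k_dualD[OF 6] cl)
  moreover have "(\<lambda>x\<in>carrier M. (\<lambda>x\<in>carrier M. - f x) x + f x) = (\<lambda>x\<in>carrier M. 0)"
   by (rule restrict_ext) simp
  ultimately show ?case
   by (simp del: restrict_apply) (rule bexI)
 next
  case (5 f)
  then show ?case by (auto intro!: ext[OF 5, symmetric])
 qed (auto simp: add z add.assoc add.commute add.left_commute intro!: restrict_ext)
 then show ?thesis unfolding left_module_def
 proof (intro conjI ballI, goal_cases)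
  case (6 f)
  then show ?case by (auto simp: lmod_one[OF M] intro!: ext[OF 6(2), symmetric])
 qed (auto simp: sm cl k_dualD lmod_smult_l_distr[OF M] lmod_assoc[OF M] intro!: restrict_ext)
qed

lemma Hom_space_closed:
 assumes M: "left_module A M" and N: "left_module A N"
 shows "\<zero>\<^bsub>Hom_space A M N\<^esub> \<in> carrier (Hom_space A M N)"
  "f \<in> carrier (Hom_space A M N) ==> g \<in> carrier (Hom_space A M N) ==>
   f +[Hom_space A M N] g \<in> carrier (Hom_space A M N)"
  "f \<in> carrier (Hom_space A M N) ==> c *[Hom_space A M N] f \<in> carrier (Hom_space A M N)"
proof -
 interpret M: abelian_group M using M by (rule lmod_abelian_group)
 interpret N: abelian_group N using N by (rule lmod_abelian_group)
 note clM = lmod_smult_closed[OF M] and cl = lmod_smult_closed[OF N] lmod_smult_closed[OF N scalar_closed]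
 show "\<zero>\<^bsub>Hom_space A M N\<^esub> \<in> carrier (Hom_space A M N)"
  unfolding Hom_space_def by (auto intro!: HomI simp: clM lmod_smult_zero[OF N])
 show "f +[Hom_space A M N] g \<in> carrier (Hom_space A M N)"
  if "f \<in> carrier (Hom_space A M N)" "g \<in> carrier (Hom_space A M N)"
 proof -
  have fg: "f \<in> Hom A M N" "g \<in> Hom A M N" using that by (auto simp: Hom_space_def)
  show ?thesis unfolding Hom_space_def
   by (auto intro!: HomI simp: clM HomD[OF fg(1)] HomD[OF fg(2)] lmod_smult_r_distr[OF N]
     N.a_assoc N.a_comm N.a_lcomm)
 qed
 show "c *[Hom_space A M N] f \<in> carrier (Hom_space A M N)"
  if "f \<in> carrier (Hom_space A M N)"
 proof -
  have f: "f \<in> Hom A M N" using that by (auto simp: Hom_space_def)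
  have comm: "scalar A c *[N] (a *[N] f x) = a *[N] (scalar A c *[N] f x)"
   if "a \<in> carrier A" "x \<in> carrier M" for a x
   using that by (metis HomD(2)[OF f] lmod_assoc[OF N] scalar_closed scalar_comm)
  have "(\<lambda>x\<in>carrier M. scalar A c *[N] f x) \<in> Hom A M N"
  proof (rule HomI, goal_cases)
   case (4 a x)
   then show ?case using comm[OF 4] by (simp add: clM HomD[OF f])
  qed (auto simp: clM cl HomD[OF f] lmod_smult_r_distr[OF N] scalar_closed)
  then show ?thesis by (simp add: Hom_space_def)
 qed
qed

end

text \<open>A linear bijection onto the functions on \<open>T\<close>, stated without assuming that
  \<open>V\<close> is a vector space: since the coordinates separate points, the vector space axioms
  follow by comparing coordinates.\<close>

definition coordinatized :: "('k :: field, 'v) module => 't set => ('v => 't => 'k) => bool" where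
 "coordinatized V T Ph \<longleftrightarrow> finite T \<and> \<zero>\<^bsub>V\<^esub> \<in> carrier V
   \<and> (\<forall>x\<in>carrier V. \<forall>y\<in>carrier V. x +[V] y \<in> carrier V)
   \<and> (\<forall>c. \<forall>x\<in>carrier V. c *[V] x \<in> carrier V)
   \<and> (\<forall>t\<in>T. Ph \<zero>\<^bsub>V\<^esub> t = 0)
   \<and> (\<forall>x\<in>carrier V. \<forall>y\<in>carrier V. \<forall>t\<in>T. Ph (x +[V] y) t = Ph x t + Ph y t)
   \<and> (\<forall>c. \<forall>x\<in>carrier V. \<forall>t\<in>T. Ph (c *[V] x) t = c * Ph x t)
   \<and> (\<forall>x\<in>carrier V. \<forall>y\<in>carrier V. (\<forall>t\<in>T. Ph x t = Ph y t) \<longrightarrow> x = y)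
   \<and> (\<forall>h. \<exists>x\<in>carrier V. \<forall>t\<in>T. Ph x t = h t)"

lemma dim_coordinatized:
 fixes V :: "('k :: field, 'v) module"
 assumes C: "coordinatized V T Ph"
 shows "vectorspace.dim (class_ring :: 'k ring) V = card T"
proof -
 let ?K = "class_ring :: 'k ring"
 let ?W = "module_vec TYPE('k) (card T)"
 note C' = C[unfolded coordinatized_def]
 have fin: "finite T" using C' by (elim conjE)
 have z: "\<zero>\<^bsub>V\<^esub> \<in> carrier V" using C' by (elim conjE)
 have c1: "\<forall>x\<in>carrier V. \<forall>y\<in>carrier V. x +[V] y \<in> carrier V" using C' by (elim conjE)
 have c2: "\<forall>c. \<forall>x\<in>carrier V. c *[V] x \<in> carrier V" using C' by (elim conjE)
 have c3: "\<forall>t\<in>T. Ph \<zero>\<^bsub>V\<^esub> t = 0" using C' by (elim conjE)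
 have c4: "\<forall>x\<in>carrier V. \<forall>y\<in>carrier V. \<forall>t\<in>T. Ph (x +[V] y) t = Ph x t + Ph y t" using C' by (elim conjE)
 have c5: "\<forall>c. \<forall>x\<in>carrier V. \<forall>t\<in>T. Ph (c *[V] x) t = c * Ph x t" using C' by (elim conjE)
 have c6: "\<forall>x\<in>carrier V. \<forall>y\<in>carrier V. (\<forall>t\<in>T. Ph x t = Ph y t) \<longrightarrow> x = y" using C' by (elim conjE)
 have c7: "\<forall>h. \<exists>x\<in>carrier V. \<forall>t\<in>T. Ph x t = h t" using C' by (elim conjE)
 have ac: "x +[V] y \<in> carrier V" if "x \<in> carrier V" "y \<in> carrier V" for x y
  using c1 that by blast
 have sc: "c *[V] x \<in> carrier V" if "x \<in> carrier V" for c x using c2 that by blast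
 have z2: "Ph \<zero>\<^bsub>V\<^esub> t = 0" if "t \<in> T" for t using c3 that by blast
 have a: "Ph (x +[V] y) t = Ph x t + Ph y t" if "x \<in> carrier V" "y \<in> carrier V" "t \<in> T" for x y t
  using c4 that by blast
 have s: "Ph (c *[V] x) t = c * Ph x t" if "x \<in> carrier V" "t \<in> T" for c x t
  using c5 that by blast
 have eq: "x = y" if "x \<in> carrier V" "y \<in> carrier V" "\<And>t. t \<in> T ==> Ph x t = Ph y t" for x y
  using c6 that by blast
 note ex = c7[rule_format]
 have ab: "abelian_group V"
 proof (rule abelian_groupI, goal_cases)
  case (3 x y w)
  then show ?case by (intro eq) (simp_all add: ac a)
 next
  case (4 x y)
  then show ?case by (intro eq) (simp_all add: ac a)
 next
  case (5 x)
  then show ?case by (intro eq) (simp_all add: ac a z z2)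
 next
  case (6 x)
  have "(-1) *[V] x +[V] x = \<zero>\<^bsub>V\<^esub>" using 6 by (intro eq) (simp_all add: ac a sc s z z2)
  then show ?case using sc[OF 6, of "-1"] by blast
 qed (simp_all add: ac z)
 have cr: "cring ?K"
  by (rule class_cring.cring_axioms)
 have mV: "Module.module ?K V"
 proof (rule moduleI[OF cr ab], goal_cases)
  case 1 then show ?case by (simp add: sc)
 next
  case (2 c d x) then show ?case by (intro eq) (simp_all add: ac a sc s algebra_simps)
 next
  case (3 c x y) then show ?case by (intro eq) (simp_all add: ac a sc s algebra_simps)
 next
  case (4 c d x) then show ?case by (intro eq) (simp_all add: sc s)
 next
  case (5 x) then show ?case by (intro eq) (simp_all add: sc s)
 qed
 have vW: "vectorspace ?K ?W" by (rule vec_vs)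
 have vV: "vectorspace ?K V"
  using vW mV by (simp add: vectorspace_def)
 obtain t where t: "bij_betw t {0..<card T} T" using ex_bij_betw_nat_finite[OF fin] by blast
 have tT: "t i \<in> T" if "i < card T" for i using t that by (auto simp: bij_betw_def)
 \<comment> \<open>\<open>S\<close> inverts the coordinate map; it is a linear map out of the
   standard space of dimension \<open>card T\<close>.\<close>
 define S where "S v = (SOME x. x \<in> carrier V \<and> (\<forall>i<card T. Ph x (t i) = v $ i))" for v
 have S: "S v \<in> carrier V \<and> (\<forall>i<card T. Ph (S v) (t i) = v $ i)" for v
  unfolding S_def
 proof (rule someI_ex)
  obtain x where "x \<in> carrier V" "\<forall>t'\<in>T. Ph x t' = v $ (inv_into {0..<card T} t t')"
   using ex[of "\<lambda>t'. v $ (inv_into {0..<card T} t t')"] by blast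
  then show "\<exists>x. x \<in> carrier V \<and> (\<forall>i<card T. Ph x (t i) = v $ i)"
   using tT inv_into_f_f[OF bij_betw_imp_inj_on[OF t]] by (intro exI[of _ x]) auto
 qed
 have eq': "x = y" if "x \<in> carrier V" "y \<in> carrier V" "\<And>i. i < card T ==> Ph x (t i) = Ph y (t i)" for x y
 proof (rule eq[OF that(1,2)])
  fix t' assume "t' \<in> T"
  then have "t' \<in> t ` {0..<card T}" using t by (simp add: bij_betw_def)
  then obtain i where "i < card T" "t' = t i" by auto
  then show "Ph x t' = Ph y t'" using that(3) by simp
 qed
 have hom: "S \<in> LinearCombinations.module_hom ?K ?W V"
  unfolding LinearCombinations.module_hom_def
  by (auto simp: module_vec_simps S intro!: eq') (simp_all add: S ac sc a s tT)
 have lin: "linear_map ?K ?W V S"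
  by (intro linear_map.intro vW vV mod_hom.intro mod_hom_axioms.intro hom)
   (use vW mV in \<open>auto simp: vectorspace_def\<close>)
 interpret vec_space "TYPE('k)" "card T" .
 have inj: "inj_on S (carrier ?W)"
 proof (rule inj_onI)
  fix v w assume vw: "v \<in> carrier ?W" "w \<in> carrier ?W" "S v = S w"
  show "v = w"
  proof (rule eq_vecI)
   show "v $ i = w $ i" if "i < dim_vec w" for i
    using S[THEN conjunct2, rule_format, of i v] S[THEN conjunct2, rule_format, of i w] vw that
    by (simp add: module_vec_simps)
  qed (use vw in \<open>auto simp: module_vec_simps\<close>)
 qed
 have "S ` carrier ?W = carrier V"
 proof
  show "S ` carrier ?W \<subseteq> carrier V" using S by auto
  show "carrier V \<subseteq> S ` carrier ?W"
  proof
   fix x assume x: "x \<in> carrier V"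
   have "x = S (vec (card T) (\<lambda>i. Ph x (t i)))" by (rule eq') (use S x in auto)
   then show "x \<in> S ` carrier ?W" by (rule image_eqI) (simp add: module_vec_simps)
  qed
 qed
 then show ?thesis
  using linear_map.dim_eq[OF lin _ inj] dim_is_n fin_dim by simp
qed

lemma coordinatized_transfer:
 assumes C: "coordinatized V T Ph" and b: "bij_betw Ps (carrier W) (carrier V)"
  and z: "\<zero>\<^bsub>W\<^esub> \<in> carrier W" "Ps \<zero>\<^bsub>W\<^esub> = \<zero>\<^bsub>V\<^esub>"
  and a: "\<And>x y. x \<in> carrier W ==> y \<in> carrier W ==> x +[W] y \<in> carrier W"
   "\<And>x y. x \<in> carrier W ==> y \<in> carrier W ==> Ps (x +[W] y) = Ps x +[V] Ps y"
  and s: "\<And>c x. x \<in> carrier W ==> c *[W] x \<in> carrier W"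
   "\<And>c x. x \<in> carrier W ==> Ps (c *[W] x) = c *[V] Ps x"
 shows "coordinatized W T (\<lambda>x. Ph (Ps x))"
proof -
 have m: "Ps x \<in> carrier V" if "x \<in> carrier W" for x using b that by (auto simp: bij_betw_def)
 have i: "x = y" if "x \<in> carrier W" "y \<in> carrier W" "Ps x = Ps y" for x y
  using b that by (auto simp: bij_betw_def inj_on_def)
 have sur: "\<exists>x\<in>carrier W. Ps x = y" if "y \<in> carrier V" for y
  using b that unfolding bij_betw_def by (metis imageE)
 show ?thesis using C unfolding coordinatized_def
  apply (elim conjE)
  apply (intro conjI)
  subgoal by assumption
  subgoal by (rule z)
  subgoal using a by blast
  subgoal using s by blast
  subgoal using z by simp
  subgoal using a m by simp
  subgoal using s m by simp
  subgoal using m i by blast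
  subgoal using sur by metis
  done
qed

text \<open>A basis that carries its coordinate forms \<open>Z\<close> as data. Linear forms are
  then evaluated by one finite sum, without spans or independence, and exchanging the roles of
  \<open>b\<close> and \<open>Z\<close> gives a basis of the dual.\<close>

definition k_basis ::
 "('k :: field, 'a) module => ('a, 'm) module => 'b set => ('b => 'm) => ('b => 'm => 'k) => bool" where
 "k_basis A M B b Z \<longleftrightarrow> finite B \<and> (\<forall>be\<in>B. b be \<in> carrier M)
   \<and> (\<forall>be\<in>B. \<forall>x\<in>carrier M. \<forall>y\<in>carrier M. Z be (x +[M] y) = Z be x + Z be y)
   \<and> (\<forall>be\<in>B. \<forall>c. \<forall>x\<in>carrier M. Z be (scalar A c *[M] x) = c * Z be x)
   \<and> (\<forall>be\<in>B. \<forall>ga\<in>B. Z be (b ga) = (if be = ga then 1 else 0))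
   \<and> (\<forall>x\<in>carrier M. x = finsum M (\<lambda>be. scalar A (Z be x) *[M] b be) B)"

lemma additive_finsum:
 fixes fi :: "'m => 'k :: field"
 assumes M: "abelian_group M"
  and add: "\<And>x y. x \<in> carrier M ==> y \<in> carrier M ==> fi (x +[M] y) = fi x + fi y"
  and fin: "finite S" and g: "g \<in> S \<rightarrow> carrier M"
 shows "fi (finsum M g S) = (\<Sum>i\<in>S. fi (g i))"
proof -
 interpret M: abelian_group M by fact
 have z: "fi \<zero>\<^bsub>M\<^esub> = 0" using add[of "\<zero>\<^bsub>M\<^esub>" "\<zero>\<^bsub>M\<^esub>"] by (metis M.r_zero M.zero_closed add_cancel_right_right)
 show ?thesis using fin g
 proof (induction S)
  case empty
  then show ?case by (simp add: z)
 next
  case (insert i S)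
  then have "finsum M g S \<in> carrier M" "g i \<in> carrier M" by auto
  then show ?case using insert by (simp add: add)
 qed
qed

context unital_algebra
begin

lemma k_basis_functional:
 assumes M: "left_module A M" and kb: "k_basis A M B b Z"
  and add: "\<And>x y. x \<in> carrier M ==> y \<in> carrier M ==> fi (x +[M] y) = fi x + fi y"
  and hom: "\<And>c x. x \<in> carrier M ==> fi (scalar A c *[M] x) = c * fi x"
  and x: "x \<in> carrier M"
 shows "fi x = (\<Sum>be\<in>B. Z be x * fi (b be))"
proof -
 have *: "finite B" "\<And>be. be \<in> B ==> b be \<in> carrier M"
   "x = finsum M (\<lambda>be. scalar A (Z be x) *[M] b be) B"
  using kb x unfolding k_basis_def by blast+
 have "fi (finsum M (\<lambda>be. scalar A (Z be x) *[M] b be) B) = (\<Sum>be\<in>B. fi (scalar A (Z be x) *[M] b be))"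
  by (rule additive_finsum[OF lmod_abelian_group[OF M] add *(1)])
   (use *(2) lmod_smult_closed[OF M scalar_closed] in auto)
 also have "\<dots> = (\<Sum>be\<in>B. Z be x * fi (b be))" by (rule sum.cong) (simp_all add: *(2) hom)
 finally show ?thesis using *(3) by metis
qed

lemma k_basis_eqI:
 assumes kb: "k_basis A M B b Z" and x: "x \<in> carrier M" and y: "y \<in> carrier M"
  and eq: "\<And>be. be \<in> B ==> Z be x = Z be y" and M: "left_module A M"
 shows "x = y"
proof -
 interpret M: abelian_group M using M by (rule lmod_abelian_group)
 have b: "\<And>be. be \<in> B ==> b be \<in> carrier M" using kb unfolding k_basis_def by blast
 have "finsum M (\<lambda>be. scalar A (Z be x) *[M] b be) B = finsum M (\<lambda>be. scalar A (Z be y) *[M] b be) B"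
  by (rule M.finsum_cong') (use eq b lmod_smult_closed[OF M scalar_closed] in auto)
 moreover have "x = finsum M (\<lambda>be. scalar A (Z be x) *[M] b be) B"
  "y = finsum M (\<lambda>be. scalar A (Z be y) *[M] b be) B"
  using kb x y unfolding k_basis_def by blast+
 ultimately show ?thesis by (elim ssubst) (rule refl | assumption)+
qed

lemma k_basis_dual:
 assumes M: "left_module A M" and kb: "k_basis A M B b Z"
 shows "k_basis (opposite A) (k_dual A M) B (\<lambda>be. \<lambda>x\<in>carrier M. Z be x) (\<lambda>be fi. fi (b be))"
proof -
 interpret M: abelian_group M using M by (rule lmod_abelian_group)
 let ?D = "k_dual A M" and ?z = "\<lambda>be. \<lambda>x\<in>carrier M. Z be x"
 have LD: "left_module (opposite A) ?D" by (rule k_dual_left_module[OF M])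
 interpret D: abelian_group ?D using LD by (rule lmod_abelian_group)
 interpret o: unital_algebra "opposite A" by (rule opposite_unital_algebra)
 note cl = lmod_smult_closed[OF M scalar_closed]
 have fin: "finite B" and b: "\<And>be. be \<in> B ==> b be \<in> carrier M"
  and za: "\<And>be x y. be \<in> B ==> x \<in> carrier M ==> y \<in> carrier M ==> Z be (x +[M] y) = Z be x + Z be y"
  and zs: "\<And>be c x. be \<in> B ==> x \<in> carrier M ==> Z be (scalar A c *[M] x) = c * Z be x"
  and zb: "\<And>be ga. be \<in> B ==> ga \<in> B ==> Z be (b ga) = (if be = ga then 1 else 0)"
  using kb unfolding k_basis_def by blast+
 have zD: "?z be \<in> carrier ?D" if "be \<in> B" for be
  by (rule k_dualI) (use that in \<open>auto simp: za zs cl\<close>)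
 have exp: "fi = finsum ?D (\<lambda>be. scalar (opposite A) (fi (b be)) *[?D] ?z be) B" (is "fi = ?R")
  if fi: "fi \<in> carrier ?D" for fi
 proof -
  have t: "(\<lambda>be. scalar (opposite A) (fi (b be)) *[?D] ?z be) \<in> B \<rightarrow> carrier ?D"
   using zD lmod_smult_closed[OF LD o.scalar_closed] by blast
  then have R: "?R \<in> carrier ?D" by (rule D.finsum_closed)
  have "?R x = fi x" if x: "x \<in> carrier M" for x
  proof -
   have "?R x = (\<Sum>be\<in>B. (scalar (opposite A) (fi (b be)) *[?D] ?z be) x)"
    by (rule additive_finsum[OF D.abelian_group_axioms _ fin t, of "\<lambda>si. si x"]) (use x in simp)
   also have "\<dots> = (\<Sum>be\<in>B. Z be x * fi (b be))"
    by (rule sum.cong) (use x in \<open>auto simp: zs cl mult.commute\<close>)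
   also have "\<dots> = fi x"
    by (rule k_basis_functional[symmetric, OF M kb _ _ x]) (auto simp: k_dualD[OF fi])
   finally show ?thesis .
  qed
  then show ?thesis
   by (intro extensionalityI[OF k_dualD(1)[OF fi] k_dualD(1)[OF R]]) simp
 qed
 show ?thesis unfolding k_basis_def
 proof (intro conjI ballI allI)
  fix fi assume "fi \<in> carrier ?D"
  then show "fi = finsum ?D (\<lambda>be. scalar (opposite A) (fi (b be)) *[?D] ?z be) B" by (rule exp)
 next
  fix be fi si assume "be \<in> B" "fi \<in> carrier ?D" "si \<in> carrier ?D"
  then show "(fi +[?D] si) (b be) = fi (b be) + si (b be)" using b by simp
 next
  fix be c fi assume "be \<in> B" "fi \<in> carrier ?D"
  then show "(scalar (opposite A) c *[?D] fi) (b be) = c * fi (b be)" using b k_dualD(3)[of fi A M] by simp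
 next
  fix be ga assume "be \<in> B" "ga \<in> B"
  then show "(?z ga) (b be) = (if be = ga then 1 else 0)" using zb[of ga be] b by auto
 qed (use fin zD in auto)
qed

section \<open>The E-invariants\<close>

text \<open>One known presentation shows that the choice inside \<open>AR_transpose\<close> is made
  among actual presentations. The chosen one stays unknown and is controlled only through uniqueness
  up to isomorphism.\<close>

lemma AR_transpose_choice:
 fixes P1 P0 :: "('a, nat => 'a) module"
 assumes pres: "min_proj_presentation A M P1 f P0 g"
 obtains Q1 f' Q0 g' where
  "min_proj_presentation A M (Q1 :: ('a, nat => 'a) module) f' (Q0 :: ('a, nat => 'a) module) g'"
  "AR_transpose A M = quotient_module (star A Q1)
    ((\<lambda>fi. compose (carrier Q1) fi f') ` carrier (star A Q0))"
proof -
 let ?p = "SOME (P1 :: ('a, nat => 'a) module, f, P0 :: ('a, nat => 'a) module, g).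
   min_proj_presentation A M P1 f P0 g"
 obtain Q1 f' Q0 g' where eq: "?p = (Q1, f', Q0, g')" by (cases ?p) auto
 have "(case ?p of (P1, f, P0, g) => min_proj_presentation A M P1 f P0 g)"
  by (rule someI_ex) (use pres in auto)
 then have "min_proj_presentation A M Q1 f' Q0 g'" unfolding eq by simp
 moreover have "AR_transpose A M = quotient_module (star A Q1)
    ((\<lambda>fi. compose (carrier Q1) fi f') ` carrier (star A Q0))"
  unfolding AR_transpose_def eq by simp
 ultimately show ?thesis using that by blast
qed

lemma star_map_hom:
 assumes f: "f \<in> Hom A P Q" and P: "left_module A P" and Q: "left_module A Q"
 shows "(\<lambda>fi\<in>carrier (star A Q). compose (carrier P) fi f) \<in> Hom (opposite A) (star A Q) (star A P)"
proof -
 have LQ: "left_module (opposite A) (star A Q)" by (rule star_left_module[OF Q])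
 interpret S: abelian_group "star A Q" using LQ by (rule lmod_abelian_group)
 note fD = HomD[OF f]
 show ?thesis
 proof (rule HomI, goal_cases)
  case (2 fi)
  then show ?case using Hom_compose[OF f, of fi "regular_module A"] P by (simp add: star_def)
 next
  case (3 fi si)
  then have "fi +[star A Q] si \<in> carrier (star A Q)" by (rule S.a_closed)
  then show ?case using 3 fD(2) by (simp add: star_def compose_def fun_eq_iff)
 next
  case (4 a fi)
  then have "a *[star A Q] fi \<in> carrier (star A Q)" by (rule lmod_smult_closed[OF LQ])
  then show ?case using 4 fD(2) by (simp add: star_def compose_def fun_eq_iff)
 qed simp
qed

lemma AR_transpose_submodule:
 assumes M: "left_module A M" and pres: "min_proj_presentation A M Q1 f Q0 g"
 shows "left_module A Q1" "left_module A Q0" "f \<in> Hom A Q1 Q0"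
  "left_submodule (opposite A) ((\<lambda>fi. compose (carrier Q1) fi f) ` carrier (star A Q0)) (star A Q1)"
proof -
 let ?K = "Q0\<lparr>carrier := a_kernel Q0 M g\<rparr>"
 have 1: "projective_cover A Q0 M g" "projective_cover A Q1 ?K f"
  using pres by (auto simp: min_proj_presentation_def)
 show Q1: "left_module A Q1" and Q0: "left_module A Q0"
  using 1 by (auto simp: projective_cover_def fg_projective_def)
 have "f \<in> Hom A Q1 ?K" using 1 by (simp add: projective_cover_def)
 from HomD[OF this] show f: "f \<in> Hom A Q1 Q0"
  by (intro HomI) (auto simp: a_kernel_def')
 interpret o: unital_algebra "opposite A" by (rule opposite_unital_algebra)
 have LQ0: "left_module (opposite A) (star A Q0)" by (rule star_left_module[OF Q0])
 interpret S: abelian_group "star A Q0" using LQ0 by (rule lmod_abelian_group)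
 have "left_submodule (opposite A) (carrier (star A Q0)) (star A Q0)"
  by (rule o.left_submoduleI[OF LQ0]) (auto intro: lmod_smult_closed[OF LQ0])
 from o.image_left_submodule[OF LQ0 star_left_module[OF Q1] star_map_hom[OF f Q1 Q0] this]
 show "left_submodule (opposite A) ((\<lambda>fi. compose (carrier Q1) fi f) ` carrier (star A Q0)) (star A Q1)"
  by simp
qed

lemma AR_transpose_left_module:
 fixes P1 P0 :: "('a, nat => 'a) module"
 assumes M: "left_module A M" and pres: "min_proj_presentation A M P1 f P0 g"
 shows "left_module (opposite A) (AR_transpose A M)"
proof -
 interpret o: unital_algebra "opposite A" by (rule opposite_unital_algebra)
 obtain Q1 f' Q0 g' where
  p: "min_proj_presentation A M (Q1 :: ('a, nat => 'a) module) f' (Q0 :: ('a, nat => 'a) module) g'"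
  and e: "AR_transpose A M = quotient_module (star A Q1)
    ((\<lambda>fi. compose (carrier Q1) fi f') ` carrier (star A Q0))"
  using AR_transpose_choice[OF pres] by blast
 show ?thesis unfolding e
  by (rule o.quotient_left_module)
   (use AR_transpose_submodule[OF M p] star_left_module in auto)
qed

text \<open>Let \<open>X\<close> be the inverse translate of \<open>M\<close>. Transposition
  identifies the homomorphisms from \<open>X\<close> to \<open>M\<close> with those from the dual of
  \<open>M\<close> to the dual of \<open>X\<close>, and the dual of \<open>X\<close> is the
  translate of the dual of \<open>M\<close> over the opposite algebra. Thus \<open>E\<^sup>-\<close>
  over \<open>A\<close> is \<open>E\<close> of the dual module over
  \<open>opposite A\<close>.\<close>

theorem E_inv_minus_eq_card:
 fixes P1 P0 :: "('a, nat => 'a) module"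
 assumes M: "left_module A M" and kb: "k_basis A M B b Z"
  and pres: "min_proj_presentation (opposite A) (k_dual A M) P1 f P0 g"
  and co: "coordinatized (Hom_space (opposite A) (k_dual A M) (AR_tau (opposite A) (k_dual A M))) T Ph"
 shows "E_inv_minus A M = card T"
proof -
 interpret M: abelian_group M using M by (rule lmod_abelian_group)
 interpret o: unital_algebra "opposite A" by (rule opposite_unital_algebra)
 let ?N = "k_dual A M" and ?X = "AR_transpose (opposite A) (k_dual A M)"
 have N: "left_module (opposite A) ?N" by (rule k_dual_left_module[OF M])
 have X: "left_module A ?X" using o.AR_transpose_left_module[OF N pres] by simp
 interpret X: abelian_group ?X using X by (rule lmod_abelian_group)
 interpret N: abelian_group ?N using N by (rule lmod_abelian_group)
 let ?D = "k_dual A ?X"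
 have tau: "AR_tau (opposite A) ?N = ?D" by (simp add: AR_tau_def)
 let ?H = "Hom_space A ?X M" and ?H' = "Hom_space (opposite A) ?N ?D"
 note clM = lmod_smult_closed[OF M] lmod_smult_closed[OF M scalar_closed]
 note clX = lmod_smult_closed[OF X] lmod_smult_closed[OF X scalar_closed]
 have fin: "finite B" and b: "\<And>be. be \<in> B ==> b be \<in> carrier M"
  and za: "\<And>be x y. be \<in> B ==> x \<in> carrier M ==> y \<in> carrier M ==> Z be (x +[M] y) = Z be x + Z be y"
  and zs: "\<And>be c x. be \<in> B ==> x \<in> carrier M ==> Z be (scalar A c *[M] x) = c * Z be x"
  and zb: "\<And>be ga. be \<in> B ==> ga \<in> B ==> Z be (b ga) = (if be = ga then 1 else 0)"
  using kb unfolding k_basis_def by blast+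
 let ?z = "\<lambda>be. \<lambda>x\<in>carrier M. Z be x"
 have zD: "?z be \<in> carrier ?N" if "be \<in> B" for be
  by (rule k_dualI) (use that in \<open>auto simp: za zs clM\<close>)
 define Ps where "Ps th = (\<lambda>fi\<in>carrier ?N. \<lambda>x\<in>carrier ?X. fi (th x))" for th
 have mem: "(\<lambda>x\<in>carrier ?X. fi (th x)) \<in> carrier ?D" if th: "th \<in> Hom A ?X M" and fi: "fi \<in> carrier ?N" for th fi
  by (rule k_dualI) (auto simp: clX HomD[OF th] k_dualD[OF fi] scalar_closed)
 have Ps: "Ps th \<in> Hom (opposite A) ?N ?D" if th: "th \<in> Hom A ?X M" for th
 proof (rule HomI, goal_cases)
  case 1 then show ?case by (simp add: Ps_def)
 next
  case (2 fi) then show ?case using mem[OF th] by (simp add: Ps_def)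
 next
  case (3 fi si)
  then have "fi +[?N] si \<in> carrier ?N" by (rule N.a_closed)
  then show ?case using 3 HomD(2)[OF th] by (simp add: Ps_def fun_eq_iff)
 next
  case (4 a fi)
  then have "a *[?N] fi \<in> carrier ?N" by (rule lmod_smult_closed[OF N])
  then show ?case using 4 HomD(2,4)[OF th] clX by (simp add: Ps_def fun_eq_iff)
 qed
 have inj: "inj_on Ps (carrier ?H)"
 proof (rule inj_onI)
  fix th th' assume "th \<in> carrier ?H" "th' \<in> carrier ?H" and e: "Ps th = Ps th'"
  then have th: "th \<in> Hom A ?X M" "th' \<in> Hom A ?X M" by (auto simp: Hom_space_def)
  show "th = th'"
  proof (rule extensionalityI[OF HomD(1)[OF th(1)] HomD(1)[OF th(2)]])
   fix x assume x: "x \<in> carrier ?X"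
   show "th x = th' x"
   proof (rule k_basis_eqI[OF kb HomD(2)[OF th(1) x] HomD(2)[OF th(2) x] _ M])
    fix be assume "be \<in> B"
    from zD[OF this] have "Ps th (?z be) x = ?z be (th x)" "Ps th' (?z be) x = ?z be (th' x)"
     using x by (simp_all add: Ps_def del: restrict_apply) (simp_all add: Ps_def)
    then show "Z be (th x) = Z be (th' x)" using e HomD(2)[OF th(1) x] HomD(2)[OF th(2) x] by simp
   qed
  qed
 qed
 have sur: "\<exists>th\<in>carrier ?H. Ps th = Th" if Th: "Th \<in> Hom (opposite A) ?N ?D" for Th
 proof -
  note TD = HomD[OF Th]
  \<comment> \<open>The map whose transpose is \<open>Th\<close>: its coordinate at
    \<open>be\<close> is the value of \<open>Th\<close> on the coordinate form \<open>?z be\<close>.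
    Here finite dimension of \<open>M\<close> enters.\<close>
  define th where "th = (\<lambda>x\<in>carrier ?X. finsum M (\<lambda>be. scalar A (Th (?z be) x) *[M] b be) B)"
  have cl: "(\<lambda>be. scalar A (c be) *[M] b be) \<in> B \<rightarrow> carrier M" for c
   using clM b by auto
  have thM: "th x \<in> carrier M" if "x \<in> carrier ?X" for x
   using that cl by (simp add: th_def)
  have Zth: "Z ga (th x) = Th (?z ga) x" if x: "x \<in> carrier ?X" and ga: "ga \<in> B" for x ga
  proof -
   have "Z ga (th x) = (\<Sum>be\<in>B. Z ga (scalar A (Th (?z be) x) *[M] b be))"
    using additive_finsum[OF M.abelian_group_axioms za[OF ga] fin cl] x by (simp add: th_def)
   also have "\<dots> = (\<Sum>be\<in>B. if be = ga then Th (?z be) x else 0)"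
    by (rule sum.cong) (use zs zb ga b in auto)
   also have "\<dots> = Th (?z ga) x" using fin ga by simp
   finally show ?thesis .
  qed
  have fith: "fi (th x) = Th fi x" if fi: "fi \<in> carrier ?N" and x: "x \<in> carrier ?X" for fi x
  proof -
   have "fi (th x) = (\<Sum>be\<in>B. Z be (th x) * fi (b be))"
    by (rule k_basis_functional[OF M kb _ _ thM[OF x]]) (auto simp: k_dualD[OF fi])
   also have "\<dots> = (\<Sum>be\<in>B. fi (b be) * Th (?z be) x)"
    by (rule sum.cong) (simp_all add: Zth[OF x] mult.commute)
   also have "\<dots> = Th fi x"
   proof (rule o.k_basis_functional[symmetric, OF N k_basis_dual[OF M kb] _ _ fi])
    show "Th (fi +[?N] si) x = Th fi x + Th si x" if "fi \<in> carrier ?N" "si \<in> carrier ?N" for fi si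
     unfolding TD(3)[OF that] using x by simp
    show "Th (scalar (opposite A) c *[?N] fi) x = c * Th fi x" if "fi \<in> carrier ?N" for fi c
     unfolding TD(4)[OF o.scalar_closed that] using x k_dualD(3)[OF TD(2)[OF that] x] by simp
   qed
   finally show ?thesis .
  qed
  have h: "th \<in> Hom A ?X M"
  proof (rule HomI, goal_cases)
   case 1 then show ?case by (simp add: th_def)
  next
   case (2 x) then show ?case by (rule thM)
  next
   case (3 x y)
   show ?case
   proof (rule k_basis_eqI[OF kb _ _ _ M])
    fix be assume be: "be \<in> B"
    show "Z be (th (x +[?X] y)) = Z be (th x +[M] th y)"
     unfolding za[OF be thM[OF 3(1)] thM[OF 3(2)]] Zth[OF 3(1) be] Zth[OF 3(2) be]
      Zth[OF X.a_closed[OF 3] be]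
     by (rule k_dualD(2)[OF TD(2)[OF zD[OF be]] 3])
   qed (use 3 thM in auto)
  next
   case (4 a x)
   show ?case
   proof (rule k_basis_eqI[OF kb _ _ _ M])
    fix be assume be: "be \<in> B"
    have a: "a \<in> carrier (opposite A)" using 4 by simp
    have "Z be (a *[M] th x) = (a *[?N] ?z be) (th x)"
     using clM(1)[OF 4(1) thM[OF 4(2)]] thM[OF 4(2)] by simp
    also have "\<dots> = Th (a *[?N] ?z be) x"
     by (rule fith[OF lmod_smult_closed[OF N a zD[OF be]] 4(2)])
    also have "\<dots> = Th (?z be) (a *[?X] x)"
     unfolding TD(4)[OF a zD[OF be]] using 4 by simp
    also have "\<dots> = Z be (th (a *[?X] x))" using Zth[OF clX(1)[OF 4] be] by simp
    finally show "Z be (th (a *[?X] x)) = Z be (a *[M] th x)" by simp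
   qed (use 4 thM clM clX in auto)
  qed
  have "Ps th = Th"
  proof (rule extensionalityI[OF HomD(1)[OF Ps[OF h]] TD(1)])
   fix fi assume fi: "fi \<in> carrier ?N"
   show "Ps th fi = Th fi"
    by (rule extensionalityI[OF k_dualD(1)[OF HomD(2)[OF Ps[OF h] fi]] k_dualD(1)[OF TD(2)[OF fi]]])
     (use fi fith in \<open>simp add: Ps_def\<close>)
  qed
  then show ?thesis using h by (auto simp: Hom_space_def)
 qed
 have bij: "bij_betw Ps (carrier ?H) (carrier ?H')"
 proof -
  have "Ps ` carrier ?H = carrier ?H'"
  proof
   show "Ps ` carrier ?H \<subseteq> carrier ?H'" using Ps by (auto simp: Hom_space_def)
   show "carrier ?H' \<subseteq> Ps ` carrier ?H"
   proof
    fix Th assume "Th \<in> carrier ?H'"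
    then have "Th \<in> Hom (opposite A) ?N ?D" by (simp add: Hom_space_def)
    from sur[OF this] show "Th \<in> Ps ` carrier ?H" by (elim bexE) (rule image_eqI, simp_all)
   qed
  qed
  then show ?thesis using inj by (simp add: bij_betw_def)
 qed
 have "coordinatized ?H T (\<lambda>th. Ph (Ps th))"
 proof (rule coordinatized_transfer[OF co[unfolded tau] bij], goal_cases)
  case 1 then show ?case by (rule Hom_space_closed(1)[OF X M])
 next
  case 2
  have "fi \<zero>\<^bsub>M\<^esub> = 0" if "fi \<in> carrier ?N" for fi
   using k_dualD(2)[OF that M.zero_closed M.zero_closed] by (metis M.r_zero M.zero_closed add_cancel_right_right)
  then show ?case by (auto simp: Hom_space_def Ps_def fun_eq_iff)
 next
  case (3 th th') then show ?case by (rule Hom_space_closed(2)[OF X M])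
 next
  case (4 th th')
  then have th: "th \<in> Hom A ?X M" "th' \<in> Hom A ?X M" by (auto simp: Hom_space_def)
  show ?case using HomD(2)[OF th(1)] HomD(2)[OF th(2)]
   by (auto simp: Hom_space_def Ps_def fun_eq_iff k_dualD(2))
 next
  case (5 c th) then show ?case by (rule Hom_space_closed(3)[OF X M])
 next
  case (6 c th)
  then have th: "th \<in> Hom A ?X M" by (auto simp: Hom_space_def)
  show ?case using HomD(2)[OF th] clX
   by (auto simp: Hom_space_def Ps_def fun_eq_iff HomD(4)[OF th scalar_closed])
 qed
 then show ?thesis
  unfolding E_inv_minus_def dim_Hom_def AR_tau_minus_def by (rule dim_coordinatized)
qed

end

text \<open>The direct sum of the projective modules \<open>A e k\<close> for idempotents \<open>e k\<close>, \<open>k < q\<close>.\<close>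

definition idem_module :: "('k, 'a) module => nat => (nat => 'a) => ('a, nat => 'a) module" where
 "idem_module A q e =
   (free_module A q)\<lparr>carrier := {x \<in> {..<q} \<rightarrow>\<^sub>E carrier A. \<forall>k<q. x k \<otimes>\<^bsub>A\<^esub> e k = x k}\<rparr>"

definition idem_gen :: "('k, 'a) module => nat => (nat => 'a) => nat => nat => 'a" where
 "idem_gen A q e k = (\<lambda>j\<in>{..<q}. if j = k then e k else \<zero>\<^bsub>A\<^esub>)"

lemma idem_module_simps [simp]:
 "zero (idem_module A q e) = (\<lambda>i\<in>{..<q}. \<zero>\<^bsub>A\<^esub>)"
 "add (idem_module A q e) x y = (\<lambda>i\<in>{..<q}. x i +[A] y i)"
 "a *[idem_module A q e] x = (\<lambda>i\<in>{..<q}. a \<otimes>\<^bsub>A\<^esub> x i)"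
 by (simp_all add: idem_module_def free_module_def)

lemma idem_moduleD:
 assumes "x \<in> carrier (idem_module A q e)"
 shows "x \<in> extensional {..<q}" "\<And>k. k < q ==> x k \<in> carrier A" "\<And>k. k < q ==> x k \<otimes>\<^bsub>A\<^esub> e k = x k"
 using assms by (auto simp: idem_module_def PiE_iff)

lemma idem_moduleI:
 assumes "x \<in> extensional {..<q}" "\<And>k. k < q ==> x k \<in> carrier A" "\<And>k. k < q ==> x k \<otimes>\<^bsub>A\<^esub> e k = x k"
 shows "x \<in> carrier (idem_module A q e)"
 using assms by (auto simp: idem_module_def PiE_iff)

locale idempotents = unital_algebra A for A :: "('k :: field, 'a) module" (structure) +
 fixes q :: nat and e :: "nat => 'a"
 assumes idem_closed: "k < q ==> e k \<in> carrier A"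
  and idem: "k < q ==> e k \<otimes> e k = e k"
begin

lemma idem_left_module: "left_module A (idem_module A q e)"
proof -
 have "left_submodule A (carrier (idem_module A q e)) (free_module A q)"
 proof (rule left_submoduleI[OF free_left_module], goal_cases)
  case 1 then show ?case by (auto simp: idem_module_def free_module_def)
 next
  case 2 then show ?case by (auto intro!: idem_moduleI simp: free_module_def idem_closed)
 next
  case (3 x y) then show ?case
   by (auto intro!: idem_moduleI simp: free_module_def idem_closed idem_moduleD l_distr)
 next
  case (4 a x) then show ?case
   by (auto intro!: idem_moduleI simp: free_module_def idem_closed idem_moduleD m_assoc)
 qed
 from left_submodule_module[OF free_left_module this] show ?thesis
  by (simp add: idem_module_def free_module_def)
qed

lemma idem_gen_closed: "k < q ==> idem_gen A q e k \<in> carrier (idem_module A q e)"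
 by (auto intro!: idem_moduleI simp: idem_gen_def idem_closed idem)

lemma idem_projection:
 "(\<lambda>x\<in>carrier (free_module A q). \<lambda>k\<in>{..<q}. x k \<otimes> e k) \<in> Hom A (free_module A q) (idem_module A q e)"
proof (rule HomI, goal_cases)
 case (2 x)
 then show ?case
  by (auto intro!: idem_moduleI simp: free_module_def idem_closed idem m_assoc PiE_iff)
next
 case (3 x y)
 then show ?case
  by (auto simp: free_module_def idem_closed PiE_iff l_distr fun_eq_iff)
next
 case (4 a x)
 then show ?case
  by (auto simp: free_module_def idem_closed PiE_iff m_assoc fun_eq_iff)
qed simp

lemma idem_free: "x \<in> carrier (idem_module A q e) ==> x \<in> carrier (free_module A q)"
 by (auto simp: idem_module_def free_module_def)

lemma idem_projective: "fg_projective A (idem_module A q e)"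
 unfolding fg_projective_def
proof (intro conjI exI bexI ballI)
 show "(\<lambda>x\<in>carrier (idem_module A q e). x) \<in> Hom A (idem_module A q e) (free_module A q)"
 proof (rule HomI, goal_cases)
  case (3 x y)
  then have "x +[idem_module A q e] y \<in> carrier (idem_module A q e)"
   using lmod_abelian_group[OF idem_left_module]
   by (simp add: abelian_group_def abelian_monoid.a_closed del: idem_module_simps)
  then show ?case using 3 by (simp add: free_module_def)
 next
  case (4 a x)
  then have "a *[idem_module A q e] x \<in> carrier (idem_module A q e)"
   by (rule lmod_smult_closed[OF idem_left_module])
  then show ?case using 4 by (simp add: free_module_def)
 qed (auto intro: idem_free)
 show "(\<lambda>x\<in>carrier (free_module A q). \<lambda>k\<in>{..<q}. x k \<otimes> e k)
   ((\<lambda>x\<in>carrier (idem_module A q e). x) x) = x"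
  if x: "x \<in> carrier (idem_module A q e)" for x
  using idem_free[OF x] idem_moduleD[OF x] by (auto simp: x fun_eq_iff extensional_def x)
qed (rule idem_left_module idem_projection)+

lemma idem_expansion:
 assumes si: "si \<in> Hom A (idem_module A q e) L" and L: "left_module A L"
  and z: "z \<in> carrier (idem_module A q e)"
 shows "si z = finsum L (\<lambda>k. z k *[L] si (idem_gen A q e k)) {..<q}"
proof -
 let ?F = "free_module A q" and ?I = "idem_module A q e"
 let ?r = "\<lambda>x\<in>carrier ?F. \<lambda>k\<in>{..<q}. x k \<otimes> e k"
 let ?u = "\<lambda>i. \<lambda>j\<in>{..<q}. if j = i then \<one> else \<zero>"
 interpret F: abelian_group ?F using free_left_module by (rule lmod_abelian_group)
 interpret L: abelian_group L using L by (rule lmod_abelian_group)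
 have zF: "z \<in> carrier ?F" using z by (rule idem_free)
 have zc: "z k \<in> carrier A" if "k < q" for k using idem_moduleD(2)[OF z that] .
 have uF: "?u i \<in> carrier ?F" for i by (auto simp: free_module_def)
 define fi where "fi = compose (carrier ?F) si ?r"
 have fi: "fi \<in> Hom A ?F L" unfolding fi_def
  by (rule Hom_compose[OF idem_projection si free_left_module])
 have rz: "?r z = z"
  using zF idem_moduleD[OF z] by (auto simp: fun_eq_iff extensional_def)
 have ru: "?r (?u k) = idem_gen A q e k" if "k < q" for k
 proof -
  have "?r (?u k) = (\<lambda>j\<in>{..<q}. ?u k j \<otimes> e j)" using uF by (simp only: restrict_apply if_True)
  also have "\<dots> = idem_gen A q e k" using that
   by (auto simp: idem_gen_def idem_closed fun_eq_iff)
  finally show ?thesis .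
 qed
 have c: "(\<lambda>k. z k *[?F] ?u k) \<in> {..<q} \<rightarrow> carrier ?F"
  using lmod_smult_closed[OF free_left_module _ uF] zc by auto
 have "si z = fi z" using zF rz by (simp only: fi_def compose_def restrict_apply if_True)
 also have "\<dots> = fi (finsum ?F (\<lambda>k. z k *[?F] ?u k) {..<q})"
  by (rule arg_cong[OF free_expansion[OF zF]])
 also have "\<dots> = finsum L (\<lambda>k. fi (z k *[?F] ?u k)) {..<q}"
  by (rule Hom_finsum[OF fi F.abelian_group_axioms L.abelian_group_axioms _ c]) simp
 also have "\<dots> = finsum L (\<lambda>k. z k *[L] si (idem_gen A q e k)) {..<q}"
 proof (rule L.finsum_cong')
  fix k assume k: "k \<in> {..<q}"
  have "fi (z k *[?F] ?u k) = z k *[L] fi (?u k)"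
   by (rule HomD(4)[OF fi zc uF]) (use k in simp)
  also have "fi (?u k) = si (?r (?u k))"
   using uF by (simp only: fi_def compose_def restrict_apply if_True)
  also have "?r (?u k) = idem_gen A q e k" by (rule ru) (use k in simp)
  finally show "fi (z k *[?F] ?u k) = z k *[L] si (idem_gen A q e k)" .
 qed (use HomD(2)[OF si idem_gen_closed] lmod_smult_closed[OF L zc] in auto)
 finally show ?thesis .
qed

end

context unital_algebra
begin

lemma star_finsum_apply:
 assumes P: "left_module A P" and "finite S" "g \<in> S \<rightarrow> carrier (star A P)" "x \<in> carrier P"
 shows "finsum (star A P) g S x = finsum A (\<lambda>i. g i x) S"
proof -
 interpret F: abelian_group "star A P"
  using star_left_module[OF P] by (rule lmod_abelian_group)
 have c: "fi x \<in> carrier A" if "fi \<in> carrier (star A P)" for fi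
  using HomD(2)[of fi A P "regular_module A" x] that assms(4)
  by (simp add: star_def regular_module_def)
 show ?thesis using assms(2,3)
 proof (induction S)
  case empty
  then show ?case using assms(4) by (simp only: F.finsum_empty finsum_empty) (simp add: star_def)
 next
  case (insert i S)
  have "finsum A (\<lambda>i. g i x) (insert i S) = g i x \<oplus> finsum A (\<lambda>i. g i x) S"
   by (rule finsum_insert) (use insert c in auto)
  moreover have "finsum (star A P) g (insert i S) = g i +[star A P] finsum (star A P) g S"
   by (rule F.finsum_insert) (use insert in auto)
  ultimately show ?case using insert assms(4) by (simp add: star_def)
 qed
qed

text \<open>
 For a presentation by sums of modules \<open>A e\<close> in which \<open>f\<close> is right multiplication by elements
 \<open>u k\<close>, a homomorphism from \<open>M\<close> to \<open>\<tau> M\<close> is a family of linear forms on the spaces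
 \<open>ep k M\<close> vanishing on \<open>u k M\<close>.
\<close>

theorem E_inv_coordinates:
 fixes M :: "('a, 'm) module"
 assumes M: "left_module A M" and kb: "k_basis A M B b Z"
  and ep: "idempotents A q ep" and e: "idempotents A q e"
  and u: "\<And>k. k < q ==> u k \<in> carrier A" "\<And>k. k < q ==> ep k \<otimes> u k = u k"
   "\<And>k. k < q ==> u k \<otimes> e k = u k"
  and f: "\<And>x. x \<in> carrier (idem_module A q ep) ==> f x = (\<lambda>k\<in>{..<q}. x k \<otimes> u k)"
  and pres: "min_proj_presentation A M (idem_module A q ep) f (idem_module A q e) g"
  and T: "T \<subseteq> {..<q} \<times> B"
  and T1: "\<And>k be. (k, be) \<in> T ==> ep k *[M] b be = b be"
  and T2: "\<And>k be m. (k, be) \<in> T ==> m \<in> carrier M ==> Z be (u k *[M] m) = 0"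
  and T3: "\<And>k be. k < q ==> be \<in> B ==> (k, be) \<notin> T ==>
   ep k *[M] b be = \<zero>\<^bsub>M\<^esub> \<or> (\<exists>m\<in>carrier M. u k *[M] m = b be)"
 shows "\<exists>Ph :: ('m => ((nat => 'a) => 'a) set => 'k) => _. coordinatized (Hom_space A M (AR_tau A M)) T Ph"
proof -
 interpret M: abelian_group M using M by (rule lmod_abelian_group)
 interpret ep: idempotents A q ep by (rule ep)
 interpret e: idempotents A q e by (rule e)
 interpret o: unital_algebra "opposite A" by (rule opposite_unital_algebra)
 let ?I1 = "idem_module A q ep" and ?I0 = "idem_module A q e"
 \<comment> \<open>The presentation behind \<open>AR_tau\<close> is the chosen one, not the given
   one. The isomorphisms \<open>al1\<close> and \<open>al0\<close> below transport the explicit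
   generators and the explicit form of \<open>f\<close> to it.\<close>
 obtain Q1 f' Q0 g' where
  p: "min_proj_presentation A M (Q1 :: ('a, nat => 'a) module) f' (Q0 :: ('a, nat => 'a) module) g'"
  and Xe: "AR_transpose A M = quotient_module (star A Q1)
    ((\<lambda>fi. compose (carrier Q1) fi f') ` carrier (star A Q0))"
  using AR_transpose_choice[OF pres] by blast
 note sub = AR_transpose_submodule[OF M p]
 let ?N = "(\<lambda>fi. compose (carrier Q1) fi f') ` carrier (star A Q0)"
 let ?S1 = "star A Q1" and ?S0 = "star A Q0"
 define X where "X = quotient_module ?S1 ?N"
 define cl where "cl si = ?N +>\<^bsub>?S1\<^esub> si" for si
 have S1: "left_module (opposite A) ?S1" and S0: "left_module (opposite A) ?S0"
  using sub star_left_module by auto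
 interpret S1: abelian_group ?S1 using S1 by (rule lmod_abelian_group)
 interpret Q1: abelian_group Q1 using sub(1) by (rule lmod_abelian_group)
 note qm = o.quotient_add[OF S1 sub(4), folded X_def] o.quotient_eq[OF S1 sub(4)]
  o.quotient_zero[OF S1 sub(4), folded X_def] o.quotient_smult[OF S1 sub(4), folded X_def]
 have X: "left_module (opposite A) X"
  unfolding X_def by (rule o.quotient_left_module[OF S1 sub(4)])
 interpret X: abelian_group X using X by (rule lmod_abelian_group)
 have Xc: "carrier X = cl ` carrier ?S1"
  by (simp add: X_def cl_def quotient_module_carrier)
 have cl_add: "cl (si +[?S1] si') = cl si +[X] cl si'" if "si \<in> carrier ?S1" "si' \<in> carrier ?S1" for si si'
  using qm(1)[OF that] by (simp add: cl_def)
 have cl_sm: "cl (a *[?S1] si) = a *[X] cl si" if "a \<in> carrier A" "si \<in> carrier ?S1" for si a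
  using qm(4)[OF _ that(2), of a] that(1) by (simp add: cl_def)
 have cl_zero: "cl si = \<zero>\<^bsub>X\<^esub>" if "si \<in> ?N" for si
 proof -
  have c: "si \<in> carrier ?S1" using that left_submoduleD(1)[OF sub(4)] by blast
  have "\<ominus>\<^bsub>?S1\<^esub> \<zero>\<^bsub>?S1\<^esub> = \<zero>\<^bsub>?S1\<^esub>"
   by (metis S1.r_neg S1.l_zero S1.a_inv_closed S1.zero_closed)
  then have "si +[?S1] \<ominus>\<^bsub>?S1\<^esub> \<zero>\<^bsub>?S1\<^esub> = si"
   using S1.r_zero[OF c] by (simp only:)
  from qm(2)[OF c S1.zero_closed, unfolded this] have "cl si = cl \<zero>\<^bsub>?S1\<^esub>"
   using that by (simp only: cl_def)
  then show ?thesis using qm(3) by (simp add: cl_def)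
 qed
 have clX: "cl si \<in> carrier X" if "si \<in> carrier ?S1" for si using that Xc by auto
 have tau: "AR_tau A M = k_dual (opposite A) X" by (simp add: AR_tau_def Xe X_def)
 let ?D = "k_dual (opposite A) X"
 have D: "left_module A ?D" using o.k_dual_left_module[OF X] by simp
 obtain al1 al0 where al0: "al0 \<in> Hom A ?I0 Q0" "bij_betw al0 (carrier ?I0) (carrier Q0)"
  and al1: "al1 \<in> Hom A ?I1 Q1" "bij_betw al1 (carrier ?I1) (carrier Q1)"
  and fal: "\<And>x. x \<in> carrier ?I1 ==> f' (al1 x) = al0 (f x)"
  using min_proj_presentation_unique[OF M pres p] by blast
 have I1: "left_module A ?I1" by (rule ep.idem_left_module)
 have I0: "left_module A ?I0" by (rule e.idem_left_module)
 define be1 where "be1 = (\<lambda>y\<in>carrier Q1. inv_into (carrier ?I1) al1 y)"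
 define be0 where "be0 = (\<lambda>y\<in>carrier Q0. inv_into (carrier ?I0) al0 y)"
 have be1: "be1 \<in> Hom A Q1 ?I1" unfolding be1_def by (rule Hom_inv_into[OF al1 I1 sub(1)])
 have be0: "be0 \<in> Hom A Q0 ?I0" unfolding be0_def by (rule Hom_inv_into[OF al0 I0 sub(2)])
 have be1al: "be1 (al1 x) = x" if "x \<in> carrier ?I1" for x
  using that al1(2) HomD(2)[OF al1(1) that] by (simp add: be1_def bij_betw_def)
 have be0al: "be0 (al0 x) = x" if "x \<in> carrier ?I0" for x
  using that al0(2) HomD(2)[OF al0(1) that] by (simp add: be0_def bij_betw_def)
 have albe1: "al1 (be1 y) = y" if "y \<in> carrier Q1" for y
  using that al1(2) by (simp add: be1_def bij_betw_def f_inv_into_f)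
 define y where "y k = al1 (idem_gen A q ep k)" for k
 have yQ: "y k \<in> carrier Q1" if "k < q" for k
  using HomD(2)[OF al1(1) ep.idem_gen_closed[OF that]] by (simp add: y_def)
 have coord: "(\<lambda>x\<in>carrier P. ga x k) \<in> carrier (star A P)"
  if "ga \<in> Hom A P (idem_module A q e')" "left_module A P" "k < q" for ga e' k and P :: "('a, nat => 'a) module"
 proof -
  interpret P: abelian_group P using that(2) by (rule lmod_abelian_group)
  have "(\<lambda>x\<in>carrier P. ga x k) \<in> Hom A P (regular_module A)"
  proof (rule HomI, goal_cases)
   case (2 x)
   then show ?case using idem_moduleD(2)[OF HomD(2)[OF that(1)] that(3)] by (simp add: regular_module_def)
  next
   case (3 x y)
   then show ?case using HomD(3)[OF that(1)] that(3) by (simp add: regular_module_def)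
  next
   case (4 a x)
   then show ?case using HomD(4)[OF that(1)] that(3) lmod_smult_closed[OF that(2)]
    by (simp add: regular_module_def)
  qed simp
  then show ?thesis by (simp add: star_def)
 qed
 \<comment> \<open>The functions \<open>pr k\<close> are dual to the elements \<open>y k\<close>;
   together they form a dual basis of the projective module \<open>Q1\<close>, so the
   \<open>pr k\<close> generate \<open>star A Q1\<close>, as \<open>expand\<close> shows.\<close>
 define pr where "pr k = (\<lambda>x\<in>carrier Q1. be1 x k)" for k
 have pr: "pr k \<in> carrier ?S1" if "k < q" for k
  unfolding pr_def by (rule coord[OF be1 sub(1) that])
 define rh where "rh k = (\<lambda>x\<in>carrier Q0. be0 x k)" for k
 have rh: "rh k \<in> carrier ?S0" if "k < q" for k
  unfolding rh_def by (rule coord[OF be0 sub(2) that])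
 have S1D: "si \<in> Hom A Q1 (regular_module A)" if "si \<in> carrier ?S1" for si
  using that by (simp add: star_def)
 have siy: "si (y k) \<in> carrier A" if "si \<in> carrier ?S1" "k < q" for si k
  using HomD(2)[OF S1D[OF that(1)] yQ[OF that(2)]] by (simp add: regular_module_def)
 have S1_eqI: "si = si'" if "si \<in> carrier ?S1" "si' \<in> carrier ?S1" "\<And>x. x \<in> carrier Q1 ==> si x = si' x" for si si'
  by (rule extensionalityI[OF HomD(1)[OF S1D[OF that(1)]] HomD(1)[OF S1D[OF that(2)]]]) (rule that(3))
 have s_app: "(a *[?S1] si) x = si x \<otimes> a" if "x \<in> carrier Q1" for a si x
  using that by (simp add: star_def)
 have smS: "a *[?S1] si \<in> carrier ?S1" if "a \<in> carrier A" "si \<in> carrier ?S1" for a si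
  using lmod_smult_closed[OF S1, of a si] that by simp
 have expand: "si = finsum ?S1 (\<lambda>k. si (y k) *[?S1] pr k) {..<q}" (is "_ = ?R si")
  if si: "si \<in> carrier ?S1" for si
 proof (rule S1_eqI[OF si])
  have c: "(\<lambda>k. si (y k) *[?S1] pr k) \<in> {..<q} \<rightarrow> carrier ?S1"
   using smS[OF siy[OF si] pr] by auto
  then show "?R si \<in> carrier ?S1" by (rule S1.finsum_closed)
  fix x assume x: "x \<in> carrier Q1"
  have bx: "be1 x \<in> carrier ?I1" by (rule HomD(2)[OF be1 x])
  have h: "compose (carrier ?I1) si al1 \<in> Hom A ?I1 (regular_module A)"
   by (rule Hom_compose[OF al1(1) S1D[OF si] I1])
  have "?R si x = finsum A (\<lambda>k. (si (y k) *[?S1] pr k) x) {..<q}"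
   by (rule star_finsum_apply[OF sub(1) _ c x]) simp
  also have "\<dots> = finsum A (\<lambda>k. be1 x k \<otimes> si (y k)) {..<q}"
   by (rule finsum_cong') (use x idem_moduleD(2)[OF bx] siy[OF si] in \<open>auto simp: s_app pr_def\<close>)
  also have "\<dots> = finsum (regular_module A)
    (\<lambda>k. be1 x k *[regular_module A] (compose (carrier ?I1) si al1) (idem_gen A q ep k)) {..<q}"
  proof -
   have r: "finsum (regular_module A) = finsum A"
    by (simp add: fun_eq_iff finsum_def finprod_def regular_module_def)
   show ?thesis unfolding r
    by (rule finsum_cong')
     (use idem_moduleD(2)[OF bx] siy[OF si] ep.idem_gen_closed in
      \<open>auto simp: compose_def regular_module_def y_def\<close>)
  qed
  also have "\<dots> = compose (carrier ?I1) si al1 (be1 x)"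
   by (rule ep.idem_expansion[OF h regular_left_module bx, symmetric])
  also have "\<dots> = si x" using bx x by (simp add: compose_def albe1)
  finally show "si x = ?R si x" by simp
 qed
 have kbD: "finite B" "\<And>be. be \<in> B ==> b be \<in> carrier M"
  "\<And>be x y. be \<in> B ==> x \<in> carrier M ==> y \<in> carrier M ==> Z be (x +[M] y) = Z be x + Z be y"
  "\<And>be c x. be \<in> B ==> x \<in> carrier M ==> Z be (scalar A c *[M] x) = c * Z be x"
  "\<And>be ga. be \<in> B ==> ga \<in> B ==> Z be (b ga) = (if be = ga then 1 else 0)"
  using kb unfolding k_basis_def by blast+
 note clM = lmod_smult_closed[OF M]
 let ?H = "Hom_space A M ?D"
 \<comment> \<open>A homomorphism is recorded by the values of the images of basis vectors of
   \<open>M\<close> on the classes of the generators \<open>pr k\<close>.\<close>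
 define Ph where "Ph th t = th (b (snd t)) (cl (pr (fst t)))" for th :: "'m => ((nat => 'a) => 'a) set => 'k" and t
 have pair_sm: "th m (cl (a *[?S1] si)) = th (a *[M] m) (cl si)"
  if "th \<in> Hom A M ?D" "m \<in> carrier M" "a \<in> carrier A" "si \<in> carrier ?S1" for th m a si
  using HomD(4)[OF that(1,3,2)] clX[OF that(4)] cl_sm[OF that(3,4)] by simp
 have D0: "fi \<zero>\<^bsub>X\<^esub> = 0" if "fi \<in> carrier ?D" for fi
  using k_dualD(2)[OF that X.zero_closed X.zero_closed] by (metis X.r_zero X.zero_closed add_cancel_right_right)
 \<comment> \<open>The two alternatives of \<open>T3\<close> kill a coordinate for different
   reasons. Either \<open>ep k\<close> fixes \<open>pr k\<close> and can be moved over to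
   \<open>b be\<close>, which it annihilates; or \<open>b be\<close> is \<open>u k\<close> times
   some \<open>m\<close>, and moving \<open>u k\<close> back onto \<open>pr k\<close> gives a map
   that factors through \<open>f'\<close>, so its class is zero.\<close>
 have T0: "th (b be) (cl (pr k)) = 0"
  if th: "th \<in> Hom A M ?D" and k: "k < q" and be: "be \<in> B" and nT: "(k, be) \<notin> T" for th k be
  using T3[OF k be nT]
 proof
  assume z: "ep k *[M] b be = \<zero>\<^bsub>M\<^esub>"
  have "ep k *[?S1] pr k = pr k"
   by (rule S1_eqI[OF smS[OF ep.idem_closed[OF k] pr[OF k]] pr[OF k]])
    (simp add: s_app pr_def idem_moduleD(3)[OF HomD(2)[OF be1] k])
  then have "th (b be) (cl (pr k)) = th \<zero>\<^bsub>M\<^esub> (cl (pr k))"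
   using pair_sm[OF th kbD(2)[OF be] ep.idem_closed[OF k] pr[OF k]] z by simp
  also have "\<dots> = 0"
   using Hom_zero[OF th M.abelian_group_axioms lmod_abelian_group[OF D]] clX[OF pr[OF k]] by simp
  finally show ?thesis .
 next
  assume "\<exists>m\<in>carrier M. u k *[M] m = b be"
  then obtain m where m: "m \<in> carrier M" "u k *[M] m = b be" by blast
  have "u k *[?S1] pr k = compose (carrier Q1) (rh k) f'"
  proof (rule S1_eqI[OF smS[OF u(1)[OF k] pr[OF k]]])
   show "compose (carrier Q1) (rh k) f' \<in> carrier ?S1"
    using left_submoduleD(1)[OF sub(4)] rh[OF k] by blast
   fix x assume x: "x \<in> carrier Q1"
   have bx: "be1 x \<in> carrier ?I1" by (rule HomD(2)[OF be1 x])
   have fI: "f (be1 x) \<in> carrier ?I0"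
    unfolding f[OF bx]
    by (rule idem_moduleI) (use idem_moduleD(2)[OF bx] u e.idem_closed in \<open>auto simp: m_assoc\<close>)
   have "f' x = al0 (f (be1 x))" using fal[OF bx] albe1[OF x] by simp
   then have "be0 (f' x) k = be1 x k \<otimes> u k" using be0al[OF fI] f[OF bx] k by simp
   then show "(u k *[?S1] pr k) x = compose (carrier Q1) (rh k) f' x"
    using x HomD(2)[OF sub(3) x] by (simp add: s_app pr_def rh_def compose_def)
  qed
  then have "u k *[?S1] pr k \<in> ?N" using rh[OF k] by blast
  then have "th m (cl (u k *[?S1] pr k)) = 0"
   using cl_zero D0[OF HomD(2)[OF th m(1)]] by simp
  then show ?thesis using pair_sm[OF th m(1) u(1)[OF k] pr[OF k]] m(2) by simp
 qed
 have th_formula: "th m (cl si) = (\<Sum>k<q. \<Sum>be\<in>B. Z be (si (y k) *[M] m) * th (b be) (cl (pr k)))"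
  if th: "th \<in> Hom A M ?D" and m: "m \<in> carrier M" and si: "si \<in> carrier ?S1" for th m si
 proof -
  have c: "(\<lambda>k. si (y k) *[?S1] pr k) \<in> {..<q} \<rightarrow> carrier ?S1"
   using smS[OF siy[OF si] pr] by auto
  have "th m (cl si) = th m (cl (finsum ?S1 (\<lambda>k. si (y k) *[?S1] pr k) {..<q}))"
   by (rule arg_cong[OF expand[OF si]])
  also have "\<dots> = (\<Sum>k<q. th m (cl (si (y k) *[?S1] pr k)))"
   by (rule additive_finsum[OF S1.abelian_group_axioms, of "\<lambda>si. th m (cl si)"])
    (use c in \<open>simp_all add: cl_add k_dualD(2)[OF HomD(2)[OF th m]] clX\<close>)
  also have "\<dots> = (\<Sum>k<q. th (si (y k) *[M] m) (cl (pr k)))"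
   by (rule sum.cong) (use pair_sm[OF th m siy[OF si] pr] in auto)
  also have "\<dots> = (\<Sum>k<q. \<Sum>be\<in>B. Z be (si (y k) *[M] m) * th (b be) (cl (pr k)))"
  proof (rule sum.cong[OF refl])
   fix k assume "k \<in> {..<q}" then have k: "k < q" by simp
   show "th (si (y k) *[M] m) (cl (pr k)) = (\<Sum>be\<in>B. Z be (si (y k) *[M] m) * th (b be) (cl (pr k)))"
   proof (rule k_basis_functional[OF M kb, of "\<lambda>m. th m (cl (pr k))"])
    show "th (x +[M] x') (cl (pr k)) = th x (cl (pr k)) + th x' (cl (pr k))"
     if "x \<in> carrier M" "x' \<in> carrier M" for x x'
     using HomD(3)[OF th that] clX[OF pr[OF k]] by simp
    show "th (scalar A c *[M] x) (cl (pr k)) = c * th x (cl (pr k))" if "x \<in> carrier M" for x c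
     using HomD(4)[OF th scalar_closed that] clX[OF pr[OF k]]
      k_dualD(3)[OF HomD(2)[OF th that] clX[OF pr[OF k]], of c] by simp
   qed (rule clM[OF siy[OF si k] m])
  qed
  finally show ?thesis .
 qed
 have inj: "th = th'" if th: "th \<in> Hom A M ?D" and th': "th' \<in> Hom A M ?D"
  and eq: "\<And>t. t \<in> T ==> Ph th t = Ph th' t" for th th'
 proof (rule extensionalityI[OF HomD(1)[OF th] HomD(1)[OF th']])
  fix m assume m: "m \<in> carrier M"
  have eq': "th (b be) (cl (pr k)) = th' (b be) (cl (pr k))" if "k < q" "be \<in> B" for k be
   using eq[of "(k, be)"] T0[OF th that] T0[OF th' that] by (cases "(k, be) \<in> T") (auto simp: Ph_def)
  show "th m = th' m"
  proof (rule extensionalityI[OF k_dualD(1)[OF HomD(2)[OF th m]] k_dualD(1)[OF HomD(2)[OF th' m]]])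
   fix x assume "x \<in> carrier X"
   then obtain si where si: "si \<in> carrier ?S1" "x = cl si" using Xc by auto
   show "th m x = th' m x"
    unfolding si(2) th_formula[OF th m si(1)] th_formula[OF th' m si(1)]
    by (intro sum.cong refl) (simp add: eq')
  qed
 qed
 \<comment> \<open>Prescribed coordinates define linear forms \<open>ze k\<close> on
   \<open>M\<close>. By \<open>T2\<close> they vanish on the multiples of \<open>u k\<close>, which
   is what makes \<open>Ga m\<close> vanish on \<open>?N\<close> and descend to the
   quotient.\<close>
 have sur: "\<exists>th\<in>Hom A M ?D. \<forall>t\<in>T. Ph th t = h t" for h
 proof -
  define ze where "ze k m = (\<Sum>be\<in>B. (if (k, be) \<in> T then h (k, be) else 0) * Z be m)" for k m
  have zea: "ze k (m +[M] m') = ze k m + ze k m'" if "m \<in> carrier M" "m' \<in> carrier M" for k m m'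
   using that by (simp add: ze_def kbD(3) distrib_left sum.distrib)
  have zes: "ze k (scalar A c *[M] m) = c * ze k m" if "m \<in> carrier M" for k m c
   using that by (simp add: ze_def kbD(4) sum_distrib_left algebra_simps)
  have zeu: "ze k (u k *[M] m) = 0" if "m \<in> carrier M" for k m
   unfolding ze_def using T2[OF _ that] by (intro sum.neutral) auto
  define Ga where "Ga m si = (\<Sum>k<q. ze k (si (y k) *[M] m))" for m and si :: "(nat => 'a) => 'a"
  have s_add: "(si +[?S1] si') x = si x \<oplus> si' x" if "x \<in> carrier Q1" for si si' x
   using that by (simp add: star_def)
  have Gaa: "Ga m (si +[?S1] si') = Ga m si + Ga m si'"
   if "m \<in> carrier M" "si \<in> carrier ?S1" "si' \<in> carrier ?S1" for m si si'
   unfolding Ga_def sum.distrib[symmetric]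
   by (rule sum.cong) (use that yQ siy clM in \<open>auto simp: s_add lmod_smult_l_distr[OF M] zea\<close>)
  have Ga0: "Ga m si = 0" if m: "m \<in> carrier M" and N: "si \<in> ?N" for m si
  proof -
   obtain fi where fi: "fi \<in> carrier ?S0" "si = compose (carrier Q1) fi f'" using N by blast
   have fiH: "fi \<in> Hom A Q0 (regular_module A)" using fi(1) by (simp add: star_def)
   have "ze k (si (y k) *[M] m) = 0" if k: "k < q" for k
   proof -
    have fd: "f (idem_gen A q ep k) = u k *[?I0] idem_gen A q e k"
     unfolding f[OF ep.idem_gen_closed[OF k]] idem_module_simps
     by (rule restrict_ext) (use u k in \<open>auto simp: idem_gen_def\<close>)
    have g: "idem_gen A q e k \<in> carrier ?I0" by (rule e.idem_gen_closed[OF k])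
    have c: "fi (al0 (idem_gen A q e k)) \<in> carrier A"
     using HomD(2)[OF fiH HomD(2)[OF al0(1) g]] by (simp add: regular_module_def)
    have "si (y k) = fi (al0 (f (idem_gen A q ep k)))"
     using yQ[OF k] fal[OF ep.idem_gen_closed[OF k]] by (simp add: fi(2) compose_def y_def)
    also have "\<dots> = u k \<otimes> fi (al0 (idem_gen A q e k))"
     unfolding fd HomD(4)[OF al0(1) u(1)[OF k] g]
      HomD(4)[OF fiH u(1)[OF k] HomD(2)[OF al0(1) g]] by (simp add: regular_module_def)
    finally have "si (y k) *[M] m = u k *[M] (fi (al0 (idem_gen A q e k)) *[M] m)"
     using lmod_assoc[OF M u(1)[OF k] c m] by simp
    then show ?thesis using zeu[OF clM[OF c m]] by simp
   qed
   then show ?thesis by (simp add: Ga_def)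
  qed
  have Gacl: "Ga m si = Ga m si'"
   if m: "m \<in> carrier M" and si: "si \<in> carrier ?S1" "si' \<in> carrier ?S1" and e: "cl si = cl si'" for m si si'
  proof -
   have N: "si +[?S1] \<ominus>\<^bsub>?S1\<^esub> si' \<in> ?N" using qm(2)[OF si] e by (simp add: cl_def)
   have "(si +[?S1] \<ominus>\<^bsub>?S1\<^esub> si') +[?S1] si' = si"
    using si by (simp add: S1.a_assoc S1.l_neg)
   then have "Ga m si = Ga m (si +[?S1] \<ominus>\<^bsub>?S1\<^esub> si') + Ga m si'"
    using Gaa[OF m, of "si +[?S1] \<ominus>\<^bsub>?S1\<^esub> si'" si'] si by simp
   then show ?thesis using Ga0[OF m N] by simp
  qed
  define th where "th = (\<lambda>m\<in>carrier M. \<lambda>x\<in>carrier X. Ga m (SOME si. si \<in> carrier ?S1 \<and> x = cl si))"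
  have thcl: "th m (cl si) = Ga m si" if "m \<in> carrier M" "si \<in> carrier ?S1" for m si
  proof -
   have "(SOME si'. si' \<in> carrier ?S1 \<and> cl si = cl si') \<in> carrier ?S1
     \<and> cl si = cl (SOME si'. si' \<in> carrier ?S1 \<and> cl si = cl si')"
    by (rule someI[of "\<lambda>si'. si' \<in> carrier ?S1 \<and> cl si = cl si'" si]) (use that in simp)
   then have "Ga m (SOME si'. si' \<in> carrier ?S1 \<and> cl si = cl si') = Ga m si"
    by (elim conjE) (rule Gacl[OF that(1) _ that(2)], assumption, erule sym)
   then show ?thesis using that clX[OF that(2)] by (simp add: th_def)
  qed
  have thD: "th m \<in> carrier ?D" if m: "m \<in> carrier M" for m
  proof (rule k_dualI, goal_cases)
   case 1 then show ?case using m by (simp add: th_def)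
  next
   case (2 x x')
   then obtain si si' where si: "si \<in> carrier ?S1" "x = cl si" "si' \<in> carrier ?S1" "x' = cl si'"
    using Xc by auto
   then have "x +[X] x' = cl (si +[?S1] si')" using cl_add by simp
   then show ?case using thcl[OF m] Gaa[OF m] si by simp
  next
   case (3 c x)
   then obtain si where si: "si \<in> carrier ?S1" "x = cl si" using Xc by auto
   have e: "scalar (opposite A) c *[X] x = cl (scalar A c *[?S1] si)"
    using cl_sm[OF scalar_closed si(1)] si(2) by simp
   have "Ga m (scalar A c *[?S1] si) = c * Ga m si"
    unfolding Ga_def sum_distrib_left
   proof (rule sum.cong[OF refl])
    fix k assume "k \<in> {..<q}" then have k: "k < q" by simp
    have "si (y k) \<otimes> scalar A c = scalar A c \<otimes> si (y k)" using scalar_comm[OF siy[OF si(1) k]] by simp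
    then have "(scalar A c *[?S1] si) (y k) *[M] m = scalar A c *[M] (si (y k) *[M] m)"
     using lmod_assoc[OF M scalar_closed siy[OF si(1) k] m] s_app[OF yQ[OF k]] by simp
    then show "ze k ((scalar A c *[?S1] si) (y k) *[M] m) = c * ze k (si (y k) *[M] m)"
     using zes[OF clM[OF siy[OF si(1) k] m]] by simp
   qed
   then show ?case
    unfolding e using thcl[OF m] smS[OF scalar_closed si(1)] si by simp
  qed
  have "th \<in> Hom A M ?D"
  proof (rule HomI, goal_cases)
   case 1 then show ?case by (simp add: th_def)
  next
   case (2 m) then show ?case by (rule thD)
  next
   case (3 m m')
   have "th (m +[M] m') x = th m x + th m' x" if x: "x \<in> carrier X" for x
   proof -
    obtain si where si: "si \<in> carrier ?S1" "x = cl si" using Xc x by auto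
    have "Ga (m +[M] m') si = Ga m si + Ga m' si"
     unfolding Ga_def sum.distrib[symmetric]
     by (rule sum.cong) (use 3 si siy clM in \<open>auto simp: lmod_smult_r_distr[OF M] zea\<close>)
    then show ?thesis using si thcl 3 by simp
   qed
   then show ?case
    using k_dualD(1)[OF thD[of "m +[M] m'"]] 3 by (auto simp: fun_eq_iff extensional_def)
  next
   case (4 a m)
   have "th (a *[M] m) x = th m (a *[X] x)" if x: "x \<in> carrier X" for x
   proof -
    obtain si where si: "si \<in> carrier ?S1" "x = cl si" using Xc x by auto
    have "Ga (a *[M] m) si = Ga m (a *[?S1] si)"
     unfolding Ga_def
     by (rule sum.cong) (use 4 si siy yQ in \<open>auto simp: s_app lmod_assoc[OF M]\<close>)
    then show ?thesis
     using si thcl[OF clM[OF 4] si(1)] thcl[OF 4(2) smS[OF 4(1) si(1)]] cl_sm[OF 4(1) si(1)] by simp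
   qed
   then show ?case
    using k_dualD(1)[OF thD[OF clM[OF 4]]] by (auto simp: fun_eq_iff extensional_def)
  qed
  moreover have "Ph th t = h t" if t: "t \<in> T" for t
  proof -
   obtain k be where kbe: "t = (k, be)" "k < q" "be \<in> B" using t T by blast
   have gen: "be1 (y j) = idem_gen A q ep j" if "j < q" for j
    using be1al[OF ep.idem_gen_closed[OF that]] by (simp add: y_def)
   have pry: "pr k (y j) = (if j = k then ep k else \<zero>)" if "j < q" for j
    using gen[OF that] yQ[OF that] kbe(2) by (auto simp: pr_def idem_gen_def)
   have ze0: "ze j \<zero>\<^bsub>M\<^esub> = 0" for j
    using zea[OF M.zero_closed M.zero_closed, of j] by (metis M.r_zero M.zero_closed add_cancel_right_right)
   have "Ph th t = (\<Sum>j<q. ze j (pr k (y j) *[M] b be))"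
    using thcl[OF kbD(2)[OF kbe(3)] pr[OF kbe(2)]] kbe by (simp add: Ph_def Ga_def)
   also have "\<dots> = (\<Sum>j<q. if j = k then ze k (b be) else 0)"
    by (rule sum.cong)
     (use pry T1[of k be] t kbe kbD(2) in \<open>auto simp: lmod_zero_smult[OF M ring_axioms] ze0\<close>)
   also have "\<dots> = ze k (b be)" using kbe(2) by simp
   also have "\<dots> = (\<Sum>ga\<in>B. if ga = be then h (k, be) else 0)"
    unfolding ze_def by (rule sum.cong) (use kbD(5) kbe t in auto)
   also have "\<dots> = h t" using kbe kbD(1) by simp
   finally show ?thesis .
  qed
  ultimately show ?thesis by blast
 qed
 have "coordinatized ?H T Ph"
  unfolding coordinatized_def
 proof (intro conjI ballI allI impI)
  show "finite T" using T kbD(1) by (meson finite_SigmaI finite_lessThan finite_subset)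
  show "\<zero>\<^bsub>?H\<^esub> \<in> carrier ?H" by (rule Hom_space_closed(1)[OF M D])
  show "th +[?H] th' \<in> carrier ?H" if "th \<in> carrier ?H" "th' \<in> carrier ?H" for th th'
   by (rule Hom_space_closed(2)[OF M D that])
  show "c *[?H] th \<in> carrier ?H" if "th \<in> carrier ?H" for c th
   by (rule Hom_space_closed(3)[OF M D that])
  have t: "b (snd t) \<in> carrier M" "cl (pr (fst t)) \<in> carrier X" if "t \<in> T" for t
   using that T kbD(2) clX pr by auto
  show "Ph \<zero>\<^bsub>?H\<^esub> x = 0" if "x \<in> T" for x
   using t[OF that] by (simp add: Ph_def Hom_space_def)
  show "Ph (th +[?H] th') x = Ph th x + Ph th' x" if "x \<in> T" for th th' x
   using t[OF that] by (simp add: Ph_def Hom_space_def)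
  show "Ph (c *[?H] th) x = c * Ph th x" if "th \<in> carrier ?H" "x \<in> T" for c th x
  proof -
   have th: "th \<in> Hom A M ?D" using that by (simp add: Hom_space_def)
   show ?thesis using t[OF that(2)] k_dualD(3)[OF HomD(2)[OF th t(1)[OF that(2)]] t(2)[OF that(2)], of c]
    by (simp add: Ph_def Hom_space_def)
  qed
  show "th = th'" if "th \<in> carrier ?H" "th' \<in> carrier ?H" "\<forall>t\<in>T. Ph th t = Ph th' t" for th th'
   using inj[of th th'] that by (simp add: Hom_space_def)
  show "\<exists>x\<in>carrier ?H. \<forall>t\<in>T. Ph x t = h t" for h
   using sur[of h] by (simp add: Hom_space_def)
 qed
 then show ?thesis unfolding tau by blast
qed

end

section \<open>Algebras with a basis of paths on an oriented cycle\<close>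

lemma k_basis_ex:
 assumes A: "unital_algebra A" and M: "left_module A M" and kb: "k_basis A M B b Z"
 shows "\<exists>x\<in>carrier M. \<forall>be\<in>B. Z be x = h be"
proof -
 interpret unital_algebra A by fact
 interpret M: abelian_group M using M by (rule lmod_abelian_group)
 have kbD: "finite B" "\<And>be. be \<in> B ==> b be \<in> carrier M"
  "\<And>be x y. be \<in> B ==> x \<in> carrier M ==> y \<in> carrier M ==> Z be (x +[M] y) = Z be x + Z be y"
  "\<And>be c x. be \<in> B ==> x \<in> carrier M ==> Z be (scalar A c *[M] x) = c * Z be x"
  "\<And>be ga. be \<in> B ==> ga \<in> B ==> Z be (b ga) = (if be = ga then 1 else 0)"
  using kb unfolding k_basis_def by blast+
 let ?x = "finsum M (\<lambda>be. scalar A (h be) *[M] b be) B"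
 have c: "(\<lambda>be. scalar A (h be) *[M] b be) \<in> B \<rightarrow> carrier M"
  using kbD(2) lmod_smult_closed[OF M scalar_closed] by auto
 have "Z ga ?x = h ga" if ga: "ga \<in> B" for ga
 proof -
  have "Z ga ?x = (\<Sum>be\<in>B. Z ga (scalar A (h be) *[M] b be))"
   by (rule additive_finsum[OF M.abelian_group_axioms kbD(3)[OF ga] kbD(1) c])
  also have "\<dots> = (\<Sum>be\<in>B. if be = ga then h be else 0)"
   by (rule sum.cong) (use kbD(2,4,5) ga in auto)
  also have "\<dots> = h ga" using kbD(1) ga by simp
  finally show ?thesis .
 qed
 then show ?thesis using M.finsum_closed[OF c] by blast
qed

lemma (in unital_algebra) left_submodule_finsum:
 assumes M: "left_module A M" and L: "left_submodule A L M" and "finite S" "g \<in> S \<rightarrow> L"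
 shows "finsum M g S \<in> L"
proof -
 interpret M: abelian_group M using M by (rule lmod_abelian_group)
 note LD = left_submoduleD[OF L]
 show ?thesis using assms(3,4)
 proof (induction S)
  case empty then show ?case by (simp add: LD)
 next
  case (insert i S)
  then have "g \<in> S \<rightarrow> carrier M" "g i \<in> carrier M" using LD(1) by auto
  then show ?case using insert LD(3) by simp
 qed
qed

context idempotents
begin

lemma idem_finsum_apply:
 assumes "finite S" "g \<in> S \<rightarrow> carrier (idem_module A q e)" "j < q"
 shows "finsum (idem_module A q e) g S j = finsum A (\<lambda>i. g i j) S"
proof -
 let ?I = "idem_module A q e"
 interpret I: abelian_group ?I using idem_left_module by (rule lmod_abelian_group)
 show ?thesis using assms(1,2)
 proof (induction S)
  case empty
  then show ?case using assms(3) by (simp only: I.finsum_empty finsum_empty) simp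
 next
  case (insert i S)
  have "finsum A (\<lambda>i. g i j) (insert i S) = g i j \<oplus> finsum A (\<lambda>i. g i j) S"
   by (rule finsum_insert) (use insert assms(3) idem_moduleD(2)[of _ A q e j] in auto)
  moreover have "finsum ?I g (insert i S) = g i +[?I] finsum ?I g S"
   by (rule I.finsum_insert) (use insert in auto)
  ultimately show ?case using insert assms(3) by simp
 qed
qed

lemma idem_hom:
 assumes M: "left_module A M" and m: "\<And>k. k < q ==> m k \<in> carrier M"
 shows "(\<lambda>x\<in>carrier (idem_module A q e). finsum M (\<lambda>k. x k *[M] m k) {..<q})
  \<in> Hom A (idem_module A q e) M"
proof -
 interpret M: abelian_group M using M by (rule lmod_abelian_group)
 let ?I = "idem_module A q e"
 interpret I: abelian_group ?I using idem_left_module by (rule lmod_abelian_group)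
 have c: "(\<lambda>k. x k *[M] m k) \<in> {..<q} \<rightarrow> carrier M" if "x \<in> carrier ?I" for x
  using lmod_smult_closed[OF M idem_moduleD(2)[OF that] m] by auto
 show ?thesis
 proof (rule HomI, goal_cases)
  case (2 x) then show ?case using c by simp
 next
  case (3 x y)
  then have xy: "x +[?I] y \<in> carrier ?I" by (rule I.a_closed)
  have "finsum M (\<lambda>k. (x +[?I] y) k *[M] m k) {..<q}
    = finsum M (\<lambda>k. x k *[M] m k +[M] y k *[M] m k) {..<q}"
   by (rule M.finsum_cong') (use 3 m in \<open>auto simp: idem_moduleD lmod_smult_closed[OF M]
    lmod_smult_l_distr[OF M]\<close>)
  also have "\<dots> = finsum M (\<lambda>k. x k *[M] m k) {..<q} +[M] finsum M (\<lambda>k. y k *[M] m k) {..<q}"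
   by (rule M.finsum_addf) (use c 3 in auto)
  finally show ?case using 3 xy by (simp del: idem_module_simps)
 next
  case (4 a x)
  then have ax: "a *[?I] x \<in> carrier ?I" by (rule lmod_smult_closed[OF idem_left_module])
  have "finsum M (\<lambda>k. (a *[?I] x) k *[M] m k) {..<q}
    = finsum M (\<lambda>k. a *[M] (x k *[M] m k)) {..<q}"
   by (rule M.finsum_cong') (use 4 m in \<open>auto simp: idem_moduleD lmod_smult_closed[OF M]
    lmod_assoc[OF M]\<close>)
  also have "\<dots> = a *[M] finsum M (\<lambda>k. x k *[M] m k) {..<q}"
   by (rule lmod_finsum_smult[symmetric, OF M 4(1) _ c[OF 4(2)]]) simp
  finally show ?case using 4 ax by (simp del: idem_module_simps)
 qed simp
qed

text \<open>Nakayama's lemma by successive approximation. Each generator is a sum of an element of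
  \<open>L\<close> and one of \<open>K\<close>; substituting this into a remainder produces an
  element of \<open>L\<close> and a new remainder whose coefficients lie one step deeper in the
  filtration. After \<open>N\<close> steps the remainder is zero.\<close>

lemma superfluous_of_filtration:
 fixes F :: "nat => 'a set"
 assumes F0: "F 0 = carrier A" and FN: "F N = {\<zero>}"
  and Fz: "\<And>t. \<zero> \<in> F t" and Fs: "\<And>t. F t \<subseteq> carrier A"
  and Fa: "\<And>t x y. x \<in> F t ==> y \<in> F t ==> x \<oplus> y \<in> F t"
  and Fm: "\<And>t x y. x \<in> F t ==> y \<in> F 1 ==> x \<otimes> y \<in> F (Suc t)"
  and K: "\<And>x k. x \<in> K ==> k < q ==> x k \<in> F 1" and KI: "K \<subseteq> carrier (idem_module A q e)"
 shows "superfluous A K (idem_module A q e)"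
 unfolding superfluous_def
proof (intro allI impI, elim conjE)
 let ?I = "idem_module A q e"
 note I = idem_left_module
 interpret I: abelian_group ?I using I by (rule lmod_abelian_group)
 fix L assume L: "left_submodule A L ?I" and LK: "L <+>\<^bsub>?I\<^esub> K = carrier ?I"
 note LD = left_submoduleD[OF L]
 have Lc: "x \<in> carrier ?I" if "x \<in> L" for x using that LD(1) by auto
 have Kc: "x \<in> carrier ?I" if "x \<in> K" for x using that KI by auto
 have Ffin: "finsum A g S \<in> F t" if "finite S" "g \<in> S \<rightarrow> F t" for g t and S :: "nat set"
  using that
 proof (induction S)
  case (insert i S)
  then have "g \<in> S \<rightarrow> carrier A" "g i \<in> carrier A" using Fs by auto
  then show ?case using insert Fa by simp
 qed (simp add: Fz)
 have split: "\<exists>l r. l \<in> L \<and> r \<in> K \<and> x = l +[?I] r" if "x \<in> carrier ?I" for x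
  using that unfolding LK[symmetric] set_add_def' by blast
 have idh: "(\<lambda>x\<in>carrier ?I. x) \<in> Hom A ?I ?I"
  by (rule HomI) (auto simp: lmod_smult_closed[OF I] simp del: idem_module_simps)
 have exp: "w = finsum ?I (\<lambda>k. w k *[?I] idem_gen A q e k) {..<q}" if w: "w \<in> carrier ?I" for w
 proof -
  have "w = (\<lambda>x\<in>carrier ?I. x) w" using w by simp
  also have "\<dots> = finsum ?I (\<lambda>k. w k *[?I] (\<lambda>x\<in>carrier ?I. x) (idem_gen A q e k)) {..<q}"
   by (rule idem_expansion[OF idh I w])
  also have "\<dots> = finsum ?I (\<lambda>k. w k *[?I] idem_gen A q e k) {..<q}"
   by (rule I.finsum_cong') (use idem_gen_closed lmod_smult_closed[OF I idem_moduleD(2)[OF w]]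
    in \<open>auto simp del: idem_module_simps\<close>)
  finally show ?thesis .
 qed
 have claim: "\<exists>l w. l \<in> L \<and> w \<in> carrier ?I \<and> x = l +[?I] w \<and> (\<forall>k<q. w k \<in> F t)"
  if "x \<in> carrier ?I" for x t
  using that
 proof (induction t)
  case 0
  then have "x = \<zero>\<^bsub>?I\<^esub> +[?I] x" by (simp del: idem_module_simps)
  then show ?case using LD(2) 0 F0 idem_moduleD(2)[OF 0] by blast
 next
  case (Suc t)
  then obtain l w where lw: "l \<in> L" "w \<in> carrier ?I" "x = l +[?I] w" "\<forall>k<q. w k \<in> F t" by blast
  obtain lk rk where lr: "\<And>k. k < q ==> lk k \<in> L" "\<And>k. k < q ==> rk k \<in> K"
   "\<And>k. k < q ==> idem_gen A q e k = lk k +[?I] rk k"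
   using split[OF idem_gen_closed] by metis
  note wc = idem_moduleD(2)[OF lw(2)]
  let ?l = "finsum ?I (\<lambda>k. w k *[?I] lk k) {..<q}" and ?r = "finsum ?I (\<lambda>k. w k *[?I] rk k) {..<q}"
  have lc: "(\<lambda>k. w k *[?I] lk k) \<in> {..<q} \<rightarrow> carrier ?I"
   using lmod_smult_closed[OF I wc] lr(1) Lc by auto
  have rc: "(\<lambda>k. w k *[?I] rk k) \<in> {..<q} \<rightarrow> carrier ?I"
   using lmod_smult_closed[OF I wc] lr(2) Kc by auto
  have l: "?l \<in> L"
   by (rule left_submodule_finsum[OF I L]) (use LD(4)[OF wc] lr(1) in auto)
  have r: "?r \<in> carrier ?I" by (rule I.finsum_closed[OF rc])
  have rF: "?r j \<in> F (Suc t)" if j: "j < q" for j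
   unfolding idem_finsum_apply[OF finite_lessThan rc j]
   by (rule Ffin) (use j Fm K lr(2) lw(4) in auto)
  have "w = finsum ?I (\<lambda>k. w k *[?I] idem_gen A q e k) {..<q}" by (rule exp[OF lw(2)])
  also have "\<dots> = finsum ?I (\<lambda>k. w k *[?I] lk k +[?I] w k *[?I] rk k) {..<q}"
  proof (rule I.finsum_cong')
   fix k assume k: "k \<in> {..<q}"
   then show "w k *[?I] idem_gen A q e k = w k *[?I] lk k +[?I] w k *[?I] rk k"
    unfolding lr(3)[OF k[unfolded lessThan_iff]]
    by (intro lmod_smult_r_distr[OF I]) (use wc lr Lc Kc in auto)
  qed (use lc rc in \<open>auto simp del: idem_module_simps\<close>)
  also have "\<dots> = ?l +[?I] ?r" by (rule I.finsum_addf[OF lc rc])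
  finally have "x = (l +[?I] ?l) +[?I] ?r"
   using lw(1,3) Lc l r by (simp add: I.a_assoc del: idem_module_simps)
  then show ?case using LD(3)[OF lw(1) l] r rF by blast
 qed
 show "L = carrier ?I"
 proof
  show "L \<subseteq> carrier ?I" by (rule LD(1))
  show "carrier ?I \<subseteq> L"
  proof
   fix x assume x: "x \<in> carrier ?I"
   obtain l w where lw: "l \<in> L" "w \<in> carrier ?I" "x = l +[?I] w" "\<forall>k<q. w k \<in> F N"
    using claim[OF x] by blast
   have "w = \<zero>\<^bsub>?I\<^esub>"
    using idem_moduleD(1)[OF lw(2)] lw(4) FN by (auto simp: fun_eq_iff extensional_def)
   then show "x \<in> L" using lw(1,3) I.r_zero[OF Lc[OF lw(1)]] by simp
  qed
 qed
qed

end

text \<open>\<open>p j l\<close> plays the role of the path of length \<open>l\<close> from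
  \<open>j\<close>, which ends at \<open>(sg ^^ l) j\<close> and is nonzero exactly for
  \<open>l < c j\<close>. The successor map is any permutation, so that the opposite algebra, with
  reversed arrows, is an instance too.\<close>

locale cyclic_algebra = unital_algebra A for A :: "('k :: field, 'a) module" (structure) +
 fixes n :: nat and sg :: "nat => nat" and c :: "nat => nat" and p :: "nat => nat => 'a"
  and Y :: "nat \<times> nat => 'a => 'k"
 assumes sg: "bij_betw sg {..<n} {..<n}"
  and c_pos: "j < n ==> 0 < c j"
  and p_closed: "j < n ==> p j l \<in> carrier A"
  and p_zero: "j < n ==> c j \<le> l ==> p j l = \<zero>"
  and p_mult: "i < n ==> j < n ==> p i k \<otimes> p j l = (if i = (sg ^^ l) j then p j (k + l) else \<zero>)"
  and A_basis: "k_basis A (regular_module A) {(j, l). j < n \<and> l < c j} (\<lambda>(j, l). p j l) Y"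
begin

abbreviation "PB \<equiv> {(j, l). j < n \<and> l < c j}"

lemma sg_pow: "j < n ==> (sg ^^ l) j < n"
 by (induction l) (use sg in \<open>auto simp: bij_betw_def\<close>)

lemma sg_pow_inj: "i < n ==> j < n ==> (sg ^^ l) i = (sg ^^ l) j ==> i = j"
proof (induction l)
 case (Suc l)
 have "inj_on sg {..<n}" using sg by (simp add: bij_betw_def)
 then have "(sg ^^ l) i = (sg ^^ l) j"
  using Suc.prems sg_pow by (auto dest!: inj_onD)
 then show ?case using Suc by blast
qed simp

lemma Y_add: "be \<in> PB ==> x \<in> carrier A ==> y \<in> carrier A ==> Y be (x \<oplus> y) = Y be x + Y be y"
 and Y_scalar: "be \<in> PB ==> x \<in> carrier A ==> Y be (scalar A d \<otimes> x) = d * Y be x"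
 and Y_p: "j < n ==> l < c j ==> i < n ==> Y (j, l) (p i t) = (if j = i \<and> l = t then 1 else 0)"
 and Y_zero: "be \<in> PB ==> Y be \<zero> = 0"
proof -
 note kb = A_basis[unfolded k_basis_def]
 show add: "Y be (x \<oplus> y) = Y be x + Y be y" if "be \<in> PB" "x \<in> carrier A" "y \<in> carrier A" for be x y
  using conjunct1[OF conjunct2[OF conjunct2[OF kb]], rule_format, of be x y] that
  by (simp add: regular_module_def)
 show "Y be (scalar A d \<otimes> x) = d * Y be x" if "be \<in> PB" "x \<in> carrier A" for be x
  using conjunct1[OF conjunct2[OF conjunct2[OF conjunct2[OF kb]]], rule_format, of be x] that
  by (simp add: regular_module_def)
 show z: "Y be \<zero> = 0" if "be \<in> PB" for be
  using add[OF that zero_closed zero_closed] by (metis r_zero zero_closed add_cancel_right_right)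
 show "Y (j, l) (p i t) = (if j = i \<and> l = t then 1 else 0)" if "j < n" "l < c j" "i < n"
 proof (cases "t < c i")
  case True
  then show ?thesis
   using conjunct1[OF conjunct2[OF conjunct2[OF conjunct2[OF conjunct2[OF kb]]]], rule_format, of "(j, l)" "(i, t)"]
    that by auto
 next
  case False
  then show ?thesis using z[of "(j, l)"] p_zero[of i t] that by auto
 qed
qed

lemma Y_eqI: "x \<in> carrier A ==> y \<in> carrier A ==> (\<And>j l. j < n ==> l < c j ==> Y (j, l) x = Y (j, l) y) ==> x = y"
 by (rule k_basis_eqI[OF A_basis _ _ _ regular_left_module]) (auto simp: regular_module_def)

lemma Y_ex: "\<exists>x\<in>carrier A. \<forall>j<n. \<forall>l<c j. Y (j, l) x = h j l"
proof -
 obtain x where x: "x \<in> carrier (regular_module A)" "\<forall>be\<in>PB. Y be x = h (fst be) (snd be)"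
  using k_basis_ex[OF unital_algebra_axioms regular_left_module A_basis, of "\<lambda>be. h (fst be) (snd be)"] by blast
 show ?thesis
 proof (intro bexI allI impI)
  fix j l assume "j < n" "l < c j"
  then show "Y (j, l) x = h j l" using bspec[OF x(2), of "(j, l)"] by simp
 qed (use x in \<open>simp add: regular_module_def\<close>)
qed

lemma A_functional:
 assumes add: "\<And>x y. x \<in> carrier A ==> y \<in> carrier A ==> fi (x \<oplus> y) = fi x + fi y"
  and hom: "\<And>d x. x \<in> carrier A ==> fi (scalar A d \<otimes> x) = d * fi x" and x: "x \<in> carrier A"
 shows "fi x = (\<Sum>(i, t)\<in>PB. Y (i, t) x * fi (p i t))"
proof -
 have "fi x = (\<Sum>be\<in>PB. Y be x * fi ((\<lambda>(j, l). p j l) be))"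
  by (rule k_basis_functional[OF regular_left_module A_basis])
   (use assms in \<open>simp_all add: regular_module_def\<close>)
 then show ?thesis by (simp add: case_prod_unfold)
qed

lemma finite_PB: "finite PB"
 using A_basis by (simp add: k_basis_def)

text \<open>Right multiplication by \<open>p i t\<close> puts \<open>t\<close> arrows in front of a
  path, so coordinates are shifted by \<open>t\<close> and attached to the start
  \<open>i\<close>.\<close>

lemma Y_mult_p:
 assumes a: "a \<in> carrier A" and i: "i < n" and j: "j < n" "s < c j"
 shows "Y (j, s) (a \<otimes> p i t) = (if j = i \<and> t \<le> s then Y ((sg ^^ t) i, s - t) a else 0)"
proof -
 have w: "(sg ^^ t) i < n" by (rule sg_pow[OF i])
 have "Y (j, s) (a \<otimes> p i t) = (\<Sum>(i', r)\<in>PB. Y (i', r) a * Y (j, s) (p i' r \<otimes> p i t))"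
  by (rule A_functional[of "\<lambda>a. Y (j, s) (a \<otimes> p i t)"])
   (use a i j p_closed in \<open>simp_all add: l_distr Y_add m_assoc scalar_closed Y_scalar\<close>)
 also have "\<dots> = (\<Sum>be\<in>PB. if be = ((sg ^^ t) i, s - t) \<and> j = i \<and> t \<le> s then Y be a else 0)"
 proof (rule sum.cong[OF refl])
  fix be assume be: "be \<in> PB"
  obtain i' r where "be = (i', r)" "i' < n" "r < c i'" using be by auto
  then show "(case be of (i', r) => Y (i', r) a * Y (j, s) (p i' r \<otimes> p i t))
    = (if be = ((sg ^^ t) i, s - t) \<and> j = i \<and> t \<le> s then Y be a else 0)"
   using i j by (auto simp: p_mult Y_p Y_zero)
 qed
 also have "\<dots> = (if j = i \<and> t \<le> s then Y ((sg ^^ t) i, s - t) a else 0)"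
 proof (cases "j = i \<and> t \<le> s")
  case True
  \<comment> \<open>The tail of a nonzero path is nonzero: otherwise \<open>p i s\<close> would
    vanish although \<open>s < c i\<close>.\<close>
  have "s - t < c ((sg ^^ t) i)"
  proof (rule ccontr)
   assume "\<not> s - t < c ((sg ^^ t) i)"
   then have "p ((sg ^^ t) i) (s - t) = \<zero>" using p_zero[OF w] by simp
   then have "p i s = \<zero>" using p_mult[OF w i, of "s - t" t] True p_closed[OF i] by simp
   then show False using Y_p[of i s i s] Y_zero[of "(i, s)"] True j i by simp
  qed
  then show ?thesis using True w finite_PB by simp
 qed auto
 finally show ?thesis .
qed

definition F :: "nat => 'a set" where
 "F t = {a \<in> carrier A. \<forall>j<n. \<forall>s<c j. s < t \<longrightarrow> Y (j, s) a = 0}"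

lemma F_mult:
 assumes a: "a \<in> F t" and b: "b \<in> F s"
 shows "a \<otimes> b \<in> F (t + s)"
proof -
 have c: "a \<in> carrier A" "b \<in> carrier A" using a b by (auto simp: F_def)
 have "Y (j, r) (a \<otimes> b) = 0" if j: "j < n" "r < c j" "r < t + s" for j r
 proof -
  have sa: "a \<otimes> (scalar A d \<otimes> x) = scalar A d \<otimes> (a \<otimes> x)" if "x \<in> carrier A" for d x
   using that c(1) by (metis m_assoc scalar_closed scalar_comm)
  have "Y (j, r) (a \<otimes> b) = (\<Sum>(i, t')\<in>PB. Y (i, t') b * Y (j, r) (a \<otimes> p i t'))"
   by (rule A_functional[of "\<lambda>b. Y (j, r) (a \<otimes> b)"])
    (use c j in \<open>simp_all add: r_distr Y_add sa Y_scalar\<close>)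
  also have "\<dots> = 0"
  proof (rule sum.neutral, safe)
   fix i t' assume i: "i < n" "t' < c i"
   show "Y (i, t') b * Y (j, r) (a \<otimes> p i t') = 0"
   proof (cases "t' < s")
    case True then show ?thesis using b i by (simp add: F_def)
   next
    case False
    have "Y (j, r) (a \<otimes> p i t') = 0"
    proof (cases "j = i \<and> t' \<le> r")
     case True
     have "Y ((sg ^^ t') i, r - t') a = 0" if "r - t' < c ((sg ^^ t') i)"
      using a that False j(3) True sg_pow[OF i(1)] by (auto simp: F_def)
     moreover have "r - t' < c ((sg ^^ t') i)"
     proof (rule ccontr)
      assume "\<not> r - t' < c ((sg ^^ t') i)"
      then have "p ((sg ^^ t') i) (r - t') = \<zero>" using p_zero[OF sg_pow[OF i(1)]] by simp
      then have "p i r = \<zero>" using p_mult[OF sg_pow[OF i(1)] i(1), of t' "r - t'" t'] True p_closed[OF i(1)] by simp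
      then show False using Y_p[of i r i r] Y_zero[of "(i, r)"] True j i by simp
     qed
     ultimately show ?thesis using Y_mult_p[OF c(1) i(1) j(1,2)] by simp
    next
     case False
     show ?thesis unfolding Y_mult_p[OF c(1) i(1) j(1,2)] using False by (rule if_not_P)
    qed
    then show ?thesis by simp
   qed
  qed
  finally show ?thesis .
 qed
 then show ?thesis using c by (simp add: F_def)
qed

lemma F_props:
 "F 0 = carrier A" "F (\<Sum>j<n. c j) = {\<zero>}" "\<zero> \<in> F t" "F t \<subseteq> carrier A"
 "x \<in> F t ==> y \<in> F t ==> x \<oplus> y \<in> F t" "x \<in> F t ==> y \<in> F 1 ==> x \<otimes> y \<in> F (Suc t)"
proof -
 show "F (\<Sum>j<n. c j) = {\<zero>}"
 proof
  have "c j \<le> (\<Sum>j<n. c j)" if "j < n" for j using that by (intro member_le_sum) auto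
  then have "s < (\<Sum>j<n. c j)" if "j < n" "s < c j" for j s using that by (meson less_le_trans)
  then show "F (\<Sum>j<n. c j) \<subseteq> {\<zero>}" by (auto simp: F_def Y_zero intro!: Y_eqI)
 qed (auto simp: F_def Y_zero)
 show "x \<in> F t ==> y \<in> F 1 ==> x \<otimes> y \<in> F (Suc t)" using F_mult[of x t y 1] by simp
qed (auto simp: F_def Y_zero Y_add)

text \<open>
 \<open>M\<close> is the direct sum of the uniserial submodules generated by elements \<open>m k\<close> that sit at the
 vertices \<open>v k\<close>; the submodule generated by \<open>m k\<close> has length \<open>l k\<close>.
\<close>

definition jordan_basis ::
  "('a, 'm) module => nat => (nat => nat) => (nat => nat) => (nat => 'm) => (nat \<times> nat => 'm => 'k) => bool" where
 "jordan_basis M q v l m Z \<longleftrightarrow> left_module A M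
   \<and> (\<forall>k<q. v k < n \<and> 0 < l k \<and> m k \<in> carrier M
     \<and> p (v k) 0 *[M] m k = m k \<and> p (v k) (l k) *[M] m k = \<zero>\<^bsub>M\<^esub>)
   \<and> k_basis A M {(k, x). k < q \<and> x < l k} (\<lambda>(k, x). p (v k) x *[M] m k) Z"

context
 fixes M :: "('a, 'm) module" and q :: nat and v l :: "nat => nat" and m :: "nat => 'm"
  and Z :: "nat \<times> nat => 'm => 'k"
 assumes J: "jordan_basis M q v l m Z"
begin

private lemma M: "left_module A M"
 and vl: "k < q ==> v k < n" "k < q ==> 0 < l k" "k < q ==> m k \<in> carrier M"
 "k < q ==> p (v k) 0 *[M] m k = m k" "k < q ==> p (v k) (l k) *[M] m k = \<zero>\<^bsub>M\<^esub>"
 and kb: "k_basis A M {(k, x). k < q \<and> x < l k} (\<lambda>(k, x). p (v k) x *[M] m k) Z"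
 using J by (auto simp: jordan_basis_def)

private lemma pm_zero:
 assumes k: "k < q" and x: "l k \<le> x"
 shows "p (v k) x *[M] m k = \<zero>\<^bsub>M\<^esub>"
proof -
 have w: "(sg ^^ l k) (v k) < n" by (rule sg_pow[OF vl(1)[OF k]])
 have "p (v k) x = p ((sg ^^ l k) (v k)) (x - l k) \<otimes> p (v k) (l k)"
  using p_mult[OF w vl(1)[OF k], of "x - l k" "l k"] x by simp
 then show ?thesis
  using lmod_assoc[OF M p_closed[OF w] p_closed[OF vl(1)[OF k]] vl(3)[OF k], of "x - l k" "l k"]
   vl(5)[OF k] lmod_smult_zero[OF M p_closed[OF w]] by simp
qed

private lemma p_pm:
 assumes k: "k < q" and i: "i < n"
 shows "p i t *[M] (p (v k) x *[M] m k)
  = (if i = (sg ^^ x) (v k) then p (v k) (t + x) *[M] m k else \<zero>\<^bsub>M\<^esub>)"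
 unfolding lmod_assoc[OF M p_closed[OF i] p_closed[OF vl(1)[OF k]] vl(3)[OF k], symmetric]
  p_mult[OF i vl(1)[OF k], of t x]
 by (simp add: lmod_zero_smult[OF M ring_axioms vl(3)[OF k]])

private lemma p_m:
 assumes k: "k < q" and i: "i < n"
 shows "p i t *[M] m k = (if i = v k then p (v k) t *[M] m k else \<zero>\<^bsub>M\<^esub>)"
 using p_pm[OF k i, of t 0] vl(4)[OF k] by simp

private lemma Zb: "k < q ==> x < l k ==> k' < q ==> x' < l k' ==>
  Z (k, x) (p (v k') x' *[M] m k') = (if k = k' \<and> x = x' then 1 else 0)"
 using conjunct1[OF conjunct2[OF conjunct2[OF conjunct2[OF conjunct2[OF kb[unfolded k_basis_def]]]]], rule_format, of "(k, x)" "(k', x')"]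
 by auto

private lemma Za: "k < q ==> x < l k ==> y \<in> carrier M ==> y' \<in> carrier M ==>
  Z (k, x) (y +[M] y') = Z (k, x) y + Z (k, x) y'"
 using conjunct1[OF conjunct2[OF conjunct2[OF kb[unfolded k_basis_def]]], rule_format, of "(k, x)"]
 by auto

private lemma Zs: "k < q ==> x < l k ==> y \<in> carrier M ==>
  Z (k, x) (scalar A d *[M] y) = d * Z (k, x) y"
 using conjunct1[OF conjunct2[OF conjunct2[OF conjunct2[OF kb[unfolded k_basis_def]]]], rule_format, of "(k, x)"]
 by auto

private lemma Z0: "k < q ==> x < l k ==> Z (k, x) \<zero>\<^bsub>M\<^esub> = 0"
proof -
 interpret M: abelian_group M using M by (rule lmod_abelian_group)
 show "k < q ==> x < l k ==> Z (k, x) \<zero>\<^bsub>M\<^esub> = 0"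
  using Za[of k x "\<zero>\<^bsub>M\<^esub>" "\<zero>\<^bsub>M\<^esub>"] by (metis M.r_zero M.zero_closed add_cancel_right_right)
qed

private lemma Zpm: "k < q ==> x < l k ==> k' < q ==>
  Z (k, x) (p (v k') x' *[M] m k') = (if k = k' \<and> x = x' then 1 else 0)"
 by (cases "x' < l k'") (auto simp: Zb pm_zero Z0)

private lemma Z_smult_m:
 assumes k: "k < q" "x < l k" "k' < q" and a: "a \<in> carrier A" and xc: "x < c (v k)"
 shows "Z (k, x) (a *[M] m k') = (if k = k' then Y (v k, x) a else 0)"
proof -
 note m = vl(3)[OF k(3)]
 note cl = lmod_smult_closed[OF M]
 have "Z (k, x) (a *[M] m k') = (\<Sum>(i, t)\<in>PB. Y (i, t) a * Z (k, x) (p i t *[M] m k'))"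
  by (rule A_functional[of "\<lambda>a. Z (k, x) (a *[M] m k')"])
   (use a m k cl in \<open>simp_all add: lmod_smult_l_distr[OF M] lmod_assoc[OF M]
    Za Zs scalar_closed\<close>)
 also have "\<dots> = (\<Sum>be\<in>PB. if be = (v k, x) then (if k = k' then Y (v k, x) a else 0) else 0)"
 proof (rule sum.cong[OF refl], clarify)
  fix i t assume "i < n" "t < c i"
  then show "Y (i, t) a * Z (k, x) (p i t *[M] m k')
    = (if (i, t) = (v k, x) then (if k = k' then Y (v k, x) a else 0) else 0)"
   using k p_m[OF k(3) \<open>i < n\<close>, of t] Zpm[OF k(1,2,3), of t] Z0[OF k(1,2)] by (cases "i = v k'") auto
 qed
 also have "\<dots> = (if k = k' then Y (v k, x) a else 0)"
  using finite_PB vl(1)[OF k(1)] xc by simp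
 finally show ?thesis .
qed

lemma jordan_length_le:
 assumes k: "k < q"
 shows "l k \<le> c (v k)"
proof (rule ccontr)
 assume "\<not> l k \<le> c (v k)"
 then have "Z (k, c (v k)) (\<zero> *[M] m k) = 1"
  using Zb[OF k _ k, of "c (v k)" "c (v k)"] p_zero[OF vl(1)[OF k] order_refl] by simp
 then show False
  using Z0[OF k, of "c (v k)"] lmod_zero_smult[OF M ring_axioms vl(3)[OF k]] \<open>\<not> l k \<le> c (v k)\<close> by simp
qed

private lemma xc: "k < q ==> x < l k ==> x < c (v k)"
 using jordan_length_le[of k] by simp

lemmas jordan_left_module = M
 and jordan_gens = vl
 and jordan_k_basis = kb
 and jordan_pm_zero = pm_zero
 and jordan_p_pm = p_pm
 and jordan_Z_add = Za
 and jordan_Z_scalar = Zs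
 and jordan_Z_zero = Z0
 and jordan_Z_pm = Zpm

abbreviation (input) "w k \<equiv> (sg ^^ l k) (v k)"
text \<open>The relation on \<open>m k\<close> is the path of length \<open>l k\<close> from
  \<open>v k\<close>, which ends at \<open>w k\<close>. A summand with \<open>l k = c (v k)\<close>
  is projective and has no relation; the zero idempotent keeps one index set for both terms of the
  presentation.\<close>

abbreviation (input) "ep k \<equiv> (if l k < c (v k) then p (w k) 0 else \<zero>)"
abbreviation (input) "P1 \<equiv> idem_module A q (\<lambda>k. ep k)"
abbreviation (input) "P0 \<equiv> idem_module A q (\<lambda>k. p (v k) 0)"
abbreviation (input) "f1 \<equiv> (\<lambda>x\<in>carrier P1. \<lambda>k\<in>{..<q}. x k \<otimes> p (v k) (l k))"
abbreviation (input) "g1 \<equiv> (\<lambda>x\<in>carrier P0. finsum M (\<lambda>k. x k *[M] m k) {..<q})"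

private lemma e_idem: "idempotents A q (\<lambda>k. p (v k) 0)"
 by unfold_locales (simp_all add: vl p_closed p_mult)

private lemma ep_idem: "idempotents A q (\<lambda>k. ep k)"
 by unfold_locales (auto simp: vl p_closed p_mult sg_pow)

private lemma Z_g:
 assumes x: "x \<in> carrier P0" and k: "k < q" "s < l k"
 shows "Z (k, s) (g1 x) = Y (v k, s) (x k)"
proof -
 note xD = idem_moduleD[OF x]
 have "Z (k, s) (g1 x) = (\<Sum>k'<q. Z (k, s) (x k' *[M] m k'))"
  using x additive_finsum[OF lmod_abelian_group[OF M] Za[OF k], of "{..<q}" "\<lambda>k'. x k' *[M] m k'"]
   lmod_smult_closed[OF M xD(2) vl(3)] by simp
 also have "\<dots> = (\<Sum>k'<q. if k = k' then Y (v k, s) (x k) else 0)"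
  by (rule sum.cong) (use k xD(2) Z_smult_m[OF k _ _ xc[OF k]] in auto)
 also have "\<dots> = Y (v k, s) (x k)" using k by simp
 finally show ?thesis .
qed

private lemma Y_P0: "x \<in> carrier P0 ==> k < q ==> j < n ==> s < c j ==> j \<noteq> v k ==> Y (j, s) (x k) = 0"
 using idem_moduleD(3)[of x A q "\<lambda>k. p (v k) 0" k] Y_mult_p[of "x k" "v k" j s 0]
  idem_moduleD(2)[of x A q "\<lambda>k. p (v k) 0" k] vl(1)[of k] by simp

private lemma Y_P1:
 assumes x: "x \<in> carrier P1" and k: "k < q" and j: "j < n" "s < c j" and "j \<noteq> w k \<or> \<not> l k < c (v k)"
 shows "Y (j, s) (x k) = 0"
proof -
 note xD = idem_moduleD[OF x]
 show ?thesis
 proof (cases "l k < c (v k)")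
  case True
  then show ?thesis
   using xD(3)[OF k] Y_mult_p[OF xD(2)[OF k] sg_pow[OF vl(1)[OF k], of "l k"] j, of 0] assms(5) by simp
 next
  case False
  then show ?thesis using xD(3)[OF k] xD(2)[OF k] Y_zero[of "(j, s)"] j by simp
 qed
qed

private lemma ker_g: "a_kernel P0 M g1 = {x \<in> carrier P0. \<forall>k<q. \<forall>s<l k. Y (v k, s) (x k) = 0}"
proof -
 interpret e: idempotents A q "\<lambda>k. p (v k) 0" by (rule e_idem)
 interpret M: abelian_group M using M by (rule lmod_abelian_group)
 have "g1 x = \<zero>\<^bsub>M\<^esub> \<longleftrightarrow> (\<forall>k<q. \<forall>s<l k. Y (v k, s) (x k) = 0)" if x: "x \<in> carrier P0" for x
 proof
  assume "g1 x = \<zero>\<^bsub>M\<^esub>"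
  then have "Z (k, s) (g1 x) = 0" if "k < q" "s < l k" for k s using Z0[OF that] by (simp only:)
  then show "\<forall>k<q. \<forall>s<l k. Y (v k, s) (x k) = 0" using Z_g[OF x] by (simp only:) simp
 next
  assume *: "\<forall>k<q. \<forall>s<l k. Y (v k, s) (x k) = 0"
  show "g1 x = \<zero>\<^bsub>M\<^esub>"
   by (rule k_basis_eqI[OF kb HomD(2)[OF e.idem_hom[OF M vl(3)] x] M.zero_closed _ M])
    (use * Z_g[OF x] Z0 in \<open>auto simp del: restrict_apply\<close>)
 qed
 then show ?thesis unfolding a_kernel_def' by (intro Collect_cong conj_cong refl) blast
qed

text \<open>The syzygy of the summand \<open>k\<close> consists of the multiples of the path of
  length \<open>l k\<close>, again a uniserial module, now generated at \<open>w k\<close> (or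
  zero). Both maps are covers because the elements of their kernels have no coefficients of length
  0.\<close>

lemma jordan_presentation: "min_proj_presentation A M P1 f1 P0 g1"
proof -
 interpret e: idempotents A q "\<lambda>k. p (v k) 0" by (rule e_idem)
 interpret ep: idempotents A q "\<lambda>k. ep k" by (rule ep_idem)
 interpret M: abelian_group M using M by (rule lmod_abelian_group)
 have g: "g1 \<in> Hom A P0 M" by (rule e.idem_hom[OF M vl(3)])
 have gsur: "g1 ` carrier P0 = carrier M"
 proof
  show "g1 ` carrier P0 \<subseteq> carrier M" using HomD(2)[OF g] by blast
  show "carrier M \<subseteq> g1 ` carrier P0"
  proof
   fix y assume y: "y \<in> carrier M"
   have "\<forall>k. \<exists>a\<in>carrier A. \<forall>j<n. \<forall>s<c j. Y (j, s) a = (if j = v k \<and> s < l k then Z (k, s) y else 0)"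
    by (rule allI, rule Y_ex)
   then have "\<exists>a. \<forall>k. a k \<in> carrier A \<and> (\<forall>j<n. \<forall>s<c j. Y (j, s) (a k) = (if j = v k \<and> s < l k then Z (k, s) y else 0))"
    unfolding Bex_def by (rule choice)
   then obtain a where a: "\<And>k. a k \<in> carrier A"
    "\<And>k j s. j < n ==> s < c j ==> Y (j, s) (a k) = (if j = v k \<and> s < l k then Z (k, s) y else 0)" by blast
   let ?x = "\<lambda>k\<in>{..<q}. a k"
   have x: "?x \<in> carrier P0"
   proof (rule idem_moduleI)
    fix k assume k: "k < q"
    have "a k \<otimes> p (v k) 0 = a k"
     by (rule Y_eqI) (use a k vl(1)[OF k] p_closed in \<open>auto simp: Y_mult_p\<close>)
    then show "?x k \<otimes> p (v k) 0 = ?x k" using k by simp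
   qed (use a in auto)
   have "y = g1 ?x"
   proof (rule k_basis_eqI[OF kb y HomD(2)[OF g x] _ M], clarify)
    fix k s assume "k < q" "s < l k"
    then show "Z (k, s) y = Z (k, s) (g1 ?x)"
     using Z_g[OF x] a(2) vl(1) xc by simp
   qed
   then show "y \<in> g1 ` carrier P0" using x by (rule image_eqI)
  qed
 qed
 have gsup: "superfluous A (a_kernel P0 M g1) P0"
 proof (rule e.superfluous_of_filtration[OF F_props(1,2,3,4,5,6)])
  fix x k assume x: "x \<in> a_kernel P0 M g1" and k: "k < q"
  then have x': "x \<in> carrier P0" "\<forall>k<q. \<forall>s<l k. Y (v k, s) (x k) = 0" unfolding ker_g by auto
  show "x k \<in> F 1" unfolding F_def
   using idem_moduleD(2)[OF x'(1) k] Y_P0[OF x'(1) k] x'(2) k vl(2)[OF k] by auto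
 qed (auto simp: a_kernel_def')
 have cover0: "projective_cover A P0 M g1"
  unfolding projective_cover_def by (intro conjI e.idem_projective g gsur gsup)
 let ?K = "P0\<lparr>carrier := a_kernel P0 M g1\<rparr>"
 interpret P1: abelian_group P1 using ep.idem_left_module by (rule lmod_abelian_group)
 have f_app: "f1 x k = x k \<otimes> p (v k) (l k)" if "x \<in> carrier P1" "k < q" for x k using that by simp
 have fK: "f1 x \<in> a_kernel P0 M g1" if x: "x \<in> carrier P1" for x
 proof -
  note xD = idem_moduleD[OF x]
  have "f1 x \<in> carrier P0"
   by (rule idem_moduleI) (use x xD vl p_closed p_mult in \<open>auto simp: m_assoc\<close>)
  moreover have "Y (v k, s) (f1 x k) = 0" if k: "k < q" "s < l k" for k s
   unfolding f_app[OF x k(1)]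
   using Y_mult_p[OF xD(2)[OF k(1)] vl(1)[OF k(1)] vl(1)[OF k(1)] xc[OF k], of "l k"] k by simp
  ultimately show ?thesis unfolding ker_g by blast
 qed
 have f: "f1 \<in> Hom A P1 ?K"
 proof (rule HomI, goal_cases)
  case 1 then show ?case by simp
 next
  case (2 x) then show ?case using fK by (simp del: restrict_apply)
 next
  case (3 x y)
  then have "x +[P1] y \<in> carrier P1" by (rule P1.a_closed)
  then show ?case
   using 3 idem_moduleD(2)[OF 3(1)] idem_moduleD(2)[OF 3(2)] p_closed[OF vl(1)]
   by (auto simp: fun_eq_iff l_distr)
 next
  case (4 a x)
  then have "a *[P1] x \<in> carrier P1" by (rule lmod_smult_closed[OF ep.idem_left_module])
  then show ?case
   using 4 idem_moduleD(2)[OF 4(2)] p_closed[OF vl(1)]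
   by (auto simp: fun_eq_iff m_assoc)
 qed
 have fsur: "f1 ` carrier P1 = carrier ?K"
 proof
  show "f1 ` carrier P1 \<subseteq> carrier ?K" using HomD(2)[OF f] by blast
  show "carrier ?K \<subseteq> f1 ` carrier P1"
  proof
   fix x assume "x \<in> carrier ?K"
   then have x: "x \<in> carrier P0" "\<forall>k<q. \<forall>s<l k. Y (v k, s) (x k) = 0"
    using ker_g by auto
   note xD = idem_moduleD[OF x(1)]
   \<comment> \<open>Division by the path of length \<open>l k\<close>: the coordinates of
     \<open>x k\<close> are shifted down by \<open>l k\<close>. Nothing is lost, because those below
     \<open>l k\<close> vanish on the kernel.\<close>
   have "\<forall>k. \<exists>a\<in>carrier A. \<forall>j<n. \<forall>s<c j. Y (j, s) a =
     (if j = w k \<and> s + l k < c (v k) then Y (v k, s + l k) (x k) else 0)"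
    by (rule allI, rule Y_ex)
   then have "\<exists>a. \<forall>k. a k \<in> carrier A \<and> (\<forall>j<n. \<forall>s<c j. Y (j, s) (a k) = 
     (if j = w k \<and> s + l k < c (v k) then Y (v k, s + l k) (x k) else 0))"
    unfolding Bex_def by (rule choice)
   then obtain a where a: "\<And>k. a k \<in> carrier A"
    "\<And>k j s. j < n ==> s < c j ==> Y (j, s) (a k) =
     (if j = w k \<and> s + l k < c (v k) then Y (v k, s + l k) (x k) else 0)" by blast
   let ?y = "\<lambda>k\<in>{..<q}. a k"
   have y: "?y \<in> carrier P1"
   proof (rule idem_moduleI)
    fix k assume k: "k < q"
    have w: "w k < n" by (rule sg_pow[OF vl(1)[OF k]])
    have "a k \<otimes> ep k = a k"
     by (rule Y_eqI) (use a k w p_closed in \<open>auto simp: Y_mult_p Y_zero\<close>)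
    then show "?y k \<otimes> ep k = ?y k" using k by simp
   qed (use a in auto)
   have "x = f1 ?y"
   proof (rule extensionalityI[OF xD(1), of "f1 ?y"])
    show "f1 ?y \<in> extensional {..<q}" using y by simp
    fix k assume "k \<in> {..<q}" then have k: "k < q" by simp
    have w: "w k < n" by (rule sg_pow[OF vl(1)[OF k]])
    have "x k = a k \<otimes> p (v k) (l k)"
    proof (rule Y_eqI)
     fix j s assume j: "j < n" "s < c j"
     show "Y (j, s) (x k) = Y (j, s) (a k \<otimes> p (v k) (l k))"
     proof (cases "j = v k \<and> l k \<le> s")
      case True
      have "s - l k < c (w k)"
      proof (rule ccontr)
       assume "\<not> s - l k < c (w k)"
       then have "p (w k) (s - l k) = \<zero>" using p_zero[OF w] by simp
       then have "p (v k) s = \<zero>"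
        using p_mult[OF w vl(1)[OF k], of "s - l k" "l k"] True p_closed[OF vl(1)[OF k]] by simp
       then show False using Y_p[of j s j s] Y_zero[of "(j, s)"] True j by simp
      qed
      then show ?thesis using Y_mult_p[OF a(1) vl(1)[OF k] j, of k "l k"] True a(2)[OF w] j by simp
     next
      case False
      then have "Y (j, s) (x k) = 0" using Y_P0[OF x(1) k j] x(2) k by (cases "j = v k") auto
      then show ?thesis using Y_mult_p[OF a(1) vl(1)[OF k] j, of k "l k"] False by auto
     qed
    qed (use xD(2)[OF k] a(1) p_closed[OF vl(1)[OF k]] in auto)
    then show "x k = f1 ?y k" using y k by simp
   qed
   then show "x \<in> f1 ` carrier P1" using y by (rule image_eqI)
  qed
 qed
 have fsup: "superfluous A (a_kernel P1 ?K f1) P1"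
 proof (rule ep.superfluous_of_filtration[OF F_props(1,2,3,4,5,6)])
  fix x k assume "x \<in> a_kernel P1 ?K f1" and k: "k < q"
  then have x: "x \<in> carrier P1" "f1 x = (\<lambda>i\<in>{..<q}. \<zero>)" by (auto simp: a_kernel_def')
  note xD = idem_moduleD[OF x(1)]
  \<comment> \<open>The coefficient of length 0 of \<open>x k\<close> at \<open>w k\<close>
    reappears in this product as the coefficient of length \<open>l k\<close>, so it vanishes; if
    \<open>l k < c (v k)\<close> fails, \<open>x k\<close> itself is zero.\<close>
  have "x k \<otimes> p (v k) (l k) = \<zero>" using fun_cong[OF x(2), of k] f_app[OF x(1) k] k by simp
  then have "Y (w k, 0) (x k) = 0" if "l k < c (v k)"
   using Y_mult_p[OF xD(2)[OF k] vl(1)[OF k] vl(1)[OF k] that, of "l k"] Y_zero[of "(v k, l k)"]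
    that vl(1)[OF k] by simp
  then have "Y (j, 0) (x k) = 0" if "j < n" for j
   using Y_P1[OF x(1) k that c_pos[OF that]] by blast
  then show "x k \<in> F 1" unfolding F_def using xD(2)[OF k] by auto
 qed (auto simp: a_kernel_def')
 have "projective_cover A P1 ?K f1"
  unfolding projective_cover_def by (intro conjI ep.idem_projective f fsur fsup)
 with cover0 show ?thesis unfolding min_proj_presentation_def by blast
qed

text \<open>The basis vector at position \<open>x\<close> of the summand \<open>k'\<close> sits at
  the vertex \<open>w k\<close> where the relation of the nonprojective summand \<open>k\<close>
  ends, and \<open>x < l k\<close> says that it is not a multiple of the path of length
  \<open>l k\<close>. By \<open>E_inv_coordinates\<close> such pairs index coordinates on the space
  whose dimension is \<open>E\<close>.\<close>

abbreviation (input) "E_set \<equiv> {(k, (k', x)). k < q \<and> l k < c (v k) \<and> k' < q \<and> x < l k' \<and> x < l k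
  \<and> (sg ^^ x) (v k') = (sg ^^ l k) (v k)}"

theorem jordan_coordinates:
 "\<exists>Ph :: ('m => ((nat => 'a) => 'a) set => 'k) => _. coordinatized (Hom_space A M (AR_tau A M)) E_set Ph"
proof (rule E_inv_coordinates[OF M kb ep_idem e_idem _ _ _ _ jordan_presentation])
 let ?b = "\<lambda>(k, x). p (v k) x *[M] m k"
 fix k assume k: "k < q"
 have w: "w k < n" by (rule sg_pow[OF vl(1)[OF k]])
 show "p (v k) (l k) \<in> carrier A" by (rule p_closed[OF vl(1)[OF k]])
 show "ep k \<otimes> p (v k) (l k) = p (v k) (l k)"
  using p_mult[OF w vl(1)[OF k], of 0 "l k"] p_zero[OF vl(1)[OF k], of "l k"] p_closed[OF vl(1)[OF k]] by auto
 show "p (v k) (l k) \<otimes> p (v k) 0 = p (v k) (l k)"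
  using p_mult[OF vl(1)[OF k] vl(1)[OF k], of "l k" 0] by simp
 show "ep k *[M] ?b be = \<zero>\<^bsub>M\<^esub> \<or> (\<exists>y\<in>carrier M. p (v k) (l k) *[M] y = ?b be)"
  if be: "be \<in> {(k, x). k < q \<and> x < l k}" and nT: "(k, be) \<notin> E_set" for be
 proof -
  obtain k' x where b: "be = (k', x)" "k' < q" "x < l k'" using be by auto
  have c: "?b be \<in> carrier M"
   using b lmod_smult_closed[OF M p_closed[OF vl(1)[OF b(2)]] vl(3)[OF b(2)]] by simp
  consider "\<not> l k < c (v k)" | "l k < c (v k)" "(sg ^^ x) (v k') \<noteq> w k" |
   "l k < c (v k)" "(sg ^^ x) (v k') = w k" "l k \<le> x"
   using nT b k by force
  then show ?thesis
  proof cases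
   case 1
   then show ?thesis using lmod_zero_smult[OF M ring_axioms c] by simp
  next
   case 2
   then show ?thesis using p_pm[OF b(2) w, of 0 x] b(1) by auto
  next
   case 3
   have "(sg ^^ l k) ((sg ^^ (x - l k)) (v k')) = (sg ^^ l k) (v k)"
    using 3 by (metis comp_apply funpow_add le_add_diff_inverse)
   then have "(sg ^^ (x - l k)) (v k') = v k"
    using sg_pow_inj[OF sg_pow[OF vl(1)[OF b(2)]] vl(1)[OF k]] by blast
   then have "p (v k) (l k) *[M] (p (v k') (x - l k) *[M] m k') = ?b be"
    using p_pm[OF b(2) vl(1)[OF k], of "l k" "x - l k"] b(1) 3 by simp
   then show ?thesis
    using lmod_smult_closed[OF M p_closed[OF vl(1)[OF b(2)]] vl(3)[OF b(2)]] by blast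
  qed
 qed
next
 let ?b = "\<lambda>(k, x). p (v k) x *[M] m k"
 fix k be assume "(k, be) \<in> E_set"
 then obtain k' x where b: "be = (k', x)" "k < q" "l k < c (v k)" "k' < q" "x < l k'" "x < l k"
  "(sg ^^ x) (v k') = w k" by auto
 have w: "w k < n" by (rule sg_pow[OF vl(1)[OF b(2)]])
 show "ep k *[M] ?b be = ?b be" using p_pm[OF b(4) w, of 0 x] b by simp
 fix y assume y: "y \<in> carrier M"
 note cl = lmod_smult_closed[OF M]
 have sa: "p (v k) (l k) *[M] (scalar A d *[M] z) = scalar A d *[M] (p (v k) (l k) *[M] z)"
  if "z \<in> carrier M" for d z
  using that p_closed[OF vl(1)[OF b(2)]] by (metis lmod_assoc[OF M] scalar_closed scalar_comm)
 have "Z (k', x) (p (v k) (l k) *[M] y)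
   = (\<Sum>ga\<in>{(k, x). k < q \<and> x < l k}. Z ga y * Z (k', x) (p (v k) (l k) *[M] ?b ga))"
  by (rule k_basis_functional[OF M kb, of "\<lambda>y. Z (k', x) (p (v k) (l k) *[M] y)"])
   (use b y cl p_closed[OF vl(1)[OF b(2)]] in
    \<open>simp_all add: lmod_smult_r_distr[OF M] Za Zs sa\<close>)
 also have "\<dots> = 0"
 proof (rule sum.neutral, clarify)
  fix k'' t assume "k'' < q" "t < l k''"
  then have "Z (k', x) (p (v k) (l k) *[M] (p (v k'') t *[M] m k'')) = 0"
   using b p_pm[of k'' "v k" "l k" t] vl(1)[OF b(2)] Zpm[OF b(4,5), of k'' "l k + t"] Z0[OF b(4,5)]
   by auto
  then show "Z (k'', t) y * Z (k', x) (p (v k) (l k) *[M] (p (v k'') t *[M] m k'')) = 0" by simp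
 qed
 finally show "Z be (p (v k) (l k) *[M] y) = 0" using b(1) by simp
qed (auto)

corollary jordan_E_inv: "E_inv A M = card E_set"
 using jordan_coordinates dim_coordinatized unfolding E_inv_def dim_Hom_def by blast

end

end

section \<open>Dimension and growth of functions\<close>

text \<open>Degree is an upper bound attached to a function, not an invariant of a formal
  polynomial: the same function may be built in several ways.\<close>

inductive poly_le :: "nat => (nat => nat) => nat => ((nat => 'k :: field mat) => 'k) => bool"
 for n :: nat and d :: "nat => nat" where
 const: "poly_le n d t (\<lambda>_. c)"
| coord: "i < n ==> r < d ((i + 1) mod n) ==> s < d i ==> 0 < t ==> poly_le n d t (\<lambda>M. M i $$ (r, s))"
| add: "poly_le n d t f ==> poly_le n d t g ==> poly_le n d t (\<lambda>M. f M + g M)"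
| mult: "poly_le n d t f ==> poly_le n d t' g ==> poly_le n d (t + t') (\<lambda>M. f M * g M)"

lemma poly_le_mono: "poly_le n d t f ==> t \<le> t' ==> poly_le n d t' f"
 using poly_le.mult[of n d t f "t' - t" "\<lambda>_. 1"] poly_le.const[of n d "t' - t" 1] by simp

lemma poly_le_smult: "poly_le n d t f ==> poly_le n d t (\<lambda>M. c * f M)"
 using poly_le.mult[of n d 0 "\<lambda>_. c" t f] poly_le.const[of n d 0 c] by simp

lemma poly_le_sum: "(\<And>i. i \<in> A ==> poly_le n d t (f i)) ==> poly_le n d t (\<lambda>M. \<Sum>i\<in>A. f i M)"
 by (induction A rule: infinite_finite_induct) (auto intro: poly_le.const poly_le.add)

lemma poly_le_power: "poly_le n d t f ==> poly_le n d (j * t) (\<lambda>M. f M ^ j)"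
 by (induction j) (auto intro: poly_le.const poly_le.mult)

lemma poly_le_regular: "poly_le n d t f ==> f \<in> regular_functions n d"
 by (induction rule: poly_le.induct) (auto intro: regular_functions.intros)

lemma regular_poly_le: "f \<in> regular_functions n d ==> \<exists>t. poly_le n d t f"
proof (induction rule: regular_functions.induct)
 case (coord i r s)
 then show ?case using poly_le.coord[of i n r d s 1] by auto
next
 case (add f g)
 then obtain t t' where "poly_le n d t f" "poly_le n d t' g" by auto
 then have "poly_le n d (max t t') f" "poly_le n d (max t t') g" by (auto elim: poly_le_mono)
 then show ?case using poly_le.add by blast
qed (auto intro: poly_le.const poly_le.mult)

lemma topspace_zariski [simp]: "topspace (zariski n d) = rep n d"
proof
 have "openin (zariski n d) (topspace (zariski n d))" by simp
 then show "topspace (zariski n d) \<subseteq> rep n d" unfolding openin_zariski by auto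
 have "openin (zariski n d) (rep n d)"
  unfolding openin_zariski
  by (rule exI[of _ "{\<lambda>_. 1}"]) (auto simp: zero_locus_def intro: regular_functions.const)
 then show "rep n d \<subseteq> topspace (zariski n d)" by (rule openin_subset)
qed

lemma closedin_zariski:
 "closedin (zariski n d) S \<longleftrightarrow> (\<exists>F \<subseteq> regular_functions n d. S = zero_locus n d F)"
proof -
 have z: "zero_locus n d F \<subseteq> rep n d" for F :: "((nat => 'a mat) => 'a) set"
  by (auto simp: zero_locus_def)
 show ?thesis unfolding closedin_def openin_zariski topspace_zariski
 proof (intro iffI conjI; (elim conjE)?)
  assume "S \<subseteq> rep n d" "\<exists>F\<subseteq>regular_functions n d. rep n d - S = rep n d - zero_locus n d F"
  then show "\<exists>F\<subseteq>regular_functions n d. S = zero_locus n d F"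
   using z by (metis double_diff subset_refl)
 qed (use z in auto)
qed

lemma closedin_zero: "f \<in> regular_functions n d ==> closedin (zariski n d) {x \<in> rep n d. f x = 0}"
 unfolding closedin_zariski by (rule exI[of _ "{f}"]) (auto simp: zero_locus_def)

lemma closedin_separate:
 assumes "closedin (zariski n d) A" "x \<in> rep n d" "x \<notin> A"
 obtains f t where "poly_le n d t f" "\<forall>y\<in>A. f y = 0" "f x \<noteq> 0"
proof -
 obtain F where F: "F \<subseteq> regular_functions n d" "A = zero_locus n d F"
  using assms(1) closedin_zariski by blast
 then obtain f where "f \<in> F" "f x \<noteq> 0" using assms(2,3) by (auto simp: zero_locus_def)
 moreover have "\<forall>y\<in>A. f y = 0" using F(2) \<open>f \<in> F\<close> by (auto simp: zero_locus_def)
 ultimately show ?thesis using that regular_poly_le F(1) by blast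
qed

section \<open>Linear dependence and Hilbert functions\<close>

lemma homogeneous_system:
 fixes a :: "'i => 'b => 'k :: field"
 assumes "finite B" "finite I" "card B < card I"
 shows "\<exists>c. (\<exists>i\<in>I. c i \<noteq> 0) \<and> (\<forall>b\<in>B. (\<Sum>i\<in>I. c i * a i b) = 0)"
 using assms
proof (induction B arbitrary: I a rule: finite_induct)
 case empty
 then have "I \<noteq> {}" by auto
 then show ?case by (intro exI[of _ "\<lambda>_. 1"]) auto
next
 case (insert b B)
 show ?case
 proof (cases "\<forall>i\<in>I. a i b = 0")
  case True
  have "card B < card I" using insert by simp
  from insert.IH[OF insert.prems(1) this, of a] True show ?thesis by auto
 next
  case False
  then obtain i0 where i0: "i0 \<in> I" "a i0 b \<noteq> 0" by blast
  let ?I = "I - {i0}"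
  have "card B < card ?I" using insert i0 by (simp add: card_Diff_singleton)
  from insert.IH[OF _ this, of "\<lambda>i b'. a i b' - a i b / a i0 b * a i0 b'"] insert.prems(1)
  obtain c where c: "\<exists>i\<in>?I. c i \<noteq> 0"
   "\<forall>b'\<in>B. (\<Sum>i\<in>?I. c i * (a i b' - a i b / a i0 b * a i0 b')) = 0" by auto
  let ?c = "\<lambda>i. if i = i0 then - (\<Sum>i\<in>?I. c i * a i b / a i0 b) else c i"
  have split: "(\<Sum>i\<in>I. ?c i * a i b') = (\<Sum>i\<in>?I. c i * (a i b' - a i b / a i0 b * a i0 b'))" for b'
  proof -
   have "(\<Sum>i\<in>I. ?c i * a i b') = ?c i0 * a i0 b' + (\<Sum>i\<in>?I. ?c i * a i b')"
    using insert.prems(1) i0 by (simp add: sum.remove)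
   also have "(\<Sum>i\<in>?I. ?c i * a i b') = (\<Sum>i\<in>?I. c i * a i b')" by (rule sum.cong) auto
   finally show ?thesis
    by (simp add: sum_distrib_right sum_subtractf[symmetric] right_diff_distrib mult.assoc)
  qed
  have "(\<Sum>i\<in>?I. c i * (a i b - a i b / a i0 b * a i0 b)) = 0" using i0 by simp
  then show ?thesis using c split i0 by (intro exI[of _ ?c]) auto
 qed
qed

text \<open>This bounds the value at \<open>t\<close> of the affine Hilbert function of
  \<open>Y\<close>, that is, the dimension of the space of restrictions to \<open>Y\<close> of
  functions of degree at most \<open>t\<close>. Accordingly \<open>growth\<close> says that the
  Hilbert function is at most of order \<open>t ^ k\<close>.\<close>

definition spanned where
 "spanned n d Y t N \<longleftrightarrow> (\<exists>B. finite B \<and> card B \<le> N \<and>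
   (\<forall>f. poly_le n d t f \<longrightarrow> (\<exists>a. \<forall>x\<in>Y. f x = (\<Sum>b\<in>B. a b * (b x :: 'k :: field)))))"

definition growth where
 "growth n d (Y :: (nat => 'k :: field mat) set) k \<longleftrightarrow> (\<exists>C. \<forall>t. spanned n d Y t (C * (t + 1) ^ k))"

lemma spanned_dependent:
 assumes sp: "spanned n d Y t N" and I: "finite I" "N < card I" and g: "\<And>i. i \<in> I ==> poly_le n d t (g i)"
 shows "\<exists>c. (\<exists>i\<in>I. c i \<noteq> 0) \<and> (\<forall>x\<in>Y. (\<Sum>i\<in>I. c i * g i x) = 0)"
proof -
 obtain B where B: "finite B" "card B \<le> N" "\<forall>f. poly_le n d t f \<longrightarrow> (\<exists>a. \<forall>x\<in>Y. f x = (\<Sum>b\<in>B. a b * b x))"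
  using sp unfolding spanned_def by blast
 have "\<forall>i\<in>I. \<exists>a. \<forall>x\<in>Y. g i x = (\<Sum>b\<in>B. a b * b x)" using B(3) g by blast
 then obtain a where a: "\<forall>i\<in>I. \<forall>x\<in>Y. g i x = (\<Sum>b\<in>B. a i b * b x)" by metis
 obtain c where c: "\<exists>i\<in>I. c i \<noteq> 0" "\<forall>b\<in>B. (\<Sum>i\<in>I. c i * a i b) = 0"
  using homogeneous_system[of B I a] B I by auto
 have "(\<Sum>i\<in>I. c i * g i x) = 0" if x: "x \<in> Y" for x
 proof -
  have "(\<Sum>i\<in>I. c i * g i x) = (\<Sum>i\<in>I. \<Sum>b\<in>B. c i * a i b * b x)"
   by (rule sum.cong) (use a x in \<open>auto simp: sum_distrib_left mult.assoc\<close>)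
  also have "\<dots> = (\<Sum>b\<in>B. (\<Sum>i\<in>I. c i * a i b) * b x)"
   unfolding sum_distrib_right by (rule sum.swap)
  also have "\<dots> = 0" using c(2) by simp
  finally show ?thesis .
 qed
 then show ?thesis using c(1) by blast
qed

text \<open>A maximal family of independent restrictions has at most \<open>N\<close> members and
  spans all others. So a bound can be proved by producing linear relations, which is how sweeps and
  closures are treated.\<close>

lemma spanned_of_dependent:
 assumes dep: "\<And>g :: nat => (nat => 'k :: field mat) => 'k. (\<And>i. poly_le n d t (g i)) ==>
  \<exists>c. (\<exists>i\<le>N. c i \<noteq> 0) \<and> (\<forall>x\<in>Y. (\<Sum>i\<le>N. c i * g i x) = 0)"
 shows "spanned n d Y t N"
proof -
 define ind where "ind m g \<longleftrightarrow> (\<forall>i. poly_le n d t (g i)) \<and>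
  (\<forall>c. (\<forall>x\<in>Y. (\<Sum>i<m. c i * g i x) = 0) \<longrightarrow> (\<forall>i<m. c i = 0))" for m and g :: "nat => (nat => 'k mat) => 'k"
 have bound: "m \<le> N" if ind: "ind m g" for m g
 proof (rule ccontr)
  assume m: "\<not> m \<le> N"
  from dep[OF conjunct1[OF ind[unfolded ind_def], rule_format]]
  obtain c where c': "(\<exists>i\<le>N. c i \<noteq> 0) \<and> (\<forall>x\<in>Y. (\<Sum>i\<le>N. c i * g i x) = 0)" ..
  note c = conjunct1[OF c'] conjunct2[OF c']
  let ?c = "\<lambda>i. if i \<le> N then c i else 0"
  have "(\<Sum>i<m. ?c i * g i x) = (\<Sum>i\<le>N. c i * g i x)" for x
  proof -
   have "(\<Sum>i<m. ?c i * g i x) = (\<Sum>i\<in>{..<m} \<inter> {i. i \<le> N}. c i * g i x)"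
    by (rule sum.mono_neutral_cong_right) auto
   also have "{..<m} \<inter> {i. i \<le> N} = {..N}" using m by auto
   finally show ?thesis .
  qed
  then have "\<forall>x\<in>Y. (\<Sum>i<m. ?c i * g i x) = 0" using c(2) by simp
  then have "\<forall>i<m. ?c i = 0" using that[unfolded ind_def, THEN conjunct2, rule_format, of ?c] by blast
  moreover obtain i where "i \<le> N" "c i \<noteq> 0" using c(1) by blast
  ultimately show False using m by (auto dest!: spec[of _ i])
 qed
 have "ind 0 (\<lambda>_ _. 0)" by (simp add: ind_def poly_le.const)
 then have ex: "\<exists>g. ind 0 g" by blast
 define m where "m = (GREATEST m. \<exists>g. ind m g)"
 have "\<exists>g. ind m g" unfolding m_def by (rule GreatestI_nat[of _ 0 N]) (use ex bound in auto)
 then obtain g where g: "ind m g" by blast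
 have max: "\<not> ind (Suc m) g'" for g'
 proof
  assume "ind (Suc m) g'"
  then have "Suc m \<le> m" unfolding m_def
   by (intro Greatest_le_nat[of "\<lambda>m. \<exists>g. ind m g" _ N]) (use bound in auto)
  then show False by simp
 qed
 have sp: "\<exists>a. \<forall>x\<in>Y. f x = (\<Sum>i<m. a i * g i x)" if f: "poly_le n d t f" for f
 proof -
  have p: "\<forall>i. poly_le n d t ((g(m := f)) i)" using g f by (simp add: ind_def)
  then obtain c where c: "\<forall>x\<in>Y. (\<Sum>i<Suc m. c i * (g(m := f)) i x) = 0" "\<exists>i<Suc m. c i \<noteq> 0"
   using max[of "g(m := f)"] unfolding ind_def by blast
  have e: "(\<Sum>i<Suc m. c i * (g(m := f)) i x) = (\<Sum>i<m. c i * g i x) + c m * f x" for x by simp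
  have "c m \<noteq> 0"
  proof
   assume "c m = 0"
   then have "\<forall>i<m. c i = 0" using g c(1) unfolding ind_def e by simp
   then show False using c(2) \<open>c m = 0\<close> less_Suc_eq by auto
  qed
  have "f x = (\<Sum>i<m. - c i / c m * g i x)" if "x \<in> Y" for x
  proof -
   have "c m * f x = - (\<Sum>i<m. c i * g i x)" using c(1) that unfolding e by (simp add: eq_neg_iff_add_eq_0 add.commute)
   then have "f x = - (\<Sum>i<m. c i * g i x) / c m" using \<open>c m \<noteq> 0\<close> by (simp add: field_simps)
   also have "\<dots> = (\<Sum>i<m. - c i / c m * g i x)"
    by (simp add: sum_divide_distrib sum_negf)
   finally show ?thesis .
  qed
  then show ?thesis by (intro exI[of _ "\<lambda>i. - c i / c m"]) blast
 qed
 have "inj_on g {..<m}"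
 proof (rule inj_onI, rule ccontr)
  fix i j assume ij: "i \<in> {..<m}" "j \<in> {..<m}" "g i = g j" "i \<noteq> j"
  let ?c = "\<lambda>l. if l = i then 1 else if l = j then -1 else (0::'k)"
  have "(\<Sum>l<m. ?c l * g l x) = 0" for x
  proof -
   have "(\<Sum>l<m. ?c l * g l x) = (\<Sum>l\<in>{i, j}. ?c l * g l x)"
    by (rule sum.mono_neutral_right) (use ij in auto)
   also have "\<dots> = 0" using ij by simp
   finally show ?thesis .
  qed
  then have z: "\<forall>x\<in>Y. (\<Sum>l<m. ?c l * g l x) = 0" by (rule ballI)
  from conjunct2[OF g[unfolded ind_def], THEN spec, THEN mp, OF z] have "?c i = 0" using ij by blast
  then show False by simp
 qed
 note inj = this
 show ?thesis unfolding spanned_def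
 proof (intro exI[of _ "g ` {..<m}"] conjI allI impI)
  show "card (g ` {..<m}) \<le> N" using bound[OF g] inj by (simp add: card_image)
  fix f :: "(nat => 'k mat) => 'k" assume "poly_le n d t f"
  then obtain a where a: "\<forall>x\<in>Y. f x = (\<Sum>i<m. a i * g i x)" using sp by blast
  have "(\<Sum>b\<in>g ` {..<m}. a (the_inv_into {..<m} g b) * b x) = (\<Sum>i<m. a i * g i x)" for x
   unfolding sum.reindex[OF inj] by (rule sum.cong) (simp_all add: the_inv_into_f_f[OF inj])
  then show "\<exists>a. \<forall>x\<in>Y. f x = (\<Sum>b\<in>g ` {..<m}. a b * b x)"
   using a by (intro exI[of _ "\<lambda>b. a (the_inv_into {..<m} g b)"]) simp
 qed simp
qed

text \<open>The head of the list is the exponent of the function with the highest index, so that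
  removing the head matches the induction along the chain.\<close>

primrec chain_monomial :: "(nat => 'x => 'k :: field) => nat list => 'x => 'k" where
 "chain_monomial f [] x = 1"
| "chain_monomial f (j # l) x = f (length l) x ^ j * chain_monomial f l x"

lemma poly_le_chain_monomial:
 assumes "\<And>i. i < length l ==> poly_le n d e (f i)" "set l \<subseteq> {..t}"
 shows "poly_le n d (length l * (e * t)) (chain_monomial f l)"
 using assms
proof (induction l)
 case Nil
 have "chain_monomial f [] = (\<lambda>_. 1)" by (simp add: fun_eq_iff)
 then show ?case by (simp add: poly_le.const)
next
 case (Cons j l)
 have "poly_le n d (j * e) (\<lambda>x. f (length l) x ^ j)" by (rule poly_le_power) (use Cons.prems in simp)
 moreover have "j * e \<le> e * t" using Cons.prems(2) by (simp add: mult.commute)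
 ultimately have "poly_le n d (e * t) (\<lambda>x. f (length l) x ^ j)" by (rule poly_le_mono)
 moreover have "poly_le n d (length l * (e * t)) (chain_monomial f l)" using Cons by simp
 ultimately have "poly_le n d (e * t + length l * (e * t)) (\<lambda>x. f (length l) x ^ j * chain_monomial f l x)"
  by (rule poly_le.mult)
 moreover have "chain_monomial f (j # l) = (\<lambda>x. f (length l) x ^ j * chain_monomial f l x)"
  by (simp add: fun_eq_iff)
 ultimately show ?case by simp
qed

text \<open>
 If \<open>f i\<close> vanishes on \<open>Z i\<close> but not on the irreducible set \<open>Z (i + 1)\<close>, then the \<open>f i\<close> are
 algebraically independent as functions on the last set of the chain.
\<close>

lemma chain_monomials_independent:
 fixes f :: "nat => (nat => 'k :: field mat) => 'k"
 assumes irr: "\<And>i. i \<le> m ==> irreducible_set (zariski n d) (Z i)"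
  and sub: "\<And>i. i < m ==> Z i \<subseteq> Z (Suc i)"
  and reg: "\<And>i. i < m ==> f i \<in> regular_functions n d"
  and van: "\<And>i x. i < m ==> x \<in> Z i ==> f i x = 0"
  and nv: "\<And>i. i < m ==> \<exists>x\<in>Z (Suc i). f i x \<noteq> 0"
  and c: "\<forall>x\<in>Z m. (\<Sum>l | length l = m \<and> set l \<subseteq> {..t}. c l * chain_monomial f l x) = 0"
  and l: "length l = m" "set l \<subseteq> {..t}"
 shows "c l = 0"
 using assms
proof (induction m arbitrary: c l)
 case 0
 obtain x where x: "x \<in> Z 0" using "0.prems"(1)[of 0] by (auto simp: irreducible_set_def)
 have "{l. length l = 0 \<and> set l \<subseteq> {..t}} = {[]}" by auto
 then have "c [] = 0" using bspec[OF "0.prems"(6) x] by simp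
 then show ?case using "0.prems"(7) by simp
next
 case (Suc m)
 let ?L = "{l. length l = m \<and> set l \<subseteq> {..t}}"
 have finL: "finite ?L" using finite_lists_length_eq[of "{..t}" m] by (simp add: conj_commute)
 have expand: "(\<Sum>l | length l = Suc m \<and> set l \<subseteq> {..t}. c l * chain_monomial f l x)
   = (\<Sum>j\<le>t. f m x ^ j * (\<Sum>l\<in>?L. c (j # l) * chain_monomial f l x))" for x
 proof -
  have e: "{l. length l = Suc m \<and> set l \<subseteq> {..t}} = (\<lambda>(j, l). j # l) ` ({..t} \<times> ?L)"
   by (auto simp: length_Suc_conv image_iff)
  have "(\<Sum>l | length l = Suc m \<and> set l \<subseteq> {..t}. c l * chain_monomial f l x)
    = (\<Sum>(j, l)\<in>{..t} \<times> ?L. c (j # l) * chain_monomial f (j # l) x)"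
   unfolding e by (subst sum.reindex) (auto simp: inj_on_def case_prod_unfold)
  also have "\<dots> = (\<Sum>j\<le>t. \<Sum>l\<in>?L. c (j # l) * chain_monomial f (j # l) x)"
   by (rule sum.cartesian_product[symmetric])
  also have "\<dots> = (\<Sum>j\<le>t. f m x ^ j * (\<Sum>l\<in>?L. c (j # l) * chain_monomial f l x))"
   unfolding sum_distrib_left by (intro sum.cong) (auto simp: algebra_simps)
  finally show ?thesis .
 qed
 have rfm: "f m \<in> regular_functions n d" using Suc.prems(3) by simp
 obtain tf where tf: "poly_le n d tf (f m)" using regular_poly_le[OF rfm] by blast
 \<comment> \<open>The combination is a polynomial in \<open>f m\<close>; its coefficients are shown
   to vanish one after the other, beginning with the power 0.\<close>
 have all: "j \<le> t \<longrightarrow> (\<forall>l\<in>?L. c (j # l) = 0)" for j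
 proof (induction j rule: less_induct)
  case (less j)
  show ?case
  proof (intro impI ballI)
   fix l assume jt: "j \<le> t" and l: "l \<in> ?L"
   let ?h = "\<lambda>x. \<Sum>i\<in>{j..t}. f m x ^ (i - j) * (\<Sum>l\<in>?L. c (i # l) * chain_monomial f l x)"
   have fh: "f m x ^ j * ?h x = 0" if x: "x \<in> Z (Suc m)" for x
   proof -
    have "f m x ^ j * ?h x = (\<Sum>i\<in>{j..t}. f m x ^ i * (\<Sum>l\<in>?L. c (i # l) * chain_monomial f l x))"
     unfolding sum_distrib_left[of "f m x ^ j"]
     by (intro sum.cong) (auto simp: mult.assoc[symmetric] power_add[symmetric])
    also have "\<dots> = (\<Sum>i\<le>t. f m x ^ i * (\<Sum>l\<in>?L. c (i # l) * chain_monomial f l x))"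
    proof (rule sum.mono_neutral_left)
     show "\<forall>i\<in>{..t} - {j..t}. f m x ^ i * (\<Sum>l\<in>?L. c (i # l) * chain_monomial f l x) = 0"
      using less.IH by auto
    qed auto
    also have "\<dots> = 0" using Suc.prems(6) x expand by simp
    finally show ?thesis .
   qed
   have hreg: "?h \<in> regular_functions n d"
   proof -
    have mon: "\<exists>t'. poly_le n d t' (chain_monomial f l')" if "l' \<in> ?L" for l'
     using that
    proof -
     have "\<And>k. k \<le> m ==> length l' = k ==> \<exists>t'. poly_le n d t' (chain_monomial f l')" for l'
     proof (induction l')
      case Nil
      have "chain_monomial f [] = (\<lambda>_. 1)" by (simp add: fun_eq_iff)
      then show ?case using poly_le.const by metis
     next
      case (Cons a l')
      then obtain t1 where "poly_le n d t1 (chain_monomial f l')" by fastforce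
      moreover obtain t2 where "poly_le n d t2 (f (length l'))"
       using regular_poly_le[OF Suc.prems(3)[of "length l'"]] Cons.prems by auto
      ultimately have "poly_le n d (a * t2 + t1) (\<lambda>x. f (length l') x ^ a * chain_monomial f l' x)"
       by (intro poly_le.mult poly_le_power)
      moreover have "chain_monomial f (a # l') = (\<lambda>x. f (length l') x ^ a * chain_monomial f l' x)"
       by (simp add: fun_eq_iff)
      ultimately show ?case by metis
     qed
     then show ?thesis using that by auto
    qed
    then have "\<forall>l'\<in>?L. \<exists>t'. poly_le n d t' (chain_monomial f l')" by blast
    then obtain T where T: "\<forall>l'\<in>?L. poly_le n d (T l') (chain_monomial f l')" by (rule bchoice[THEN exE])
    define T' where "T' = (\<Sum>l'\<in>?L. T l')"
    have "poly_le n d T' (chain_monomial f l')" if "l' \<in> ?L" for l'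
    proof -
     have "T l' \<le> T'" unfolding T'_def by (rule member_le_sum) (use that finL in auto)
     then show ?thesis using T that by (auto intro: poly_le_mono)
    qed
    then have "poly_le n d T' (\<lambda>x. \<Sum>l\<in>?L. c (i # l) * chain_monomial f l x)" for i
     by (intro poly_le_sum poly_le_smult) auto
    then have "poly_le n d (t * tf + T') (\<lambda>x. f m x ^ (i - j) * (\<Sum>l\<in>?L. c (i # l) * chain_monomial f l x))"
     if "i \<in> {j..t}" for i
     by (intro poly_le_mono[OF poly_le.mult[OF poly_le_power[OF tf]]]) (use that in auto)
    then have "poly_le n d (t * tf + T') ?h" by (intro poly_le_sum) auto
    then show ?thesis by (rule poly_le_regular)
   qed
   \<comment> \<open>Irreducibility cancels the factor \<open>f m x ^ j\<close>: the set lies in one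
     of the two zero sets, and not in the first.\<close>
   have "Z (Suc m) \<subseteq> {x \<in> rep n d. f m x = 0} \<union> {x \<in> rep n d. ?h x = 0}"
    using fh Suc.prems(1)[of "Suc m"] by (auto simp: irreducible_set_def)
   then have "Z (Suc m) \<subseteq> {x \<in> rep n d. f m x = 0} \<or> Z (Suc m) \<subseteq> {x \<in> rep n d. ?h x = 0}"
    using Suc.prems(1)[of "Suc m"] closedin_zero[OF rfm] closedin_zero[OF hreg]
    unfolding irreducible_set_def by blast
   then have h0: "?h x = 0" if "x \<in> Z (Suc m)" for x
    using Suc.prems(5)[of m] that by blast
   have "(\<Sum>l\<in>?L. c (j # l) * chain_monomial f l x) = 0" if x: "x \<in> Z m" for x
   proof -
    \<comment> \<open>On \<open>Z m\<close> the function \<open>f m\<close> vanishes, so only the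
      term with exponent 0 survives (\<open>0 ^ 0 = 1\<close>), and it has one function
      less.\<close>
    have "?h x = (\<Sum>i\<in>{j}. f m x ^ (i - j) * (\<Sum>l\<in>?L. c (i # l) * chain_monomial f l x))"
     by (rule sum.mono_neutral_right) (use jt Suc.prems(4)[of m x] x in auto)
    then show ?thesis using h0[of x] Suc.prems(2)[of m] x by auto
   qed
   then have *: "\<forall>x\<in>Z m. (\<Sum>l | length l = m \<and> set l \<subseteq> {..t}. c (j # l) * chain_monomial f l x) = 0"
    by blast
   show "c (j # l) = 0"
    by (rule Suc.IH[OF _ _ _ _ _ *]) (use Suc.prems l in auto)
  qed
 qed
 obtain j l' where "l = j # l'" "length l' = m" using Suc.prems(7) by (auto simp: length_Suc_conv)
 then show ?case using all[of j] Suc.prems(8) by auto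
qed

text \<open>A chain of length \<open>m\<close> yields \<open>(t + 1) ^ m\<close> independent
  monomials with exponents at most \<open>t\<close>, all of degree at most a fixed multiple of
  \<open>t\<close>. Growth of order \<open>k\<close> has room for them for every \<open>t\<close>
  only if \<open>m \<le> k\<close>.\<close>

theorem growth_chain_bound:
 assumes gr: "growth n d V k" and V: "V \<subseteq> rep n d"
  and irr: "\<And>i. i \<le> m ==> irreducible_set (zariski n d) (Z i)"
  and cl: "\<And>i. i \<le> m ==> closedin (subtopology (zariski n d) V) (Z i)"
  and less: "\<And>i. i < m ==> Z i \<subset> Z (Suc i)"
 shows "m \<le> k"
proof (rule ccontr)
 assume "\<not> m \<le> k"
 obtain C where C: "\<And>t. spanned n d V t (C * (t + 1) ^ k)" using gr unfolding growth_def by blast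
 have "\<forall>i<m. \<exists>f t. poly_le n d t f \<and> (\<forall>x\<in>Z i. f x = 0) \<and> (\<exists>x\<in>Z (Suc i). f x \<noteq> 0)"
 proof (intro allI impI)
  fix i assume i: "i < m"
  obtain A where A: "closedin (zariski n d) A" "Z i = A \<inter> V"
   using cl[of i] i by (auto simp: closedin_subtopology)
  obtain x where x: "x \<in> Z (Suc i)" "x \<notin> Z i" using less[OF i] by blast
  have "x \<in> V" using cl[of "Suc i"] i x(1) closedin_subset by fastforce
  then have "x \<notin> A" "x \<in> rep n d" using x A V by auto
  then obtain f t where "poly_le n d t f" "\<forall>y\<in>A. f y = 0" "f x \<noteq> 0"
   using closedin_separate[OF A(1)] by metis
  then show "\<exists>f t. poly_le n d t f \<and> (\<forall>x\<in>Z i. f x = 0) \<and> (\<exists>x\<in>Z (Suc i). f x \<noteq> 0)"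
   using x A by blast
 qed
 then obtain f T where f: "\<And>i. i < m ==> poly_le n d (T i) (f i)" "\<And>i x. i < m ==> x \<in> Z i ==> f i x = 0"
  "\<And>i. i < m ==> \<exists>x\<in>Z (Suc i). f i x \<noteq> 0" by metis
 define e where "e = (\<Sum>i<m. T i)"
 have Te: "T i \<le> e" if "i < m" for i unfolding e_def by (rule member_le_sum) (use that in auto)
 have fe: "poly_le n d e (f i)" if "i < m" for i
  by (rule poly_le_mono[OF f(1)[OF that] Te[OF that]])
 have bound: "(t + 1) ^ m \<le> C * (m * (e * t) + 1) ^ k" for t
 proof (rule ccontr)
  let ?L = "{l. length l = m \<and> set l \<subseteq> {..t}}"
  assume "\<not> (t + 1) ^ m \<le> C * (m * (e * t) + 1) ^ k"
  moreover have "card ?L = (t + 1) ^ m"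
   using card_lists_length_eq[of "{..t}" m] by (simp add: conj_commute)
  ultimately have "C * (m * (e * t) + 1) ^ k < card ?L" by simp
  moreover have "finite ?L" using finite_lists_length_eq[of "{..t}" m] by (simp add: conj_commute)
  moreover have "poly_le n d (m * (e * t)) (chain_monomial f l)" if "l \<in> ?L" for l
   using poly_le_chain_monomial[of l n d e f t] fe that by auto
  ultimately obtain c where c: "\<exists>l\<in>?L. c l \<noteq> 0" "\<forall>x\<in>V. (\<Sum>l\<in>?L. c l * chain_monomial f l x) = 0"
   using spanned_dependent[OF C, of ?L "m * (e * t)" "chain_monomial f"] by blast
  have "Z m \<subseteq> V" using cl[of m] closedin_subset by fastforce
  then have "\<forall>x\<in>Z m. (\<Sum>l\<in>?L. c l * chain_monomial f l x) = 0" using c(2) by blast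
  note van = this
  have "c l = 0" if l: "l \<in> ?L" for l
  proof (rule chain_monomials_independent[of m n d Z f c t l])
   show "Z i \<subseteq> Z (Suc i)" if "i < m" for i using less[OF that] by blast
   show "f i \<in> regular_functions n d" if "i < m" for i by (rule poly_le_regular[OF fe[OF that]])
  qed (use irr f(2,3) van l in blast)+
  then show False using c(1) by blast
 qed
 define D where "D = C * (m * e + 1) ^ k"
 have "(t + 1) ^ m \<le> D * (t + 1) ^ k" for t
 proof -
  have "m * (e * t) + 1 \<le> (m * e + 1) * (t + 1)" by (simp add: algebra_simps)
  then have "(m * (e * t) + 1) ^ k \<le> ((m * e + 1) * (t + 1)) ^ k" by (rule power_mono) simp
  then have "C * (m * (e * t) + 1) ^ k \<le> C * ((m * e + 1) * (t + 1)) ^ k" by (rule mult_le_mono2)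
  with bound[of t] have "(t + 1) ^ m \<le> C * ((m * e + 1) * (t + 1)) ^ k" by (rule order_trans)
  then show ?thesis unfolding D_def power_mult_distrib by (simp only: mult.assoc)
 qed
 \<comment> \<open>For \<open>m > k\<close> the inequality
   \<open>(t + 1) ^ m \<le> D * (t + 1) ^ k\<close> fails at \<open>t = D\<close>.\<close>
 from this[of D] have "(D + 1) ^ (m - k) * (D + 1) ^ k \<le> D * (D + 1) ^ k"
  using \<open>\<not> m \<le> k\<close> by (simp add: power_add[symmetric])
 then have "(D + 1) ^ (m - k) \<le> D" by simp
 moreover have "D + 1 \<le> (D + 1) ^ (m - k)" using \<open>\<not> m \<le> k\<close> by (intro self_le_power) auto
 ultimately show False by simp
qed

corollary krull_dim_le_growth:
 assumes "growth n d V k" "V \<subseteq> rep n d"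
 shows "krull_dim (zariski n d) V \<le> enat k"
 unfolding krull_dim_def
proof (rule Sup_least, clarify)
 fix m and Z :: "nat => (nat => 'a mat) set"
 assume "\<forall>i\<le>m. irreducible_set (zariski n d) (Z i) \<and> closedin (subtopology (zariski n d) V) (Z i)"
  "\<forall>i<m. Z i \<subset> Z (Suc i)"
 then have "m \<le> k" by (intro growth_chain_bound[OF assms, of m Z]) auto
 then show "enat m \<le> enat k" by simp
qed

text \<open>Monomials are counted with each exponent at most \<open>t\<close>, which gives a crude
  exponent. It serves only to bound the lengths of chains, so that a maximal one can be chosen in an
  orbit.\<close>

lemma growth_rep: "\<exists>N. growth n d (rep n d :: (nat => 'k :: field mat) set) N"
proof -
 define X where "X = (\<lambda>(i, r, s) M. M i $$ (r, s) :: 'k) `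
  {(i, r, s). i < n \<and> r < d ((i + 1) mod n) \<and> s < d i}"
 have finX: "finite X"
 proof -
  have "{(i, r, s). i < n \<and> r < d ((i + 1) mod n) \<and> s < d i}
   \<subseteq> (SIGMA i:{..<n}. {..<d ((i + 1) mod n)} \<times> {..<d i})" by auto
  then show ?thesis unfolding X_def by (intro finite_imageI) (auto intro: finite_subset)
 qed
 define mon where "mon a M = (\<Prod>xi\<in>X. xi M ^ a xi)" for a M
 define E where "E t = (X \<rightarrow>\<^sub>E {..t})" for t :: nat
 have finE: "finite (E t)" for t unfolding E_def by (rule finite_PiE) (use finX in auto)
 define Sp where "Sp t = {f. \<exists>c. f = (\<lambda>M. \<Sum>a\<in>E t. c a * mon a M)}" for t
 have Sp_add: "(\<lambda>M. f M + g M) \<in> Sp t" if fg: "f \<in> Sp t" "g \<in> Sp t" for f g t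
 proof -
  obtain c where "f = (\<lambda>M. \<Sum>a\<in>E t. c a * mon a M)"
   using fg(1) unfolding Sp_def mem_Collect_eq by blast
  moreover obtain c' where "g = (\<lambda>M. \<Sum>a\<in>E t. c' a * mon a M)"
   using fg(2) unfolding Sp_def mem_Collect_eq by blast
  ultimately have "(\<lambda>M. f M + g M) = (\<lambda>M. \<Sum>a\<in>E t. (c a + c' a) * mon a M)"
   by (simp add: distrib_right sum.distrib)
  then show ?thesis unfolding Sp_def by (intro CollectI exI)
 qed
 have Sp_smult: "(\<lambda>M. b * f M) \<in> Sp t" if fg: "f \<in> Sp t" for f b t
 proof -
  obtain c where "f = (\<lambda>M. \<Sum>a\<in>E t. c a * mon a M)" using fg by (auto simp: Sp_def)
  then have "(\<lambda>M. b * f M) = (\<lambda>M. \<Sum>a\<in>E t. (b * c a) * mon a M)"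
   by (simp add: sum_distrib_left mult.assoc)
  then show ?thesis unfolding Sp_def by (intro CollectI exI)
 qed
 have Sp_mon: "mon a \<in> Sp t" if "a \<in> E t" for a t
 proof -
  have "mon a = (\<lambda>M. \<Sum>a'\<in>E t. (if a' = a then 1 else 0) * mon a' M)"
  proof
   fix M
   have "(\<Sum>a'\<in>E t. (if a' = a then 1 else 0) * mon a' M) = (\<Sum>a'\<in>E t. if a' = a then mon a' M else 0)"
    by (rule sum.cong) auto
   then show "mon a M = (\<Sum>a'\<in>E t. (if a' = a then 1 else 0) * mon a' M)"
    using that finE by simp
  qed
  then show ?thesis unfolding Sp_def by (intro CollectI exI)
 qed
 have Sp_sum: "(\<lambda>M. \<Sum>i\<in>A. f i M) \<in> Sp t" if "finite A" "\<And>i. i \<in> A ==> f i \<in> Sp t" for A :: "((((nat => 'k mat) => 'k) => nat)) set" and f t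
  using that
 proof (induction A)
  case empty
  have "(\<lambda>M. \<Sum>i\<in>{}. f i M) = (\<lambda>M. \<Sum>a\<in>E t. 0 * mon a M)" by simp
  then show ?case unfolding Sp_def by (intro CollectI exI[of _ "\<lambda>_. 0"])
 next
  case (insert i A)
  then show ?case using Sp_add[of "f i" t "\<lambda>M. \<Sum>i\<in>A. f i M"] by simp
 qed
 have mon_mult: "(\<lambda>M. mon a M * mon b M) \<in> Sp (t + t')" if "a \<in> E t" "b \<in> E t'" for a b t t'
 proof -
  let ?e = "\<lambda>xi\<in>X. a xi + b xi"
  have "?e \<in> E (t + t')" using that by (auto simp: E_def PiE_iff intro!: add_mono)
  moreover have "(\<lambda>M. mon a M * mon b M) = mon ?e"
  proof
   fix M
   have "mon a M * mon b M = (\<Prod>xi\<in>X. xi M ^ a xi * xi M ^ b xi)" by (simp only: mon_def prod.distrib)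
   also have "\<dots> = mon ?e M" unfolding mon_def by (rule prod.cong) (simp_all add: power_add)
   finally show "mon a M * mon b M = mon ?e M" .
  qed
  ultimately show ?thesis using Sp_mon by simp
 qed
 have Sp_mult: "(\<lambda>M. f M * g M) \<in> Sp (t + t')" if fg: "f \<in> Sp t" "g \<in> Sp t'" for f g t t'
 proof -
  obtain c where f: "f = (\<lambda>M. \<Sum>a\<in>E t. c a * mon a M)"
   using fg(1) unfolding Sp_def mem_Collect_eq by blast
  obtain c' where g: "g = (\<lambda>M. \<Sum>a\<in>E t'. c' a * mon a M)"
   using fg(2) unfolding Sp_def mem_Collect_eq by blast
  have "(\<lambda>M. \<Sum>a\<in>E t. (\<lambda>M. \<Sum>b\<in>E t'. c a * c' b * (mon a M * mon b M)) M) \<in> Sp (t + t')"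
   by (intro Sp_sum finE Sp_smult mon_mult)
  moreover have "(\<lambda>M. f M * g M) = (\<lambda>M. \<Sum>a\<in>E t. \<Sum>b\<in>E t'. c a * c' b * (mon a M * mon b M))"
   unfolding f g sum_product by (intro ext sum.cong) (auto simp: algebra_simps)
  ultimately show ?thesis by simp
 qed
 have Sp_const: "(\<lambda>_. c) \<in> Sp t" for c t
 proof -
  have "(\<lambda>xi\<in>X. 0) \<in> E t" by (auto simp: E_def)
  from Sp_smult[OF Sp_mon[OF this], of c] show ?thesis
   by (simp add: mon_def cong: prod.cong)
 qed
 have all: "f \<in> Sp t" if "poly_le n d t f" for t f
  using that
 proof (induction rule: poly_le.induct)
  case (const t c)
  then show ?case by (rule Sp_const)
 next
  case (coord i r s t)
  let ?x = "\<lambda>M. M i $$ (r, s) :: 'k"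
  have xX: "?x \<in> X" unfolding X_def by (rule image_eqI[of _ _ "(i, r, s)"]) (use coord in auto)
  let ?a = "\<lambda>xi\<in>X. if xi = ?x then 1 else 0 :: nat"
  have "?a \<in> E t" using coord by (auto simp: E_def PiE_iff)
  moreover have "mon ?a = ?x"
  proof
   fix M
   have "mon ?a M = (\<Prod>xi\<in>X. if xi = ?x then xi M else 1)"
    unfolding mon_def by (rule prod.cong) auto
   also have "\<dots> = ?x M" using xX finX by simp
   finally show "mon ?a M = ?x M" .
  qed
  ultimately show ?case using Sp_mon[of ?a t] by (simp only:)
 qed (auto intro: Sp_add Sp_mult)
 have "spanned n d (rep n d :: (nat => 'k mat) set) t (1 * (t + 1) ^ card X)" for t
 proof -
  have "card (mon ` E t) \<le> (t + 1) ^ card X"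
  proof -
   have "card (E t) = (t + 1) ^ card X" unfolding E_def using finX by (simp add: card_PiE)
   then show ?thesis using card_image_le[OF finE[of t], of mon] by simp
  qed
  moreover have "\<exists>b. \<forall>x\<in>rep n d. f x = (\<Sum>m\<in>mon ` E t. b m * m x)" if pf: "poly_le n d t f" for f
  proof -
   obtain c where c: "f = (\<lambda>M. \<Sum>a\<in>E t. c a * mon a M)" using all[OF pf] by (auto simp: Sp_def)
   let ?b = "\<lambda>m. \<Sum>a | a \<in> E t \<and> mon a = m. c a"
   have "(\<Sum>m\<in>mon ` E t. ?b m * m x) = (\<Sum>m\<in>mon ` E t. \<Sum>a | a \<in> E t \<and> mon a = m. c a * mon a x)" for x
    unfolding sum_distrib_right by (intro sum.cong) auto
   also have "\<dots> x = (\<Sum>a\<in>E t. c a * mon a x)" for x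
    by (rule sum.image_gen[OF finE, symmetric])
   finally show ?thesis using c by (intro exI[of _ ?b]) simp
  qed
  ultimately show ?thesis unfolding spanned_def using finE by (intro exI[of _ "mon ` E t"]) auto
 qed
 then have "growth n d (rep n d :: (nat => 'k mat) set) (card X)" unfolding growth_def by blast
 then show ?thesis by blast
qed

section \<open>Orbits\<close>

text \<open>Over a finite field, the product of all \<open>X - a\<close> increased by 1 is a
  nonconstant polynomial without roots.\<close>

lemma infinite_UNIV_alg_closed: "infinite (UNIV :: 'k :: alg_closed_field set)"
proof
 assume fin: "finite (UNIV :: 'k set)"
 define p where "p = (\<Prod>a\<in>(UNIV :: 'k set). [:- a, 1:])"
 have "degree p = card (UNIV :: 'k set)" unfolding p_def by (subst degree_prod_sum_eq) auto
 then have "degree (p + 1) > 0"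
  using fin by (subst degree_add_eq_left) (auto simp: card_gt_0_iff)
 then obtain x where "poly (p + 1) x = 0" using alg_closed_imp_poly_has_root by blast
 moreover have "poly p x = 0" unfolding p_def poly_prod using fin by (auto simp: prod_zero_iff)
 ultimately show False by simp
qed

text \<open>
 A family \<open>Ph s\<close> of transformations whose coordinates are rational functions of the parameter
 with common denominator \<open>q\<close>, whose numerators have degree at most \<open>e\<close> and coefficients linear in
 the coordinates.
\<close>

definition poly_family where
 "poly_family n d q e Ph \<longleftrightarrow> degree (q :: 'k :: field poly) \<le> e \<and>
   (\<forall>s. poly q s \<noteq> 0 \<longrightarrow> (\<forall>M\<in>rep n d. Ph s M \<in> rep n d)) \<and>
   (\<forall>i<n. \<forall>r<d ((i + 1) mod n). \<forall>c<d i. \<exists>p. (\<forall>M. degree (p M) \<le> e)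
    \<and> (\<forall>j. poly_le n d 1 (\<lambda>M. coeff (p M) j))
    \<and> (\<forall>s. poly q s \<noteq> 0 \<longrightarrow> (\<forall>M\<in>rep n d. poly q s * Ph s M i $$ (r, c) = poly (p M) s)))"

text \<open>Multiplication by \<open>q ^ t\<close> clears the denominators of
  \<open>f (Ph s M)\<close>. What matters is that the coefficients have the same degree bound
  \<open>t\<close> in \<open>M\<close> as \<open>f\<close>, while the degree in the parameter
  \<open>s\<close> is at most \<open>t * e\<close>.\<close>

definition pulls_back where
 "pulls_back n d q e Ph t f p \<longleftrightarrow> (\<forall>M. degree (p M) \<le> t * e) \<and> (\<forall>j. poly_le n d t (\<lambda>M. coeff (p M) j))
  \<and> (\<forall>s. poly q s \<noteq> 0 \<longrightarrow> (\<forall>M\<in>rep n d. poly q s ^ t * f (Ph s M) = poly (p M) s))"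

lemma pulls_backD:
 assumes "pulls_back n d q e Ph t f p"
 shows "degree (p M) \<le> t * e" "poly_le n d t (\<lambda>M. coeff (p M) j)"
  "poly q s \<noteq> 0 ==> M \<in> rep n d ==> poly q s ^ t * f (Ph s M) = poly (p M) s"
 using assms unfolding pulls_back_def by simp_all

lemma poly_family_pullback:
 fixes q :: "'k :: field poly"
 assumes fam: "poly_family n d q e Ph" and f: "poly_le n d t f"
 shows "\<exists>p. pulls_back n d q e Ph t f p"
 using f
proof (induction rule: poly_le.induct)
 case (const t c)
 have "degree (Polynomial.smult c (q ^ t)) \<le> t * e"
  using degree_power_le[of q t] fam unfolding poly_family_def
  by (metis degree_smult_le le_trans mult.commute mult_le_mono2)
 then show ?case unfolding pulls_back_def
  by (intro exI[of _ "\<lambda>_. Polynomial.smult c (q ^ t)"]) (auto simp: poly_power intro: poly_le.const)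
next
 case (coord i r c t)
 obtain p where p: "\<And>M. degree (p M) \<le> e" "\<And>j. poly_le n d 1 (\<lambda>M. coeff (p M) j)"
  "\<And>s M. poly q s \<noteq> 0 ==> M \<in> rep n d ==> poly q s * Ph s M i $$ (r, c) = poly (p M) s"
  using fam coord unfolding poly_family_def by metis
 have dq: "degree q \<le> e" using fam by (simp add: poly_family_def)
 obtain t' where t': "t = Suc t'" using coord by (cases t) auto
 show ?case unfolding pulls_back_def
 proof (intro exI[of _ "\<lambda>M. q ^ t' * p M"] conjI allI impI ballI)
  fix M
  have "degree (q ^ t') \<le> t' * e"
   using degree_power_le[of q t'] dq by (metis le_trans mult.commute mult_le_mono2)
  then show "degree (q ^ t' * p M) \<le> t * e"
   using degree_mult_le[of "q ^ t'" "p M"] p(1)[of M] t' by simp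
 next
  fix j
  have "poly_le n d 1 (\<lambda>M. coeff (q ^ t' * p M) j)"
   unfolding coeff_mult by (intro poly_le_sum poly_le_smult p)
  then show "poly_le n d t (\<lambda>M. coeff (q ^ t' * p M) j)" using t' by (auto elim: poly_le_mono)
 next
  fix s and M :: "nat => 'k mat" assume "poly q s \<noteq> 0" "M \<in> rep n d"
  from p(3)[OF this] show "poly q s ^ t * Ph s M i $$ (r, c) = poly (q ^ t' * p M) s"
   by (simp add: t' poly_power)
 qed
next
 case (add t f g)
 then obtain p p' where "pulls_back n d q e Ph t f p" "pulls_back n d q e Ph t g p'" by blast
 note p = pulls_backD[OF this(1)] and p' = pulls_backD[OF this(2)]
 show ?case unfolding pulls_back_def
  by (intro exI[of _ "\<lambda>M. p M + p' M"])
   (auto simp: p(3) p'(3) distrib_left intro!: poly_le.add p(2) p'(2) degree_add_le p(1) p'(1))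
next
 case (mult t f t' g)
 then obtain p p' where "pulls_back n d q e Ph t f p" "pulls_back n d q e Ph t' g p'" by blast
 note p = pulls_backD[OF this(1)] and p' = pulls_backD[OF this(2)]
 show ?case unfolding pulls_back_def
 proof (intro exI[of _ "\<lambda>M. p M * p' M"] conjI allI impI ballI)
  fix M show "degree (p M * p' M) \<le> (t + t') * e"
   using degree_mult_le[of "p M" "p' M"] p(1)[of M] p'(1)[of M] by (simp add: distrib_right)
 next
  fix j show "poly_le n d (t + t') (\<lambda>M. coeff (p M * p' M) j)"
   unfolding coeff_mult by (intro poly_le_sum poly_le.mult p p')
 next
  fix s and M :: "nat => 'k mat" assume "poly q s \<noteq> 0" "M \<in> rep n d"
  from p(3)[OF this, symmetric] p'(3)[OF this, symmetric]
  show "poly q s ^ (t + t') * (f (Ph s M) * g (Ph s M)) = poly (p M * p' M) s"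
   by (simp only: poly_mult power_add mult_ac)
 qed
qed

definition sweep where
 "sweep q Ph Y = (\<Union>s\<in>{s. poly q s \<noteq> 0}. Ph s ` Y)"

lemma family_preimage_closed:
 assumes fam: "poly_family n d q e Ph" and s: "poly q s \<noteq> 0" and A: "closedin (zariski n d) A"
 shows "closedin (zariski n d) {M \<in> rep n d. Ph s M \<in> A}"
proof -
 obtain F where F: "F \<subseteq> regular_functions n d" "A = zero_locus n d F"
  using A closedin_zariski by blast
 have "\<forall>f\<in>F. \<exists>g\<in>regular_functions n d. \<forall>M\<in>rep n d. f (Ph s M) = 0 \<longleftrightarrow> g M = 0"
 proof
  fix f assume "f \<in> F"
  then obtain t where "poly_le n d t f" using F(1) regular_poly_le by blast
  from poly_family_pullback[OF fam this] obtain p where "pulls_back n d q e Ph t f p" by blast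
  note p = pulls_backD[OF this]
  have e: "poly (p M) s = (\<Sum>i\<le>t * e. s ^ i * coeff (p M) i)" for M
   using p(1)[of M] by (subst poly_as_sum_of_monoms'[of "p M" "t * e", symmetric])
    (auto simp: poly_sum poly_monom mult.commute)
  have "poly_le n d t (\<lambda>M. \<Sum>i\<le>t * e. s ^ i * coeff (p M) i)"
   by (intro poly_le_sum poly_le_smult p(2))
  then have "(\<lambda>M. poly (p M) s) \<in> regular_functions n d" unfolding e by (rule poly_le_regular)
  moreover have "f (Ph s M) = 0 \<longleftrightarrow> poly (p M) s = 0" if "M \<in> rep n d" for M
   using p(3)[OF s that, symmetric] s by simp
  ultimately show "\<exists>g\<in>regular_functions n d. \<forall>M\<in>rep n d. f (Ph s M) = 0 \<longleftrightarrow> g M = 0"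
   by (intro bexI[of _ "\<lambda>M. poly (p M) s"] ballI)
 qed
 then have "\<exists>G. \<forall>f\<in>F. G f \<in> regular_functions n d \<and> (\<forall>M\<in>rep n d. f (Ph s M) = 0 \<longleftrightarrow> G f M = 0)"
  unfolding Bex_def by (rule bchoice)
 then obtain G where G: "\<forall>f\<in>F. G f \<in> regular_functions n d \<and> (\<forall>M\<in>rep n d. f (Ph s M) = 0 \<longleftrightarrow> G f M = 0)" ..
 have "Ph s M \<in> rep n d" if "M \<in> rep n d" for M using fam s that unfolding poly_family_def by blast
 then have "{M \<in> rep n d. Ph s M \<in> A} = zero_locus n d (G ` F)"
  using G unfolding F(2) zero_locus_def by auto
 then show ?thesis unfolding closedin_zariski using G by blast
qed

text \<open>If two closed sets cover the sweep, each parameter moves the irreducible set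
  \<open>Y\<close> into one of them. A closed set that misses some point \<open>Ph s0 y0\<close>
  contains \<open>Ph s Y\<close> for finitely many \<open>s\<close> only, as these are roots of a
  nonzero polynomial; but there are infinitely many parameters.\<close>

lemma sweep_irreducible:
 fixes q :: "'k :: alg_closed_field poly"
 assumes fam: "poly_family n d q e Ph" and q: "q \<noteq> 0" and Y: "irreducible_set (zariski n d) Y"
 shows "irreducible_set (zariski n d) (sweep q Ph Y)"
proof -
 let ?S = "{s. poly q s \<noteq> 0}"
 have S: "infinite ?S"
 proof
  assume "finite ?S"
  moreover have "finite {s. poly q s = 0}" using q by (rule poly_roots_finite)
  ultimately have "finite (?S \<union> {s. poly q s = 0})" by simp
  moreover have "?S \<union> {s. poly q s = 0} = UNIV" by auto
  ultimately show False using infinite_UNIV_alg_closed[where 'k = 'k] by simp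
 qed
 have Yr: "Y \<subseteq> rep n d" "Y \<noteq> {}" using Y by (auto simp: irreducible_set_def)
 have Phr: "Ph s M \<in> rep n d" if "poly q s \<noteq> 0" "M \<in> rep n d" for s M
  using fam that unfolding poly_family_def by blast
 have fin: "finite {s \<in> ?S. Ph s ` Y \<subseteq> A}" if A: "closedin (zariski n d) A" and n: "\<not> sweep q Ph Y \<subseteq> A" for A
 proof -
  obtain s0 y0 where s0: "poly q s0 \<noteq> 0" "y0 \<in> Y" "Ph s0 y0 \<notin> A" using n by (auto simp: sweep_def)
  then have y0: "y0 \<in> rep n d" using Yr by auto
  obtain f t where f: "poly_le n d t f" "\<forall>y\<in>A. f y = 0" "f (Ph s0 y0) \<noteq> 0"
   using closedin_separate[OF A Phr[OF s0(1) y0] s0(3)] by metis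
  obtain p where "pulls_back n d q e Ph t f p" using poly_family_pullback[OF fam f(1)] by blast
  note p = pulls_backD[OF this]
  have "poly (p y0) s0 \<noteq> 0" using p(3)[OF s0(1) y0, symmetric] s0(1) f(3) by simp
  then have "p y0 \<noteq> 0" by auto
  then have "finite {s. poly (p y0) s = 0}" by (rule poly_roots_finite)
  moreover have "{s \<in> ?S. Ph s ` Y \<subseteq> A} \<subseteq> {s. poly (p y0) s = 0}"
  proof (intro subsetI CollectI)
   fix s assume "s \<in> {s \<in> ?S. Ph s ` Y \<subseteq> A}"
   then have "poly q s \<noteq> 0" "Ph s y0 \<in> A" using s0(2) by auto
   then show "poly (p y0) s = 0" using p(3)[of s y0, symmetric] y0 f(2) by simp
  qed
  ultimately show ?thesis by (rule rev_finite_subset)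
 qed
 show ?thesis unfolding irreducible_set_def
 proof (intro conjI allI impI; (elim conjE)?)
  show "sweep q Ph Y \<subseteq> topspace (zariski n d)" using Phr Yr by (auto simp: sweep_def)
  obtain s where "s \<in> ?S" using S by (metis ex_in_conv finite.emptyI)
  then show "sweep q Ph Y \<noteq> {}" using Yr by (auto simp: sweep_def)
  fix A B assume A: "closedin (zariski n d) A" and B: "closedin (zariski n d) B"
   and AB: "sweep q Ph Y \<subseteq> A \<union> B"
  have "Ph s ` Y \<subseteq> A \<or> Ph s ` Y \<subseteq> B" if s: "poly q s \<noteq> 0" for s
  proof -
   have "Y \<subseteq> {M \<in> rep n d. Ph s M \<in> A} \<union> {M \<in> rep n d. Ph s M \<in> B}"
    using AB s Yr by (auto simp: sweep_def)
   then have "Y \<subseteq> {M \<in> rep n d. Ph s M \<in> A} \<or> Y \<subseteq> {M \<in> rep n d. Ph s M \<in> B}"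
    using Y family_preimage_closed[OF fam s A] family_preimage_closed[OF fam s B]
    unfolding irreducible_set_def by blast
   then show ?thesis by auto
  qed
  then have "?S \<subseteq> {s \<in> ?S. Ph s ` Y \<subseteq> A} \<union> {s \<in> ?S. Ph s ` Y \<subseteq> B}" by blast
  then have "\<not> (finite {s \<in> ?S. Ph s ` Y \<subseteq> A} \<and> finite {s \<in> ?S. Ph s ` Y \<subseteq> B})"
   using S finite_subset by blast
  then show "sweep q Ph Y \<subseteq> A \<or> sweep q Ph Y \<subseteq> B" using fin[OF A] fin[OF B] by blast
 qed
qed

text \<open>Up to the factor \<open>q ^ t\<close>, a function of degree \<open>t\<close> on the
  sweep is a polynomial in \<open>s\<close> with at most \<open>t * e + 1\<close> coefficients, each
  of degree at most \<open>t\<close> on \<open>Y\<close>. This multiplies the Hilbert function by a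
  factor of order \<open>t\<close>.\<close>

lemma sweep_growth:
 assumes fam: "poly_family n d q e Ph" and Y: "Y \<subseteq> rep n d" and gr: "growth n d Y k"
 shows "growth n d (sweep q Ph Y) (Suc k)"
proof -
 obtain C where C: "\<And>t. spanned n d Y t (C * (t + 1) ^ k)" using gr unfolding growth_def by blast
 have "spanned n d (sweep q Ph Y) t (C * (e + 1) * (t + 1) ^ Suc k)" for t
 proof (rule spanned_of_dependent)
  let ?N = "C * (e + 1) * (t + 1) ^ Suc k"
  fix g :: "nat => (nat => 'a mat) => 'a" assume g: "\<And>i. poly_le n d t (g i)"
  obtain B where B: "finite B" "card B \<le> C * (t + 1) ^ k"
   "\<forall>f. poly_le n d t f \<longrightarrow> (\<exists>a. \<forall>x\<in>Y. f x = (\<Sum>b\<in>B. a b * b x))"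
   using C[of t] unfolding spanned_def by blast
  have "\<forall>i. \<exists>p. pulls_back n d q e Ph t (g i) p" using poly_family_pullback[OF fam g] by blast
  then obtain p where "\<forall>i. pulls_back n d q e Ph t (g i) (p i)" by (rule choice[THEN exE])
  note p = pulls_backD[OF spec[OF this]]
  have "\<forall>i j. \<exists>a. \<forall>x\<in>Y. coeff (p i x) j = (\<Sum>b\<in>B. a b * b x)" using B(3) p(2) by blast
  then obtain a where a: "\<And>i j x. x \<in> Y ==> coeff (p i x) j = (\<Sum>b\<in>B. a i j b * b x)" by metis
  have "card ({..t * e} \<times> B) < card {..?N}"
  proof -
   have "card ({..t * e} \<times> B) = (t * e + 1) * card B" by (simp add: card_cartesian_product)
   also have "\<dots> \<le> (t * e + 1) * (C * (t + 1) ^ k)" by (rule mult_le_mono2[OF B(2)])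
   also have "\<dots> \<le> ((e + 1) * (t + 1)) * (C * (t + 1) ^ k)"
    by (rule mult_le_mono1) (simp add: algebra_simps)
   finally show ?thesis by (simp add: algebra_simps)
  qed
  then obtain c where c: "\<exists>i\<in>{..?N}. c i \<noteq> 0"
   "\<forall>jb\<in>{..t * e} \<times> B. (\<Sum>i\<in>{..?N}. c i * a i (fst jb) (snd jb)) = 0"
   using homogeneous_system[of "{..t * e} \<times> B" "{..?N}" "\<lambda>i jb. a i (fst jb) (snd jb)"] B(1) by auto
  have "(\<Sum>i\<le>?N. c i * g i x) = 0" if "x \<in> sweep q Ph Y" for x
  proof -
   obtain s y where sy: "poly q s \<noteq> 0" "y \<in> Y" "x = Ph s y" using \<open>x \<in> sweep q Ph Y\<close> by (auto simp: sweep_def)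
   have yr: "y \<in> rep n d" using sy(2) Y by auto
   have pp: "poly (p i y) s = (\<Sum>j\<le>t * e. \<Sum>b\<in>B. a i j b * (b y * s ^ j))" for i
   proof -
    have "poly (p i y) s = (\<Sum>j\<le>t * e. coeff (p i y) j * s ^ j)"
     by (subst poly_as_sum_of_monoms'[OF p(1)[of i y], symmetric]) (simp add: poly_sum poly_monom)
    also have "\<dots> = (\<Sum>j\<le>t * e. \<Sum>b\<in>B. a i j b * (b y * s ^ j))"
     by (intro sum.cong refl) (simp add: a[OF sy(2)] sum_distrib_right mult.assoc)
    finally show ?thesis .
   qed
   have "poly q s ^ t * (\<Sum>i\<le>?N. c i * g i x) = (\<Sum>i\<le>?N. c i * poly (p i y) s)"
    unfolding sum_distrib_left sy(3)
    by (intro sum.cong refl) (simp add: p(3)[OF sy(1) yr, symmetric])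
   also have "\<dots> = (\<Sum>i\<le>?N. \<Sum>j\<le>t * e. \<Sum>b\<in>B. c i * a i j b * (b y * s ^ j))"
    by (simp add: pp sum_distrib_left mult.assoc)
   also have "\<dots> = (\<Sum>j\<le>t * e. \<Sum>b\<in>B. (\<Sum>i\<le>?N. c i * a i j b) * (b y * s ^ j))"
    by (subst sum.swap, rule sum.cong[OF refl], subst sum.swap) (simp add: sum_distrib_right)
   also have "\<dots> = 0"
    by (intro sum.neutral ballI) (use c(2) in auto)
   finally show ?thesis using sy(1) by simp
  qed
  then show "\<exists>c. (\<exists>i\<le>?N. c i \<noteq> 0) \<and> (\<forall>x\<in>sweep q Ph Y. (\<Sum>i\<le>?N. c i * g i x) = 0)"
   using c(1) by (intro exI[of _ c]) auto
 qed
 then show ?thesis unfolding growth_def by blast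
qed

lemma zariski_closure_vanish:
 assumes "f \<in> regular_functions n d" "\<And>y. y \<in> Y ==> f y = 0" "Y \<subseteq> rep n d" "x \<in> Abstract_Topology.closure_of (zariski n d) Y"
 shows "f x = 0"
proof -
 have "Abstract_Topology.closure_of (zariski n d) Y \<subseteq> {x \<in> rep n d. f x = 0}"
  by (rule closure_of_minimal) (use assms closedin_zero in auto)
 then show ?thesis using assms(4) by blast
qed

text \<open>A linear relation between polynomial functions that holds on \<open>Y\<close> holds on
  its closure.\<close>

lemma growth_closure:
 assumes gr: "growth n d Y k" and Y: "Y \<subseteq> rep n d"
 shows "growth n d (Abstract_Topology.closure_of (zariski n d) Y) k"
proof -
 obtain C where C: "\<And>t. spanned n d Y t (C * (t + 1) ^ k)" using gr unfolding growth_def by blast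
 have "spanned n d (Abstract_Topology.closure_of (zariski n d) Y) t (C * (t + 1) ^ k)" for t
 proof (rule spanned_of_dependent)
  fix g :: "nat => (nat => 'a mat) => 'a" assume g: "\<And>i. poly_le n d t (g i)"
  obtain c where c: "\<exists>i\<in>{..C * (t + 1) ^ k}. c i \<noteq> 0"
   "\<forall>x\<in>Y. (\<Sum>i\<in>{..C * (t + 1) ^ k}. c i * g i x) = 0"
   using spanned_dependent[OF C, of "{..C * (t + 1) ^ k}" t g] g by auto
  have "poly_le n d t (\<lambda>x. \<Sum>i\<in>{..C * (t + 1) ^ k}. c i * g i x)"
   by (intro poly_le_sum poly_le_smult g)
  from zariski_closure_vanish[OF poly_le_regular[OF this] _ Y] c(2)
  have "(\<Sum>i\<in>{..C * (t + 1) ^ k}. c i * g i x) = 0"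
   if "x \<in> Abstract_Topology.closure_of (zariski n d) Y" for x
   using that by blast
  then show "\<exists>c. (\<exists>i\<le>C * (t + 1) ^ k. c i \<noteq> 0) \<and>
   (\<forall>x\<in>Abstract_Topology.closure_of (zariski n d) Y. (\<Sum>i\<le>C * (t + 1) ^ k. c i * g i x) = 0)"
   using c(1) by (intro exI[of _ c]) auto
 qed
 then show ?thesis unfolding growth_def by blast
qed

lemma irreducible_between:
 assumes Y: "irreducible_set X Y" and "Y \<subseteq> Z" "Z \<subseteq> Abstract_Topology.closure_of X Y"
 shows "irreducible_set X Z"
 unfolding irreducible_set_def
proof (intro conjI allI impI; (elim conjE)?)
 show "Z \<subseteq> topspace X" using assms(3) closure_of_subset_topspace by (rule subset_trans)
 show "Z \<noteq> {}" using Y assms(2) by (auto simp: irreducible_set_def)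
 fix A B assume AB: "closedin X A" "closedin X B" "Z \<subseteq> A \<union> B"
 then have "Y \<subseteq> A \<or> Y \<subseteq> B" using Y assms(2) unfolding irreducible_set_def by blast
 then show "Z \<subseteq> A \<or> Z \<subseteq> B"
  using closure_of_minimal[of Y A X] closure_of_minimal[of Y B X] AB(1,2) assms(3) by blast
qed

lemma irreducible_singleton: "x \<in> topspace X ==> irreducible_set X {x}"
 by (auto simp: irreducible_set_def)

section \<open>The base change group and its action\<close>

lemma GL_iff:
 "g \<in> GL m \<longleftrightarrow> g \<in> carrier_mat m m \<and> (\<exists>h\<in>carrier_mat m m. g * h = 1\<^sub>m m \<and> h * g = 1\<^sub>m m)"
 by (auto simp: Units_def ring_mat_def)

lemma ring_mat_monoid: "Group.monoid (ring_mat TYPE('k :: field) m ())"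
proof -
 interpret ring "ring_mat TYPE('k) m ()" by (rule ring_mat)
 show ?thesis by (rule monoid_axioms)
qed

lemma GL_inv:
 assumes "(g :: 'k :: field mat) \<in> GL m"
 shows "inv\<^bsub>ring_mat TYPE('k) m ()\<^esub> g \<in> carrier_mat m m"
  "g * inv\<^bsub>ring_mat TYPE('k) m ()\<^esub> g = 1\<^sub>m m" "inv\<^bsub>ring_mat TYPE('k) m ()\<^esub> g * g = 1\<^sub>m m"
  "inv\<^bsub>ring_mat TYPE('k) m ()\<^esub> g \<in> GL m"
proof -
 interpret monoid "ring_mat TYPE('k) m ()" by (rule ring_mat_monoid)
 show "inv\<^bsub>ring_mat TYPE('k) m ()\<^esub> g \<in> GL m" using assms by simp
 show "inv\<^bsub>ring_mat TYPE('k) m ()\<^esub> g \<in> carrier_mat m m"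
  using Units_inv_closed[OF assms] by (simp add: ring_mat_simps)
 show "g * inv\<^bsub>ring_mat TYPE('k) m ()\<^esub> g = 1\<^sub>m m" "inv\<^bsub>ring_mat TYPE('k) m ()\<^esub> g * g = 1\<^sub>m m"
  using Units_r_inv[OF assms] Units_l_inv[OF assms] by (simp_all add: ring_mat_simps)
qed

lemma GL_inv_eq:
 assumes "(g :: 'k :: field mat) \<in> carrier_mat m m" "h \<in> carrier_mat m m" "g * h = 1\<^sub>m m" "h * g = 1\<^sub>m m"
 shows "inv\<^bsub>ring_mat TYPE('k) m ()\<^esub> g = h"
proof -
 interpret monoid "ring_mat TYPE('k) m ()" by (rule ring_mat_monoid)
 show ?thesis by (rule inv_unique'[symmetric]) (use assms in \<open>auto simp: ring_mat_simps\<close>)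
qed

definition rep_act :: "nat => (nat => nat) => (nat => 'k :: field mat) => (nat => 'k mat) => nat => 'k mat" where
 "rep_act n d g M = (\<lambda>i\<in>{..<n}. g ((i + 1) mod n) * M i * inv\<^bsub>ring_mat TYPE('k) (d i) ()\<^esub> (g i))"

abbreviation "GLd n d \<equiv> (\<Pi>\<^sub>E i\<in>{..<n}. GL (d i))"

lemma rep_orbit_act: "rep_orbit n d M = (\<lambda>g. rep_act n d g M) ` GLd n d"
 by (auto simp: rep_orbit_def rep_act_def)

lemma repD: "M \<in> rep n d ==> i < n ==> M i \<in> carrier_mat (d ((i + 1) mod n)) (d i)"
 by (auto simp: rep_def)

lemma GLdD: "g \<in> GLd n d ==> i < n ==> g i \<in> GL (d i)" "g \<in> GLd n d ==> i < n ==> g i \<in> carrier_mat (d i) (d i)"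
 using GL_iff by (auto simp: PiE_iff)

lemma rep_act_rep:
 assumes g: "g \<in> GLd n d" and M: "M \<in> rep n d"
 shows "rep_act n d g M \<in> rep n d"
 unfolding rep_def rep_act_def
proof (rule restrict_PiE_iff[THEN iffD2], rule ballI)
 fix i assume "i \<in> {..<n}"
 then have i: "i < n" "(i + 1) mod n < n" by auto
 show "g ((i + 1) mod n) * M i * inv\<^bsub>ring_mat TYPE('a) (d i) ()\<^esub> (g i) \<in> carrier_mat (d ((i + 1) mod n)) (d i)"
  by (rule mult_carrier_mat[OF mult_carrier_mat[OF GLdD(2)[OF g i(2)] repD[OF M i(1)]] GL_inv(1)[OF GLdD(1)[OF g i(1)]]])
qed

lemma rep_act_one:
 assumes M: "M \<in> rep n d"
 shows "rep_act n d (\<lambda>i\<in>{..<n}. 1\<^sub>m (d i)) M = M"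
proof
 fix i
 show "rep_act n d (\<lambda>i\<in>{..<n}. 1\<^sub>m (d i)) M i = M i"
 proof (cases "i < n")
  case True
  have "inv\<^bsub>ring_mat TYPE('a) (d i) ()\<^esub> (1\<^sub>m (d i) :: 'a mat) = 1\<^sub>m (d i)" by (rule GL_inv_eq) auto
  moreover have "(i + 1) mod n < n" using True by auto
  ultimately show ?thesis using True repD[OF M True] by (simp add: rep_act_def)
 next
  case False
  then show ?thesis using M by (simp add: rep_act_def rep_def PiE_iff extensional_def)
 qed
qed

lemma mat_assoc4:
 assumes A: "A \<in> carrier_mat a b" and B: "B \<in> carrier_mat b c" and C: "C \<in> carrier_mat c k"
  and D: "D \<in> carrier_mat k l"
 shows "A * (B * C) * D = A * B * (C * D)"
 unfolding assoc_mult_mat[OF A B mult_carrier_mat[OF C D]] assoc_mult_mat[OF A mult_carrier_mat[OF B C] D]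
  assoc_mult_mat[OF B C D] ..

lemma rep_act_act:
 assumes g: "g \<in> GLd n d" and h: "h \<in> GLd n d" and M: "M \<in> rep n d"
 shows "(\<lambda>i\<in>{..<n}. g i * h i) \<in> GLd n d"
  "rep_act n d g (rep_act n d h M) = rep_act n d (\<lambda>i\<in>{..<n}. g i * h i) M"
proof -
 show gh: "(\<lambda>i\<in>{..<n}. g i * h i) \<in> GLd n d"
 proof (rule restrict_PiE_iff[THEN iffD2], rule ballI)
  fix i assume "i \<in> {..<n}"
  then have i: "i < n" by simp
  interpret monoid "ring_mat TYPE('a) (d i) ()" by (rule ring_mat_monoid)
  show "g i * h i \<in> GL (d i)"
   using Units_m_closed[OF GLdD(1)[OF g i] GLdD(1)[OF h i]] by (simp add: ring_mat_simps)
 qed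
 show "rep_act n d g (rep_act n d h M) = rep_act n d (\<lambda>i\<in>{..<n}. g i * h i) M"
 proof
  fix i
  show "rep_act n d g (rep_act n d h M) i = rep_act n d (\<lambda>i\<in>{..<n}. g i * h i) M i"
  proof (cases "i < n")
   case True
   let ?j = "(i + 1) mod n"
   have j: "?j < n" using True by auto
   let ?gi = "inv\<^bsub>ring_mat TYPE('a) (d i) ()\<^esub> (g i)" and ?hi = "inv\<^bsub>ring_mat TYPE('a) (d i) ()\<^esub> (h i)"
   note c = GLdD(2)[OF g True] GLdD(2)[OF h True] GLdD(2)[OF g j] GLdD(2)[OF h j] repD[OF M True]
    GL_inv(1)[OF GLdD(1)[OF g True]] GL_inv(1)[OF GLdD(1)[OF h True]]
   note gi = GL_inv[OF GLdD(1)[OF g True]] and hi = GL_inv[OF GLdD(1)[OF h True]]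
   have inv: "inv\<^bsub>ring_mat TYPE('a) (d i) ()\<^esub> (g i * h i) = ?hi * ?gi"
   proof (rule GL_inv_eq)
    show "g i * h i * (?hi * ?gi) = 1\<^sub>m (d i)"
     unfolding mat_assoc4[OF c(1) c(2) c(7) c(6), symmetric] hi(2) using c gi(2) by simp
    show "?hi * ?gi * (g i * h i) = 1\<^sub>m (d i)"
     unfolding mat_assoc4[OF c(7) c(6) c(1) c(2), symmetric] gi(3) using c hi(3) by simp
   qed (use c in auto)
   have "g ?j * (h ?j * M i * ?hi) * ?gi = g ?j * (h ?j * M i) * (?hi * ?gi)"
    by (rule mat_assoc4[OF c(3) mult_carrier_mat[OF c(4,5)] c(7,6)])
   also have "g ?j * (h ?j * M i) = g ?j * h ?j * M i" by (rule assoc_mult_mat[OF c(3-5), symmetric])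
   finally have "g ?j * (h ?j * M i * ?hi) * ?gi = g ?j * h ?j * M i * (?hi * ?gi)" .
   then show ?thesis using True j by (simp add: rep_act_def inv)
  qed (simp add: rep_act_def)
 qed
qed

lemma rep_orbit_self: "M \<in> rep n d ==> M \<in> rep_orbit n d M"
proof -
 assume M: "M \<in> rep n d"
 have "(\<lambda>i\<in>{..<n}. 1\<^sub>m (d i)) \<in> GLd n d" by (auto simp: GL_iff)
 then have "rep_act n d (\<lambda>i\<in>{..<n}. 1\<^sub>m (d i)) M \<in> rep_orbit n d M"
  unfolding rep_orbit_act by (rule imageI)
 then show "M \<in> rep_orbit n d M" unfolding rep_act_one[OF M] .
qed

lemma rep_orbit_act_closed:
 assumes M: "M \<in> rep n d" and "x \<in> rep_orbit n d M" "g \<in> GLd n d"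
 shows "rep_act n d g x \<in> rep_orbit n d M"
proof -
 obtain h where h: "h \<in> GLd n d" "x = rep_act n d h M" using assms(2) unfolding rep_orbit_act by blast
 show ?thesis unfolding rep_orbit_act h(2) rep_act_act(2)[OF assms(3) h(1) M]
  by (rule imageI[OF rep_act_act(1)[OF assms(3) h(1) M]])
qed

lemma rep_orbit_rep: "M \<in> rep n d ==> rep_orbit n d M \<subseteq> rep n d"
 unfolding rep_orbit_act using rep_act_rep by blast

text \<open>The line through the identity and \<open>g\<close> in the product of matrix algebras.\<close>

lemma GL_line_family:
 fixes g :: "nat => 'k :: field mat"
 assumes g: "g \<in> GLd n d"
 obtains q e H where "poly_family n d q e (\<lambda>s. rep_act n d (H s))" "q \<noteq> 0"
  "\<And>s. poly q s \<noteq> 0 ==> H s \<in> GLd n d" "poly q 0 \<noteq> 0" "poly q 1 \<noteq> 0"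
  "H 0 = (\<lambda>i\<in>{..<n}. 1\<^sub>m (d i))" "H 1 = g"
proof -
 \<comment> \<open>The matrix \<open>(1 - s) 1 + s g\<close> at the vertex \<open>i\<close>, with
   polynomial entries in \<open>s\<close>. Its determinant is nonzero at 0 and 1, and its inverse is
   the adjugate divided by the determinant.\<close>
 define Hp where "Hp i = mat (d i) (d i) (\<lambda>(a, b). [:(if a = b then 1 else 0), g i $$ (a, b) - (if a = b then 1 else 0):])" for i
 have Hpc: "Hp i \<in> carrier_mat (d i) (d i)" for i by (simp add: Hp_def)
 define D where "D i = det (Hp i)" for i
 define A where "A i = adj_mat (Hp i)" for i
 have A: "A i \<in> carrier_mat (d i) (d i)" "Hp i * A i = D i \<cdot>\<^sub>m 1\<^sub>m (d i)" "A i * Hp i = D i \<cdot>\<^sub>m 1\<^sub>m (d i)" for i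
  using adj_mat[OF Hpc[of i]] by (simp_all add: A_def D_def)
 define ev where "ev s = map_mat (\<lambda>p. poly p (s :: 'k))" for s
 have evc: "ev s B \<in> carrier_mat a b" if "B \<in> carrier_mat a b" for s B a b
  using that by (simp add: ev_def)
 have ev_mult: "ev s (B * C) = ev s B * ev s C" if "B \<in> carrier_mat a b" "C \<in> carrier_mat b c" for s B C a b c
 proof -
  interpret ev: comm_ring_hom "\<lambda>p. poly p s" by unfold_locales auto
  show ?thesis unfolding ev_def by (rule ev.mat_hom_mult[OF that])
 qed
 have ev_det: "det (ev s B) = poly (det B) s" for s B
 proof -
  interpret ev: comm_ring_hom "\<lambda>p. poly p s" by unfold_locales auto
  show ?thesis unfolding ev_def by (rule ev.hom_det)
 qed
 have ev_sc: "ev s (p \<cdot>\<^sub>m 1\<^sub>m m) = poly p s \<cdot>\<^sub>m 1\<^sub>m m" for s p m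
  by (rule eq_matI) (auto simp: ev_def)
 define q where "q = (\<Prod>i<n. D i)"
 define H where "H s = (\<lambda>i\<in>{..<n}. ev s (Hp i))" for s
 have H0: "H 0 = (\<lambda>i\<in>{..<n}. 1\<^sub>m (d i))"
  unfolding H_def by (rule restrict_ext) (auto simp: ev_def Hp_def intro!: eq_matI)
 have H1: "H 1 = g"
 proof
  fix i show "H 1 i = g i"
  proof (cases "i < n")
   case True
   then show ?thesis using GLdD(2)[OF g True] by (auto simp: H_def ev_def Hp_def intro!: eq_matI)
  next
   case False
   then show ?thesis using g by (simp add: H_def PiE_iff extensional_def)
  qed
 qed
 have q0: "poly q 0 \<noteq> 0"
 proof -
  have "poly (D i) 0 = 1" if "i < n" for i
  proof -
   have "ev 0 (Hp i) = 1\<^sub>m (d i)" using fun_cong[OF H0, of i] that by (simp add: H_def)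
   then show ?thesis using ev_det[of 0 "Hp i"] by (simp add: D_def)
  qed
  then show ?thesis by (simp add: q_def poly_prod)
 qed
 have q1: "poly q 1 \<noteq> 0"
 proof -
  have "poly (D i) 1 \<noteq> 0" if i: "i < n" for i
  proof -
   have "ev 1 (Hp i) = g i" using fun_cong[OF H1, of i] i by (simp add: H_def)
   then have "poly (D i) 1 = det (g i)" using ev_det[of 1 "Hp i"] by (simp add: D_def)
   moreover have "det (g i) \<noteq> 0"
    using det_mult[OF GLdD(2)[OF g i] GL_inv(1)[OF GLdD(1)[OF g i]]] GL_inv(2)[OF GLdD(1)[OF g i]] by auto
   ultimately show ?thesis by simp
  qed
  then show ?thesis by (simp add: q_def poly_prod)
 qed
 have Dnz: "poly (D i) s \<noteq> 0" if "poly q s \<noteq> 0" "i < n" for s i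
  using that by (auto simp: q_def poly_prod)
 have inv1: "ev s (Hp i) * ((1 / poly (D i) s) \<cdot>\<^sub>m ev s (A i)) = 1\<^sub>m (d i)"
  "((1 / poly (D i) s) \<cdot>\<^sub>m ev s (A i)) * ev s (Hp i) = 1\<^sub>m (d i)"
  if "poly (D i) s \<noteq> 0" for s i
 proof -
  have E: "ev s (Hp i) \<in> carrier_mat (d i) (d i)" and G: "ev s (A i) \<in> carrier_mat (d i) (d i)"
   using evc[OF Hpc] evc[OF A(1)] by blast+
  have "ev s (Hp i) * ev s (A i) = poly (D i) s \<cdot>\<^sub>m 1\<^sub>m (d i)"
   unfolding ev_mult[OF Hpc A(1), symmetric] A(2) ev_sc ..
  then show "ev s (Hp i) * ((1 / poly (D i) s) \<cdot>\<^sub>m ev s (A i)) = 1\<^sub>m (d i)"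
   unfolding mult_smult_distrib[OF E G] using that by (auto intro!: eq_matI)
  have "ev s (A i) * ev s (Hp i) = poly (D i) s \<cdot>\<^sub>m 1\<^sub>m (d i)"
   unfolding ev_mult[OF A(1) Hpc, symmetric] A(3) ev_sc ..
  then show "((1 / poly (D i) s) \<cdot>\<^sub>m ev s (A i)) * ev s (Hp i) = 1\<^sub>m (d i)"
   unfolding mult_smult_assoc_mat[OF G E] using that by (auto intro!: eq_matI)
 qed
 have HG: "H s \<in> GLd n d" if "poly q s \<noteq> 0" for s
  unfolding H_def
 proof (rule restrict_PiE_iff[THEN iffD2], rule ballI)
  fix i assume "i \<in> {..<n}"
  then have "poly (D i) s \<noteq> 0" using Dnz[OF that] by simp
  from inv1[OF this] show "ev s (Hp i) \<in> GL (d i)"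
   unfolding GL_iff using evc[OF Hpc] evc[OF A(1)]
   by (intro conjI bexI[of _ "(1 / poly (D i) s) \<cdot>\<^sub>m ev s (A i)"]) auto
 qed
 \<comment> \<open>The coefficient of the entry \<open>(a, b)\<close> of \<open>M i\<close> in the
   entry \<open>(r, c)\<close> of the transformed matrix, after multiplication by \<open>q\<close>:
   the determinant at \<open>i\<close> cancels the denominator of the inverse, and the determinants
   at the other vertices remain.\<close>
 define R where "R i r c a b = (\<Prod>j\<in>{..<n} - {i}. D j) * Hp ((i + 1) mod n) $$ (r, a) * A i $$ (b, c)" for i r c a b
 define e where "e = degree q + (\<Sum>i<n. \<Sum>r<d ((i + 1) mod n). \<Sum>c<d i. \<Sum>a<d ((i + 1) mod n). \<Sum>b<d i. degree (R i r c a b))"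
 have Re: "degree (R i r c a b) \<le> e" if "i < n" "r < d ((i + 1) mod n)" "c < d i" "a < d ((i + 1) mod n)" "b < d i" for i r c a b
 proof -
  have "degree (R i r c a b) \<le> (\<Sum>b<d i. degree (R i r c a b))"
   by (rule member_le_sum[of b]) (use that in auto)
  also have "\<dots> \<le> (\<Sum>a<d ((i + 1) mod n). \<Sum>b<d i. degree (R i r c a b))"
   by (rule member_le_sum[of a]) (use that in auto)
  also have "\<dots> \<le> (\<Sum>c<d i. \<Sum>a<d ((i + 1) mod n). \<Sum>b<d i. degree (R i r c a b))"
   by (rule member_le_sum[of c]) (use that in auto)
  also have "\<dots> \<le> (\<Sum>r<d ((i + 1) mod n). \<Sum>c<d i. \<Sum>a<d ((i + 1) mod n). \<Sum>b<d i. degree (R i r c a b))"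
   by (rule member_le_sum[of r]) (use that in auto)
  also have "\<dots> \<le> (\<Sum>i<n. \<Sum>r<d ((i + 1) mod n). \<Sum>c<d i. \<Sum>a<d ((i + 1) mod n). \<Sum>b<d i. degree (R i r c a b))"
   by (rule member_le_sum[of i]) (use that in auto)
  finally show ?thesis by (simp add: e_def)
 qed
 have "poly_family n d q e (\<lambda>s. rep_act n d (H s))"
  unfolding poly_family_def
 proof (intro conjI allI impI ballI)
  show "degree q \<le> e" by (simp add: e_def)
  show "rep_act n d (H s) M \<in> rep n d" if "poly q s \<noteq> 0" "M \<in> rep n d" for s and M :: "nat => 'k mat"
   by (rule rep_act_rep[OF HG[OF that(1)] that(2)])
  fix i r c assume i: "i < n" and r: "r < d ((i + 1) mod n)" and c: "c < d i"
  let ?j = "(i + 1) mod n"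
  have j: "?j < n" using i by auto
  let ?p = "\<lambda>M. \<Sum>a<d ?j. \<Sum>b<d i. Polynomial.smult (M i $$ (a, b)) (R i r c a b)"
  show "\<exists>p. (\<forall>M. degree (p M) \<le> e) \<and> (\<forall>j. poly_le n d 1 (\<lambda>M. coeff (p M) j))
    \<and> (\<forall>s. poly q s \<noteq> 0 \<longrightarrow> (\<forall>M\<in>rep n d. poly q s * rep_act n d (H s) M i $$ (r, c) = poly (p M) s))"
  proof (intro exI[of _ ?p] conjI allI impI ballI)
   fix M :: "nat => 'k mat" show "degree (?p M) \<le> e"
    by (intro degree_sum_le finite_lessThan order_trans[OF degree_smult_le Re]) (use i r c in auto)
  next
   fix k
   have "poly_le n d 1 (\<lambda>M. \<Sum>a<d ?j. \<Sum>b<d i. coeff (R i r c a b) k * M i $$ (a, b))"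
    by (intro poly_le_sum poly_le_smult poly_le.coord) (use i in auto)
   then show "poly_le n d 1 (\<lambda>M. coeff (?p M) k)"
    by (simp add: coeff_sum mult.commute)
  next
   fix s and M :: "nat => 'k mat" assume s: "poly q s \<noteq> 0" and M: "M \<in> rep n d"
   note Mi = repD[OF M i]
   have inv: "inv\<^bsub>ring_mat TYPE('k) (d i) ()\<^esub> (H s i) = (1 / poly (D i) s) \<cdot>\<^sub>m ev s (A i)"
    using GL_inv_eq[OF _ _ inv1[OF Dnz[OF s i]]] evc[OF Hpc] evc[OF A(1)] i by (simp add: H_def)
   have "rep_act n d (H s) M i = ev s (Hp ?j) * M i * ((1 / poly (D i) s) \<cdot>\<^sub>m ev s (A i))"
    using i j inv by (simp add: rep_act_def H_def)
   also have "\<dots> = ev s (Hp ?j) * (M i * ((1 / poly (D i) s) \<cdot>\<^sub>m ev s (A i)))"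
   proof (rule assoc_mult_mat[OF evc[OF Hpc] Mi])
    show "(1 / poly (D i) s) \<cdot>\<^sub>m ev s (A i) \<in> carrier_mat (d i) (d i)" using evc[OF A(1)] by simp
   qed
   finally have e: "rep_act n d (H s) M i $$ (r, c)
    = (\<Sum>a<d ?j. poly (Hp ?j $$ (r, a)) s * (\<Sum>b<d i. M i $$ (a, b) * (1 / poly (D i) s * poly (A i $$ (b, c)) s)))"
    using Hpc[of ?j] A(1)[of i] Mi r c
    by (simp add: scalar_prod_def ev_def atLeast0LessThan)
   have qq: "poly q s = poly (\<Prod>j\<in>{..<n} - {i}. D j) s * poly (D i) s"
    using i by (simp add: q_def prod.remove[of _ i] mult.commute)
   show "poly q s * rep_act n d (H s) M i $$ (r, c) = poly (?p M) s"
    unfolding e poly_sum poly_smult sum_distrib_left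
    by (intro sum.cong refl) (use Dnz[OF s i] in \<open>simp add: R_def qq\<close>)
  qed
 qed
 moreover have "q \<noteq> 0" using q0 by auto
 ultimately show ?thesis using that HG q0 q1 H0 H1 by blast
qed

text \<open>A \<open>good\<close> set \<open>Y\<close> in the orbit has growth exponent
  \<open>k\<close> and at the same time a chain of length \<open>k\<close> that ends at the trace of
  its closure on the orbit. Chain lengths are bounded, so a good set with maximal \<open>k\<close>
  exists; it turns out to be dense in the orbit, and then \<open>k\<close> bounds the growth of the
  closure from above and the dimension of the orbit from below.\<close>

theorem orbit_closure_growth:
 fixes M :: "nat => 'k :: alg_closed_field mat"
 assumes M: "M \<in> rep n d"
 defines "O' \<equiv> rep_orbit n d M" and "cl \<equiv> Abstract_Topology.closure_of (zariski n d)"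
 shows "irreducible_set (zariski n d) O'"
  and "\<exists>k. growth n d (cl O') k \<and> enat k \<le> krull_dim (zariski n d) O'"
proof -
 let ?X = "zariski n d"
 define good where "good k Y \<longleftrightarrow> Y \<subseteq> O' \<and> M \<in> Y \<and> irreducible_set ?X Y \<and> growth n d Y k \<and>
  (\<exists>Z. (\<forall>i\<le>k. irreducible_set ?X (Z i) \<and> closedin (subtopology ?X O') (Z i)) \<and>
    (\<forall>i<k. Z i \<subset> Z (Suc i)) \<and> Z k = O' \<inter> cl Y)" for k Y
 have Or: "O' \<subseteq> rep n d" unfolding O'_def by (rule rep_orbit_rep[OF M])
 have MO: "M \<in> O'" unfolding O'_def by (rule rep_orbit_self[OF M])
 have clc: "closedin (subtopology ?X O') (O' \<inter> cl Y)" for Y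
  unfolding closedin_subtopology cl_def using closedin_closure_of by blast
 have sub_cl: "Y \<subseteq> cl Y" if "Y \<subseteq> O'" for Y
  unfolding cl_def by (rule closure_of_subset) (use that Or in auto)
 have irr_cl: "irreducible_set ?X (O' \<inter> cl Y)" if "irreducible_set ?X Y" "Y \<subseteq> O'" for Y
  by (rule irreducible_between[OF that(1)]) (use sub_cl[OF that(2)] that(2) in \<open>auto simp: cl_def\<close>)
 have good0: "good 0 {M}"
 proof -
  have irr: "irreducible_set ?X {M}" by (rule irreducible_singleton) (simp add: M)
  have "spanned n d {M} t (1 * (t + 1) ^ 0)" for t
   unfolding spanned_def
   by (rule exI[of _ "{\<lambda>_. 1}"]) auto
  then have "growth n d {M} 0" unfolding growth_def by blast
  then show ?thesis unfolding good_def
   using MO irr irr_cl[OF irr] clc by (intro conjI exI[of _ "\<lambda>_. O' \<inter> cl {M}"]) auto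
 qed
 obtain N where N: "growth n d (rep n d :: (nat => 'k mat) set) N" using growth_rep by blast
 have grow_sub: "growth n d S' k" if "growth n d S k" "S' \<subseteq> S" for S S' :: "(nat => 'k mat) set" and k
  using that unfolding growth_def spanned_def by (meson subsetD)
 have bound: "k \<le> N" if gk: "good k Y" for k Y
 proof -
  obtain Z where "\<forall>i\<le>k. irreducible_set ?X (Z i) \<and> closedin (subtopology ?X O') (Z i)"
    "\<forall>i<k. Z i \<subset> Z (Suc i)" using gk unfolding good_def by blast
  then show ?thesis by (intro growth_chain_bound[OF grow_sub[OF N Or] Or, of k Z]) auto
 qed
 define k where "k = (GREATEST k. \<exists>Y. good k Y)"
 have "\<exists>Y. good k Y" unfolding k_def
  by (rule GreatestI_nat[of _ 0 N]) (use good0 bound in blast)+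
 then obtain Y where Y: "good k Y" by blast
 have max: "\<not> good (Suc k) Y'" for Y'
 proof
  assume "good (Suc k) Y'"
  then have "Suc k \<le> k" unfolding k_def
   by (intro Greatest_le_nat[of "\<lambda>k. \<exists>Y. good k Y" _ N]) (use bound in blast)+
  then show False by simp
 qed
 obtain Z where Z: "\<forall>i\<le>k. irreducible_set ?X (Z i) \<and> closedin (subtopology ?X O') (Z i)"
  "\<forall>i<k. Z i \<subset> Z (Suc i)" "Z k = O' \<inter> cl Y" using Y unfolding good_def by blast
 have YO: "Y \<subseteq> O'" "M \<in> Y" "irreducible_set ?X Y" "growth n d Y k" using Y by (auto simp: good_def)
 \<comment> \<open>If a translate of \<open>M\<close> lies outside the closure of \<open>Y\<close>,
   sweeping along the line from 1 to \<open>g\<close> retains \<open>Y\<close> (parameter 0),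
   reaches the translate (parameter 1), and raises the growth exponent and the length of the chain
   by one, against maximality.\<close>
 have stable: "rep_act n d g M \<in> cl Y" if g: "g \<in> GLd n d" for g
 proof (rule ccontr)
  assume nin: "rep_act n d g M \<notin> cl Y"
  obtain q e H where H: "poly_family n d q e (\<lambda>s. rep_act n d (H s))" "q \<noteq> 0"
   "\<And>s. poly q s \<noteq> 0 ==> H s \<in> GLd n d" "poly q 0 \<noteq> 0" "poly q 1 \<noteq> 0"
   "H 0 = (\<lambda>i\<in>{..<n}. 1\<^sub>m (d i))" "H 1 = g"
   using GL_line_family[OF g] by blast
  let ?Y = "sweep q (\<lambda>s. rep_act n d (H s)) Y"
  have YO': "?Y \<subseteq> O'"
   using rep_orbit_act_closed[OF M _ H(3)] YO(1) unfolding sweep_def O'_def by blast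
  have YY: "Y \<subseteq> ?Y"
  proof
   fix y assume y: "y \<in> Y"
   then have "rep_act n d (H 0) y = y" using rep_act_one[of y n d] YO(1) Or H(6) by auto
   then show "y \<in> ?Y" using H(4) y unfolding sweep_def by (intro UN_I[of 0] image_eqI[of _ _ y]) auto
  qed
  have gin: "rep_act n d g M \<in> ?Y"
   using H(5,7) YO(2) unfolding sweep_def by (intro UN_I[of 1] image_eqI[of _ _ M]) auto
  have irr: "irreducible_set ?X ?Y" by (rule sweep_irreducible[OF H(1,2) YO(3)])
  have gr: "growth n d ?Y (Suc k)" by (rule sweep_growth[OF H(1) _ YO(4)]) (use YO(1) Or in blast)
  have "cl Y \<subseteq> cl ?Y" unfolding cl_def by (rule closure_of_mono[OF YY])
  then have "Z k \<subset> O' \<inter> cl ?Y" using Z(3) nin gin sub_cl[OF YO'] YO' by blast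
  then have "good (Suc k) ?Y"
   unfolding good_def
   using YO' YY YO(2) irr gr Z irr_cl[OF irr YO'] clc[of ?Y]
   by (intro conjI exI[of _ "Z(Suc k := O' \<inter> cl ?Y)"]) (auto simp: less_Suc_eq le_Suc_eq)
  then show False using max by blast
 qed
 then have OY: "O' \<subseteq> cl Y" unfolding O'_def rep_orbit_act by blast
 show "irreducible_set ?X O'"
  by (rule irreducible_between[OF YO(3,1)]) (use OY in \<open>simp add: cl_def\<close>)
 have "cl O' \<subseteq> cl Y"
  unfolding cl_def by (rule closure_of_minimal) (use OY in \<open>auto simp: cl_def\<close>)
 moreover have "growth n d (cl Y) k"
  unfolding cl_def by (rule growth_closure[OF YO(4)]) (use YO(1) Or in blast)
 ultimately have "growth n d (cl O') k" using grow_sub by blast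
 moreover have "enat k \<le> krull_dim ?X O'"
  unfolding krull_dim_def by (rule Sup_upper) (use Z in blast)
 ultimately show "\<exists>k. growth n d (cl O') k \<and> enat k \<le> krull_dim ?X O'" by blast
qed

text \<open>The common exponent \<open>k\<close> bounds the first dimension from above and the
  second from below. Truncated subtraction of extended naturals turns the inequality into the value
  0; finiteness of the first dimension matters here.\<close>

corollary orbit_closure_dim:
 fixes M :: "nat => 'k :: alg_closed_field mat"
 assumes M: "M \<in> rep n d" and V: "V \<subseteq> Abstract_Topology.closure_of (zariski n d) (rep_orbit n d M)"
 shows "krull_dim (zariski n d) V - krull_dim (zariski n d) (rep_orbit n d M) = 0"
proof -
 obtain k where k: "growth n d (Abstract_Topology.closure_of (zariski n d) (rep_orbit n d M)) k"
  "enat k \<le> krull_dim (zariski n d) (rep_orbit n d M)"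
  using orbit_closure_growth(2)[OF M] by blast
 have "growth n d V k" using k(1) V unfolding growth_def spanned_def by (meson subsetD)
 moreover have "V \<subseteq> rep n d" using V closure_of_subset_topspace[of "zariski n d"] by auto
 ultimately have "krull_dim (zariski n d) V \<le> enat k" by (rule krull_dim_le_growth)
 then obtain a where a: "krull_dim (zariski n d) V = enat a" "a \<le> k"
  by (cases "krull_dim (zariski n d) V") auto
 then show ?thesis using k(2)
  by (cases "krull_dim (zariski n d) (rep_orbit n d M)") (auto simp: zero_enat_def)
qed

section \<open>Path algebras of oriented cycles and their quotients\<close>

lemma path_algebra_simps [simp]:
 "zero (path_algebra n) = (\<lambda>_. 0)" "add (path_algebra n) x y = (\<lambda>p. x p + y p)"
 "smult (path_algebra n) a x = (\<lambda>p. a * x p)"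
 "one (path_algebra n) = (\<lambda>(i, l). if i < n \<and> l = 0 then 1 else 0)"
 by (simp_all add: path_algebra_def)

lemma path_algebra_mult:
 "mult (path_algebra n) x y (i, l) = (\<Sum>k\<le>l. x ((i + k) mod n, l - k) * y (i, k))"
 by (simp add: path_algebra_def)

lemma path_carrier_iff:
 "x \<in> carrier (path_algebra n) \<longleftrightarrow> finite {p. x p \<noteq> 0} \<and> {p. x p \<noteq> 0} \<subseteq> paths n"
 by (simp add: path_algebra_def)

lemma path_supp: "x \<in> carrier (path_algebra n) ==> x (i, l) \<noteq> 0 ==> i < n"
 by (force simp: path_carrier_iff paths_def)

lemma path_elt_carrier: "p \<in> paths n ==> path_elt p \<in> carrier (path_algebra n)"
proof -
 assume "p \<in> paths n"
 moreover have "{q. path_elt p q \<noteq> (0 :: 'a)} = {p}" by (auto simp: path_elt_def)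
 ultimately show ?thesis by (simp add: path_carrier_iff)
qed

lemma path_induct [consumes 1, case_names zero step]:
 fixes x :: "nat \<times> nat => 'k :: field"
 assumes x: "x \<in> carrier (path_algebra n)"
  and zero: "P (\<lambda>_. 0)"
  and step: "\<And>p a x. p \<in> paths n ==> a \<noteq> 0 ==> x p = 0 ==> x \<in> carrier (path_algebra n) ==> P x ==>
   P (\<lambda>q. a * path_elt p q + x q)"
 shows "P x"
proof -
 have "\<forall>x. {p. x p \<noteq> 0} = S \<longrightarrow> S \<subseteq> paths n \<longrightarrow> P x" if "finite S" for S
  using that
 proof (induction S)
  case empty
  have "x = (\<lambda>_. 0)" if "{p. x p \<noteq> 0} = {}" for x :: "nat \<times> nat => 'k" using that by auto
  then show ?case using zero by blast
 next
  case (insert p S)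
  show ?case
  proof (intro allI impI)
   fix x :: "nat \<times> nat => 'k" assume e: "{p. x p \<noteq> 0} = insert p S" and s: "insert p S \<subseteq> paths n"
   let ?y = "x(p := 0)"
   have y: "{p. ?y p \<noteq> 0} = S" using e insert.hyps(2) by auto
   then have a1: "P ?y" using insert.IH s by blast
   have a2: "?y \<in> carrier (path_algebra n)"
    unfolding path_carrier_iff y using insert.hyps(1) s by auto
   have a3: "x p \<noteq> 0" using e by auto
   have "P (\<lambda>q. x p * path_elt p q + ?y q)" by (rule step[OF _ a3 _ a2 a1]) (use s in auto)
   moreover have "(\<lambda>q. x p * path_elt p q + ?y q) = x" by (auto simp: path_elt_def)
   ultimately show "P x" by simp
  qed
 qed
 then show ?thesis using x unfolding path_carrier_iff by blast
qed

lemma path_mult_linear: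
 "mult (path_algebra n) (\<lambda>q. a * x q + y q) z = (\<lambda>q. a * mult (path_algebra n) x z q + mult (path_algebra n) y z q)"
 "mult (path_algebra n) z (\<lambda>q. a * x q + y q) = (\<lambda>q. a * mult (path_algebra n) z x q + mult (path_algebra n) z y q)"
 by (auto simp: path_algebra_mult sum.distrib sum_distrib_left algebra_simps fun_eq_iff)

lemma path_mult_zero [simp]:
 "mult (path_algebra n) (\<lambda>_. 0) z = (\<lambda>_. 0)" "mult (path_algebra n) z (\<lambda>_. 0) = (\<lambda>_. 0)"
 by (auto simp: path_algebra_mult fun_eq_iff)

lemma path_elt_mult:
 "mult (path_algebra n) (path_elt (a, l)) (path_elt (i, k)) =
  (if a = (i + k) mod n then path_elt (i, l + k) else (\<lambda>_. 0 :: 'k :: field))"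
proof
 fix q :: "nat \<times> nat" obtain j L where q: "q = (j, L)" by fastforce
 have "mult (path_algebra n) (path_elt (a, l)) (path_elt (i, k)) (j, L)
  = (\<Sum>k'\<le>L. if k' = k then (if a = (i + k) mod n \<and> j = i \<and> L - k = l then 1 else 0) else (0 :: 'k))"
  unfolding path_algebra_mult by (rule sum.cong) (auto simp: path_elt_def)
 also have "\<dots> = (if a = (i + k) mod n then path_elt (i, l + k) else (\<lambda>_. 0)) (j, L)"
  by (auto simp: path_elt_def)
 finally show "mult (path_algebra n) (path_elt (a, l)) (path_elt (i, k)) q
   = (if a = (i + k) mod n then path_elt (i, l + k) else (\<lambda>_. 0 :: 'k)) q" by (simp add: q)
qed

lemma path_mult_closed:
 assumes n: "0 < n" and x: "x \<in> carrier (path_algebra n)" and y: "y \<in> carrier (path_algebra n)"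
 shows "mult (path_algebra n) x y \<in> carrier (path_algebra n)"
proof -
 let ?f = "\<lambda>(p, q). (fst q, snd p + snd q)"
 have "{p. mult (path_algebra n) x y p \<noteq> 0} \<subseteq> ?f ` ({p. x p \<noteq> 0} \<times> {p. y p \<noteq> 0})"
 proof
  fix q assume "q \<in> {p. mult (path_algebra n) x y p \<noteq> 0}"
  moreover obtain i l where q: "q = (i, l)" by fastforce
  ultimately have "(\<Sum>k\<le>l. x ((i + k) mod n, l - k) * y (i, k)) \<noteq> 0" by (simp add: path_algebra_mult)
  then obtain k where "k \<le> l" "x ((i + k) mod n, l - k) * y (i, k) \<noteq> 0" by (meson atMost_iff sum.neutral)
  then show "q \<in> ?f ` ({p. x p \<noteq> 0} \<times> {p. y p \<noteq> 0})"
   unfolding q by (intro image_eqI[of _ _ "(((i + k) mod n, l - k), (i, k))"]) auto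
 qed
 moreover have "?f ` ({p. x p \<noteq> 0} \<times> {p. y p \<noteq> 0}) \<subseteq> paths n"
  using y by (auto simp: path_carrier_iff paths_def)
 moreover have "finite (?f ` ({p. x p \<noteq> 0} \<times> {p. y p \<noteq> 0}))"
  using x y by (auto simp: path_carrier_iff)
 ultimately show ?thesis unfolding path_carrier_iff by (meson finite_subset subset_trans)
qed

lemma path_lin_closed:
 "x \<in> carrier (path_algebra n) ==> y \<in> carrier (path_algebra n) ==> (\<lambda>q. a * x q + y q) \<in> carrier (path_algebra n)"
proof -
 assume "x \<in> carrier (path_algebra n)" "y \<in> carrier (path_algebra n)"
 moreover have "{q. a * x q + y q \<noteq> 0} \<subseteq> {q. x q \<noteq> 0} \<union> {q. y q \<noteq> 0}" by auto
 ultimately show ?thesis unfolding path_carrier_iff by (meson finite_Un finite_subset le_sup_iff subset_trans)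
qed

text \<open>By linearity in each argument only three paths have to be multiplied, and there
  associativity is addition of lengths and of vertices modulo \<open>n\<close>.\<close>

lemma path_mult_assoc:
 fixes x y z :: "nat \<times> nat => 'k :: field"
 assumes n: "0 < n" and x: "x \<in> carrier (path_algebra n)" and y: "y \<in> carrier (path_algebra n)"
  and z: "z \<in> carrier (path_algebra n)"
 shows "mult (path_algebra n) (mult (path_algebra n) x y) z = mult (path_algebra n) x (mult (path_algebra n) y z)"
 using x
proof (induction rule: path_induct)
 case (step p a x)
 have "mult (path_algebra n) (mult (path_algebra n) (path_elt p) y) z
   = mult (path_algebra n) (path_elt p) (mult (path_algebra n) y z)"
  using y
 proof (induction rule: path_induct)
  case (step p' a y)
  have "mult (path_algebra n) (mult (path_algebra n) (path_elt p) (path_elt p')) z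
   = mult (path_algebra n) (path_elt p) (mult (path_algebra n) (path_elt p') z)"
   using z
  proof (induction rule: path_induct)
   case (step p'' a z)
   obtain i l i' l' i'' l'' where p: "p = (i, l)" "p' = (i', l')" "p'' = (i'', l'')" by fastforce
   have "mult (path_algebra n) (mult (path_algebra n) (path_elt p) (path_elt p')) (path_elt p'' :: nat \<times> nat => 'k)
    = mult (path_algebra n) (path_elt p) (mult (path_algebra n) (path_elt p') (path_elt p''))"
    unfolding p path_elt_mult by (auto simp: path_elt_mult mod_simps add_ac)
   then show ?case by (simp only: path_mult_linear step.IH)
  qed simp
  then show ?case by (simp only: path_mult_linear step.IH)
 qed simp
 then show ?case by (simp only: path_mult_linear step.IH)
qed simp

lemma path_one_carrier: "(\<lambda>(i, l). if i < n \<and> l = 0 then 1 else 0) \<in> carrier (path_algebra n)"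
proof -
 have e: "{p. ((case p of (i, l) => if i < n \<and> l = 0 then 1 else 0) :: 'a) \<noteq> 0} = {..<n} \<times> {0}"
  by (auto split: if_splits)
 show ?thesis unfolding path_carrier_iff e paths_def by auto
qed

lemma path_mult_one:
 assumes n: "0 < n" and x: "x \<in> carrier (path_algebra n)"
 shows "mult (path_algebra n) (\<lambda>(i, l). if i < n \<and> l = 0 then 1 else 0) x = x"
  "mult (path_algebra n) x (\<lambda>(i, l). if i < n \<and> l = 0 then 1 else 0) = x"
proof -
 show "mult (path_algebra n) (\<lambda>(i, l). if i < n \<and> l = 0 then 1 else 0) x = x"
 proof
  fix q :: "nat \<times> nat" obtain i l where q: "q = (i, l)" by fastforce
  have "(\<Sum>k\<le>l. (if (i + k) mod n < n \<and> l - k = 0 then 1 else 0) * x (i, k))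
   = (\<Sum>k\<le>l. if k = l then x (i, k) else 0)" by (rule sum.cong) (use n in auto)
  then show "mult (path_algebra n) (\<lambda>(i, l). if i < n \<and> l = 0 then 1 else 0) x q = x q"
   by (simp add: q path_algebra_mult)
 qed
 show "mult (path_algebra n) x (\<lambda>(i, l). if i < n \<and> l = 0 then 1 else 0) = x"
 proof
  fix q :: "nat \<times> nat" obtain i l where q: "q = (i, l)" by fastforce
  have z: "x (i, l) = 0" if "\<not> i < n" for l
   using x that by (force simp: path_carrier_iff paths_def)
  have "(\<Sum>k\<le>l. x ((i + k) mod n, l - k) * (if i < n \<and> k = 0 then 1 else 0))
   = (\<Sum>k\<le>l. if k = 0 then (if i < n then x (i mod n, l) else 0) else 0)" by (rule sum.cong) auto
  then show "mult (path_algebra n) x (\<lambda>(i, l). if i < n \<and> l = 0 then 1 else 0) q = x q"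
   using z by (simp add: q path_algebra_mult)
 qed
qed

lemma path_ring:
 assumes n: "0 < n"
 shows "ring (path_algebra n :: ('k :: field, _) module)"
proof (rule ringI)
 let ?B = "path_algebra n :: ('k, _) module"
 have add: "(\<lambda>q. x q + y q) \<in> carrier ?B" if "x \<in> carrier ?B" "y \<in> carrier ?B" for x y
  using path_lin_closed[OF that, of 1] by simp
 have z: "(\<lambda>_. 0) \<in> carrier ?B" by (simp add: path_carrier_iff)
 show "abelian_group ?B"
 proof (rule abelian_groupI)
  fix x assume x: "x \<in> carrier ?B"
  show "\<exists>y\<in>carrier ?B. y +[?B] x = \<zero>\<^bsub>?B\<^esub>"
   by (rule bexI[of _ "\<lambda>q. - x q"]) (use x in \<open>auto simp: path_carrier_iff\<close>)
 qed (auto simp: add add_ac z)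
 show "Group.monoid ?B"
  by (rule monoidI) (auto simp: path_mult_closed n path_mult_assoc path_mult_one path_one_carrier)
 fix x y z assume "x \<in> carrier ?B" "y \<in> carrier ?B" "z \<in> carrier ?B"
 show "(x +[?B] y) \<otimes>\<^bsub>?B\<^esub> z = x \<otimes>\<^bsub>?B\<^esub> z +[?B] y \<otimes>\<^bsub>?B\<^esub> z"
  using path_mult_linear(1)[of n 1 x y z] by simp
 show "z \<otimes>\<^bsub>?B\<^esub> (x +[?B] y) = z \<otimes>\<^bsub>?B\<^esub> x +[?B] z \<otimes>\<^bsub>?B\<^esub> y"
  using path_mult_linear(2)[of n z 1 x y] by simp
qed

lemma path_scalar_mult:
 assumes n: "0 < n" and x: "x \<in> carrier (path_algebra n)"
 shows "mult (path_algebra n) (scalar (path_algebra n) a) x = (\<lambda>q. a * x q)"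
  "mult (path_algebra n) x (scalar (path_algebra n) a) = (\<lambda>q. a * x q)"
 using path_mult_linear(1)[of n a "\<lambda>(i, l). if i < n \<and> l = 0 then 1 else 0" "\<lambda>_. 0" x]
  path_mult_linear(2)[of n x a "\<lambda>(i, l). if i < n \<and> l = 0 then 1 else 0" "\<lambda>_. 0"]
  path_mult_one[OF n x] by simp_all

lemma path_scalar_carrier: "scalar (path_algebra n) a \<in> carrier (path_algebra n)"
 using path_lin_closed[OF path_one_carrier, of "\<lambda>_. 0" n a] by (simp add: path_carrier_iff)

section \<open>Ideals generated by paths and their Kupisch series\<close>

definition long_ideal :: "nat => (nat => nat) => (nat \<times> nat => 'k :: field) set" where
 "long_ideal n c = {x \<in> carrier (path_algebra n). \<forall>i l. x (i, l) \<noteq> 0 \<longrightarrow> c i \<le> l}"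

lemma long_ideal_carrier: "x \<in> long_ideal n c ==> x \<in> carrier (path_algebra n)"
 by (simp add: long_ideal_def)

lemma long_idealD: "x \<in> long_ideal n c ==> x (i, l) \<noteq> 0 ==> c i \<le> l"
 by (simp add: long_ideal_def)

lemma path_elt_long_ideal: "i < n ==> path_elt (i, l) \<in> long_ideal n c \<longleftrightarrow> c i \<le> l"
 using path_elt_carrier[of "(i, l)" n] by (auto simp: long_ideal_def path_elt_def paths_def)

lemma long_ideal_cong: "(\<And>i. i < n ==> c i = c' i) ==> long_ideal n c = long_ideal n c'"
 unfolding long_ideal_def path_carrier_iff paths_def by fastforce

lemma long_ideal_inj:
 assumes "(long_ideal n c :: (nat \<times> nat => 'k :: field) set) = long_ideal n c'" "i < n"
 shows "c i = c' i"
 using path_elt_long_ideal[of i n _ c, where 'a = 'k] path_elt_long_ideal[of i n _ c', where 'a = 'k] assms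
 by (metis dual_order.eq_iff)

lemma kupisch_iterate:
 assumes "\<And>i. i < n ==> c i \<le> Suc (c ((i + 1) mod n))" "i < n"
 shows "c i \<le> k + c ((i + k) mod n)"
proof (induction k)
 case (Suc k)
 have "c ((i + k) mod n) \<le> Suc (c (((i + k) mod n + 1) mod n))"
  by (rule assms(1)) (use assms(2) in auto)
 then show ?case using Suc by (simp add: mod_simps)
qed (use assms in simp)

text \<open>Left multiplication prolongs a path at its end and keeps its start. Right multiplication
  moves the start backwards, and there the iterated inequality for \<open>c\<close> is used.\<close>

lemma long_ideal_ideal:
 assumes n: "0 < n" and c: "\<And>i. i < n ==> c i \<le> Suc (c ((i + 1) mod n))"
 shows "ideal (long_ideal n c) (path_algebra n :: ('k :: field, _) module)"
proof -
 let ?B = "path_algebra n :: ('k, _) module"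
 interpret ring ?B by (rule path_ring[OF n])
 note supp = path_supp
 have lin: "(\<lambda>q. a * x q + y q) \<in> long_ideal n c" if "x \<in> long_ideal n c" "y \<in> long_ideal n c" for a and x y :: "nat \<times> nat => 'k"
  unfolding long_ideal_def
 proof (intro CollectI conjI allI impI)
  show "(\<lambda>q. a * x q + y q) \<in> carrier ?B"
   using that by (intro path_lin_closed) (simp_all add: long_ideal_def)
  fix i l assume "a * x (i, l) + y (i, l) \<noteq> 0"
  then have "x (i, l) \<noteq> 0 \<or> y (i, l) \<noteq> 0" by auto
  then show "c i \<le> l" using that by (auto simp: long_ideal_def)
 qed
 have z: "(\<lambda>_. 0) \<in> (long_ideal n c :: (nat \<times> nat => 'k) set)" by (auto simp: long_ideal_def path_carrier_iff)
 have "subgroup (long_ideal n c) (add_monoid ?B)"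
 proof (rule group.subgroupI[OF a_group])
  fix x assume x: "x \<in> (long_ideal n c :: (nat \<times> nat => 'k) set)"
  then have xc: "x \<in> carrier ?B" by (simp add: long_ideal_def)
  have y: "(\<lambda>q. - 1 * x q + 0) \<in> long_ideal n c" by (rule lin[OF x z])
  then have yc: "(\<lambda>q. - x q) \<in> carrier ?B" by (simp add: long_ideal_def)
  have "\<ominus>\<^bsub>?B\<^esub> x = (\<lambda>q. - x q)" by (rule minus_equality) (use xc yc in auto)
  then show "inv\<^bsub>add_monoid ?B\<^esub> x \<in> long_ideal n c" using y by (simp add: a_inv_def)
 next
  fix x y assume "x \<in> (long_ideal n c :: (nat \<times> nat => 'k) set)" "y \<in> (long_ideal n c :: (nat \<times> nat => 'k) set)"
  then show "x \<otimes>\<^bsub>add_monoid ?B\<^esub> y \<in> long_ideal n c" using lin[of x y 1] by simp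
 qed (use z in \<open>auto simp: long_ideal_def\<close>)
 then show ?thesis
 proof (rule idealI[OF ring_axioms])
  fix x y assume x: "x \<in> (long_ideal n c :: (nat \<times> nat => 'k) set)" and y: "y \<in> carrier ?B"
  then have xc: "x \<in> carrier ?B" by (simp add: long_ideal_def)
  have ex: "\<exists>k\<le>l. u ((i + k) mod n, l - k) \<noteq> 0 \<and> w (i, k) \<noteq> 0" if "mult ?B u w (i, l) \<noteq> 0" for u w i l
  proof -
   have "(\<Sum>k\<le>l. u ((i + k) mod n, l - k) * w (i, k)) \<noteq> 0" using that by (simp add: path_algebra_mult)
   then obtain k where "k \<le> l" "u ((i + k) mod n, l - k) * w (i, k) \<noteq> 0" by (meson atMost_iff sum.neutral)
   then show ?thesis by auto
  qed
  show "y \<otimes>\<^bsub>?B\<^esub> x \<in> long_ideal n c"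
   unfolding long_ideal_def
  proof (intro CollectI conjI allI impI)
   show "y \<otimes>\<^bsub>?B\<^esub> x \<in> carrier ?B" using xc y by simp
   fix i l assume "(y \<otimes>\<^bsub>?B\<^esub> x) (i, l) \<noteq> 0"
   then obtain k where "k \<le> l" "x (i, k) \<noteq> 0" using ex by blast
   then show "c i \<le> l" using x by (auto simp: long_ideal_def intro: order_trans)
  qed
  show "x \<otimes>\<^bsub>?B\<^esub> y \<in> long_ideal n c"
   unfolding long_ideal_def
  proof (intro CollectI conjI allI impI)
   show "x \<otimes>\<^bsub>?B\<^esub> y \<in> carrier ?B" using xc y by simp
   fix i l assume "(x \<otimes>\<^bsub>?B\<^esub> y) (i, l) \<noteq> 0"
   then obtain k where k: "k \<le> l" "x ((i + k) mod n, l - k) \<noteq> 0" "y (i, k) \<noteq> 0" using ex by blast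
   then have "c ((i + k) mod n) \<le> l - k" using x by (simp add: long_ideal_def)
   moreover have "c i \<le> k + c ((i + k) mod n)" by (rule kupisch_iterate) (use c supp[OF y k(3)] in auto)
   ultimately show "c i \<le> l" using k(1) by simp
  qed
 qed
qed

lemma long_ideal_subset:
 assumes n: "0 < n" and I: "ideal I (path_algebra n :: ('k :: field, _) module)"
  and p: "\<And>i l. i < n ==> c i \<le> l ==> path_elt (i, l) \<in> I"
 shows "long_ideal n c \<subseteq> I"
proof
 let ?B = "path_algebra n :: ('k, _) module"
 interpret ideal I ?B by (rule I)
 fix x assume x: "x \<in> (long_ideal n c :: (nat \<times> nat => 'k) set)"
 then have "x \<in> carrier ?B" by (simp add: long_ideal_def)
 then have "(\<forall>i l. x (i, l) \<noteq> 0 \<longrightarrow> c i \<le> l) \<longrightarrow> x \<in> I"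
 proof (induction rule: path_induct)
  case zero
  have "\<zero>\<^bsub>?B\<^esub> \<in> I" by (rule additive_subgroup.zero_closed[OF ideal.axioms(1)[OF I]])
  then show ?case by simp
 next
  case (step p' a x)
  show ?case
  proof
   assume *: "\<forall>i l. a * path_elt p' (i, l) + x (i, l) \<noteq> 0 \<longrightarrow> c i \<le> l"
   obtain i l where p': "p' = (i, l)" by fastforce
   have "c i \<le> l" using *[rule_format, of i l] step by (simp add: p' path_elt_def)
   then have e: "path_elt (i, l) \<in> I" using p step.hyps(1) by (simp add: p' paths_def)
   have "c j \<le> k" if "x (j, k) \<noteq> 0" for j k
    using *[rule_format, of j k] that step.hyps by (auto simp: p' path_elt_def split: if_splits)
   then have x: "x \<in> I" using step.IH by blast
   have "mult ?B (scalar ?B a) (path_elt (i, l)) \<in> I" by (rule I_l_closed[OF e path_scalar_carrier])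
   then have "(\<lambda>q. a * path_elt (i, l) q) \<in> I"
    using path_scalar_mult(1)[OF n a_Hcarr[OF e]] by simp
   from additive_subgroup.a_closed[OF ideal.axioms(1)[OF I] this x] show "(\<lambda>q. a * path_elt p' q + x q) \<in> I" by (simp add: p')
  qed
 qed
 then show "x \<in> I" using x by (simp add: long_ideal_def)
qed

text \<open>\<open>c i\<close> is the least length at which the path from \<open>i\<close> runs
  through a generator. The last two conclusions bound \<open>c\<close> from both sides: together
  they give \<open>c = 1\<close> for the arrow ideal, and the lower bound gives
  \<open>2 \<le> c\<close> for generators of length at least two.\<close>

lemma path_ideal_long_ideal:
 assumes n: "0 < n" and R: "R \<subseteq> paths n" "R \<noteq> {}"
 obtains c where "\<And>i. i < n ==> c i \<le> Suc (c ((i + 1) mod n))"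
  "Idl\<^bsub>path_algebra n\<^esub> (path_elt ` R) = (long_ideal n c :: (nat \<times> nat => 'k :: field) set)"
  "\<And>m i. (\<forall>(j, l)\<in>R. m \<le> l) ==> i < n ==> m \<le> c i"
  "\<And>i l. (i, l) \<in> R ==> c i \<le> l"
proof -
 let ?B = "path_algebra n :: ('k, _) module"
 interpret B: ring ?B by (rule path_ring[OF n])
 define S where "S i l \<longleftrightarrow> (\<exists>(a, b)\<in>R. \<exists>k. k + b \<le> l \<and> a = (i + k) mod n)" for i l
 define c where "c i = (LEAST l. S i l)" for i
 have ex: "\<exists>l. S i l" if i: "i < n" for i
 proof -
  obtain a b where ab: "(a, b) \<in> R" using R(2) by auto
  then have a: "a < n" using R(1) by (auto simp: paths_def)
  \<comment> \<open>\<open>n - i\<close> steps lead to the vertex 0 and \<open>a\<close> further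
    steps to \<open>a\<close>, so every sufficiently long path contains the generator
    \<open>(a, b)\<close>.\<close>
  have "(i + (a + (n - i))) mod n = a" using i a by simp
  then have "S i (a + (n - i) + b)" unfolding S_def using ab by force
  then show ?thesis by blast
 qed
 have Sc: "S i (c i)" if "i < n" for i unfolding c_def using LeastI_ex[OF ex[OF that]] .
 have cS: "c i \<le> l" if "S i l" for i l unfolding c_def by (rule Least_le[of "S i", OF that])
 have K: "c i \<le> Suc (c ((i + 1) mod n))" if i: "i < n" for i
 proof (rule cS)
  have "(i + 1) mod n < n" using n by simp
  from Sc[OF this] obtain a b k where "(a, b) \<in> R" "k + b \<le> c ((i + 1) mod n)" "a = ((i + 1) mod n + k) mod n"
   unfolding S_def by blast
  moreover have "((i + 1) mod n + k) mod n = (i + Suc k) mod n" by (simp add: mod_simps)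
  ultimately have "Suc k + b \<le> Suc (c ((i + 1) mod n))" "a = (i + Suc k) mod n" "(a, b) \<in> R" by simp_all
  then show "S i (Suc (c ((i + 1) mod n)))" unfolding S_def by blast
 qed
 have sub: "path_elt ` R \<subseteq> carrier ?B" using R path_elt_carrier by blast
 have I: "ideal (Idl\<^bsub>?B\<^esub> (path_elt ` R)) ?B" by (rule B.genideal_ideal[OF sub])
 have "Idl\<^bsub>?B\<^esub> (path_elt ` R) = (long_ideal n c :: (nat \<times> nat => 'k) set)"
 proof
  show "Idl\<^bsub>?B\<^esub> (path_elt ` R) \<subseteq> long_ideal n c"
  proof (rule B.genideal_minimal)
   show "ideal (long_ideal n c) ?B" by (rule long_ideal_ideal) (use n K in auto)
   show "path_elt ` R \<subseteq> (long_ideal n c :: (nat \<times> nat => 'k) set)"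
   proof
    fix x :: "nat \<times> nat => 'k" assume "x \<in> path_elt ` R"
    then obtain a b where ab: "(a, b) \<in> R" "x = path_elt (a, b)" by auto
    then have a: "a < n" using R(1) by (auto simp: paths_def)
    have "S a b" unfolding S_def using ab(1) a by (intro bexI[of _ "(a, b)"]) (auto intro!: exI[of _ 0])
    then show "x \<in> long_ideal n c" using path_elt_long_ideal[OF a] cS ab(2) by blast
   qed
  qed
  show "long_ideal n c \<subseteq> Idl\<^bsub>?B\<^esub> (path_elt ` R)"
  proof (rule long_ideal_subset[OF n I])
   fix i l assume i: "i < n" and l: "c i \<le> l"
   interpret I: ideal "Idl\<^bsub>?B\<^esub> (path_elt ` R)" ?B by (rule I)
   obtain a b k where k: "(a, b) \<in> R" "k + b \<le> c i" "a = (i + k) mod n" using Sc[OF i] unfolding S_def by blast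
   have "path_elt (a, b) \<in> Idl\<^bsub>?B\<^esub> (path_elt ` R)" using B.genideal_self[OF sub] k(1) by blast
   then have "mult ?B (path_elt (a, b)) (path_elt (i, k)) \<in> Idl\<^bsub>?B\<^esub> (path_elt ` R)"
    by (rule I.I_r_closed) (use i path_elt_carrier in \<open>auto simp: paths_def\<close>)
   then have e: "path_elt (i, b + k) \<in> Idl\<^bsub>?B\<^esub> (path_elt ` R)" using k(3) by (simp add: path_elt_mult)
   have "mult ?B (path_elt ((a + b) mod n, l - k - b)) (path_elt (i, b + k)) \<in> Idl\<^bsub>?B\<^esub> (path_elt ` R)"
    by (rule I.I_l_closed[OF e path_elt_carrier]) (use n in \<open>auto simp: paths_def\<close>)
   then show "path_elt (i, l) \<in> Idl\<^bsub>?B\<^esub> (path_elt ` R)"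
    unfolding path_elt_mult using k l by (simp add: mod_simps add_ac)
  qed
 qed
 moreover have "m \<le> c i" if "\<forall>(j, l)\<in>R. m \<le> l" "i < n" for m i
  using Sc[OF that(2)] that(1) unfolding S_def by fastforce
 moreover have "c i \<le> l" if "(i, l) \<in> R" for i l
 proof (rule cS)
  have "i < n" using that R(1) by (auto simp: paths_def)
  then show "S i l" unfolding S_def using that by (intro bexI[of _ "(i, l)"]) (auto intro!: exI[of _ 0])
 qed
 ultimately show ?thesis using that K by blast
qed

lemma nakayama_ideal_long_ideal:
 assumes n: "0 < n" and I: "nakayama_ideal n (I :: (nat \<times> nat => 'k :: field) set)"
 obtains c where "\<And>i. i < n ==> c i \<le> Suc (c ((i + 1) mod n))" "\<And>i. i < n ==> 2 \<le> c i" "I = long_ideal n c"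
proof -
 obtain R where R: "R \<subseteq> paths n" "R \<noteq> {}" "\<forall>(i, l)\<in>R. 2 \<le> l" "I = Idl\<^bsub>path_algebra n\<^esub> (path_elt ` R)"
  using I unfolding nakayama_ideal_def by blast
 obtain c where c: "\<And>i. i < n ==> c i \<le> Suc (c ((i + 1) mod n))"
  "Idl\<^bsub>path_algebra n\<^esub> (path_elt ` R) = (long_ideal n c :: (nat \<times> nat => 'k) set)"
  "\<And>m i. (\<forall>(j, l)\<in>R. m \<le> l) ==> i < n ==> m \<le> c i"
  by (rule path_ideal_long_ideal[OF n R(1,2), where 'k = 'k]) blast
 show ?thesis by (rule that[of c, OF c(1) c(3)]) (use R(3,4) c(2) in auto)
qed

lemma arrow_ideal_long_ideal:
 assumes n: "0 < n"
 shows "arrow_ideal n = (long_ideal n (\<lambda>_. 1) :: (nat \<times> nat => 'k :: field) set)"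
proof -
 let ?R = "{(i, 1 :: nat) | i. i < n}"
 have "?R \<subseteq> paths n" "?R \<noteq> {}" using n by (auto simp: paths_def)
 then obtain c where c: "Idl\<^bsub>path_algebra n\<^esub> (path_elt ` ?R) = (long_ideal n c :: (nat \<times> nat => 'k) set)"
  "\<And>m i. (\<forall>(j, l)\<in>?R. m \<le> l) ==> i < n ==> m \<le> c i" "\<And>i l. (i, l) \<in> ?R ==> c i \<le> l"
  by (rule path_ideal_long_ideal[OF n, where 'k = 'k]) blast
 have "c i = 1" if "i < n" for i using c(2)[of 1 i] c(3)[of i 1] that by fastforce
 then show ?thesis unfolding arrow_ideal_def c(1) by (intro long_ideal_cong) simp
qed

text \<open>A path of length \<open>m + 1\<close> is its first arrow followed by a path of length
  \<open>m\<close>. For multiples of a path the scalar is absorbed into the arrow, as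
  \<open>ideal_prod\<close> is closed under sums of products.\<close>

lemma ideal_power_arrow_ideal:
 assumes n: "0 < n"
 shows "ideal_power (path_algebra n) (arrow_ideal n) m = (long_ideal n (\<lambda>_. m) :: (nat \<times> nat => 'k :: field) set)"
proof (induction m)
 case 0
 show ?case by (simp add: long_ideal_def)
next
 case (Suc m)
 let ?B = "path_algebra n :: ('k, _) module"
 let ?I = "long_ideal n (\<lambda>_. m) :: (nat \<times> nat => 'k) set" and ?J = "long_ideal n (\<lambda>_. 1) :: (nat \<times> nat => 'k) set"
 interpret B: ring ?B by (rule path_ring[OF n])
 have S: "ideal (long_ideal n (\<lambda>_. Suc m)) ?B" by (rule long_ideal_ideal[OF n]) simp
 have J: "ideal ?J ?B" by (rule long_ideal_ideal[OF n]) simp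
 have "ideal_prod ?B ?I ?J = long_ideal n (\<lambda>_. Suc m)"
 proof
  show "ideal_prod ?B ?I ?J \<subseteq> long_ideal n (\<lambda>_. Suc m)"
  proof
   fix x assume "x \<in> ideal_prod ?B ?I ?J"
   then show "x \<in> long_ideal n (\<lambda>_. Suc m)"
   proof induction
    case (prod x y)
    show ?case unfolding long_ideal_def
    proof (intro CollectI conjI allI impI)
     have "x \<in> carrier ?B" "y \<in> carrier ?B" using prod long_ideal_carrier by blast+
     then show "x \<otimes>\<^bsub>?B\<^esub> y \<in> carrier ?B" by (rule path_mult_closed[OF n])
     fix i l assume "(x \<otimes>\<^bsub>?B\<^esub> y) (i, l) \<noteq> 0"
     then have "(\<Sum>k\<le>l. x ((i + k) mod n, l - k) * y (i, k)) \<noteq> 0" by (simp add: path_algebra_mult)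
     then obtain k where "k \<le> l" "x ((i + k) mod n, l - k) * y (i, k) \<noteq> 0" by (meson atMost_iff sum.neutral)
     then have k: "k \<le> l" "x ((i + k) mod n, l - k) \<noteq> 0" "y (i, k) \<noteq> 0" by auto
     have "m \<le> l - k" by (rule long_idealD[OF prod(1) k(2)])
     moreover have "1 \<le> k" by (rule long_idealD[OF prod(2) k(3)])
     ultimately have "k \<le> l" "m \<le> l - k" "1 \<le> k" using k(1) by blast+
     then show "Suc m \<le> l" by simp
    qed
   next
    case (sum x y)
    show ?case by (rule additive_subgroup.a_closed[OF ideal.axioms(1)[OF S] sum.IH])
   qed
  qed
  show "long_ideal n (\<lambda>_. Suc m) \<subseteq> ideal_prod ?B ?I ?J"
  proof
   have p: "path_elt (i, l) \<in> ?I" if "i < n" "m \<le> l" for i l using path_elt_long_ideal[OF that(1), of l "\<lambda>_. m", where 'a = 'k] that(2) by simp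
   fix x assume x: "x \<in> (long_ideal n (\<lambda>_. Suc m) :: (nat \<times> nat => 'k) set)"
   then have "x \<in> carrier ?B" by (simp add: long_ideal_def)
   then have "(\<forall>i l. x (i, l) \<noteq> 0 \<longrightarrow> Suc m \<le> l) \<longrightarrow> x \<in> ideal_prod ?B ?I ?J"
   proof (induction rule: path_induct)
    case zero
    have "mult ?B (path_elt (0, m)) (\<lambda>_. 0) \<in> ideal_prod ?B ?I ?J"
     by (rule ideal_prod.prod[OF p[OF n]]) (auto simp: long_ideal_def path_carrier_iff)
    then show ?case by simp
   next
    case (step p' a x)
    show ?case
    proof
     assume *: "\<forall>i l. a * path_elt p' (i, l) + x (i, l) \<noteq> 0 \<longrightarrow> Suc m \<le> l"
     obtain i l where p': "p' = (i, l)" by fastforce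
     have i: "i < n" using step.hyps(1) by (simp add: p' paths_def)
     have l: "Suc m \<le> l" using *[rule_format, of i l] step by (simp add: p' path_elt_def)
     have "Suc m \<le> k" if "x (j, k) \<noteq> 0" for j k
      using *[rule_format, of j k] that step.hyps by (auto simp: p' path_elt_def split: if_splits)
     then have x: "x \<in> ideal_prod ?B ?I ?J" using step.IH by blast
     have j: "(i + 1) mod n < n" using n by simp
     have "path_elt (i, 1) \<in> ?J" using path_elt_long_ideal[OF i] by blast
     then have "(\<lambda>q. a * path_elt (i, 1) q) \<in> ?J"
      using ideal.I_l_closed[OF J _ path_scalar_carrier, of "path_elt (i, 1)" a]
       path_scalar_mult(1)[OF n path_elt_carrier[of "(i, 1)" n], of a] i by (simp add: paths_def)
     moreover have "path_elt ((i + 1) mod n, l - 1) \<in> ?I" by (rule p[OF j]) (use l in simp)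
     ultimately have "mult ?B (path_elt ((i + 1) mod n, l - 1)) (\<lambda>q. a * path_elt (i, 1) q) \<in> ideal_prod ?B ?I ?J"
      by (intro ideal_prod.prod)
     moreover have "mult ?B (path_elt ((i + 1) mod n, l - 1)) (\<lambda>q. a * path_elt (i, 1) q) = (\<lambda>q. a * path_elt (i, l) q)"
      using path_mult_linear(2)[of n "path_elt ((i + 1) mod n, l - 1)" a "path_elt (i, 1)" "\<lambda>_. 0"] l
      by (simp add: path_elt_mult)
     ultimately have "(\<lambda>q. a * path_elt p' q) \<in> ideal_prod ?B ?I ?J" by (simp add: p')
     from ideal_prod.sum[OF this x] show "(\<lambda>q. a * path_elt p' q + x q) \<in> ideal_prod ?B ?I ?J" by simp
    qed
   qed
   then show "x \<in> ideal_prod ?B ?I ?J" using x by (simp add: long_ideal_def)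
  qed
 qed
 then show ?case using Suc by (simp add: arrow_ideal_long_ideal[OF n])
qed

text \<open>If the forms separate points and are dual to \<open>b\<close>, the expansion follows,
  since its two sides have equal coordinates.\<close>

lemma k_basisI:
 assumes A: "unital_algebra A" and M: "left_module A M" and B: "finite B"
  and b: "\<And>be. be \<in> B ==> b be \<in> carrier M"
  and za: "\<And>be x y. be \<in> B ==> x \<in> carrier M ==> y \<in> carrier M ==> Z be (x +[M] y) = Z be x + Z be y"
  and zs: "\<And>be a x. be \<in> B ==> x \<in> carrier M ==> Z be (scalar A a *[M] x) = a * Z be x"
  and zb: "\<And>be ga. be \<in> B ==> ga \<in> B ==> Z be (b ga) = (if be = ga then 1 else 0)"
  and eq: "\<And>x y. x \<in> carrier M ==> y \<in> carrier M ==> (\<And>be. be \<in> B ==> Z be x = Z be y) ==> x = y"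
 shows "k_basis A M B b Z"
 unfolding k_basis_def
proof (intro conjI ballI allI)
 interpret A: unital_algebra A by (rule A)
 interpret M: abelian_group M using M by (rule lmod_abelian_group)
 fix x assume x: "x \<in> carrier M"
 have c: "(\<lambda>be. scalar A (Z be x) *[M] b be) \<in> B \<rightarrow> carrier M"
  using b lmod_smult_closed[OF M A.scalar_closed] by auto
 show "x = finsum M (\<lambda>be. scalar A (Z be x) *[M] b be) B"
 proof (rule eq[OF x M.finsum_closed[OF c]])
  fix ga assume ga: "ga \<in> B"
  have "Z ga (finsum M (\<lambda>be. scalar A (Z be x) *[M] b be) B) = (\<Sum>be\<in>B. Z ga (scalar A (Z be x) *[M] b be))"
   by (rule additive_finsum[OF M.abelian_group_axioms za[OF ga] B c])
  also have "\<dots> = (\<Sum>be\<in>B. if be = ga then Z ga x else 0)"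
   by (rule sum.cong) (use b zs zb ga in auto)
  also have "\<dots> = Z ga x" using B ga by simp
  finally show "Z ga x = Z ga (finsum M (\<lambda>be. scalar A (Z be x) *[M] b be) B)" by simp
 qed
qed (use assms in auto)

section \<open>The Nakayama algebra as a cyclic algebra\<close>

locale nakayama_quotient =
 fixes n :: nat and c :: "nat => nat" and A :: "('k :: field, (nat \<times> nat => 'k) set) module"
  and B :: "('k, nat \<times> nat => 'k) module" and I :: "(nat \<times> nat => 'k) set"
 assumes n: "0 < n" and kup: "\<And>i. i < n ==> c i \<le> Suc (c ((i + 1) mod n))" and c2: "\<And>i. i < n ==> 2 \<le> c i"
 defines "I \<equiv> long_ideal n c" and "B \<equiv> path_algebra n" and "A \<equiv> nakayama_algebra n I"
begin

sublocale B: ring B unfolding B_def by (rule path_ring[OF n])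
sublocale I: ideal I B unfolding I_def B_def by (rule long_ideal_ideal) (use n kup in auto)

definition "q x = I +>\<^bsub>B\<^esub> x"

lemma A_simps:
 "carrier A = q ` carrier B" "x \<in> carrier B ==> y \<in> carrier B ==> q x +[A] q y = q (x +[B] y)"
 "x \<in> carrier B ==> y \<in> carrier B ==> q x \<otimes>\<^bsub>A\<^esub> q y = q (x \<otimes>\<^bsub>B\<^esub> y)"
 "\<one>\<^bsub>A\<^esub> = q \<one>\<^bsub>B\<^esub>" "\<zero>\<^bsub>A\<^esub> = q \<zero>\<^bsub>B\<^esub>"
proof -
 show "carrier A = q ` carrier B"
  by (auto simp: A_def B_def[symmetric] quotient_algebra_def FactRing_def A_RCOSETS_def' q_def)
 show "q x +[A] q y = q (x +[B] y)" if "x \<in> carrier B" "y \<in> carrier B"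
  using I.a_rcos_sum[OF that] by (simp add: A_def B_def[symmetric] quotient_algebra_def FactRing_def q_def)
 show "q x \<otimes>\<^bsub>A\<^esub> q y = q (x \<otimes>\<^bsub>B\<^esub> y)" if "x \<in> carrier B" "y \<in> carrier B"
  using I.rcoset_mult_add[OF that] by (simp add: A_def B_def[symmetric] quotient_algebra_def FactRing_def q_def)
 show "\<one>\<^bsub>A\<^esub> = q \<one>\<^bsub>B\<^esub>" by (simp add: A_def B_def[symmetric] quotient_algebra_def FactRing_def q_def)
 have "I +>\<^bsub>B\<^esub> \<zero>\<^bsub>B\<^esub> = I" by (rule B.a_coset_add_zero[OF I.a_subset])
 then show "\<zero>\<^bsub>A\<^esub> = q \<zero>\<^bsub>B\<^esub>" by (simp add: A_def B_def[symmetric] quotient_algebra_def FactRing_def q_def)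
qed

lemma q_rep:
 assumes x: "x \<in> carrier B" and y: "y \<in> q x"
 shows "y \<in> carrier B" "\<And>i l. l < c i ==> y (i, l) = x (i, l)" "q y = q x" "\<exists>h\<in>I. y = h +[B] x"
proof -
 show h': "\<exists>h\<in>I. y = h +[B] x" using y by (auto simp: q_def a_r_coset_def')
 then obtain h where h: "h \<in> I" "y = h +[B] x" by blast
 then show yc: "y \<in> carrier B" using x I.a_Hcarr by simp
 show "y (i, l) = x (i, l)" if "l < c i" for i l
  using h(2) h(1)[unfolded I_def long_ideal_def] that by (force simp: B_def)
 show "q y = q x" unfolding q_def
  using I.a_repr_independence'[OF _ x, of y] y by (simp add: q_def)
qed

lemma q_self: "x \<in> carrier B ==> x \<in> q x"
 unfolding q_def by (rule I.a_rcos_self)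

lemma q_eq:
 assumes x: "x \<in> carrier B" and y: "y \<in> carrier B" and e: "\<And>i l. i < n ==> l < c i ==> x (i, l) = y (i, l)"
 shows "q x = q y"
proof -
 have "(\<lambda>p. - 1 * y p + x p) \<in> carrier B"
  using path_lin_closed[of y n x "-1"] x y by (simp add: B_def)
 then have h: "(\<lambda>p. - 1 * y p + x p) \<in> I" unfolding I_def long_ideal_def
 proof (intro CollectI conjI allI impI)
  fix i l assume *: "- 1 * y (i, l) + x (i, l) \<noteq> 0"
  then have "x (i, l) \<noteq> 0 \<or> y (i, l) \<noteq> 0" by auto
  then have "i < n" using path_supp x y unfolding B_def by blast
  then show "c i \<le> l" using * e[of i l] by fastforce
 qed (simp add: B_def)
 have "x = (\<lambda>p. - 1 * y p + x p) +[B] y" by (auto simp: B_def)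
 then have "x \<in> q y" unfolding q_def a_r_coset_def' using h by blast
 then show ?thesis using q_rep(3)[OF y] by blast
qed

lemma A_smult: "x \<in> carrier B ==> a *[A] q x = q (a *[B] x)"
proof -
 assume x: "x \<in> carrier B"
 have cl: "a *[B] y \<in> carrier B" if "y \<in> carrier B" for y
  using path_lin_closed[of y n "\<lambda>_. 0" a] that by (simp add: B_def path_carrier_iff)
 have "q (a *[B] y) = q (a *[B] x)" if "y \<in> q x" for y
  by (rule q_eq) (use cl q_rep[OF x that] x in \<open>auto simp: B_def\<close>)
 then have "(\<Union>y\<in>q x. q (a *[B] y)) = (\<Union>y\<in>q x. q (a *[B] x))" by (intro SUP_cong) auto
 also have "\<dots> = q (a *[B] x)" using q_self[OF x] by (auto simp only: UN_constant split: if_splits)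
 finally show ?thesis by (simp add: A_def B_def[symmetric] quotient_algebra_def q_def)
qed

text \<open>\<open>quotient_algebra\<close> repackages the quotient ring as a record of another
  type, so the ring axioms have to be transferred field by field.\<close>

lemma ring_cong:
 assumes "ring (R :: 'r ring)" "carrier S = carrier R" "add S = add R" "mult S = mult R" "one S = one R" "zero S = zero R"
 shows "ring (S :: ('x, 'r) module)"
proof -
 interpret R: ring R by fact
 show ?thesis
 proof (rule ringI)
  show "abelian_group S"
   by (rule abelian_groupI) (auto simp: assms(2-) R.a_assoc R.a_comm R.a_lcomm intro!: bexI[of _ "\<ominus>\<^bsub>R\<^esub> x" for x] R.l_neg)
  show "Group.monoid S" by (rule monoidI) (auto simp: assms(2-) R.m_assoc)
 qed (auto simp: assms(2-) R.l_distr R.r_distr)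
qed

lemma A_ring: "ring A"
 by (rule ring_cong[OF I.quotient_is_ring]) (simp_all add: A_def quotient_algebra_def B_def)

lemma scalar_A: "scalar A a = q (scalar B a)"
 using A_smult[of "\<one>\<^bsub>B\<^esub>" a] A_simps(4) by simp

lemma scalar_B_carrier: "scalar B a \<in> carrier B"
 unfolding B_def by (rule path_scalar_carrier)

lemma A_algebra: "unital_algebra A"
proof (intro unital_algebra.intro A_ring unital_algebra_axioms.intro)
 interpret A: ring A by (rule A_ring)
 note sc = scalar_B_carrier
 show "scalar A a \<in> carrier A" for a using A_simps(1) scalar_A sc by auto
 show "scalar A (a + b) = scalar A a +[A] scalar A b" for a b
  using A_simps(2)[OF sc sc, of a b] unfolding scalar_A by (simp add: B_def fun_eq_iff distrib_right)
 show "scalar A (a * b) = scalar A a \<otimes>\<^bsub>A\<^esub> scalar A b" for a b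
 proof -
  have "scalar B a \<otimes>\<^bsub>B\<^esub> scalar B b = scalar B (a * b)"
   unfolding B_def path_scalar_mult(1)[OF n path_scalar_carrier] by (simp add: mult.assoc fun_eq_iff)
  then show ?thesis using A_simps(3)[OF sc sc, of a b] unfolding scalar_A by simp
 qed
 have "scalar B 1 = \<one>\<^bsub>B\<^esub>" by (simp add: B_def)
 then show "scalar A 1 = \<one>\<^bsub>A\<^esub>" using scalar_A[of 1] A_simps(4) by (simp only:)
 show "scalar A a \<otimes>\<^bsub>A\<^esub> x = x \<otimes>\<^bsub>A\<^esub> scalar A a" if x: "x \<in> carrier A" for a x
 proof -
  obtain y where y: "y \<in> carrier B" "x = q y" using x A_simps(1) by auto
  then show ?thesis
   using A_simps(3)[OF sc y(1), of a] A_simps(3)[OF y(1) sc, of a]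
    path_scalar_mult[OF n, of y a] unfolding scalar_A by (simp add: B_def)
 qed
qed

definition "p j l = q (path_elt (j, l))"
text \<open>An arbitrary representative of the coset is read off. This is well defined for lengths
  below \<open>c j\<close>, where all representatives agree, and these are the coordinates that
  occur in the basis.\<close>

definition "Y jl X = (SOME x. x \<in> X) jl"
definition "sg i = (i + 1) mod n"

lemma sg_pow_mod: "i < n ==> (sg ^^ k) i = (i + k) mod n"
 by (induction k) (auto simp: sg_def mod_simps)

lemma Y_q: "x \<in> carrier B ==> l < c j ==> Y (j, l) (q x) = x (j, l)"
 unfolding Y_def by (rule q_rep(2)[OF _ someI[of "\<lambda>y. y \<in> q x", OF q_self]])

lemma path_elt_B: "j < n ==> path_elt (j, l) \<in> carrier B"
 unfolding B_def by (rule path_elt_carrier) (simp add: paths_def)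

lemma A_cyclic: "cyclic_algebra A n sg c p Y"
proof (intro cyclic_algebra.intro A_algebra cyclic_algebra_axioms.intro)
 interpret unital_algebra A by (rule A_algebra)
 show "bij_betw sg {..<n} {..<n}"
 proof (rule bij_betw_byWitness[of _ "\<lambda>i. (i + n - 1) mod n"])
  show "\<forall>i\<in>{..<n}. (sg i + n - 1) mod n = i"
  proof
   fix i assume "i \<in> {..<n}"
   then show "(sg i + n - 1) mod n = i"
    by (cases "i + 1 = n") (auto simp: sg_def)
  qed
  show "\<forall>i\<in>{..<n}. sg ((i + n - 1) mod n) = i"
  proof
   fix i assume i: "i \<in> {..<n}"
   have "sg ((i + n - 1) mod n) = (i + n - 1 + 1) mod n" by (simp only: sg_def mod_simps)
   then show "sg ((i + n - 1) mod n) = i" using i by simp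
  qed
 qed (use n in \<open>auto simp: sg_def\<close>)
 show "0 < c j" if "j < n" for j using c2[OF that] by simp
 show "p j l \<in> carrier A" if "j < n" for j l using A_simps(1) path_elt_B[OF that] by (auto simp: p_def)
 show "p j l = \<zero>\<^bsub>A\<^esub>" if "j < n" "c j \<le> l" for j l
  unfolding p_def A_simps(5)
  by (rule q_eq) (use path_elt_B[OF that(1)] that in \<open>auto simp: path_elt_def B_def path_carrier_iff\<close>)
 show "p i k \<otimes>\<^bsub>A\<^esub> p j l = (if i = (sg ^^ l) j then p j (k + l) else \<zero>\<^bsub>A\<^esub>)" if "i < n" "j < n" for i j k l
  using A_simps(3)[OF path_elt_B[OF that(1)] path_elt_B[OF that(2)], of k l] A_simps(5)
  by (simp add: p_def sg_pow_mod[OF that(2)] B_def path_elt_mult)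
 show "k_basis A (regular_module A) {(j, l). j < n \<and> l < c j} (\<lambda>(j, l). p j l) Y"
 proof (rule k_basisI[OF A_algebra regular_left_module])
  have "{(j, l). j < n \<and> l < c j} = (SIGMA j:{..<n}. {..<c j})" by auto
  then show "finite {(j, l). j < n \<and> l < c j}" by simp
  fix be assume be: "be \<in> {(j, l). j < n \<and> l < c j}"
  then obtain j l where jl: "be = (j, l)" "j < n" "l < c j" by auto
  show "(case be of (j, l) => p j l) \<in> carrier (regular_module A)"
   using jl path_elt_B[OF jl(2)] A_simps(1) by (auto simp: regular_module_def p_def)
  show "Y be (x +[regular_module A] y) = Y be x + Y be y"
   if xy: "x \<in> carrier (regular_module A)" "y \<in> carrier (regular_module A)" for x y
  proof -
   obtain x' y' where "x' \<in> carrier B" "x = q x'" "y' \<in> carrier B" "y = q y'"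
    using xy A_simps(1) by (auto simp: regular_module_def)
   then show ?thesis using A_simps(2)[of x' y'] Y_q[OF _ jl(3)] B.a_closed[of x' y']
    by (simp add: regular_module_def jl(1)) (simp add: B_def)
  qed
  show "Y be (scalar A a *[regular_module A] x) = a * Y be x" if x: "x \<in> carrier (regular_module A)" for a x
  proof -
   obtain x' where x': "x' \<in> carrier B" "x = q x'"
    using x A_simps(1) by (auto simp: regular_module_def)
   have e: "scalar B a \<otimes>\<^bsub>B\<^esub> x' = (\<lambda>p. a * x' p)"
    using path_scalar_mult(1)[OF n, of x' a] x'(1) by (simp add: B_def)
   have "scalar A a \<otimes>\<^bsub>A\<^esub> x = q (scalar B a \<otimes>\<^bsub>B\<^esub> x')"
    unfolding scalar_A x'(2) by (rule A_simps(3)[OF scalar_B_carrier x'(1)])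
   then show ?thesis
    using Y_q[OF B.m_closed[OF scalar_B_carrier x'(1)] jl(3), of a] Y_q[OF x'(1) jl(3)] e
    by (simp add: regular_module_def jl(1) x'(2))
  qed
  show "Y be (case ga of (j, l) => p j l) = (if be = ga then 1 else 0)"
   if "ga \<in> {(j, l). j < n \<and> l < c j}" for ga
   using that jl path_elt_B Y_q[OF path_elt_B jl(3)] by (auto simp: p_def path_elt_def split: if_splits)
 next
  fix x y assume xy: "x \<in> carrier (regular_module A)" "y \<in> carrier (regular_module A)"
   and e: "\<And>be. be \<in> {(j, l). j < n \<and> l < c j} ==> Y be x = Y be y"
  have "x \<in> q ` carrier B" "y \<in> q ` carrier B" using xy A_simps(1) by (auto simp: regular_module_def)
  then obtain x' y' where *: "x' \<in> carrier B" "x = q x'" "y' \<in> carrier B" "y = q y'" by blast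
  show "x = y" unfolding *
   by (rule q_eq[OF *(1,3)]) (use e Y_q[OF *(1)] Y_q[OF *(3)] * in fastforce)
 qed
qed

end

section \<open>Duality and decomposition into uniserial modules\<close>

context cyclic_algebra
begin

definition "tu = inv_into {..<n} sg"

lemma tu: "j < n ==> tu j < n" "j < n ==> sg (tu j) = j" "j < n ==> tu (sg j) = j" "bij_betw tu {..<n} {..<n}"
proof -
 show "bij_betw tu {..<n} {..<n}" unfolding tu_def by (rule bij_betw_inv_into[OF sg])
 then show "j < n ==> tu j < n" by (auto simp: bij_betw_def)
 show "j < n ==> sg (tu j) = j" unfolding tu_def using bij_betw_inv_into_right[OF sg] by simp
 show "j < n ==> tu (sg j) = j" unfolding tu_def using bij_betw_inv_into_left[OF sg] by simp
qed

lemma tu_pow: "j < n ==> (tu ^^ l) j < n"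
 by (induction l) (auto simp: tu)

lemma sgtu_pow: "j < n ==> (sg ^^ l) ((tu ^^ l) j) = j"
proof (induction l arbitrary: j)
 case (Suc l)
 have "(sg ^^ Suc l) ((tu ^^ Suc l) j) = sg ((sg ^^ l) ((tu ^^ l) (tu j)))"
  by (simp only: funpow.simps funpow_Suc_right comp_apply) (simp add: funpow_swap1)
 then show ?case using Suc tu by simp
qed simp

lemma tusg_pow: "j < n ==> (tu ^^ l) ((sg ^^ l) j) = j"
 by (rule sg_pow_inj[OF tu_pow[OF sg_pow] _ sgtu_pow[OF sg_pow]]) simp_all

lemma p_eq_zero_iff: "j < n ==> p j l = \<zero> \<longleftrightarrow> c j \<le> l"
 using p_zero[of j l] Y_p[of j l j l] Y_zero[of "(j, l)"] by fastforce

text \<open>The Kupisch series of the opposite algebra: \<open>c' j\<close> is the number of nonzero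
  paths that end at \<open>j\<close>.\<close>

definition "c' j = (LEAST l. c ((tu ^^ l) j) \<le> l)"

lemma c'_iff:
 assumes j: "j < n"
 shows "l < c' j \<longleftrightarrow> l < c ((tu ^^ l) j)"
proof -
 \<comment> \<open>If the path of length \<open>l\<close> ending at \<open>j\<close> is zero, so is
   its prolongation backwards by one arrow. Hence the least vanishing length decides all
   lengths.\<close>
 have up: "c ((tu ^^ Suc l) j) \<le> Suc l" if "c ((tu ^^ l) j) \<le> l" for l
 proof -
  have t: "(tu ^^ l) j < n" "(tu ^^ Suc l) j < n" using tu_pow[OF j] by blast+
  have s: "(tu ^^ l) j = (sg ^^ 1) ((tu ^^ Suc l) j)" using tu(2)[OF t(1)] by simp
  have "p ((tu ^^ Suc l) j) (l + 1) = p ((tu ^^ l) j) l \<otimes> p ((tu ^^ Suc l) j) 1"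
   unfolding p_mult[OF t, of l 1] by (rule if_P[OF s, symmetric])
  also have "p ((tu ^^ l) j) l = \<zero>" using p_zero[OF t(1) that] .
  also have "\<zero> \<otimes> p ((tu ^^ Suc l) j) 1 = \<zero>" by (rule l_null[OF p_closed[OF t(2)]])
  finally show ?thesis using p_eq_zero_iff[OF t(2)] by simp
 qed
 have mono: "c ((tu ^^ l') j) \<le> l'" if "c ((tu ^^ l) j) \<le> l" "l \<le> l'" for l l'
  using that(2,1) by (induction rule: dec_induct) (use up in blast)+
 have ex: "\<exists>l. c ((tu ^^ l) j) \<le> l"
 proof
  have "(tu ^^ (\<Sum>j<n. c j)) j < n" by (rule tu_pow[OF j])
  then show "c ((tu ^^ (\<Sum>j<n. c j)) j) \<le> (\<Sum>j<n. c j)"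
   by (intro member_le_sum) auto
 qed
 have L: "c ((tu ^^ c' j) j) \<le> c' j" unfolding c'_def by (rule LeastI_ex[OF ex])
 show ?thesis
 proof
  assume "l < c' j"
  then show "l < c ((tu ^^ l) j)" unfolding c'_def using not_less_Least by (metis not_less)
 next
  assume "l < c ((tu ^^ l) j)"
  then show "l < c' j" using mono[OF L, of l] by (metis not_less)
 qed
qed

text \<open>In the opposite algebra, the path of length \<open>l\<close> from \<open>j\<close> is
  the path of \<open>A\<close> of that length which ends at \<open>j\<close> and therefore starts at
  \<open>(tu ^^ l) j\<close>; multiplication prolongs it at its start.\<close>

lemma opposite_cyclic:
 "cyclic_algebra (opposite A) n tu c' (\<lambda>j l. p ((tu ^^ l) j) l) (\<lambda>(j, l). Y ((tu ^^ l) j, l))"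
proof (intro cyclic_algebra.intro opposite_unital_algebra cyclic_algebra_axioms.intro)
 interpret o: unital_algebra "opposite A" by (rule opposite_unital_algebra)
 show "bij_betw tu {..<n} {..<n}" by (rule tu)
 show "0 < c' j" if "j < n" for j using c'_iff[OF that, of 0] c_pos[OF that] by simp
 show "p ((tu ^^ l) j) l \<in> carrier (opposite A)" if "j < n" for j l
  using p_closed[OF tu_pow[OF that]] by simp
 show "p ((tu ^^ l) j) l = \<zero>\<^bsub>opposite A\<^esub>" if "j < n" "c' j \<le> l" for j l
  using p_zero[OF tu_pow[OF that(1)], of l l] c'_iff[OF that(1), of l] that(2) by simp
 show "p ((tu ^^ k) i) k \<otimes>\<^bsub>opposite A\<^esub> p ((tu ^^ l) j) l =
   (if i = (tu ^^ l) j then p ((tu ^^ (k + l)) j) (k + l) else \<zero>\<^bsub>opposite A\<^esub>)"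
  if "i < n" "j < n" for i j k l
  using p_mult[OF tu_pow[OF that(2)] tu_pow[OF that(1)], of l l k k] sgtu_pow[OF that(1), of k]
  by (auto simp: funpow_add add.commute)
 show "k_basis (opposite A) (regular_module (opposite A)) {(j, l). j < n \<and> l < c' j}
   (\<lambda>(j, l). p ((tu ^^ l) j) l) (\<lambda>(j, l). Y ((tu ^^ l) j, l))"
 proof (rule k_basisI[OF opposite_unital_algebra o.regular_left_module])
  have "{(j, l). j < n \<and> l < c' j} = (SIGMA j:{..<n}. {..<c' j})" by auto
  then show "finite {(j, l). j < n \<and> l < c' j}" by simp
  fix be assume "be \<in> {(j, l). j < n \<and> l < c' j}"
  then obtain j l where be: "be = (j, l)" "j < n" "l < c' j" by auto
  have in_PB: "((tu ^^ l) j, l) \<in> PB" using c'_iff[OF be(2)] be tu_pow by simp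
  show "(case be of (j, l) => p ((tu ^^ l) j) l) \<in> carrier (regular_module (opposite A))"
   using p_closed[OF tu_pow[OF be(2)]] by (simp add: regular_module_def be(1))
  show "(case be of (j, l) => Y ((tu ^^ l) j, l)) (x +[regular_module (opposite A)] y)
   = (case be of (j, l) => Y ((tu ^^ l) j, l)) x + (case be of (j, l) => Y ((tu ^^ l) j, l)) y"
   if "x \<in> carrier (regular_module (opposite A))" "y \<in> carrier (regular_module (opposite A))" for x y
   using that Y_add[OF in_PB] by (simp add: regular_module_def be(1))
  show "(case be of (j, l) => Y ((tu ^^ l) j, l)) (scalar (opposite A) a *[regular_module (opposite A)] x)
   = a * (case be of (j, l) => Y ((tu ^^ l) j, l)) x"
   if "x \<in> carrier (regular_module (opposite A))" for a x
   using that by (simp add: regular_module_def be(1) Y_scalar[OF in_PB] scalar_comm[symmetric])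
  fix ga assume "ga \<in> {(j, l). j < n \<and> l < c' j}"
  then obtain i t where ga: "ga = (i, t)" "i < n" "t < c' i" by auto
  have "(tu ^^ l) j = (tu ^^ l) i ==> j = i"
   using sgtu_pow[OF be(2), of l] sgtu_pow[OF ga(2), of l] by metis
  then show "(case be of (j, l) => Y ((tu ^^ l) j, l)) (case ga of (j, l) => p ((tu ^^ l) j) l) = (if be = ga then 1 else 0)"
   using Y_p[OF tu_pow[OF be(2)] _ tu_pow[OF ga(2)], of l l t t] c'_iff[OF be(2), of l] be ga by auto
 next
  fix x y assume xy: "x \<in> carrier (regular_module (opposite A))" "y \<in> carrier (regular_module (opposite A))"
   and e: "\<And>be. be \<in> {(j, l). j < n \<and> l < c' j} ==>
    (case be of (j, l) => Y ((tu ^^ l) j, l)) x = (case be of (j, l) => Y ((tu ^^ l) j, l)) y"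
  show "x = y"
  proof (rule Y_eqI)
   fix j l assume j: "j < n" "l < c j"
   have s: "(sg ^^ l) j < n" by (rule sg_pow[OF j(1)])
   show "Y (j, l) x = Y (j, l) y"
    using e[of "((sg ^^ l) j, l)"] c'_iff[OF s, of l] tusg_pow[OF j(1), of l] j s by simp
  qed (use xy in \<open>auto simp: regular_module_def\<close>)
 qed
qed

text \<open>The dual of a uniserial module is uniserial with the order of positions reversed: it is
  generated by the coordinate form of the socle, which sits at the last vertex of the summand, and
  position \<open>x\<close> becomes \<open>l k - 1 - x\<close>.\<close>

lemma jordan_dual:
 assumes J: "jordan_basis M q v l m Z"
 shows "cyclic_algebra.jordan_basis (opposite A) n (\<lambda>j l. p ((tu ^^ l) j) l) (k_dual A M) q
  (\<lambda>k. (sg ^^ (l k - 1)) (v k)) l (\<lambda>k. \<lambda>y\<in>carrier M. Z (k, l k - 1) y)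
  (\<lambda>(k, x) fi. fi (p (v k) (l k - 1 - x) *[M] m k))"
proof -
 interpret o: cyclic_algebra "opposite A" n tu c' "\<lambda>j l. p ((tu ^^ l) j) l" "\<lambda>(j, l). Y ((tu ^^ l) j, l)"
  by (rule opposite_cyclic)
 note M = jordan_left_module[OF J] and vl = jordan_gens[OF J] and kb = jordan_k_basis[OF J]
 note p_pm = jordan_p_pm[OF J] and Za = jordan_Z_add[OF J] and Zs = jordan_Z_scalar[OF J]
  and Z0 = jordan_Z_zero[OF J] and Zpm = jordan_Z_pm[OF J]
 interpret M: abelian_group M using M by (rule lmod_abelian_group)
 let ?D = "k_dual A M"
 let ?v = "\<lambda>k. (sg ^^ (l k - 1)) (v k)"
 let ?m = "\<lambda>k. \<lambda>y\<in>carrier M. Z (k, l k - 1) y"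
 have D: "left_module (opposite A) ?D" by (rule k_dual_left_module[OF M])
 note cl = lmod_smult_closed[OF M]
 have bM: "p (v k) x *[M] m k \<in> carrier M" if "k < q" for k x
  using cl[OF p_closed[OF vl(1)[OF that]] vl(3)[OF that]] .
 have Zr: "(\<lambda>y\<in>carrier M. Z (k, x) y) \<in> carrier ?D" if "k < q" "x < l k" for k x
  by (rule k_dualI) (use that in \<open>auto simp: Za Zs cl scalar_closed\<close>)
 have mD: "?m k \<in> carrier ?D" if "k < q" for k by (rule Zr[OF that]) (use vl(2)[OF that] in simp)
 have vn: "?v k < n" if "k < q" for k by (rule sg_pow[OF vl(1)[OF that]])
 \<comment> \<open>Acting by the reversed path of length \<open>x\<close> moves the coordinate form
   from the socle up by \<open>x\<close> positions and kills it once the top is passed.\<close>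
 have act: "p ((tu ^^ x) (?v k)) x *[?D] ?m k = (\<lambda>y\<in>carrier M. if x < l k then Z (k, l k - 1 - x) y else 0)"
  if k: "k < q" for k x
 proof
  fix y
  show "(p ((tu ^^ x) (?v k)) x *[?D] ?m k) y = (\<lambda>y\<in>carrier M. if x < l k then Z (k, l k - 1 - x) y else 0) y"
  proof (cases "y \<in> carrier M")
   case y: True
   let ?j = "(tu ^^ x) (?v k)"
   have j: "?j < n" by (rule tu_pow[OF vn[OF k]])
   note cj = cl[OF p_closed[OF j]]
   have lk: "l k - 1 < l k" using vl(2)[OF k] by simp
   have sa: "p ?j x *[M] (scalar A a *[M] y) = scalar A a *[M] (p ?j x *[M] y)" if "y \<in> carrier M" for a y
    using that p_closed[OF j] by (metis lmod_assoc[OF M] scalar_closed scalar_comm)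
   have "Z (k, l k - 1) (p ?j x *[M] y) = (\<Sum>be\<in>{(k, x). k < q \<and> x < l k}.
     Z be y * Z (k, l k - 1) (p ?j x *[M] (case be of (k, x) => p (v k) x *[M] m k)))"
    by (rule k_basis_functional[OF M kb _ _ y, of "\<lambda>y. Z (k, l k - 1) (p ?j x *[M] y)"])
     (use k lk cj in \<open>simp_all add: lmod_smult_r_distr[OF M p_closed[OF j]] Za sa Zs del: One_nat_def\<close>)
   also have "\<dots> = (\<Sum>be\<in>{(k, x). k < q \<and> x < l k}. if be = (k, l k - 1 - x) \<and> x < l k then Z be y else 0)"
   proof (rule sum.cong[OF refl], clarify)
    fix k' t assume k': "k' < q" "t < l k'"
    have 1: "Z (k, l k - 1) (p ?j x *[M] (p (v k') t *[M] m k'))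
     = (if ?j = (sg ^^ t) (v k') \<and> k = k' \<and> l k - 1 = x + t then 1 else 0)"
    proof (cases "?j = (sg ^^ t) (v k')")
     case True
     show ?thesis unfolding p_pm[OF k'(1) j, of x t] if_P[OF True] Zpm[OF k lk k'(1), of "x + t"]
      using True by (simp only: simp_thms)
    next
     case False
     then show ?thesis unfolding p_pm[OF k'(1) j, of x t] if_not_P[OF False] Z0[OF k lk]
      by (simp only: simp_thms if_False)
    qed
    have 2: "?j = (sg ^^ t) (v k)" if "l k - 1 = x + t"
    proof -
     have "?v k = (sg ^^ x) ((sg ^^ t) (v k))" using that by (simp add: funpow_add)
     then show ?thesis using tusg_pow[OF sg_pow[OF vl(1)[OF k]]] by simp
    qed
    show "Z (k', t) y * Z (k, l k - 1) (p ?j x *[M] (p (v k') t *[M] m k'))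
     = (if (k', t) = (k, l k - 1 - x) \<and> x < l k then Z (k', t) y else 0)"
     unfolding 1 using 2 k' by auto
   qed
   also have "\<dots> = (if x < l k then Z (k, l k - 1 - x) y else 0)"
   proof -
    have "finite {(k, x). k < q \<and> x < l k}" using kb by (simp add: k_basis_def)
    then show ?thesis using k lk by (cases "x < l k") auto
   qed
   finally show ?thesis using y cj by simp
  qed simp
 qed
 show ?thesis unfolding o.jordan_basis_def
 proof (intro conjI allI impI D)
  fix k assume k: "k < q"
  show "?v k < n" "0 < l k" "?m k \<in> carrier ?D" using vn[OF k] vl(2)[OF k] mD[OF k] by auto
  show "p ((tu ^^ 0) (?v k)) 0 *[?D] ?m k = ?m k" unfolding act[OF k] using vl(2)[OF k] by simp
  show "p ((tu ^^ l k) (?v k)) (l k) *[?D] ?m k = \<zero>\<^bsub>?D\<^esub>" unfolding act[OF k] by simp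
 next
  have kbD: "finite {(k, x). k < q \<and> x < l k}" using kb by (simp add: k_basis_def)
  show "k_basis (opposite A) ?D {(k, x). k < q \<and> x < l k} (\<lambda>(k, x). p ((tu ^^ x) (?v k)) x *[?D] ?m k)
    (\<lambda>(k, x) fi. fi (p (v k) (l k - 1 - x) *[M] m k))"
  proof (rule k_basisI[OF opposite_unital_algebra D kbD])
   fix be assume "be \<in> {(k, x). k < q \<and> x < l k}"
   then obtain k x where be: "be = (k, x)" "k < q" "x < l k" by auto
   show "(case be of (k, x) => p ((tu ^^ x) (?v k)) x *[?D] ?m k) \<in> carrier ?D"
    using be act[OF be(2), of x] Zr[OF be(2), of "l k - 1 - x"] by simp
   show "(case be of (k, x) => \<lambda>fi. fi (p (v k) (l k - 1 - x) *[M] m k)) (fi +[?D] si)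
    = (case be of (k, x) => \<lambda>fi. fi (p (v k) (l k - 1 - x) *[M] m k)) fi
    + (case be of (k, x) => \<lambda>fi. fi (p (v k) (l k - 1 - x) *[M] m k)) si" for fi si
    using bM[OF be(2)] by (simp add: be(1))
   show "(case be of (k, x) => \<lambda>fi. fi (p (v k) (l k - 1 - x) *[M] m k)) (scalar (opposite A) a *[?D] fi)
    = a * (case be of (k, x) => \<lambda>fi. fi (p (v k) (l k - 1 - x) *[M] m k)) fi" if "fi \<in> carrier ?D" for fi a
    using bM[OF be(2)] k_dualD(3)[OF that] by (simp add: be(1))
   fix ga assume "ga \<in> {(k, x). k < q \<and> x < l k}"
   then obtain k' x' where ga: "ga = (k', x')" "k' < q" "x' < l k'" by auto
   have "(p ((tu ^^ x') (?v k')) x' *[?D] ?m k') (p (v k) (l k - 1 - x) *[M] m k)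
    = (if k' = k \<and> l k' - 1 - x' = l k - 1 - x then 1 else 0)"
    unfolding act[OF ga(2)] using bM[OF be(2)] ga(3) Zpm[OF ga(2) _ be(2), of "l k' - 1 - x'" "l k - 1 - x"] by simp
   moreover have "(k' = k \<and> l k' - 1 - x' = l k - 1 - x) = (be = ga)" using be ga by auto
   ultimately show "(case be of (k, x) => \<lambda>fi. fi (p (v k) (l k - 1 - x) *[M] m k))
     (case ga of (k, x) => p ((tu ^^ x) (?v k)) x *[?D] ?m k) = (if be = ga then 1 else 0)"
    by (simp only: be(1) ga(1) prod.case)
  next
   fix fi si assume fi: "fi \<in> carrier ?D" and si: "si \<in> carrier ?D"
    and e: "\<And>be. be \<in> {(k, x). k < q \<and> x < l k} ==>
     (case be of (k, x) => \<lambda>fi. fi (p (v k) (l k - 1 - x) *[M] m k)) fi =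
     (case be of (k, x) => \<lambda>fi. fi (p (v k) (l k - 1 - x) *[M] m k)) si"
   show "fi = si"
   proof (rule o.k_basis_eqI[OF k_basis_dual[OF M kb] fi si _ D], clarify)
    fix k x assume "k < q" "x < l k"
    then show "fi (p (v k) x *[M] m k) = si (p (v k) x *[M] m k)"
     using e[of "(k, l k - 1 - x)"] by simp
   qed
  qed
 qed
qed

text \<open>The formula for \<open>E\<close> is applied to the dual basis over the opposite algebra
  and translated back. Nonprojective summands of the dual become noninjective ones:
  \<open>l k < c (tu (v k))\<close> says that the summand is the radical of a uniserial module that
  is longer by one.\<close>

theorem jordan_E_inv_minus:
 assumes J: "jordan_basis M q v l m Z"
 shows "E_inv_minus A M = card {(k, (k', x)). k < q \<and> l k < c (tu (v k)) \<and> k' < q \<and> x < l k' \<and> x < l k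
  \<and> (sg ^^ (l k' - 1 - x)) (v k') = tu (v k)}"
proof -
 interpret o: cyclic_algebra "opposite A" n tu c' "\<lambda>j l. p ((tu ^^ l) j) l" "\<lambda>(j, l). Y ((tu ^^ l) j, l)"
  by (rule opposite_cyclic)
 note vl = jordan_gens[OF J]
 let ?v = "\<lambda>k. (sg ^^ (l k - 1)) (v k)"
 let ?E = "{(k, (k', x)). k < q \<and> l k < c' (?v k) \<and> k' < q \<and> x < l k' \<and> x < l k
  \<and> (tu ^^ x) (?v k') = (tu ^^ l k) (?v k)}"
 have 1: "(tu ^^ l k) (?v k) = tu (v k)" if k: "k < q" for k
 proof -
  have "(tu ^^ l k) (?v k) = tu ((tu ^^ (l k - 1)) (?v k))"
   using vl(2)[OF k] by (metis Suc_pred' comp_apply funpow.simps(2))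
  then show ?thesis using tusg_pow[OF vl(1)[OF k]] by simp
 qed
 have 2: "l k < c' (?v k) \<longleftrightarrow> l k < c (tu (v k))" if k: "k < q" for k
  using c'_iff[OF sg_pow[OF vl(1)[OF k]], of "l k" "l k - 1"] 1[OF k] by simp
 have 3: "(tu ^^ x) (?v k) = (sg ^^ (l k - 1 - x)) (v k)" if k: "k < q" "x < l k" for k x
 proof -
  have "l k - 1 = x + (l k - 1 - x)" using that by simp
  then have "?v k = (sg ^^ x) ((sg ^^ (l k - 1 - x)) (v k))" by (metis comp_apply funpow_add)
  then show ?thesis using tusg_pow[OF sg_pow[OF vl(1)[OF k(1)]]] by simp
 qed
 obtain Ph :: "(('b => 'k) => ((nat => 'a) => 'a) set => 'k) => _" where
  "coordinatized (Hom_space (opposite A) (k_dual A M) (AR_tau (opposite A) (k_dual A M))) ?E Ph"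
  using o.jordan_coordinates[OF jordan_dual[OF J]] by blast
 then have "E_inv_minus A M = card ?E"
  by (rule E_inv_minus_eq_card[OF jordan_left_module[OF J] jordan_k_basis[OF J]
    o.jordan_presentation[OF jordan_dual[OF J]]])
 also have "?E = {(k, (k', x)). k < q \<and> l k < c (tu (v k)) \<and> k' < q \<and> x < l k' \<and> x < l k
  \<and> (sg ^^ (l k' - 1 - x)) (v k') = tu (v k)}"
  using 1 2 3 by auto
 finally show ?thesis .
qed

text \<open>
 A path from a summand to a non-projective one is counted by \<open>E\<^sup>-\<close> with the two summands swapped; if the
 target is projective, reflecting the position in the first summand matches the two counts.
\<close>

theorem E_inv_eq_E_inv_minus:
 assumes cL: "\<And>j. j < n ==> c j = L" and per: "\<And>j. j < n ==> (sg ^^ (L + 1)) j = j"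
  and J: "jordan_basis M q v l m Z"
 shows "E_inv A M = E_inv_minus A M"
proof -
 note vl = jordan_gens[OF J]
 have lL: "l k \<le> L" if "k < q" for k using jordan_length_le[OF J that] cL[OF vl(1)[OF that]] by simp
 let ?E = "{(k, (k', x)). k < q \<and> l k < c (v k) \<and> k' < q \<and> x < l k' \<and> x < l k
  \<and> (sg ^^ x) (v k') = (sg ^^ l k) (v k)}"
 let ?F = "{(k, (k', x)). k < q \<and> l k < c (tu (v k)) \<and> k' < q \<and> x < l k' \<and> x < l k
  \<and> (sg ^^ (l k' - 1 - x)) (v k') = tu (v k)}"
 let ?h = "\<lambda>(k, (k', x)). if l k' < L then (k', (k, x)) else (k, (k', l k - 1 - x))"
 have E: "(k, (k', x)) \<in> ?E \<longleftrightarrow> k < q \<and> l k < L \<and> k' < q \<and> x < l k' \<and> x < l k \<and> v k' = (sg ^^ (l k - x)) (v k)" for k k' x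
 proof -
  have "(sg ^^ x) (v k') = (sg ^^ l k) (v k) \<longleftrightarrow> v k' = (sg ^^ (l k - x)) (v k)"
   if "k < q" "k' < q" "x < l k"
  proof -
   have e: "(sg ^^ l k) (v k) = (sg ^^ x) ((sg ^^ (l k - x)) (v k))"
    using that(3) by (metis comp_apply funpow_add le_add_diff_inverse less_imp_le)
   show ?thesis unfolding e
    using sg_pow_inj[OF vl(1)[OF that(2)] sg_pow[OF vl(1)[OF that(1)]], of x "l k - x"] by auto
  qed
  then show ?thesis using cL[OF vl(1)] by auto
 qed
 have F: "(k, (k', x)) \<in> ?F \<longleftrightarrow> k < q \<and> l k < L \<and> k' < q \<and> x < l k' \<and> x < l k \<and> (sg ^^ (l k' - x)) (v k') = v k" for k k' x
 proof -
  have "(sg ^^ (l k' - 1 - x)) (v k') = tu (v k) \<longleftrightarrow> (sg ^^ (l k' - x)) (v k') = v k"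
   if "k < q" "k' < q" "x < l k'"
  proof -
   have e: "(sg ^^ (l k' - x)) (v k') = sg ((sg ^^ (l k' - 1 - x)) (v k'))"
    using that(3) by (metis Suc_diff_Suc comp_apply diff_Suc_eq_diff_pred funpow.simps(2))
   show ?thesis unfolding e
    using tu(2)[OF vl(1)[OF that(1)]] tu(3)[OF sg_pow[OF vl(1)[OF that(2)]], of "l k' - 1 - x"] by auto
  qed
  then show ?thesis using cL[OF tu(1)[OF vl(1)]] by auto
 qed
 \<comment> \<open>Only here does the period \<open>L + 1\<close> enter: \<open>?y\<close> steps
   forward are undone by \<open>L + 1 - ?y\<close> further steps. The exponent on the right is the
   one required in \<open>?F\<close> for a target of length \<open>L\<close> at the reflected
   position \<open>l k - 1 - x\<close>.\<close>
 have proj: "v k' = (sg ^^ (l k - x)) (v k) \<longleftrightarrow> (sg ^^ (L - (l k - 1 - x))) (v k') = v k"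
  if "k < q" "k' < q" "x < l k" for k k' x
 proof -
  let ?y = "l k - x"
  have y: "0 < ?y" "?y \<le> L + 1" using that lL[OF that(1)] by auto
  have e1: "L - (l k - 1 - x) = L + 1 - ?y" using that lL[OF that(1)] by simp
  have 1: "(sg ^^ ?y) ((sg ^^ (L + 1 - ?y)) (v k')) = v k'"
   using per[OF vl(1)[OF that(2)]] y(2) by (metis comp_apply funpow_add le_add_diff_inverse)
  have 2: "(sg ^^ (L + 1 - ?y)) ((sg ^^ ?y) (v k)) = v k"
   using per[OF vl(1)[OF that(1)]] y(2) by (metis comp_apply funpow_add le_add_diff_inverse2)
  show ?thesis unfolding e1 using 1 2 by auto
 qed
 have "bij_betw ?h ?E ?F"
 proof (rule bij_betw_byWitness[of _ ?h])
  show "\<forall>t\<in>?E. ?h (?h t) = t" "\<forall>t\<in>?F. ?h (?h t) = t" using cL[OF vl(1)] cL[OF tu(1)[OF vl(1)]] by auto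
  show "?h ` ?E \<subseteq> ?F"
  proof
   fix t assume "t \<in> ?h ` ?E"
   then obtain k k' x where t: "(k, (k', x)) \<in> ?E" "t = ?h (k, (k', x))" by auto
   note t' = t(1)[unfolded E]
   show "t \<in> ?F"
   proof (cases "l k' < L")
    case True
    then have "t = (k', (k, x))" using t(2) by simp
    then show ?thesis using F[of k' k x] True t' by auto
   next
    case False
    then have "l k' = L" using lL[of k'] t' by simp
    then show ?thesis using t(2) F[of k k' "l k - 1 - x"] t' proj[of k k' x] by auto
   qed
  qed
  show "?h ` ?F \<subseteq> ?E"
  proof
   fix t assume "t \<in> ?h ` ?F"
   then obtain k k' x where t: "(k, (k', x)) \<in> ?F" "t = ?h (k, (k', x))" by auto
   note t' = t(1)[unfolded F]
   show "t \<in> ?E"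
   proof (cases "l k' < L")
    case True
    then have "t = (k', (k, x))" using t(2) by simp
    then show ?thesis using E[of k' k x] True t' by auto
   next
    case False
    then have "l k' = L" using lL[of k'] t' by simp
    then show ?thesis using t(2) E[of k k' "l k - 1 - x"] t' proj[of k k' "l k - 1 - x"] by auto
   qed
  qed
 qed
 then have "card ?E = card ?F" by (rule bij_betw_same_card)
 then show ?thesis using jordan_E_inv[OF J] jordan_E_inv_minus[OF J] by simp
qed

end

section \<open>Existence of Jordan bases\<close>

lemma bounded_nat_max:
 fixes P :: "nat => bool"
 assumes "\<exists>t. P t" "\<And>t. P t ==> t \<le> N"
 obtains s where "P s" "\<And>t. P t ==> t \<le> s"
proof -
 obtain t where "P t" using assms(1) by blast
 then have "P (Greatest P)" by (rule GreatestI_nat) (use assms(2) in blast)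
 moreover have "t \<le> Greatest P" if "P t" for t
  using that by (rule Greatest_le_nat) (use assms(2) in blast)
 ultimately show ?thesis using that by blast
qed

text \<open>If \<open>C\<close> had fewer elements than \<open>S\<close>, some nontrivial
  combination of the vectors \<open>s be\<close> would have all coordinates zero. Expanding the dual
  forms \<open>W\<close> in these coordinates then makes the coefficients of the combination
  vanish.\<close>

lemma (in unital_algebra) biorthogonal_card_le:
 assumes M: "left_module A M" and kb: "k_basis A M B b Z" and S: "finite S"
  and s: "\<And>be. be \<in> S ==> s be \<in> carrier M"
  and add: "\<And>be x y. be \<in> S ==> x \<in> carrier M ==> y \<in> carrier M ==> W be (x +[M] y) = W be x + W be y"
  and hom: "\<And>be a x. be \<in> S ==> x \<in> carrier M ==> W be (scalar A a *[M] x) = a * W be x"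
  and del: "\<And>be ga. be \<in> S ==> ga \<in> S ==> W be (s ga) = (if be = ga then 1 else 0)"
  and C: "C \<subseteq> B" and van: "\<And>be ga. be \<in> S ==> ga \<in> B ==> ga \<notin> C ==> Z ga (s be) = 0"
 shows "card S \<le> card C"
proof (rule ccontr)
 assume "\<not> card S \<le> card C"
 moreover have B: "finite B" using kb by (simp add: k_basis_def)
 then have fC: "finite C" using C by (rule rev_finite_subset)
 ultimately obtain a where a: "\<exists>be\<in>S. a be \<noteq> 0" "\<forall>ga\<in>C. (\<Sum>be\<in>S. a be * Z ga (s be)) = 0"
  using homogeneous_system[OF fC S, of "\<lambda>be ga. Z ga (s be)"] by auto
 have z: "(\<Sum>be\<in>S. a be * Z ga (s be)) = 0" if "ga \<in> B" for ga
  by (cases "ga \<in> C") (use a(2) van that in auto)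
 have "a be = 0" if be: "be \<in> S" for be
 proof -
  have "a be = (\<Sum>de\<in>S. if be = de then a de else 0)" using S be by simp
  also have "\<dots> = (\<Sum>de\<in>S. a de * W be (s de))" by (rule sum.cong) (use be del in auto)
  also have "\<dots> = (\<Sum>de\<in>S. a de * (\<Sum>ga\<in>B. Z ga (s de) * W be (b ga)))"
   by (intro sum.cong arg_cong2[where f = "(*)"] refl k_basis_functional[OF M kb])
    (use be add hom s in auto)
  also have "\<dots> = (\<Sum>de\<in>S. \<Sum>ga\<in>B. a de * Z ga (s de) * W be (b ga))"
   by (simp add: sum_distrib_left mult.assoc)
  also have "\<dots> = (\<Sum>ga\<in>B. (\<Sum>de\<in>S. a de * Z ga (s de)) * W be (b ga))"
   unfolding sum_distrib_right by (rule sum.swap)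
  also have "\<dots> = 0" using z by simp
  finally show ?thesis .
 qed
 then show False using a(1) by blast
qed

context cyclic_algebra
begin

text \<open>The basis vectors at \<open>j\<close> are fixed by the idempotent \<open>p j 0\<close>,
  so in the other basis they have coordinates only at vectors which also sit at \<open>j\<close>.
  Used in both directions, this makes the number at each vertex an invariant of
  \<open>M\<close>.\<close>

lemma k_basis_vertex_card_le:
 assumes M: "left_module A M" and kb: "k_basis A M B b Z" and kb': "k_basis A M B' b' Z'"
  and vx: "\<And>be. be \<in> B ==> vx be < n \<and> p (vx be) 0 *[M] b be = b be"
  and vx': "\<And>be. be \<in> B' ==> vx' be < n \<and> p (vx' be) 0 *[M] b' be = b' be"
 shows "card {be\<in>B. vx be = j} \<le> card {be\<in>B'. vx' be = j}"
proof (rule biorthogonal_card_le[OF M kb', where s = b and W = Z])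
 note kbD = kb[unfolded k_basis_def] and kbD' = kb'[unfolded k_basis_def]
 note cl = lmod_smult_closed[OF M]
 have fB: "finite B" and b: "\<And>be. be \<in> B ==> b be \<in> carrier M" using kbD by blast+
 have b': "\<And>be. be \<in> B' ==> b' be \<in> carrier M" using kbD' by blast+
 have Za': "\<And>be x y. be \<in> B' ==> x \<in> carrier M ==> y \<in> carrier M ==> Z' be (x +[M] y) = Z' be x + Z' be y"
  and Zs': "\<And>be a x. be \<in> B' ==> x \<in> carrier M ==> Z' be (scalar A a *[M] x) = a * Z' be x"
  and Zd': "\<And>be ga. be \<in> B' ==> ga \<in> B' ==> Z' be (b' ga) = (if be = ga then 1 else 0)"
  using kbD' by blast+
 show "finite {be\<in>B. vx be = j}" using fB by simp
 show "b be \<in> carrier M" if "be \<in> {be\<in>B. vx be = j}" for be using that b by simp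
 show "Z be (x +[M] y) = Z be x + Z be y"
  if "be \<in> {be\<in>B. vx be = j}" "x \<in> carrier M" "y \<in> carrier M" for be x y
  using that kbD by blast
 show "Z be (scalar A a *[M] x) = a * Z be x" if "be \<in> {be\<in>B. vx be = j}" "x \<in> carrier M" for be a x
  using that kbD by blast
 show "Z be (b ga) = (if be = ga then 1 else 0)" if "be \<in> {be\<in>B. vx be = j}" "ga \<in> {be\<in>B. vx be = j}" for be ga
  using that kbD by blast
 show "{be\<in>B'. vx' be = j} \<subseteq> B'" by blast
 show "Z' ga (b be) = 0" if be: "be \<in> {be\<in>B. vx be = j}" and ga: "ga \<in> B'" "ga \<notin> {be\<in>B'. vx' be = j}" for be ga
 proof -
  have j: "j < n" and bj: "b be \<in> carrier M" "p j 0 *[M] b be = b be" using be vx b by auto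
  note pj = p_closed[OF j]
  interpret M: abelian_group M using M by (rule lmod_abelian_group)
  have Z0: "Z' ga \<zero>\<^bsub>M\<^esub> = 0"
   using Za'[OF ga(1) M.zero_closed M.zero_closed]
   by (metis M.r_zero M.zero_closed add_cancel_right_right)
  have sa: "p j 0 *[M] (scalar A a *[M] x) = scalar A a *[M] (p j 0 *[M] x)" if "x \<in> carrier M" for a x
   using that pj by (metis lmod_assoc[OF M] scalar_closed scalar_comm)
  have "Z' ga (p j 0 *[M] b be) = (\<Sum>de\<in>B'. Z' de (b be) * Z' ga (p j 0 *[M] b' de))"
   by (rule k_basis_functional[OF M kb' _ _ bj(1), of "\<lambda>y. Z' ga (p j 0 *[M] y)"])
    (use ga(1) cl[OF pj] in \<open>simp_all add: lmod_smult_r_distr[OF M pj] Za' Zs' sa\<close>)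
  also have "\<dots> = 0"
  proof (rule sum.neutral, rule ballI)
   fix de assume de: "de \<in> B'"
   have e: "p j 0 *[M] b' de = (p j 0 \<otimes> p (vx' de) 0) *[M] b' de"
    using vx'[OF de] lmod_assoc[OF M pj p_closed b'[OF de], of "vx' de" 0] by simp
   have "Z' ga (p j 0 *[M] b' de) = 0"
   proof (cases "j = vx' de")
    case True
    then have "ga \<noteq> de" using ga by blast
    then show ?thesis using True vx'[OF de] Zd'[OF ga(1) de] by simp
   next
    case False
    then show ?thesis unfolding e using p_mult[OF j, of "vx' de" 0 0] vx'[OF de] Z0
      lmod_zero_smult[OF M ring_axioms b'[OF de]] by simp
   qed
   then show "Z' de (b be) * Z' ga (p j 0 *[M] b' de) = 0" by simp
  qed
  finally show ?thesis using bj(2) by simp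
 qed
qed

text \<open>A Jordan basis of a submodule together with a complement, the common kernel of the \<open>Z (k, x)\<close>.\<close>

definition partial_jordan_basis ::
  "('a, 'm) module => nat => (nat => nat) => (nat => nat) => (nat => 'm) => (nat \<times> nat => 'm => 'k) => bool" where
 "partial_jordan_basis M q v l m Z \<longleftrightarrow>
   (\<forall>k<q. v k < n \<and> 0 < l k \<and> m k \<in> carrier M
    \<and> p (v k) 0 *[M] m k = m k \<and> p (v k) (l k) *[M] m k = \<zero>\<^bsub>M\<^esub>)
  \<and> (\<forall>k<q. \<forall>x<l k. \<forall>y\<in>carrier M. \<forall>z\<in>carrier M. Z (k, x) (y +[M] z) = Z (k, x) y + Z (k, x) z)
  \<and> (\<forall>k<q. \<forall>x<l k. \<forall>a. \<forall>y\<in>carrier M. Z (k, x) (scalar A a *[M] y) = a * Z (k, x) y)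
  \<and> (\<forall>k<q. \<forall>x<l k. \<forall>k'<q. \<forall>x'<l k'.
    Z (k, x) (p (v k') x' *[M] m k') = (if k = k' \<and> x = x' then 1 else 0))
  \<and> (\<forall>j<n. \<forall>t. \<forall>y\<in>carrier M. (\<forall>k<q. \<forall>x<l k. Z (k, x) y = 0) \<longrightarrow> (\<forall>k<q. \<forall>x<l k. Z (k, x) (p j t *[M] y) = 0))"

lemma partial_jordan_basisD:
 assumes "partial_jordan_basis M q v l m Z"
 shows "k < q ==> v k < n" "k < q ==> 0 < l k" "k < q ==> m k \<in> carrier M"
  "k < q ==> p (v k) 0 *[M] m k = m k" "k < q ==> p (v k) (l k) *[M] m k = \<zero>\<^bsub>M\<^esub>"
  "k < q ==> x < l k ==> y \<in> carrier M ==> z \<in> carrier M ==> Z (k, x) (y +[M] z) = Z (k, x) y + Z (k, x) z"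
  "k < q ==> x < l k ==> y \<in> carrier M ==> Z (k, x) (scalar A a *[M] y) = a * Z (k, x) y"
  "k < q ==> x < l k ==> k' < q ==> x' < l k' ==>
   Z (k, x) (p (v k') x' *[M] m k') = (if k = k' \<and> x = x' then 1 else 0)"
  "j < n ==> y \<in> carrier M ==> (\<And>k x. k < q ==> x < l k ==> Z (k, x) y = 0) ==> k < q ==> x < l k ==>
   Z (k, x) (p j t *[M] y) = 0"
proof -
 note D = assms[unfolded partial_jordan_basis_def]
 note D1 = conjunct1[OF D] and D2 = conjunct2[OF D]
 note D3 = conjunct2[OF D2]
 note D4 = conjunct2[OF D3]
 note D5 = conjunct2[OF D4]
 show "k < q ==> v k < n" "k < q ==> 0 < l k" "k < q ==> m k \<in> carrier M"
  "k < q ==> p (v k) 0 *[M] m k = m k" "k < q ==> p (v k) (l k) *[M] m k = \<zero>\<^bsub>M\<^esub>"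
  using D1 by blast+
 show "k < q ==> x < l k ==> y \<in> carrier M ==> z \<in> carrier M ==> Z (k, x) (y +[M] z) = Z (k, x) y + Z (k, x) z"
  using conjunct1[OF D2] by blast
 show "k < q ==> x < l k ==> y \<in> carrier M ==> Z (k, x) (scalar A a *[M] y) = a * Z (k, x) y"
  using conjunct1[OF D3] by blast
 show "k < q ==> x < l k ==> k' < q ==> x' < l k' ==>
   Z (k, x) (p (v k') x' *[M] m k') = (if k = k' \<and> x = x' then 1 else 0)"
  using conjunct1[OF D4] by blast
 show "j < n ==> y \<in> carrier M ==> (\<And>k x. k < q ==> x < l k ==> Z (k, x) y = 0) ==> k < q ==> x < l k ==>
   Z (k, x) (p j t *[M] y) = 0"
  using D5 by blast
qed

lemma partial_jordan_basis_card:
 assumes M: "left_module A M" and kb: "k_basis A M B b Z'" and J: "partial_jordan_basis M q v l m Z"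
 shows "q \<le> card B"
proof -
 note JD = partial_jordan_basisD[OF J]
 have fin: "finite {(k, x). k < q \<and> x < l k}"
 proof -
  have "{(k, x). k < q \<and> x < l k} = (SIGMA k:{..<q}. {..<l k})" by auto
  then show ?thesis by simp
 qed
 have "inj_on (\<lambda>k. (k, 0 :: nat)) {..<q}" by (auto simp: inj_on_def)
 moreover have "(\<lambda>k. (k, 0)) ` {..<q} \<subseteq> {(k, x). k < q \<and> x < l k}" using JD(2) by auto
 ultimately have "card {..<q} \<le> card {(k, x). k < q \<and> x < l k}" using fin by (rule card_inj_on_le)
 also have "\<dots> \<le> card B"
  by (rule biorthogonal_card_le[OF M kb fin, where s = "\<lambda>(k, x). p (v k) x *[M] m k" and W = Z])
   (auto simp: JD(1,3,6-8) lmod_smult_closed[OF M] p_closed split: if_splits)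
 finally show ?thesis by simp
qed

lemma jordan_basis_of_partial:
 assumes M: "left_module A M" and J: "partial_jordan_basis M q v l m Z"
  and N: "\<And>y. y \<in> carrier M ==> (\<forall>k<q. \<forall>x<l k. Z (k, x) y = 0) ==> y = \<zero>\<^bsub>M\<^esub>"
 shows "jordan_basis M q v l m Z"
 unfolding jordan_basis_def
proof (intro conjI M)
 note JD = partial_jordan_basisD[OF J]
 interpret M: abelian_group M using M by (rule lmod_abelian_group)
 show "\<forall>k<q. v k < n \<and> 0 < l k \<and> m k \<in> carrier M \<and> p (v k) 0 *[M] m k = m k \<and> p (v k) (l k) *[M] m k = \<zero>\<^bsub>M\<^esub>"
  using JD(1-5) by blast
 show "k_basis A M {(k, x). k < q \<and> x < l k} (\<lambda>(k, x). p (v k) x *[M] m k) Z"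
 proof (rule k_basisI[OF unital_algebra_axioms M])
  have "{(k, x). k < q \<and> x < l k} = (SIGMA k:{..<q}. {..<l k})" by auto
  then show "finite {(k, x). k < q \<and> x < l k}" by simp
  fix x y assume x: "x \<in> carrier M" and y: "y \<in> carrier M"
   and e: "\<And>be. be \<in> {(k, x). k < q \<and> x < l k} ==> Z be x = Z be y"
  define z where "z = scalar A (-1) *[M] y"
  have z: "z \<in> carrier M" unfolding z_def by (rule lmod_smult_closed[OF M scalar_closed y])
  have "x +[M] z = \<zero>\<^bsub>M\<^esub>"
  proof (rule N[OF M.a_closed[OF x z]], intro allI impI)
   fix k i assume "k < q" "i < l k"
   then show "Z (k, i) (x +[M] z) = 0" using JD(6,7) x y z e[of "(k, i)"] by (simp add: z_def)
  qed
  moreover have "y +[M] z = \<zero>\<^bsub>M\<^esub>"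
  proof (rule N[OF M.a_closed[OF y z]], intro allI impI)
   fix k i assume "k < q" "i < l k"
   then show "Z (k, i) (y +[M] z) = 0" using JD(6,7) y z by (simp add: z_def)
  qed
  ultimately show "x = y" using x y z by (metis M.add.right_cancel)
 qed (auto simp: JD(1,3,6-8) lmod_smult_closed[OF M] p_closed split: if_splits)
qed

text \<open>In the complement \<open>N\<close>, a vector is taken on which a path of the greatest
  possible length \<open>s\<close> acts nontrivially. Maximality of \<open>s\<close> makes the
  uniserial submodule generated by it, after a correction of the generator, a direct summand of
  \<open>N\<close>: a form on its socle, pulled back along paths, gives all coordinate forms of the
  new summand.\<close>

lemma partial_jordan_basis_extend:
 assumes M: "left_module A M" and kb: "k_basis A M B b W" and J: "partial_jordan_basis M q v l m Z"
  and y0: "y0 \<in> carrier M" "\<forall>k<q. \<forall>x<l k. Z (k, x) y0 = 0" "y0 \<noteq> \<zero>\<^bsub>M\<^esub>"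
 shows "\<exists>v l m Z. partial_jordan_basis M (Suc q) v l m Z"
proof -
 interpret M: abelian_group M using M by (rule lmod_abelian_group)
 note JD = partial_jordan_basisD[OF J]
 note vl = JD(1-5) and Za = JD(6) and Zs = JD(7) and Zd = JD(8)
 define N where "N = {y \<in> carrier M. \<forall>k<q. \<forall>x<l k. Z (k, x) y = 0}"
 have Np: "p j t *[M] y \<in> N" if "j < n" "y \<in> N" for j t y
  using that JD(9)[OF that(1)] lmod_smult_closed[OF M p_closed[OF that(1)]] unfolding N_def by simp
 have Ns: "scalar A a *[M] y \<in> N" if "y \<in> N" for a y
  using that lmod_smult_closed[OF M scalar_closed] Zs unfolding N_def by simp
 have Na: "y +[M] z \<in> N" if "y \<in> N" "z \<in> N" for y z
  using that Za unfolding N_def by simp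
 have Nc: "y \<in> carrier M" if "y \<in> N" for y using that by (simp add: N_def)
 have Wa: "W be (y +[M] z) = W be y + W be z" if "be \<in> B" "y \<in> carrier M" "z \<in> carrier M" for be y z
  using kb that unfolding k_basis_def by blast
 have Ws: "W be (scalar A a *[M] y) = a * W be y" if "be \<in> B" "y \<in> carrier M" for be a y
  using kb that unfolding k_basis_def by blast
 have W0: "W be \<zero>\<^bsub>M\<^esub> = 0" if "be \<in> B" for be
  using Wa[OF that M.zero_closed M.zero_closed]
  by (metis M.r_zero M.zero_closed add_cancel_right_right)
 note cl = lmod_smult_closed[OF M]
 have nz: "\<exists>be\<in>B. W be y \<noteq> 0" if "y \<in> carrier M" "y \<noteq> \<zero>\<^bsub>M\<^esub>" for y
  using k_basis_eqI[OF kb that(1) M.zero_closed _ M] W0 that(2) by auto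
 have pp: "p i k *[M] (p j t *[M] y) = (if i = (sg ^^ t) j then p j (k + t) *[M] y else \<zero>\<^bsub>M\<^esub>)"
  if "i < n" "j < n" "y \<in> carrier M" for i j k t y
  using lmod_assoc[OF M p_closed p_closed that(3), OF that(1,2), of k t, symmetric]
   p_mult[OF that(1,2), of k t] lmod_zero_smult[OF M ring_axioms that(3)] by simp
 have ps: "p j t *[M] (scalar A a *[M] y) = scalar A a *[M] (p j t *[M] y)" if "j < n" "y \<in> carrier M" for j t a y
  using that p_closed[OF that(1)] by (metis lmod_assoc[OF M] scalar_closed scalar_comm)
 let ?P = "\<lambda>t. \<exists>j<n. \<exists>y\<in>N. p j t *[M] y \<noteq> \<zero>\<^bsub>M\<^esub>"
 have "\<exists>t. ?P t"
 proof (rule ccontr)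
  assume "\<nexists>t. ?P t"
  then have z: "p j t *[M] y0 = \<zero>\<^bsub>M\<^esub>" if "j < n" for j t using that y0 unfolding N_def by blast
  obtain be where be: "be \<in> B" "W be y0 \<noteq> 0" using nz[OF y0(1,3)] by blast
  have "W be (\<one> *[M] y0) = (\<Sum>(i, t)\<in>PB. Y (i, t) \<one> * W be (p i t *[M] y0))"
   by (rule A_functional[of "\<lambda>a. W be (a *[M] y0)"])
    (use be(1) y0(1) cl in \<open>simp_all add: lmod_smult_l_distr[OF M] lmod_assoc[OF M] Wa Ws scalar_closed\<close>)
  also have "\<dots> = 0" by (rule sum.neutral) (use z W0[OF be(1)] in auto)
  finally show False using be(2) lmod_one[OF M y0(1)] by simp
 qed
 moreover have bound: "t \<le> (\<Sum>j<n. c j)" if t: "?P t" for t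
 proof -
  obtain j y where j: "j < n" "y \<in> N" "p j t *[M] y \<noteq> \<zero>\<^bsub>M\<^esub>" using t by blast
  have "t < c j"
   using j p_zero[OF j(1), of t] lmod_zero_smult[OF M ring_axioms Nc[OF j(2)]] by (metis not_less)
  also have "c j \<le> (\<Sum>j<n. c j)" using j(1) by (intro member_le_sum) auto
  finally show ?thesis by simp
 qed
 ultimately obtain s where s: "?P s" "\<And>t. ?P t ==> t \<le> s" using bounded_nat_max[of ?P] by blast
 have big: "p j t *[M] y = \<zero>\<^bsub>M\<^esub>" if "s < t" "j < n" "y \<in> N" for j t y
  using s(2)[of t] that by auto
 obtain i y1 where i: "i < n" "y1 \<in> N" "p i s *[M] y1 \<noteq> \<zero>\<^bsub>M\<^esub>" using s(1) by blast
 obtain be where be: "be \<in> B" "W be (p i s *[M] y1) \<noteq> 0" using nz[OF Nc[OF Np[OF i(1,2)]] i(3)] by blast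
 let ?i' = "(sg ^^ s) i"
 have i': "?i' < n" by (rule sg_pow[OF i(1)])
 \<comment> \<open>A linear form supported at the end vertex \<open>?i'\<close> and equal to 1 at
   \<open>p i s *[M] y1\<close>, the socle of the summand to be split off.\<close>
 define xi where "xi z = W be (p ?i' 0 *[M] z) / W be (p i s *[M] y1)" for z
 have xia: "xi (y +[M] z) = xi y + xi z" if "y \<in> carrier M" "z \<in> carrier M" for y z
  using that Wa[OF be(1)] cl[OF p_closed[OF i']]
  by (simp add: xi_def lmod_smult_r_distr[OF M p_closed[OF i']] add_divide_distrib)
 have xis: "xi (scalar A a *[M] y) = a * xi y" if "y \<in> carrier M" for a y
  using that ps[OF i'] Ws[OF be(1)] cl[OF p_closed[OF i']] by (simp add: xi_def)
 have xi0: "xi \<zero>\<^bsub>M\<^esub> = 0" using xia[OF M.zero_closed M.zero_closed]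
  by (metis M.r_zero M.zero_closed add_cancel_right_right)
 have xip: "xi (p j t *[M] y) = 0" if "j < n" "y \<in> carrier M" "(sg ^^ t) j \<noteq> ?i'" for j t y
  using pp[OF i' that(1,2), of 0 t] that(3) W0[OF be(1)] by (simp add: xi_def)
 \<comment> \<open>The generator is corrected until \<open>xi\<close> vanishes at
   \<open>p i (s - u) *[M] g\<close> for all \<open>u > 0\<close>. Step \<open>U + 1\<close> adds a
   multiple of \<open>p i (U + 1) *[M] g\<close>. The value at \<open>u = U + 1\<close> changes by
   the factor \<open>a\<close>, chosen to make it zero; the values at smaller \<open>u\<close> would
   change only through paths longer than \<open>s\<close>, which act by zero on
   \<open>N\<close>.\<close>
 have "\<exists>g. g \<in> N \<and> p i 0 *[M] g = g \<and> xi (p i s *[M] g) = 1 \<and> (\<forall>u. 0 < u \<and> u \<le> U \<and> u \<le> s \<longrightarrow> xi (p i (s - u) *[M] g) = 0)" for U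
 proof (induction U)
  case 0
  let ?g = "p i 0 *[M] y1"
  have y1: "y1 \<in> carrier M" by (rule Nc[OF i(2)])
  have "p i 0 *[M] ?g = ?g" "p i s *[M] ?g = p i s *[M] y1"
   "p ?i' 0 *[M] (p i s *[M] y1) = p i s *[M] y1"
   using pp[OF i(1) i(1) y1, of 0 0] pp[OF i(1) i(1) y1, of s 0] pp[OF i' i(1) y1, of 0 s] by simp_all
  then show ?case using Np[OF i(1,2), of 0] be(2) by (intro exI[of _ ?g]) (auto simp: xi_def)
 next
  case (Suc U)
  then obtain g where g: "g \<in> N" "p i 0 *[M] g = g" "xi (p i s *[M] g) = 1"
   "\<And>u. 0 < u ==> u \<le> U ==> u \<le> s ==> xi (p i (s - u) *[M] g) = 0" by blast
  note gM = Nc[OF g(1)]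
  show ?case
  proof (cases "Suc U \<le> s \<and> (sg ^^ Suc U) i = i")
   \<comment> \<open>Either \<open>U + 1\<close> exceeds \<open>s\<close> and there is no new
     condition, or the path of length \<open>s - (U + 1)\<close> ends at another vertex than
     \<open>?i'\<close>, where \<open>xi\<close> vanishes anyway.\<close>
   case False
   have "xi (p i (s - u) *[M] g) = 0" if u: "0 < u" "u \<le> Suc U" "u \<le> s" for u
   proof (cases "u \<le> U")
    case True then show ?thesis using g(4) u by blast
   next
    case uU: False
    then have e: "u = Suc U" using u by simp
    then have ne: "(sg ^^ Suc U) i \<noteq> i" using False u by simp
    have "(sg ^^ (s - u)) i \<noteq> ?i'"
    proof
     assume *: "(sg ^^ (s - u)) i = ?i'"
     have "?i' = (sg ^^ (s - u)) ((sg ^^ u) i)" using u(3) by (metis comp_apply funpow_add le_add_diff_inverse2)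
     then have "(sg ^^ u) i = i" using sg_pow_inj[OF sg_pow[OF i(1)] i(1)] * by metis
     then show False using ne e by simp
    qed
    then show ?thesis by (rule xip[OF i(1) gM])
   qed
   then show ?thesis using g by (intro exI[of _ g]) simp
  next
   case True
   define a where "a = - xi (p i (s - Suc U) *[M] g)"
   let ?h = "scalar A a *[M] (p i (Suc U) *[M] g)"
   have hN: "?h \<in> N" by (rule Ns[OF Np[OF i(1) g(1)]])
   note hM = Nc[OF hN]
   have ph: "p i t *[M] ?h = scalar A a *[M] (p i (t + Suc U) *[M] g)" for t
    using ps[OF i(1) cl[OF p_closed[OF i(1)] gM]] pp[OF i(1) i(1) gM, of t "Suc U"] True by simp
   have pgh: "p i t *[M] (g +[M] ?h) = p i t *[M] g +[M] scalar A a *[M] (p i (t + Suc U) *[M] g)" for t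
    using lmod_smult_r_distr[OF M p_closed[OF i(1)] gM hM] ph by simp
   have xigh: "xi (p i t *[M] (g +[M] ?h)) = xi (p i t *[M] g) + a * xi (p i (t + Suc U) *[M] g)" for t
    unfolding pgh using xia xis cl[OF p_closed[OF i(1)] gM] cl[OF scalar_closed] by simp
   have bg: "xi (p i t *[M] g) = 0" if "s < t" for t using big[OF that i(1) g(1)] xi0 by simp
   show ?thesis
   proof (intro exI[of _ "g +[M] ?h"] conjI allI impI)
    show "g +[M] ?h \<in> N" by (rule Na[OF g(1) hN])
    show "p i 0 *[M] (g +[M] ?h) = g +[M] ?h" unfolding pgh using g(2) by simp
    show "xi (p i s *[M] (g +[M] ?h)) = 1" unfolding xigh using g(3) bg[of "s + Suc U"] by simp
    fix u assume u: "0 < u \<and> u \<le> Suc U \<and> u \<le> s"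
    show "xi (p i (s - u) *[M] (g +[M] ?h)) = 0"
    proof (cases "u = Suc U")
     case True
     then show ?thesis unfolding xigh using g(3) u by (simp add: a_def)
    next
     case False
     then have "s < s - u + Suc U" using u by arith
     from bg[OF this] show ?thesis unfolding xigh using g(4)[of u] False u by simp
    qed
   qed
  qed
 qed
 then obtain g where g: "g \<in> N" "p i 0 *[M] g = g" "xi (p i s *[M] g) = 1"
  "\<And>u. 0 < u ==> u \<le> s ==> xi (p i (s - u) *[M] g) = 0" by blast
 note gM = Nc[OF g(1)]
 \<comment> \<open>Moving \<open>z\<close> from position \<open>x\<close> to the position of the
   socle and applying \<open>xi\<close> reads off a coordinate. The corrections of \<open>g\<close>
   make these forms dual to the vectors \<open>p i x *[M] g\<close>. On \<open>N\<close>, composing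
   \<open>ze x\<close> with a path of length \<open>t\<close> gives zero or
   \<open>ze (x - t)\<close>, so their common kernel in \<open>N\<close> is stable under all
   paths.\<close>
 define ze where "ze x z = xi (p ((sg ^^ x) i) (s - x) *[M] z)" for x z
 have px: "p ((sg ^^ x) i) t \<in> carrier A" for x t by (rule p_closed[OF sg_pow[OF i(1)]])
 have zea: "ze x (y +[M] z) = ze x y + ze x z" if "y \<in> carrier M" "z \<in> carrier M" for x y z
  using that xia cl[OF px] by (simp add: ze_def lmod_smult_r_distr[OF M px])
 have zes: "ze x (scalar A a *[M] y) = a * ze x y" if "y \<in> carrier M" for x a y
  using that xis cl[OF px] ps[OF sg_pow[OF i(1)]] by (simp add: ze_def)
 have zep: "ze x (p j t *[M] y) = (if (sg ^^ x) i = (sg ^^ t) j then xi (p j (s - x + t) *[M] y) else 0)"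
  if "j < n" "y \<in> carrier M" for x j t y
  using pp[OF sg_pow[OF i(1)] that, of x "s - x" t] xi0 by (simp add: ze_def)
 have zeg: "ze x (p i x' *[M] g) = (if x = x' then 1 else 0)" if "x \<le> s" "x' \<le> s" for x x'
 proof -
  have "xi (p i (s - x + x') *[M] g) = (if x = x' then 1 else 0)"
  proof (cases x x' rule: linorder_cases)
   case less
   then have "s < s - x + x'" using that by simp
   from big[OF this i(1) g(1)] show ?thesis using less xi0 by simp
  next
   case equal then show ?thesis using g(3) that by simp
  next
   case greater
   then have "s - x + x' = s - (x - x')" using that by simp
   then show ?thesis using g(4)[of "x - x'"] greater that by simp
  qed
  then show ?thesis using zep[OF i(1) gM, of x x'] by (cases "x = x'") auto
 qed
 let ?J = "SIGMA k:{..<q}. {..<l k}"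
 let ?b = "\<lambda>(k, x). p (v k) x *[M] m k"
 let ?v = "v(q := i)" and ?l = "l(q := Suc s)" and ?m = "m(q := g)"
 \<comment> \<open>The new forms are made to vanish on the old summands by subtracting their values
   on the projection to these; on \<open>N\<close> they are unchanged.\<close>
 define Z' where "Z' be y = (if fst be = q then ze (snd be) y - (\<Sum>ga\<in>?J. Z ga y * ze (snd be) (?b ga)) else Z be y)" for be y
 have ZN: "Z (k, x) y = 0" if "y \<in> N" "k < q" "x < l k" for k x y using that by (simp add: N_def)
 have Z'N: "Z' (q, x) y = ze x y" if y: "y \<in> N" for x y
 proof -
  have "(\<Sum>ga\<in>?J. Z ga y * ze x (?b ga)) = 0" by (rule sum.neutral) (use ZN[OF y] in auto)
  then show ?thesis by (simp add: Z'_def)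
 qed
 have Z'k: "Z' (k, x) y = Z (k, x) y" if "k < q" for k x y using that by (simp add: Z'_def)
 have Z'b: "Z' (q, x) (p (v k) x' *[M] m k) = 0" if k: "k < q" "x' < l k" for x k x'
 proof -
  have "(\<Sum>ga\<in>?J. Z ga (p (v k) x' *[M] m k) * ze x (?b ga)) = (\<Sum>ga\<in>?J. if ga = (k, x') then ze x (?b (k, x')) else 0)"
   by (rule sum.cong) (use k Zd in \<open>auto split: if_splits\<close>)
  also have "\<dots> = ze x (p (v k) x' *[M] m k)" using k by simp
  finally show ?thesis by (simp add: Z'_def)
 qed
 have "partial_jordan_basis M (Suc q) ?v ?l ?m Z'"
  unfolding partial_jordan_basis_def
 proof (intro conjI allI impI ballI)
  fix k assume k: "k < Suc q"
  show "?v k < n" "0 < ?l k" "?m k \<in> carrier M" "p (?v k) 0 *[M] ?m k = ?m k"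
   "p (?v k) (?l k) *[M] ?m k = \<zero>\<^bsub>M\<^esub>"
   using k vl[of k] i(1) gM g(2) big[OF _ i(1) g(1), of "Suc s"] by (cases "k = q"; simp)+
  fix x assume x: "x < ?l k"
  show "Z' (k, x) (y +[M] z) = Z' (k, x) y + Z' (k, x) z" if yz: "y \<in> carrier M" "z \<in> carrier M" for y z
  proof (cases "k = q")
   case True
   have "(\<Sum>ga\<in>?J. Z ga (y +[M] z) * ze x (?b ga))
    = (\<Sum>ga\<in>?J. Z ga y * ze x (?b ga) + Z ga z * ze x (?b ga))"
    by (rule sum.cong) (use Za yz in \<open>auto simp: distrib_right\<close>)
   then show ?thesis using zea[OF yz] True by (simp add: Z'_def sum.distrib)
  next
   case False
   then show ?thesis using k x Za yz by (simp add: Z'_def)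
  qed
  show "Z' (k, x) (scalar A a *[M] y) = a * Z' (k, x) y" if y: "y \<in> carrier M" for a y
  proof (cases "k = q")
   case True
   have "(\<Sum>ga\<in>?J. Z ga (scalar A a *[M] y) * ze x (?b ga)) = (\<Sum>ga\<in>?J. a * (Z ga y * ze x (?b ga)))"
    by (rule sum.cong) (use Zs y in auto)
   then show ?thesis using zes[OF y] True by (simp add: Z'_def sum_distrib_left right_diff_distrib)
  next
   case False
   then show ?thesis using k x Zs y by (simp add: Z'_def)
  qed
  fix k' x' assume k': "k' < Suc q" "x' < ?l k'"
  show "Z' (k, x) (p (?v k') x' *[M] ?m k') = (if k = k' \<and> x = x' then 1 else 0)"
  proof (cases "k = q"; cases "k' = q")
   assume "k = q" "k' = q"
   then show ?thesis using Z'N[OF Np[OF i(1) g(1)]] zeg[of x x'] x k' by simp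
  next
   assume *: "k = q" "k' \<noteq> q"
   then have "k' < q" "x' < l k'" using k' by simp_all
   then show ?thesis using Z'b[of k' x' x] * by simp
  next
   assume *: "k \<noteq> q" "k' = q"
   then have "k < q" "x < l k" using k x by simp_all
   then show ?thesis using Z'k ZN[OF Np[OF i(1) g(1)]] * by simp
  next
   assume *: "k \<noteq> q" "k' \<noteq> q"
   then have "k < q" "x < l k" "k' < q" "x' < l k'" using k x k' by simp_all
   then show ?thesis using Z'k Zd * by simp
  qed
 next
  fix j t y k x assume j: "j < n" and y: "y \<in> carrier M" and z: "\<forall>k<Suc q. \<forall>x<?l k. Z' (k, x) y = 0"
   and k: "k < Suc q" and x: "x < ?l k"
  have yN: "y \<in> N"
   unfolding N_def
  proof (intro CollectI conjI y allI impI)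
   fix k x assume "k < q" "x < l k"
   then show "Z (k, x) y = 0" using z[rule_format, of k x] Z'k by simp
  qed
  have zey: "ze x y = 0" if "x \<le> s" for x using z[rule_format, of q x] Z'N[OF yN] that by simp
  show "Z' (k, x) (p j t *[M] y) = 0"
  proof (cases "k = q")
   case False
   then show ?thesis using Z'k ZN[OF Np[OF j yN]] k x by simp
  next
   case True
   have xs: "x \<le> s" using x True by simp
   have "ze x (p j t *[M] y) = 0"
   proof (cases "(sg ^^ x) i = (sg ^^ t) j")
    case e: True
    show ?thesis
    proof (cases "x < t")
     case True
     then have "s < s - x + t" using xs by simp
     from big[OF this j yN] show ?thesis using zep[OF j y, of x t] xi0 by simp
    next
     case False
     have "(sg ^^ x) i = (sg ^^ t) ((sg ^^ (x - t)) i)" using False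
      by (metis comp_apply funpow_add le_add_diff_inverse not_less)
     then have "(sg ^^ (x - t)) i = j" using sg_pow_inj[OF sg_pow[OF i(1)] j] e by metis
     then show ?thesis using zey[of "x - t"] zep[OF j y, of x t] False xs e by (simp add: ze_def)
    qed
   qed (simp add: zep[OF j y])
   then show ?thesis using Z'N[OF Np[OF j yN]] True by simp
  qed
 qed
 then show ?thesis by blast
qed

text \<open>A partial basis with the greatest number of summands has zero complement, since
  otherwise another summand could be split off.\<close>

theorem jordan_basis_ex:
 assumes M: "left_module A M" and kb: "k_basis A M B b W"
 shows "\<exists>q v l m Z. jordan_basis M q v l m Z"
proof -
 let ?P = "\<lambda>q. \<exists>v l m Z. partial_jordan_basis M q v l m Z"
 have "?P 0" by (simp add: partial_jordan_basis_def)
 moreover have "q \<le> card B" if "?P q" for q using that partial_jordan_basis_card[OF M kb] by blast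
 ultimately obtain q where q: "?P q" "\<And>q'. ?P q' ==> q' \<le> q" using bounded_nat_max[of ?P] by blast
 then obtain v l m Z where J: "partial_jordan_basis M q v l m Z" by blast
 have "jordan_basis M q v l m Z"
 proof (rule jordan_basis_of_partial[OF M J], rule ccontr)
  fix y assume "y \<in> carrier M" "\<forall>k<q. \<forall>x<l k. Z (k, x) y = 0" "y \<noteq> \<zero>\<^bsub>M\<^esub>"
  then have "?P (Suc q)" by (rule partial_jordan_basis_extend[OF M kb J])
  then show False using q(2) by fastforce
 qed
 then show ?thesis by blast
qed

end

section \<open>Modules given by representations\<close>

lemma rep_module_simps [simp]:
 "carrier (rep_module n d M) = rep_space n d" "zero (rep_module n d M) = (\<lambda>i\<in>{..<n}. 0\<^sub>v (d i))"
 "add (rep_module n d M) v w = (\<lambda>i\<in>{..<n}. v i + w i)"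
 by (simp_all add: rep_module_def)

lemma rep_spaceD: "v \<in> rep_space n d ==> i < n ==> v i \<in> carrier_vec (d i)"
 by (auto simp: rep_space_def)

lemma rep_space_eqI:
 assumes v: "v \<in> rep_space n d" and w: "w \<in> rep_space n d"
  and e: "\<And>j r. j < n ==> r < d j ==> v j $ r = w j $ r"
 shows "v = w"
proof
 fix j
 show "v j = w j"
 proof (cases "j < n")
  case True
  then show ?thesis using rep_spaceD[OF v True] rep_spaceD[OF w True] e by (intro eq_vecI) auto
 next
  case False
  then show ?thesis using v w by (auto simp: rep_space_def PiE_def extensional_def)
 qed
qed

lemma rep_space_add:
 assumes "v \<in> rep_space n d" "w \<in> rep_space n d"
 shows "(\<lambda>i\<in>{..<n}. v i + w i) \<in> rep_space n d"
 unfolding rep_space_def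
 by (rule restrict_PiE_iff[THEN iffD2]) (use assms rep_spaceD in \<open>auto intro!: add_carrier_vec\<close>)

lemma rep_space_zero: "(\<lambda>i\<in>{..<n}. 0\<^sub>v (d i)) \<in> rep_space n d"
 by (auto simp: rep_space_def)

lemma path_mat_closed:
 "M \<in> rep n d ==> i < n ==> path_mat n d M i l \<in> carrier_mat (d ((i + l) mod n)) (d i)"
proof (induction l)
 case (Suc l)
 have j: "(i + l) mod n < n" using Suc.prems by simp
 have "M ((i + l) mod n) \<in> carrier_mat (d ((i + Suc l) mod n)) (d ((i + l) mod n))"
  using repD[OF Suc.prems(1) j] by (simp add: mod_simps)
 then show ?case using Suc by auto
qed simp

lemma path_mat_add:
 assumes M: "M \<in> rep n d" and i: "i < n"
 shows "path_mat n d M i (k + l) = path_mat n d M ((i + l) mod n) k * path_mat n d M i l"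
proof (induction k)
 case 0
 show ?case using left_mult_one_mat[OF path_mat_closed[OF M i, of l]] by simp
next
 case (Suc k)
 have j: "(i + l) mod n < n" "(i + l + k) mod n < n" using i by auto
 have e: "((i + l) mod n + k) mod n = (i + l + k) mod n" by (simp add: mod_simps)
 have "M ((i + l + k) mod n) \<in> carrier_mat (d (((i + l + k) mod n + 1) mod n)) (d ((i + l + k) mod n))"
  by (rule repD[OF M j(2)])
 then have "M ((i + l + k) mod n) * (path_mat n d M ((i + l) mod n) k * path_mat n d M i l)
   = M ((i + l + k) mod n) * path_mat n d M ((i + l) mod n) k * path_mat n d M i l"
  by (rule assoc_mult_mat[symmetric])
   (use path_mat_closed[OF M j(1), of k] path_mat_closed[OF M i, of l] e in auto)
 then show ?case using Suc e by (simp add: add.assoc add.commute[of k l])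
qed

definition path_coord where
 "path_coord n d M v j r = (\<lambda>(i, l). if (i + l) mod n = j then (path_mat n d M i l *\<^sub>v v i) $ r else 0)"

lemma path_action_closed: "path_action n d M x v \<in> rep_space n d"
 by (auto simp: path_action_def rep_space_def)

lemma path_action_dim [simp]: "j < n ==> dim_vec (path_action n d M x v j) = d j"
 by (simp add: path_action_def)

lemma path_action_nth:
 fixes x :: "nat \<times> nat => 'k :: field"
 assumes S: "finite S" "{p. x p \<noteq> 0} \<subseteq> S" and j: "j < n" "r < d j"
 shows "path_action n d M x v j $ r = (\<Sum>p\<in>S. x p * path_coord n d M v j r p)"
proof -
 let ?T = "{(i, l). x (i, l) \<noteq> 0 \<and> (i + l) mod n = j}"
 have "path_action n d M x v j $ r = (\<Sum>(i, l)\<in>?T. x (i, l) * (path_mat n d M i l *\<^sub>v v i) $ r)"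
  using j by (simp add: path_action_def)
 also have "\<dots> = (\<Sum>p\<in>?T. x p * path_coord n d M v j r p)"
  by (rule sum.cong) (auto simp: path_coord_def)
 also have "\<dots> = (\<Sum>p\<in>S. x p * path_coord n d M v j r p)"
  by (rule sum.mono_neutral_left) (use S in \<open>auto simp: path_coord_def split: if_splits\<close>)
 finally show ?thesis .
qed

lemma path_action_lin:
 fixes x y :: "nat \<times> nat => 'k :: field"
 assumes x: "x \<in> carrier (path_algebra n)" and y: "y \<in> carrier (path_algebra n)" and j: "j < n" "r < d j"
 shows "path_action n d M (\<lambda>q. a * x q + y q) v j $ r
  = a * path_action n d M x v j $ r + path_action n d M y v j $ r"
proof -
 let ?S = "{p. x p \<noteq> 0} \<union> {p. y p \<noteq> 0}"
 have fin: "finite ?S" using x y by (simp add: path_carrier_iff)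
 have 1: "{p. a * x p + y p \<noteq> 0} \<subseteq> ?S" "{p. x p \<noteq> 0} \<subseteq> ?S" "{p. y p \<noteq> 0} \<subseteq> ?S" by auto
 show ?thesis
  unfolding path_action_nth[of ?S "\<lambda>q. a * x q + y q" j n r d, OF fin 1(1) j]
   path_action_nth[of ?S x j n r d, OF fin 1(2) j] path_action_nth[of ?S y j n r d, OF fin 1(3) j]
  by (simp add: sum.distrib sum_distrib_left algebra_simps)
qed

lemma path_action_elt:
 assumes j: "j < n" "r < d j"
 shows "path_action n d M (path_elt (i, l)) v j $ r =
  (if (i + l) mod n = j then (path_mat n d M i l *\<^sub>v v i) $ r else 0)"
proof -
 have "{p. path_elt (i, l) p \<noteq> (0 :: 'a)} \<subseteq> {(i, l)}" by (auto simp: path_elt_def)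
 from path_action_nth[of "{(i, l)}" "path_elt (i, l)" j n r d, OF _ this j] show ?thesis
  by (simp add: path_coord_def path_elt_def)
qed

lemma path_action_elt_vertex:
 assumes M: "M \<in> rep n d" and v: "v \<in> rep_space n d" and i: "i < n" and j: "j < n"
 shows "path_action n d M (path_elt (i, l)) v j =
  (if (i + l) mod n = j then path_mat n d M i l *\<^sub>v v i else 0\<^sub>v (d j))"
proof (rule eq_vecI)
 have c: "path_mat n d M i l \<in> carrier_mat (d ((i + l) mod n)) (d i)" by (rule path_mat_closed[OF M i])
 then show d: "dim_vec (path_action n d M (path_elt (i, l)) v j) =
  dim_vec (if (i + l) mod n = j then path_mat n d M i l *\<^sub>v v i else 0\<^sub>v (d j))"
  using j by (auto simp: path_action_def)
 fix r assume "r < dim_vec (if (i + l) mod n = j then path_mat n d M i l *\<^sub>v v i else 0\<^sub>v (d j))"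
 then have "r < d j" using d j by (auto simp: path_action_def)
 then show "path_action n d M (path_elt (i, l)) v j $ r =
   (if (i + l) mod n = j then path_mat n d M i l *\<^sub>v v i else 0\<^sub>v (d j)) $ r"
  using path_action_elt[OF j, of r d M i l v] by simp
qed

lemma path_action_zero: "path_action n d M (\<lambda>_. 0) v = (\<lambda>i\<in>{..<n}. 0\<^sub>v (d i))"
proof (rule rep_space_eqI[OF path_action_closed rep_space_zero])
 fix j r assume "j < n" "r < d j"
 then show "path_action n d M (\<lambda>_. 0) v j $ r = (\<lambda>i\<in>{..<n}. 0\<^sub>v (d i)) j $ r"
  using path_action_nth[of "{}" "\<lambda>_. 0" j n r d M v] by simp
qed

lemma path_action_lin_right:
 fixes M :: "nat => 'k :: field mat"
 assumes M: "M \<in> rep n d" and x: "x \<in> carrier (path_algebra n)" and v: "v \<in> rep_space n d" and w: "w \<in> rep_space n d"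
  and j: "j < n" "r < d j"
 shows "path_action n d M x (\<lambda>i\<in>{..<n}. a \<cdot>\<^sub>v v i + w i) j $ r
  = a * path_action n d M x v j $ r + path_action n d M x w j $ r"
proof -
 have fin: "finite {p. x p \<noteq> 0}" using x by (simp add: path_carrier_iff)
 have "x p * path_coord n d M (\<lambda>i\<in>{..<n}. a \<cdot>\<^sub>v v i + w i) j r p
  = a * (x p * path_coord n d M v j r p) + x p * path_coord n d M w j r p" for p
 proof (cases "x p = 0")
  case False
  obtain i l where p: "p = (i, l)" by fastforce
  have i: "i < n" using path_supp[OF x] False p by blast
  have "(path_mat n d M i l *\<^sub>v (a \<cdot>\<^sub>v v i + w i)) = a \<cdot>\<^sub>v (path_mat n d M i l *\<^sub>v v i) + path_mat n d M i l *\<^sub>v w i"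
   using path_mat_closed[OF M i, of l] rep_spaceD[OF v i] rep_spaceD[OF w i]
   by (simp add: mult_add_distrib_mat_vec mult_mat_vec)
  then show ?thesis using i j path_mat_closed[OF M i, of l]
   by (auto simp: path_coord_def p algebra_simps)
 qed simp
 then show ?thesis
  unfolding path_action_nth[of "{p. x p \<noteq> 0}" x j n r d, OF fin order_refl j] by (simp add: sum.distrib sum_distrib_left)
qed

text \<open>By linearity in both factors this concerns two paths, where it is
  \<open>path_mat_add\<close> if they are composable, and both sides are zero otherwise.\<close>

lemma path_action_mult:
 fixes M :: "nat => 'k :: field mat"
 assumes n: "0 < n" and M: "M \<in> rep n d" and x: "x \<in> carrier (path_algebra n)" and y: "y \<in> carrier (path_algebra n)"
  and v: "v \<in> rep_space n d"
 shows "path_action n d M (mult (path_algebra n) x y) v = path_action n d M x (path_action n d M y v)"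
proof (rule rep_space_eqI[OF path_action_closed path_action_closed])
 fix j r assume j: "j < n" "r < d j"
 show "path_action n d M (mult (path_algebra n) x y) v j $ r = path_action n d M x (path_action n d M y v) j $ r"
  using x
 proof (induction rule: path_induct)
  case zero then show ?case using j by (simp add: path_action_zero)
 next
  case (step p a x)
  have pc: "path_elt p \<in> carrier (path_algebra n)" by (rule path_elt_carrier[OF step.hyps(1)])
  have "path_action n d M (mult (path_algebra n) (path_elt p) y) v j $ r
   = path_action n d M (path_elt p) (path_action n d M y v) j $ r"
   using y
  proof (induction rule: path_induct)
   case zero
   have e: "(\<lambda>i\<in>{..<n}. (-1 :: 'k) \<cdot>\<^sub>v (\<lambda>i\<in>{..<n}. 0\<^sub>v (d i)) i + (\<lambda>i\<in>{..<n}. 0\<^sub>v (d i)) i) = (\<lambda>i\<in>{..<n}. 0\<^sub>v (d i))"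
    by (rule restrict_ext) (auto intro!: eq_vecI)
   have "path_action n d M (path_elt p) (\<lambda>i\<in>{..<n}. 0\<^sub>v (d i)) j $ r = 0"
    using path_action_lin_right[of M n d _ _ _ j r "-1", OF M pc rep_space_zero rep_space_zero j] unfolding e by simp
   then show ?case unfolding path_mult_zero path_action_zero using j by (metis index_zero_vec(1) lessThan_iff restrict_apply')
  next
   case (step p' b y)
   obtain i l i' l' where p: "p = (i, l)" "p' = (i', l')" by fastforce
   have i: "i < n" "i' < n" using pc step.hyps(1) \<open>p \<in> paths n\<close> by (auto simp: p paths_def)
   note pc' = path_elt_carrier[OF step.hyps(1)]
   have "path_action n d M (mult (path_algebra n) (path_elt p) (path_elt p')) v j $ r
    = path_action n d M (path_elt p) (path_action n d M (path_elt p') v) j $ r"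
   proof (cases "i = (i' + l') mod n")
    case True
    have "path_mat n d M i l *\<^sub>v (path_mat n d M i' l' *\<^sub>v v i') = path_mat n d M i' (l + l') *\<^sub>v v i'"
     unfolding path_mat_add[OF M i(2), of l l'] True[symmetric]
     by (rule assoc_mult_mat_vec[symmetric])
      (use path_mat_closed[OF M i(1), of l] path_mat_closed[OF M i(2), of l'] rep_spaceD[OF v i(2)] True in auto)
    moreover have "(i + l) mod n = (i' + (l + l')) mod n" unfolding True by (simp add: mod_simps add_ac)
    ultimately show ?thesis using True
     by (simp add: p path_elt_mult path_action_elt[of j n r d, OF j] path_action_elt_vertex[OF M v i(2) i(1)[unfolded True]])
   next
    case False
    have "path_mat n d M i l *\<^sub>v 0\<^sub>v (d i) = 0\<^sub>v (d ((i + l) mod n))"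
     using path_mat_closed[OF M i(1), of l] by (auto intro!: eq_vecI)
    then show ?thesis using False j
     by (auto simp: p path_elt_mult path_action_elt[of j n r d, OF j] path_action_elt_vertex[OF M v i(2) i(1)] path_action_zero)
   qed
   moreover have "path_action n d M (\<lambda>q. b * path_elt p' q + y q) v
    = (\<lambda>i\<in>{..<n}. b \<cdot>\<^sub>v path_action n d M (path_elt p') v i + path_action n d M y v i)"
   proof (rule rep_space_eqI[OF path_action_closed])
    fix j r assume "j < n" "r < d j"
    then show "path_action n d M (\<lambda>q. b * path_elt p' q + y q) v j $ r
     = (\<lambda>i\<in>{..<n}. b \<cdot>\<^sub>v path_action n d M (path_elt p') v i + path_action n d M y v i) j $ r"
     using path_action_lin[OF pc' step.hyps(4), of j r d M b v] by simp
   qed (auto simp: rep_space_def path_action_def)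
   ultimately show ?case
    using step.IH path_action_lin_right[of M n d _ _ _ j r, OF M pc path_action_closed path_action_closed j]
     path_action_lin[of _ n _ j r d, OF path_mult_closed[OF n pc pc'] path_mult_closed[OF n pc step.hyps(4)] j]
    by (simp only: path_mult_linear)
  qed
  then show ?case
   using step.IH path_action_lin[of _ n _ j r d, OF pc step.hyps(4) j]
    path_action_lin[of _ n _ j r d, OF path_mult_closed[OF n pc y] path_mult_closed[OF n step.hyps(4) y] j]
   by (simp only: path_mult_linear)
 qed
qed

lemma path_action_one:
 assumes n: "0 < n" and v: "v \<in> rep_space n d"
 shows "path_action n d M (\<lambda>(i, l). if i < n \<and> l = 0 then 1 else (0 :: 'k :: field)) v = v"
proof (rule rep_space_eqI[OF path_action_closed v])
 fix j r assume j: "j < n" "r < d j"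
 let ?x = "\<lambda>(i, l). if i < n \<and> l = 0 then 1 else (0 :: 'k)"
 have "path_action n d M ?x v j $ r = (\<Sum>p\<in>{..<n} \<times> {0 :: nat}. ?x p * path_coord n d M v j r p)"
  by (rule path_action_nth[of "{..<n} \<times> {0 :: nat}" ?x j n r d M v, OF _ _ j]) (auto split: if_splits)
 also have "\<dots> = (\<Sum>p\<in>{..<n} \<times> {0 :: nat}. if p = (j, 0) then v j $ r else 0)"
  by (rule sum.cong) (use j rep_spaceD[OF v] in \<open>auto simp: path_coord_def split: if_splits\<close>)
 also have "\<dots> = v j $ r" using j by simp
 finally show "path_action n d M ?x v j $ r = v j $ r" .
qed

lemma path_action_scalar:
 assumes n: "0 < n" and v: "v \<in> rep_space n d" and j: "j < n" "r < d j"
 shows "path_action n d M (scalar (path_algebra n) a) v j $ r = a * v j $ r"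
proof -
 have "(\<lambda>_. 0) \<in> carrier (path_algebra n)" by (simp add: path_carrier_iff)
 from path_action_lin[of "\<lambda>(i, l). if i < n \<and> l = 0 then 1 else 0" n "\<lambda>_. 0" j r d M a v, OF path_one_carrier this j]
 show ?thesis using path_action_one[OF n v, of M] j by (simp add: path_action_zero)
qed

definition unit_rep :: "nat => (nat => nat) => nat \<times> nat => nat => 'k :: field vec" where
 "unit_rep n d = (\<lambda>(j, r). \<lambda>i\<in>{..<n}. if i = j then unit_vec (d i) r else 0\<^sub>v (d i))"

lemma unit_rep_closed: "unit_rep n d be \<in> rep_space n d"
 by (auto simp: unit_rep_def rep_space_def split: prod.splits)

lemma unit_rep_nth: "i < n ==> s < d i ==> unit_rep n d (j, r) i $ s = (if i = j \<and> s = r then 1 else 0)"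
 by (auto simp: unit_rep_def unit_vec_def)

lemma unit_rep_self: "j < n ==> unit_rep n d (j, r) j = unit_vec (d j) r"
 by (simp add: unit_rep_def)

lemma path_mat_unit:
 assumes M: "M \<in> rep n d" and i: "i < n" and r: "r < d ((i + l) mod n)" and s: "s < d i"
 shows "path_mat n d M i l $$ (r, s) = path_action n d M (path_elt (i, l)) (unit_rep n d (i, s)) ((i + l) mod n) $ r"
proof -
 have "(i + l) mod n < n" using i by simp
 then show ?thesis using path_action_elt[of "(i + l) mod n" n r d M i l] r
   path_mat_closed[OF M i, of l] s mult_mat_vec_def
  by (simp add: unit_rep_self[OF i])
qed

text \<open>This turns the module condition into equations. The long paths belong to the ideal and
  unit vectors recover their matrix entries; conversely, an element of the ideal acts only through
  long paths.\<close>

lemma mod_variety_iff: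
 fixes M :: "nat => 'k :: field mat"
 shows "M \<in> mod_variety n (long_ideal n c) d \<longleftrightarrow>
  M \<in> rep n d \<and> (\<forall>i<n. \<forall>l\<ge>c i. path_mat n d M i l = 0\<^sub>m (d ((i + l) mod n)) (d i))"
proof (cases "M \<in> rep n d")
 case M: True
 show ?thesis
 proof
  assume "M \<in> mod_variety n (long_ideal n c) d"
  then have z: "path_action n d M x v = (\<lambda>i\<in>{..<n}. 0\<^sub>v (d i))"
   if "x \<in> long_ideal n c" "v \<in> rep_space n d" for x v using that by (simp add: mod_variety_def)
  have "path_mat n d M i l = 0\<^sub>m (d ((i + l) mod n)) (d i)" if i: "i < n" and l: "c i \<le> l" for i l
  proof (rule eq_matI)
   fix r s assume "r < dim_row (0\<^sub>m (d ((i + l) mod n)) (d i) :: 'k mat)" "s < dim_col (0\<^sub>m (d ((i + l) mod n)) (d i) :: 'k mat)"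
   then have rs: "r < d ((i + l) mod n)" "s < d i" by simp_all
   have "path_elt (i, l) \<in> (long_ideal n c :: (nat \<times> nat => 'k) set)" using path_elt_long_ideal[OF i] l by blast
   from z[OF this unit_rep_closed] show "path_mat n d M i l $$ (r, s) = 0\<^sub>m (d ((i + l) mod n)) (d i) $$ (r, s)"
    unfolding path_mat_unit[OF M i rs] using rs i by simp
  qed (use path_mat_closed[OF M i, of l] in auto)
  then show "M \<in> rep n d \<and> (\<forall>i<n. \<forall>l\<ge>c i. path_mat n d M i l = 0\<^sub>m (d ((i + l) mod n)) (d i))" using M by blast
 next
  assume *: "M \<in> rep n d \<and> (\<forall>i<n. \<forall>l\<ge>c i. path_mat n d M i l = 0\<^sub>m (d ((i + l) mod n)) (d i))"
  have "path_action n d M x v = (\<lambda>i\<in>{..<n}. 0\<^sub>v (d i))"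
   if x: "x \<in> long_ideal n c" and v: "v \<in> rep_space n d" for x v
  proof (rule rep_space_eqI[OF path_action_closed rep_space_zero])
   fix j r assume j: "j < n" "r < d j"
   have xc: "x \<in> carrier (path_algebra n)" by (rule long_ideal_carrier[OF x])
   then have fin: "finite {p. x p \<noteq> 0}" by (simp add: path_carrier_iff)
   have "path_coord n d M v j r p = 0" if "x p \<noteq> 0" for p
   proof -
    obtain i l where p: "p = (i, l)" by fastforce
    have i: "i < n" "c i \<le> l" using path_supp[OF xc] long_idealD[OF x] that p by blast+
    then have "path_mat n d M i l = 0\<^sub>m (d ((i + l) mod n)) (d i)" using * by blast
    then show ?thesis using rep_spaceD[OF v i(1)] j by (simp add: path_coord_def p)
   qed
   then show "path_action n d M x v j $ r = (\<lambda>i\<in>{..<n}. 0\<^sub>v (d i)) j $ r"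
    using path_action_nth[of "{p. x p \<noteq> 0}" x j n r d M v, OF fin order_refl j] j by simp
  qed
  then show "M \<in> mod_variety n (long_ideal n c) d" using M by (simp add: mod_variety_def)
 qed
qed (simp add: mod_variety_def)

lemma mat_cancel_middle:
 assumes c: "X \<in> carrier_mat a b" "H' \<in> carrier_mat b b" "H \<in> carrier_mat b b" "P \<in> carrier_mat b c" "K \<in> carrier_mat c e"
  and e: "H' * H = (1\<^sub>m b :: 'k :: field mat)"
 shows "(X * H') * (H * P * K) = X * P * K" "H' * (H * P * K) = P * K"
proof -
 note PK = mult_carrier_mat[OF c(4,5)]
 have 1: "H * P * K = H * (P * K)" by (rule assoc_mult_mat[OF c(3,4,5)])
 have "H' * (H * (P * K)) = H' * H * (P * K)" by (rule assoc_mult_mat[OF c(2,3) PK, symmetric])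
 then show 2: "H' * (H * P * K) = P * K" unfolding 1 e left_mult_one_mat[OF PK] .
 have "(X * H') * (H * P * K) = X * (H' * (H * P * K))"
  unfolding 1 by (rule assoc_mult_mat[OF c(1,2) mult_carrier_mat[OF c(3) PK]])
 then show "(X * H') * (H * P * K) = X * P * K" unfolding 2 assoc_mult_mat[OF c(1,4,5)] .
qed

text \<open>The group elements at the inner vertices cancel along the path.\<close>

lemma path_mat_act:
 assumes g: "g \<in> GLd n d" and M: "(M :: nat => 'k :: field mat) \<in> rep n d" and i: "i < n"
 shows "path_mat n d (rep_act n d g M) i l
  = g ((i + l) mod n) * path_mat n d M i l * inv\<^bsub>ring_mat TYPE('k) (d i) ()\<^esub> (g i)"
proof (induction l)
 case 0
 show ?case using i GLdD[OF g i] GL_inv[OF GLdD(1)[OF g i]] by simp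
next
 case (Suc l)
 let ?j = "(i + l) mod n" and ?j' = "(i + Suc l) mod n"
 let ?gi = "inv\<^bsub>ring_mat TYPE('k) (d i) ()\<^esub> (g i)" and ?gj = "inv\<^bsub>ring_mat TYPE('k) (d ?j) ()\<^esub> (g ?j)"
 have j: "?j < n" "?j' < n" using i by auto
 have e: "(?j + 1) mod n = ?j'" by (simp add: mod_simps)
 have c: "g ?j' \<in> carrier_mat (d ?j') (d ?j')" "M ?j \<in> carrier_mat (d ?j') (d ?j)"
  "?gj \<in> carrier_mat (d ?j) (d ?j)" "g ?j \<in> carrier_mat (d ?j) (d ?j)"
  "path_mat n d M i l \<in> carrier_mat (d ?j) (d i)" "?gi \<in> carrier_mat (d i) (d i)"
  using GLdD(2)[OF g j(2)] repD[OF M j(1)] GL_inv(1)[OF GLdD(1)[OF g j(1)]] GLdD(2)[OF g j(1)]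
   path_mat_closed[OF M i, of l] GL_inv(1)[OF GLdD(1)[OF g i]] unfolding e by blast+
 have "path_mat n d (rep_act n d g M) i (Suc l) = rep_act n d g M ?j * path_mat n d (rep_act n d g M) i l" by simp
 also have "rep_act n d g M ?j = g ?j' * M ?j * ?gj" using j e by (simp add: rep_act_def)
 also have "path_mat n d (rep_act n d g M) i l = g ?j * path_mat n d M i l * ?gi" by (rule Suc.IH)
 also have "(g ?j' * M ?j * ?gj) * (g ?j * path_mat n d M i l * ?gi) = g ?j' * M ?j * path_mat n d M i l * ?gi"
  by (rule mat_cancel_middle(1)[OF mult_carrier_mat[OF c(1,2)] c(3-6) GL_inv(3)[OF GLdD(1)[OF g j(1)]]])
 also have "g ?j' * M ?j * path_mat n d M i l = g ?j' * (M ?j * path_mat n d M i l)"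
  by (rule assoc_mult_mat[OF c(1,2,5)])
 finally show ?case by simp
qed

lemma path_mat_act_zero_iff:
 assumes g: "g \<in> GLd n d" and M: "(M :: nat => 'k :: field mat) \<in> rep n d" and i: "i < n"
 shows "path_mat n d (rep_act n d g M) i l = 0\<^sub>m (d ((i + l) mod n)) (d i)
  \<longleftrightarrow> path_mat n d M i l = 0\<^sub>m (d ((i + l) mod n)) (d i)"
proof -
 let ?j = "(i + l) mod n" and ?P = "path_mat n d M i l"
 let ?gi = "inv\<^bsub>ring_mat TYPE('k) (d i) ()\<^esub> (g i)" and ?gj = "inv\<^bsub>ring_mat TYPE('k) (d ?j) ()\<^esub> (g ?j)"
 have j: "?j < n" using i by auto
 note gi = GL_inv[OF GLdD(1)[OF g i]] and gj = GL_inv[OF GLdD(1)[OF g j]]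
 note c = GLdD(2)[OF g i] GLdD(2)[OF g j] path_mat_closed[OF M i, of l] gi(1) gj(1)
 have "?gj * (g ?j * ?P * ?gi) * g i = ?P * ?gi * g i"
  by (simp only: mat_cancel_middle(2)[OF c(5) c(5,2,3,4) gj(3)])
 also have "\<dots> = ?P * (?gi * g i)" by (rule assoc_mult_mat[OF c(3,4,1)])
 also have "\<dots> = ?P" unfolding gi(3) by (rule right_mult_one_mat[OF c(3)])
 finally have e: "?gj * (g ?j * ?P * ?gi) * g i = ?P" .
 show ?thesis unfolding path_mat_act[OF g M i]
 proof
  assume "g ?j * ?P * ?gi = 0\<^sub>m (d ?j) (d i)"
  then show "?P = 0\<^sub>m (d ?j) (d i)" using e c by simp
 next
  assume "?P = 0\<^sub>m (d ?j) (d i)"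
  then show "g ?j * ?P * ?gi = 0\<^sub>m (d ?j) (d i)" using c by simp
 qed
qed

context cyclic_algebra
begin

lemma jordan_basis_reindex:
 assumes J: "jordan_basis M q v l m Z" and pr: "bij_betw pr {..<q'} {..<q}"
  and v': "\<And>k. k < q' ==> v' k = v (pr k)" and l': "\<And>k. k < q' ==> l' k = l (pr k)"
 shows "jordan_basis M q' v' l' (m \<circ> pr) (\<lambda>(k, x). Z (pr k, x))"
proof -
 note M = jordan_left_module[OF J] and vl = jordan_gens[OF J] and kb = jordan_k_basis[OF J]
 have prq: "pr k < q" if "k < q'" for k using pr that by (auto simp: bij_betw_def)
 have pri: "pr k = pr k' \<longleftrightarrow> k = k'" if "k < q'" "k' < q'" for k k'
  using pr that by (auto simp: bij_betw_def inj_on_def)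
 have "k_basis A M {(k, x). k < q' \<and> x < l' k} (\<lambda>(k, x). p (v' k) x *[M] (m \<circ> pr) k) (\<lambda>(k, x). Z (pr k, x))"
 proof (rule k_basisI[OF unital_algebra_axioms M])
  have "{(k, x). k < q' \<and> x < l' k} = (SIGMA k:{..<q'}. {..<l' k})" by auto
  then show "finite {(k, x). k < q' \<and> x < l' k}" by simp
  fix be assume "be \<in> {(k, x). k < q' \<and> x < l' k}"
  then obtain k x where be: "be = (k, x)" "k < q'" "x < l' k" by auto
  note prk = prq[OF be(2)]
  have x: "x < l (pr k)" using be l' by simp
  show "(case be of (k, x) => p (v' k) x *[M] (m \<circ> pr) k) \<in> carrier M"
   using lmod_smult_closed[OF M p_closed[OF vl(1)[OF prk]] vl(3)[OF prk]] be v' by simp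
  show "(case be of (k, x) => Z (pr k, x)) (y +[M] z) = (case be of (k, x) => Z (pr k, x)) y + (case be of (k, x) => Z (pr k, x)) z"
   if "y \<in> carrier M" "z \<in> carrier M" for y z
   using jordan_Z_add[OF J prk x that] by (simp add: be(1))
  show "(case be of (k, x) => Z (pr k, x)) (scalar A a *[M] y) = a * (case be of (k, x) => Z (pr k, x)) y"
   if "y \<in> carrier M" for a y
   using jordan_Z_scalar[OF J prk x that] by (simp add: be(1))
  fix ga assume "ga \<in> {(k, x). k < q' \<and> x < l' k}"
  then obtain k' x' where ga: "ga = (k', x')" "k' < q'" "x' < l' k'" by auto
  show "(case be of (k, x) => Z (pr k, x)) (case ga of (k, x) => p (v' k) x *[M] (m \<circ> pr) k) = (if be = ga then 1 else 0)"
   using jordan_Z_pm[OF J prk x prq[OF ga(2)], of x'] pri[OF be(2) ga(2)] v'[OF ga(2)] by (simp add: be(1) ga(1))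
 next
  fix y z assume y: "y \<in> carrier M" and z: "z \<in> carrier M"
   and e: "\<And>be. be \<in> {(k, x). k < q' \<and> x < l' k} ==>
    (case be of (k, x) => Z (pr k, x)) y = (case be of (k, x) => Z (pr k, x)) z"
  show "y = z"
  proof (rule k_basis_eqI[OF kb y z _ M], clarify)
   fix k x assume k: "k < q" "x < l k"
   then obtain k' where k': "k' < q'" "k = pr k'" using pr by (auto simp: bij_betw_def)
   then show "Z (k, x) y = Z (k, x) z" using e[of "(k', x)"] l' k by simp
  qed
 qed
 moreover have "\<forall>k<q'. v' k < n \<and> 0 < l' k \<and> (m \<circ> pr) k \<in> carrier M
   \<and> p (v' k) 0 *[M] (m \<circ> pr) k = (m \<circ> pr) k \<and> p (v' k) (l' k) *[M] (m \<circ> pr) k = \<zero>\<^bsub>M\<^esub>"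
  using vl[OF prq] v' l' by simp
 ultimately show ?thesis using M by (simp add: jordan_basis_def)
qed

end

context nakayama_quotient
begin

sublocale C: cyclic_algebra A n sg c p Y by (rule A_cyclic)

lemma variety_rep: "M \<in> mod_variety n I d ==> M \<in> rep n d"
 by (simp add: mod_variety_def)

lemma rep_smult:
 assumes M: "M \<in> mod_variety n I d" and x: "x \<in> carrier B" and v: "v \<in> rep_space n d"
 shows "q x *[rep_module n d M] v = path_action n d M x v"
proof -
 define y where "y = (SOME y. y \<in> q x)"
 have "y \<in> q x" unfolding y_def by (rule someI[of "\<lambda>y. y \<in> q x", OF q_self[OF x]])
 then obtain h where h: "h \<in> I" "y = h +[B] x" using q_rep(4)[OF x] by blast
 have hB: "h \<in> carrier B" using h(1) I.a_Hcarr by simp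
 have "path_action n d M h v = (\<lambda>i\<in>{..<n}. 0\<^sub>v (d i))" using M h(1) v by (simp add: mod_variety_def)
 then have "path_action n d M y v = path_action n d M x v"
  using path_action_lin[of h n x _ _ d M 1 v] hB x
  by (intro rep_space_eqI[OF path_action_closed path_action_closed]) (simp add: h(2) B_def)
 then show ?thesis by (simp add: rep_module_def y_def)
qed

lemma rep_left_module:
 assumes M: "M \<in> mod_variety n I d"
 shows "left_module A (rep_module n d M)"
proof -
 let ?R = "rep_module n d M"
 note Mr = variety_rep[OF M]
 have sm: "q x *[?R] v = path_action n d M x v" if "x \<in> carrier B" "v \<in> rep_space n d" for x v
  by (rule rep_smult[OF M that])
 show ?thesis unfolding left_module_def
 proof (intro conjI ballI)
  show "abelian_group ?R"
  proof (rule abelian_groupI)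
   fix v w u assume v: "v \<in> carrier ?R" and w: "w \<in> carrier ?R" and u: "u \<in> carrier ?R"
   show "v +[?R] w \<in> carrier ?R" using v w rep_space_add by simp
   show "v +[?R] w +[?R] u = v +[?R] (w +[?R] u)"
    using v w u rep_spaceD[of v n d] rep_spaceD[of w n d] rep_spaceD[of u n d]
    by (auto simp: fun_eq_iff intro!: assoc_add_vec)
   show "v +[?R] w = w +[?R] v"
    using v w rep_spaceD[of v n d] rep_spaceD[of w n d] by (auto simp: fun_eq_iff intro!: comm_add_vec)
   show "\<zero>\<^bsub>?R\<^esub> +[?R] v = v"
    by (rule rep_space_eqI[of _ n d]) (use v rep_spaceD[of v n d] rep_space_add[OF rep_space_zero] in auto)
   have "(\<lambda>i\<in>{..<n}. - v i) \<in> rep_space n d"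
   proof -
    have "v i \<in> carrier_vec (d i)" if "i < n" for i using v rep_spaceD[of v n d i] that by simp
    then show ?thesis unfolding rep_space_def by (intro restrict_PiE_iff[THEN iffD2]) auto
   qed
   moreover have "(\<lambda>i\<in>{..<n}. - v i) +[?R] v = \<zero>\<^bsub>?R\<^esub>"
    using v rep_spaceD[of v n d] by (auto simp: fun_eq_iff intro!: uminus_l_inv_vec)
   ultimately show "\<exists>y\<in>carrier ?R. y +[?R] v = \<zero>\<^bsub>?R\<^esub>" by (auto simp del: rep_module_simps(2,3))
  qed (simp add: rep_space_zero)
 next
  fix a v assume "a \<in> carrier A" and v: "v \<in> carrier ?R"
  then obtain x where x: "x \<in> carrier B" "a = q x" using A_simps(1) by auto
  then show "a *[?R] v \<in> carrier ?R" using sm path_action_closed v by simp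
 next
  fix a b v assume "a \<in> carrier A" "b \<in> carrier A" and v: "v \<in> carrier ?R"
  then obtain x y where x: "x \<in> carrier B" "a = q x" "y \<in> carrier B" "b = q y" using A_simps(1) by auto
  have v': "v \<in> rep_space n d" using v by simp
  note xy = x(1,3)[unfolded B_def]
  have "path_action n d M (x +[B] y) v = path_action n d M x v +[?R] path_action n d M y v"
  proof (rule rep_space_eqI[OF path_action_closed])
   fix j r assume j: "j < n" "r < d j"
   then show "path_action n d M (x +[B] y) v j $ r = (path_action n d M x v +[?R] path_action n d M y v) j $ r"
    using path_action_lin[of x n y j r d M 1 v, OF xy j] rep_spaceD[OF path_action_closed[of n d M]]
    by (simp add: B_def)
  qed (use rep_space_add[OF path_action_closed path_action_closed] in simp)
  then show "(a +[A] b) *[?R] v = a *[?R] v +[?R] b *[?R] v"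
   using A_simps(2)[OF x(1,3)] sm[OF x(1) v'] sm[OF x(3) v'] sm[OF B.a_closed[OF x(1,3)] v'] x by simp
  have "path_action n d M (x \<otimes>\<^bsub>B\<^esub> y) v = path_action n d M x (path_action n d M y v)"
   unfolding B_def by (rule path_action_mult[OF n Mr xy v'])
  then show "(a \<otimes>\<^bsub>A\<^esub> b) *[?R] v = a *[?R] (b *[?R] v)"
   using A_simps(3)[OF x(1,3)] sm[OF x(1) path_action_closed] sm[OF x(3) v'] sm[OF B.m_closed[OF x(1,3)] v'] x by simp
 next
  fix a v w assume "a \<in> carrier A" and v: "v \<in> carrier ?R" and w: "w \<in> carrier ?R"
  then obtain x where x: "x \<in> carrier B" "a = q x" using A_simps(1) by auto
  have vw: "v \<in> rep_space n d" "w \<in> rep_space n d" using v w by simp_all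
  have 1: "(\<lambda>i\<in>{..<n}. 1 \<cdot>\<^sub>v v i + w i) = (\<lambda>i\<in>{..<n}. v i + w i)" by (rule restrict_ext) simp
  have "path_action n d M x (v +[?R] w) = path_action n d M x v +[?R] path_action n d M x w"
  proof (rule rep_space_eqI[OF path_action_closed])
   fix j r assume j: "j < n" "r < d j"
   then show "path_action n d M x (v +[?R] w) j $ r = (path_action n d M x v +[?R] path_action n d M x w) j $ r"
    using path_action_lin_right[of M n d x v w j r 1, OF Mr x(1)[unfolded B_def] vw j] rep_spaceD[OF path_action_closed[of n d M]]
    unfolding 1 by simp
  qed (use rep_space_add[OF path_action_closed path_action_closed] in simp)
  then show "a *[?R] (v +[?R] w) = a *[?R] v +[?R] a *[?R] w"
   using sm[OF x(1)] vw rep_space_add[OF vw] x by simp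
 next
  fix v assume v: "v \<in> carrier ?R"
  then have v': "v \<in> rep_space n d" by simp
  show "\<one>\<^bsub>A\<^esub> *[?R] v = v"
   using sm[OF B.one_closed v'] path_action_one[OF n v', of M] A_simps(4) by (simp add: B_def)
 qed
qed

lemma rep_p:
 assumes M: "M \<in> mod_variety n I d" and v: "v \<in> rep_space n d" and i: "i < n" and j: "j < n"
 shows "(p i l *[rep_module n d M] v) j = (if (i + l) mod n = j then path_mat n d M i l *\<^sub>v v i else 0\<^sub>v (d j))"
 unfolding p_def rep_smult[OF M path_elt_B[OF i] v]
 by (rule path_action_elt_vertex[OF variety_rep[OF M] v i j])

lemma rep_scalar:
 assumes M: "M \<in> mod_variety n I d" and v: "v \<in> rep_space n d" and j: "j < n" "r < d j"
 shows "(scalar A a *[rep_module n d M] v) j $ r = a * v j $ r"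
 unfolding scalar_A rep_smult[OF M scalar_B_carrier v] unfolding B_def
 by (rule path_action_scalar[OF n v j])

abbreviation "vertex_basis d \<equiv> {(j, r). j < n \<and> r < d j}"

lemma rep_k_basis:
 assumes M: "M \<in> mod_variety n I d"
 shows "k_basis A (rep_module n d M) (vertex_basis d) (unit_rep n d) (\<lambda>(j, r) v. v j $ r)"
proof (rule k_basisI[OF A_algebra rep_left_module[OF M]])
 have "vertex_basis d = (SIGMA j:{..<n}. {..<d j})" by auto
 then show "finite (vertex_basis d)" by simp
 fix be assume "be \<in> vertex_basis d"
 then obtain j r where be: "be = (j, r)" "j < n" "r < d j" by auto
 show "unit_rep n d be \<in> carrier (rep_module n d M)" by (simp add: unit_rep_closed)
 show "(case be of (j, r) => \<lambda>v. v j $ r) (v +[rep_module n d M] w)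
  = (case be of (j, r) => \<lambda>v. v j $ r) v + (case be of (j, r) => \<lambda>v. v j $ r) w"
  if "v \<in> carrier (rep_module n d M)" "w \<in> carrier (rep_module n d M)" for v w
  using that be rep_spaceD[of v n d j] rep_spaceD[of w n d j] by simp
 show "(case be of (j, r) => \<lambda>v. v j $ r) (scalar A a *[rep_module n d M] v) = a * (case be of (j, r) => \<lambda>v. v j $ r) v"
  if "v \<in> carrier (rep_module n d M)" for a v
  using that be rep_scalar[OF M, of v j r a] by simp
 fix ga assume "ga \<in> vertex_basis d"
 then show "(case be of (j, r) => \<lambda>v. v j $ r) (unit_rep n d ga) = (if be = ga then 1 else 0)"
  using be by (auto simp: unit_rep_nth split: if_splits)
next
 fix v w assume vw: "v \<in> carrier (rep_module n d M)" "w \<in> carrier (rep_module n d M)"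
  and e: "\<And>be. be \<in> vertex_basis d ==> (case be of (j, r) => \<lambda>v. v j $ r) v = (case be of (j, r) => \<lambda>v. v j $ r) w"
 show "v = w"
  by (rule rep_space_eqI[of _ n d]) (use vw e in fastforce)+
qed

lemma rep_jordan_basis_ex:
 assumes M: "M \<in> mod_variety n I d"
 obtains h v l m Z where "C.jordan_basis (rep_module n d M) h v l m Z"
 using C.jordan_basis_ex[OF rep_left_module[OF M] rep_k_basis[OF M]] by blast

text \<open>The unit vectors and the Jordan basis both consist of vectors supported at single
  vertices, so they have equally many members at \<open>j\<close>.\<close>

lemma rep_jordan_dim:
 assumes M: "M \<in> mod_variety n I d" and J: "C.jordan_basis (rep_module n d M) h v l m Z" and j: "j < n"
 shows "d j = card {(k, x). k < h \<and> x < l k \<and> (v k + x) mod n = j}"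
proof -
 let ?R = "rep_module n d M"
 note R = rep_left_module[OF M] and kb = rep_k_basis[OF M] and kb' = C.jordan_k_basis[OF J]
 note vl = C.jordan_gens[OF J]
 have w: "fst be < n \<and> p (fst be) 0 *[?R] unit_rep n d be = unit_rep n d be" if b: "be \<in> vertex_basis d" for be
 proof -
  obtain i r where be: "be = (i, r)" "i < n" "r < d i" using b by auto
  have "p i 0 *[?R] unit_rep n d be = unit_rep n d be"
  proof (rule rep_space_eqI)
   show "p i 0 *[?R] unit_rep n d be \<in> rep_space n d"
    by (rule lmod_smult_closed[OF R C.p_closed[OF be(2)], unfolded rep_module_simps(1), OF unit_rep_closed])
   fix t s assume ts: "t < n" "s < d t"
   have one: "1\<^sub>m (d i) *\<^sub>v unit_rep n d be i = unit_rep n d be i"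
    by (rule one_mult_mat_vec[OF rep_spaceD[OF unit_rep_closed be(2)]])
   have "(p i 0 *[?R] unit_rep n d be) t = (if i = t then unit_rep n d be i else 0\<^sub>v (d t))"
    using rep_p[OF M unit_rep_closed be(2) ts(1), of 0 be]
    by (simp only: path_mat.simps(1) one add_0_right mod_less[OF be(2)])
   then show "(p i 0 *[?R] unit_rep n d be) t $ s = unit_rep n d be t $ s"
    using be ts
    by (cases "t = i") (simp_all add: unit_rep_nth)
  qed (rule unit_rep_closed)
  then show ?thesis using be by simp
 qed
 have w': "(case be of (k, x) => (sg ^^ x) (v k)) < n \<and>
   p (case be of (k, x) => (sg ^^ x) (v k)) 0 *[?R] (case be of (k, x) => p (v k) x *[?R] m k)
   = (case be of (k, x) => p (v k) x *[?R] m k)" if b: "be \<in> {(k, x). k < h \<and> x < l k}" for be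
 proof -
  obtain k x where be: "be = (k, x)" "k < h" "x < l k" using b by auto
  note s = C.sg_pow[OF vl(1)[OF be(2)], of x]
  show ?thesis using C.jordan_p_pm[OF J be(2) s, of 0 x] s by (simp add: be(1))
 qed
 have "card {be \<in> vertex_basis d. fst be = j} = card {be \<in> {(k, x). k < h \<and> x < l k}. (case be of (k, x) => (sg ^^ x) (v k)) = j}"
  by (rule antisym; rule C.k_basis_vertex_card_le[OF R]) (rule kb kb' w w'; assumption?)+
 moreover have "{be \<in> vertex_basis d. fst be = j} = Pair j ` {..<d j}" using j by auto
 then have "card {be \<in> vertex_basis d. fst be = j} = d j" by (simp add: card_image inj_on_def)
 moreover have "{be \<in> {(k, x). k < h \<and> x < l k}. (case be of (k, x) => (sg ^^ x) (v k)) = j}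
  = {(k, x). k < h \<and> x < l k \<and> (v k + x) mod n = j}"
  using sg_pow_mod[OF vl(1)] by auto
 ultimately show ?thesis by simp
qed

lemma supported_functional:
 assumes M: "M \<in> mod_variety n I d" and j: "j < n" and w: "w \<in> rep_space n d"
  and z: "\<And>i. i < n ==> i \<noteq> j ==> w i = 0\<^sub>v (d i)"
  and add: "\<And>x y. x \<in> rep_space n d ==> y \<in> rep_space n d ==> f (x +[rep_module n d M] y) = f x + f y"
  and hom: "\<And>a x. x \<in> rep_space n d ==> f (scalar A a *[rep_module n d M] x) = a * f x"
 shows "f w = (\<Sum>t<d j. w j $ t * f (unit_rep n d (j, t)))"
proof -
 have fin: "finite (vertex_basis d)" using rep_k_basis[OF M] by (simp add: k_basis_def)
 have "f w = (\<Sum>be\<in>vertex_basis d. (case be of (j, r) => \<lambda>v. v j $ r) w * f (unit_rep n d be))"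
  by (rule C.k_basis_functional[where fi = f, OF rep_left_module[OF M] rep_k_basis[OF M],
    unfolded rep_module_simps(1), OF add hom w])
 also have "\<dots> = (\<Sum>be\<in>Pair j ` {..<d j}. (case be of (j, r) => \<lambda>v. v j $ r) w * f (unit_rep n d be))"
 proof (rule sum.mono_neutral_right[OF fin], use j in force, rule ballI)
  fix be assume "be \<in> vertex_basis d - Pair j ` {..<d j}"
  then obtain i r where "be = (i, r)" "i < n" "r < d i" "i \<noteq> j" by auto
  then show "(case be of (j, r) => \<lambda>v. v j $ r) w * f (unit_rep n d be) = 0" using z by simp
 qed
 also have "\<dots> = (\<Sum>t<d j. w j $ t * f (unit_rep n d (j, t)))"
  by (subst sum.reindex) (auto simp: inj_on_def)
 finally show ?thesis .
qed

end

section \<open>Jordan bases of equal shape and orbits\<close>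

context nakayama_quotient
begin

lemma rep_coord_expansion:
 assumes M: "M \<in> mod_variety n I d" and J: "C.jordan_basis (rep_module n d M) h v l m Z"
  and y: "y \<in> rep_space n d" and j: "j < n" "r < d j"
 shows "y j $ r = (\<Sum>be\<in>{(k, x). k < h \<and> x < l k}. Z be y * (case be of (k, x) => p (v k) x *[rep_module n d M] m k) j $ r)"
proof (rule C.k_basis_functional[where fi = "\<lambda>y. y j $ r", OF rep_left_module[OF M] C.jordan_k_basis[OF J],
   unfolded rep_module_simps(1)])
 show "(x +[rep_module n d M] z) j $ r = x j $ r + z j $ r" if "x \<in> rep_space n d" "z \<in> rep_space n d" for x z
  using rep_spaceD[OF that(1) j(1)] rep_spaceD[OF that(2) j(1)] j by simp
qed (use y rep_scalar[OF M _ j] in auto)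

lemma jordan_vertex_support:
 assumes M: "M \<in> mod_variety n I d" and J: "C.jordan_basis (rep_module n d M) h v l m Z"
  and k: "k < h" and j: "j < n" "j \<noteq> (v k + x) mod n"
 shows "(p (v k) x *[rep_module n d M] m k) j = 0\<^sub>v (d j)"
 using rep_p[OF M _ C.jordan_gens(1)[OF J k] j(1), of "m k" x] C.jordan_gens(3)[OF J k] j(2) by auto

text \<open>
 Two modules with Jordan bases of the same shape: the coordinate matrices of the linear map that
 matches the bases and of its inverse.
\<close>

definition transfer_mat where
 "transfer_mat d h l Z b j =
   Matrix.mat (d j) (d j) (\<lambda>(r, s). \<Sum>be\<in>{(k, x). k < h \<and> x < l k}. Z be (unit_rep n d (j, s)) * b be j $ r)"

lemma transfer_mat_inverse:
 assumes M: "M \<in> mod_variety n I d" and J: "C.jordan_basis (rep_module n d M) h v l m Z"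
  and M': "M' \<in> mod_variety n I d" and J': "C.jordan_basis (rep_module n d M') h v l m' Z'"
  and j: "j < n"
 shows "transfer_mat d h l Z' (\<lambda>(k, x). p (v k) x *[rep_module n d M] m k) j
  * transfer_mat d h l Z (\<lambda>(k, x). p (v k) x *[rep_module n d M'] m' k) j = 1\<^sub>m (d j)" (is "?H * ?G = _")
proof (rule eq_matI)
 let ?J = "{(k, x). k < h \<and> x < l k}"
 let ?b = "\<lambda>(k, x). p (v k) x *[rep_module n d M] m k" and ?b' = "\<lambda>(k, x). p (v k) x *[rep_module n d M'] m' k"
 fix r s assume "r < dim_row (1\<^sub>m (d j) :: 'k mat)" "s < dim_col (1\<^sub>m (d j) :: 'k mat)"
 then have rs: "r < d j" "s < d j" by simp_all
 note vl' = C.jordan_gens[OF J']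
 have fin: "finite ?J" using C.jordan_k_basis[OF J] by (simp add: k_basis_def)
 have b'c: "?b' ga \<in> rep_space n d" if "ga \<in> ?J" for ga
  using that lmod_smult_closed[OF rep_left_module[OF M'] C.p_closed[OF vl'(1)] vl'(3)] by auto
 have vert: "?b' ga j $ t = 0" if "ga \<in> ?J" "(v (fst ga) + snd ga) mod n \<noteq> j" "t < d j" for ga t
  using that jordan_vertex_support[OF M' J' _ j] j by auto
 have vert0: "?b ga j $ t = 0" if "ga \<in> ?J" "(v (fst ga) + snd ga) mod n \<noteq> j" "t < d j" for ga t
  using that jordan_vertex_support[OF M J _ j] j by auto
 \<comment> \<open>Summing over the standard basis at \<open>j\<close> rebuilds
   \<open>?b' ga\<close> only if this vector sits at \<open>j\<close>. Vectors at other vertices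
   have zero entries at \<open>j\<close> and are discarded separately below.\<close>
 have 1: "(\<Sum>t<d j. ?b' ga j $ t * Z' be (unit_rep n d (j, t))) = (if be = ga then 1 else 0)"
  if be: "be \<in> ?J" and ga: "ga \<in> ?J" and gaj: "(v (fst ga) + snd ga) mod n = j" for be ga
 proof -
  obtain k x k' x' where be': "be = (k, x)" "k < h" "x < l k" and ga': "ga = (k', x')" "k' < h" "x' < l k'"
   using be ga by auto
  have "Z' be (?b' ga) = (\<Sum>t<d j. ?b' ga j $ t * Z' be (unit_rep n d (j, t)))"
  proof (rule supported_functional[OF M' j b'c[OF ga]])
   show "?b' ga i = 0\<^sub>v (d i)" if "i < n" "i \<noteq> j" for i
    using jordan_vertex_support[OF M' J' ga'(2) that(1), of x'] that(2) gaj ga' by simp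
   show "Z' be (x +[rep_module n d M'] y) = Z' be x + Z' be y" if "x \<in> rep_space n d" "y \<in> rep_space n d" for x y
    unfolding be'(1) by (rule C.jordan_Z_add[OF J' be'(2,3), unfolded rep_module_simps(1), OF that])
   show "Z' be (scalar A a *[rep_module n d M'] x) = a * Z' be x" if "x \<in> rep_space n d" for a x
    unfolding be'(1) by (rule C.jordan_Z_scalar[OF J' be'(2,3), unfolded rep_module_simps(1), OF that])
  qed
  then show ?thesis using C.jordan_Z_pm[OF J' be'(2,3) ga'(2), of x'] be' ga' by simp
 qed
 have "(?H * ?G) $$ (r, s) = (\<Sum>t<d j. (\<Sum>be\<in>?J. Z' be (unit_rep n d (j, t)) * ?b be j $ r)
   * (\<Sum>ga\<in>?J. Z ga (unit_rep n d (j, s)) * ?b' ga j $ t))"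
  using rs by (simp add: transfer_mat_def scalar_prod_def atLeast0LessThan)
 also have "\<dots> = (\<Sum>t<d j. \<Sum>be\<in>?J. \<Sum>ga\<in>?J. ?b be j $ r * Z ga (unit_rep n d (j, s)) * (?b' ga j $ t * Z' be (unit_rep n d (j, t))))"
  unfolding sum_product by (simp only: mult_ac)
 also have "\<dots> = (\<Sum>be\<in>?J. \<Sum>ga\<in>?J. \<Sum>t<d j. ?b be j $ r * Z ga (unit_rep n d (j, s)) * (?b' ga j $ t * Z' be (unit_rep n d (j, t))))"
  by (subst sum.swap, rule sum.cong[OF refl], rule sum.swap)
 also have "\<dots> = (\<Sum>be\<in>?J. \<Sum>ga\<in>?J. ?b be j $ r * Z ga (unit_rep n d (j, s)) * (\<Sum>t<d j. ?b' ga j $ t * Z' be (unit_rep n d (j, t))))"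
  by (simp only: sum_distrib_left)
 also have "\<dots> = (\<Sum>be\<in>?J. \<Sum>ga\<in>?J. if be = ga then Z ga (unit_rep n d (j, s)) * ?b be j $ r else 0)"
 proof (rule sum.cong[OF refl], rule sum.cong[OF refl])
  fix be ga assume bega: "be \<in> ?J" "ga \<in> ?J"
  show "?b be j $ r * Z ga (unit_rep n d (j, s)) * (\<Sum>t<d j. ?b' ga j $ t * Z' be (unit_rep n d (j, t)))
   = (if be = ga then Z ga (unit_rep n d (j, s)) * ?b be j $ r else 0)"
  proof (cases "(v (fst ga) + snd ga) mod n = j")
   case True
   show ?thesis unfolding 1[OF bega True] by simp
  next
   case False
   have "(\<Sum>t<d j. ?b' ga j $ t * Z' be (unit_rep n d (j, t))) = 0"
    by (rule sum.neutral) (use vert[OF bega(2) False] in simp)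
   then show ?thesis using vert0[OF bega(2) False rs(1)] by simp
  qed
 qed
 also have "\<dots> = (\<Sum>be\<in>?J. Z be (unit_rep n d (j, s)) * ?b be j $ r)" using fin by simp
 also have "\<dots> = unit_rep n d (j, s) j $ r"
  by (rule rep_coord_expansion[OF M J unit_rep_closed j rs(1), symmetric])
 finally show "(?H * ?G) $$ (r, s) = 1\<^sub>m (d j) $$ (r, s)" using rs j by (simp add: unit_rep_nth)
qed (simp_all add: transfer_mat_def)

text \<open>An arrow acts on both Jordan bases by the same rule, to the next position or to zero, so
  it has the same entries with respect to both. The calculation rewrites the two products in terms
  of these entries.\<close>

lemma transfer_mat_intertwines:
 assumes M: "M \<in> mod_variety n I d" and J: "C.jordan_basis (rep_module n d M) h v l m Z"
  and M': "M' \<in> mod_variety n I d" and J': "C.jordan_basis (rep_module n d M') h v l m' Z'"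
  and j: "j < n"
 defines "g \<equiv> transfer_mat d h l Z (\<lambda>(k, x). p (v k) x *[rep_module n d M'] m' k)"
 shows "g ((j + 1) mod n) * M j = M' j * g j"
proof (rule eq_matI)
 let ?J = "{(k, x). k < h \<and> x < l k}" and ?i = "(j + 1) mod n"
 let ?R = "rep_module n d M" and ?R' = "rep_module n d M'"
 let ?b = "\<lambda>(k, x). p (v k) x *[?R] m k" and ?b' = "\<lambda>(k, x). p (v k) x *[?R'] m' k"
 note vl' = C.jordan_gens[OF J']
 note R = rep_left_module[OF M] and R' = rep_left_module[OF M']
 have i: "?i < n" using n by simp
 have pj: "p j 1 \<in> carrier A" by (rule C.p_closed[OF j])
 note Mc = repD[OF variety_rep[OF M] j] and Mc' = repD[OF variety_rep[OF M'] j]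
 have gc: "g t \<in> carrier_mat (d t) (d t)" for t by (simp add: g_def transfer_mat_def)
 show "dim_row (g ?i * M j) = dim_row (M' j * g j)" "dim_col (g ?i * M j) = dim_col (M' j * g j)"
  using gc[of ?i] gc[of j] Mc Mc' by auto
 fix r s assume "r < dim_row (M' j * g j)" "s < dim_col (M' j * g j)"
 then have rs: "r < d ?i" "s < d j" using gc[of j] Mc' by auto
 let ?u = "unit_rep n d (j, s)"
 have pu: "p j 1 *[?R] ?u \<in> rep_space n d"
  by (rule lmod_smult_closed[OF R pj, unfolded rep_module_simps(1), OF unit_rep_closed])
 have Pj: "path_mat n d M j 1 = M j" "path_mat n d M' j 1 = M' j" using j Mc Mc' by auto
 have col: "(p j 1 *[?R] ?u) ?i $ t = M j $$ (t, s)" if "t < d ?i" for t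
  using rep_p[OF M unit_rep_closed j i, of 1 "(j, s)"] Pj Mc that rs by (simp add: unit_rep_self[OF j])
 have row: "(p j 1 *[?R'] y) ?i $ r = (\<Sum>t<d j. M' j $$ (r, t) * y j $ t)" if "y \<in> rep_space n d" for y
  using rep_p[OF M' that j i, of 1] Pj Mc' rs(1) rep_spaceD[OF that j]
  by (simp add: scalar_prod_def atLeast0LessThan)
 have b'c: "?b' ga \<in> rep_space n d" if "ga \<in> ?J" for ga
  using that lmod_smult_closed[OF R' C.p_closed[OF vl'(1)] vl'(3)] by auto
 have step: "Z be (p j 1 *[?R] ?b ga) = Z' be (p j 1 *[?R'] ?b' ga)" if bega: "be \<in> ?J" "ga \<in> ?J" for be ga
 proof -
  obtain k x k' x' where be': "be = (k, x)" "k < h" "x < l k" and ga': "ga = (k', x')" "k' < h" "x' < l k'"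
   using bega by auto
  show ?thesis
   using C.jordan_p_pm[OF J ga'(2) j, of 1 x'] C.jordan_p_pm[OF J' ga'(2) j, of 1 x']
    C.jordan_Z_pm[OF J be'(2,3) ga'(2), of "1 + x'"] C.jordan_Z_pm[OF J' be'(2,3) ga'(2), of "1 + x'"]
    C.jordan_Z_zero[OF J be'(2,3)] C.jordan_Z_zero[OF J' be'(2,3)]
   by (simp add: be'(1) ga'(1) del: rep_module_simps)
 qed
 have Zp: "Z be (p j 1 *[?R] ?u) = (\<Sum>ga\<in>?J. Z ga ?u * Z be (p j 1 *[?R] ?b ga))" if be: "be \<in> ?J" for be
 proof -
  obtain k x where be': "be = (k, x)" "k < h" "x < l k" using be by auto
  have sa: "p j 1 *[?R] (scalar A a *[?R] y) = scalar A a *[?R] (p j 1 *[?R] y)" if "y \<in> carrier ?R" for a y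
   using that pj by (metis lmod_assoc[OF R] C.scalar_closed C.scalar_comm)
  have uc: "?u \<in> carrier ?R" by (simp add: unit_rep_closed)
  show ?thesis
   by (rule C.k_basis_functional[where fi = "\<lambda>y. Z be (p j 1 *[?R] y)", OF R C.jordan_k_basis[OF J]])
    (simp_all add: lmod_smult_r_distr[OF R pj] sa C.jordan_Z_add[OF J be'(2,3)]
     C.jordan_Z_scalar[OF J be'(2,3)] be'(1) lmod_smult_closed[OF R pj] uc del: rep_module_simps One_nat_def)
 qed
 have "(g ?i * M j) $$ (r, s) = (\<Sum>t<d ?i. (\<Sum>be\<in>?J. Z be (unit_rep n d (?i, t)) * ?b' be ?i $ r) * M j $$ (t, s))"
  using rs gc[of ?i] Mc by (simp add: g_def transfer_mat_def scalar_prod_def atLeast0LessThan)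
 also have "\<dots> = (\<Sum>t<d ?i. \<Sum>be\<in>?J. ?b' be ?i $ r * ((p j 1 *[?R] ?u) ?i $ t * Z be (unit_rep n d (?i, t))))"
  by (rule sum.cong) (simp_all add: col sum_distrib_left sum_distrib_right mult_ac del: One_nat_def)
 also have "\<dots> = (\<Sum>be\<in>?J. ?b' be ?i $ r * (\<Sum>t<d ?i. (p j 1 *[?R] ?u) ?i $ t * Z be (unit_rep n d (?i, t))))"
  unfolding sum_distrib_left by (rule sum.swap)
 also have "\<dots> = (\<Sum>be\<in>?J. ?b' be ?i $ r * Z be (p j 1 *[?R] ?u))"
 proof (rule sum.cong[OF refl])
  fix be assume "be \<in> ?J"
  then obtain k x where be': "be = (k, x)" "k < h" "x < l k" by auto
  have "Z be (p j 1 *[?R] ?u) = (\<Sum>t<d ?i. (p j 1 *[?R] ?u) ?i $ t * Z be (unit_rep n d (?i, t)))"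
  proof (rule supported_functional[OF M i pu])
   show "(p j 1 *[?R] ?u) t = 0\<^sub>v (d t)" if "t < n" "t \<noteq> ?i" for t
    using rep_p[OF M unit_rep_closed j that(1), of 1 "(j, s)"] that(2) by simp
   show "Z be (x +[?R] y) = Z be x + Z be y" if "x \<in> rep_space n d" "y \<in> rep_space n d" for x y
    unfolding be'(1) by (rule C.jordan_Z_add[OF J be'(2,3), unfolded rep_module_simps(1), OF that])
   show "Z be (scalar A a *[?R] x) = a * Z be x" if "x \<in> rep_space n d" for a x
    unfolding be'(1) by (rule C.jordan_Z_scalar[OF J be'(2,3), unfolded rep_module_simps(1), OF that])
  qed
  then show "?b' be ?i $ r * (\<Sum>t<d ?i. (p j 1 *[?R] ?u) ?i $ t * Z be (unit_rep n d (?i, t)))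
   = ?b' be ?i $ r * Z be (p j 1 *[?R] ?u)" by simp
 qed
 also have "\<dots> = (\<Sum>be\<in>?J. \<Sum>ga\<in>?J. Z ga ?u * (Z' be (p j 1 *[?R'] ?b' ga) * ?b' be ?i $ r))"
 proof (rule sum.cong[OF refl])
  fix be assume be: "be \<in> ?J"
  have "Z be (p j 1 *[?R] ?u) = (\<Sum>ga\<in>?J. Z ga ?u * Z' be (p j 1 *[?R'] ?b' ga))"
   unfolding Zp[OF be] by (rule sum.cong[OF refl]) (simp only: step[OF be])
  then show "?b' be ?i $ r * Z be (p j 1 *[?R] ?u) = (\<Sum>ga\<in>?J. Z ga ?u * (Z' be (p j 1 *[?R'] ?b' ga) * ?b' be ?i $ r))"
   by (simp only: sum_distrib_left mult_ac)
 qed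
 also have "\<dots> = (\<Sum>ga\<in>?J. Z ga ?u * (\<Sum>be\<in>?J. Z' be (p j 1 *[?R'] ?b' ga) * ?b' be ?i $ r))"
  unfolding sum_distrib_left by (rule sum.swap)
 also have "\<dots> = (\<Sum>ga\<in>?J. Z ga ?u * (p j 1 *[?R'] ?b' ga) ?i $ r)"
 proof (rule sum.cong[OF refl])
  fix ga assume ga: "ga \<in> ?J"
  have "p j 1 *[?R'] ?b' ga \<in> rep_space n d"
   using lmod_smult_closed[OF R' pj, unfolded rep_module_simps(1), OF b'c[OF ga]] .
  from rep_coord_expansion[OF M' J' this i rs(1)]
  show "Z ga ?u * (\<Sum>be\<in>?J. Z' be (p j 1 *[?R'] ?b' ga) * ?b' be ?i $ r) = Z ga ?u * (p j 1 *[?R'] ?b' ga) ?i $ r"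
   by (simp only:)
 qed
 also have "\<dots> = (\<Sum>ga\<in>?J. \<Sum>t<d j. M' j $$ (r, t) * (Z ga ?u * ?b' ga j $ t))"
  by (rule sum.cong[OF refl]) (use row[OF b'c] in \<open>simp add: sum_distrib_left mult_ac del: One_nat_def\<close>)
 also have "\<dots> = (\<Sum>t<d j. M' j $$ (r, t) * (\<Sum>ga\<in>?J. Z ga ?u * ?b' ga j $ t))"
  unfolding sum_distrib_left by (rule sum.swap)
 also have "\<dots> = (M' j * g j) $$ (r, s)"
  using rs gc[of j] Mc' by (simp add: g_def transfer_mat_def scalar_prod_def atLeast0LessThan)
 finally show "(g ?i * M j) $$ (r, s) = (M' j * g j) $$ (r, s)" .
qed

text \<open>The shape given by \<open>h\<close>, \<open>v\<close> and \<open>l\<close> determines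
  the module: the transfer matrices at the vertices form an invertible element of the group that
  carries \<open>M\<close> to \<open>M'\<close>.\<close>

theorem jordan_same_orbit:
 assumes M: "M \<in> mod_variety n I d" and J: "C.jordan_basis (rep_module n d M) h v l m Z"
  and M': "M' \<in> mod_variety n I d" and J': "C.jordan_basis (rep_module n d M') h v l m' Z'"
 shows "M' \<in> rep_orbit n d M"
proof -
 define G where "G = transfer_mat d h l Z (\<lambda>(k, x). p (v k) x *[rep_module n d M'] m' k)"
 define H where "H = transfer_mat d h l Z' (\<lambda>(k, x). p (v k) x *[rep_module n d M] m k)"
 define g where "g = (\<lambda>i\<in>{..<n}. G i)"
 have c: "G j \<in> carrier_mat (d j) (d j)" "H j \<in> carrier_mat (d j) (d j)" for j
  by (simp_all add: G_def H_def transfer_mat_def)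
 have HG: "H j * G j = 1\<^sub>m (d j)" if "j < n" for j
  unfolding G_def H_def by (rule transfer_mat_inverse[OF M J M' J' that])
 have GH: "G j * H j = 1\<^sub>m (d j)" if "j < n" for j
  unfolding G_def H_def by (rule transfer_mat_inverse[OF M' J' M J that])
 have "G i \<in> GL (d i)" if "i < n" for i unfolding GL_iff using c[of i] HG[OF that] GH[OF that] by blast
 then have g: "g \<in> GLd n d" unfolding g_def by (intro restrict_PiE_iff[THEN iffD2]) simp
 have "rep_act n d g M = M'"
 proof
  fix j
  show "rep_act n d g M j = M' j"
  proof (cases "j < n")
   case True
   have i: "(j + 1) mod n < n" using n by simp
   have Mc: "M' j \<in> carrier_mat (d ((j + 1) mod n)) (d j)" by (rule repD[OF variety_rep[OF M'] True])
   have "inv\<^bsub>ring_mat TYPE('k) (d j) ()\<^esub> (g j) = H j"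
    unfolding g_def using True by (simp add: GL_inv_eq[OF c GH HG])
   then have "rep_act n d g M j = G ((j + 1) mod n) * M j * H j"
    using True i by (simp add: rep_act_def g_def)
   also have "G ((j + 1) mod n) * M j = M' j * G j"
    unfolding G_def by (rule transfer_mat_intertwines[OF M J M' J' True])
   also have "M' j * G j * H j = M' j * (G j * H j)" by (rule assoc_mult_mat[OF Mc c])
   also have "\<dots> = M' j" unfolding GH[OF True] by (rule right_mult_one_mat[OF Mc])
   finally show ?thesis .
  next
   case False
   then show ?thesis using variety_rep[OF M'] by (auto simp: rep_act_def rep_def PiE_def extensional_def)
  qed
 qed
 then show ?thesis unfolding rep_orbit_act using g by blast
qed

end

lemma nat_mod_add_cancel:
 assumes "(a + b) mod n = (a + c) mod (n :: nat)"
 shows "b mod n = c mod n"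
proof (cases "b \<le> c")
 case True
 then show ?thesis using assms mod_eq_dvd_iff_nat[of "a + b" "a + c" n] mod_eq_dvd_iff_nat[of b c n] by auto
next
 case False
 then show ?thesis using assms mod_eq_dvd_iff_nat[of "a + c" "a + b" n] mod_eq_dvd_iff_nat[of c b n] by auto
qed

section \<open>Realization of uniserial sums and the test modules\<close>

context nakayama_quotient
begin

lemma path_count_sum:
 fixes h :: nat and v l :: "nat => nat"
 shows "card {(k, x). k < h \<and> x < l k \<and> (v k + x) mod n = j} = (\<Sum>k<h. card {x. x < l k \<and> (v k + x) mod n = j})"
proof -
 have "{(k, x). k < h \<and> x < l k \<and> (v k + x) mod n = j} = (SIGMA k:{..<h}. {x. x < l k \<and> (v k + x) mod n = j})" by auto
 moreover have "card \<dots> = (\<Sum>k<h. card {x. x < l k \<and> (v k + x) mod n = j})" by (rule card_SigmaI) auto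
 ultimately show ?thesis by simp
qed

text \<open>The standard basis at each vertex is labelled by the positions \<open>(k, x)\<close>
  that lie there, and the arrows raise \<open>x\<close> by one. Only nonvanishing of paths is
  exported, because the decomposition of a test module is recovered from that alone.\<close>

lemma uniserial_sum_ex:
 fixes v l :: "nat => nat"
 assumes v: "\<And>k. k < h ==> v k < n" and l: "\<And>k. k < h ==> l k \<le> c (v k)"
  and d: "\<And>j. j < n ==> d j = card {(k, x). k < h \<and> x < l k \<and> (v k + x) mod n = j}"
 shows "\<exists>M\<in>mod_variety n I d. \<forall>k<h. \<forall>x<l k. path_mat n d M (v k) x \<noteq> 0\<^sub>m (d ((v k + x) mod n)) (d (v k))"
proof -
 define L where "L j = {(k, x). k < h \<and> x < l k \<and> (v k + x) mod n = j}" for j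
 have "finite (L j)" for j
 proof -
  have "L j \<subseteq> (SIGMA k:{..<h}. {..<l k})" by (auto simp: L_def)
  then show ?thesis by (rule finite_subset) simp
 qed
 then have "\<exists>f. bij_betw f {0..<card (L j)} (L j)" for j by (rule ex_bij_betw_nat_finite)
 then obtain e where "\<And>j. bij_betw (e j) {0..<card (L j)} (L j)" using choice[of "\<lambda>j f. bij_betw f {0..<card (L j)} (L j)"] by blast
 then have e: "bij_betw (e j) {..<d j} (L j)" if "j < n" for j using d[OF that] by (simp add: L_def atLeast0LessThan)
 have eL: "e j r \<in> L j" if "j < n" "r < d j" for j r using e[OF that(1)] that(2) by (auto simp: bij_betw_def)
 have ei: "e j r = e j s \<longleftrightarrow> r = s" if "j < n" "r < d j" "s < d j" for j r s
  using e[OF that(1)] that(2,3) by (auto simp: bij_betw_def inj_on_def)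
 have es: "\<exists>s<d j. e j s = (k, x)" if "j < n" "(k, x) \<in> L j" for j k x
  using e[OF that(1)] that(2) by (force simp: bij_betw_def)
 define M where "M = (\<lambda>i\<in>{..<n}. Matrix.mat (d ((i + 1) mod n)) (d i)
  (\<lambda>(r, s). if e ((i + 1) mod n) r = (fst (e i s), Suc (snd (e i s))) then 1 else (0 :: 'k)))"
 have Mr: "M \<in> rep n d" unfolding M_def rep_def by (rule restrict_PiE_iff[THEN iffD2]) simp
 have pm: "path_mat n d M i t = Matrix.mat (d ((i + t) mod n)) (d i)
   (\<lambda>(r, s). if e ((i + t) mod n) r = (fst (e i s), snd (e i s) + t) then 1 else 0)" if i: "i < n" for i t
 proof (induction t)
  case 0
  show ?case using i ei by (intro eq_matI) auto
 next
  case (Suc t)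
  let ?j = "(i + t) mod n" and ?j' = "(i + Suc t) mod n"
  have j: "?j < n" "?j' < n" using n by simp_all
  have jj: "(?j + 1) mod n = ?j'" by (simp add: mod_simps)
  have Mj: "M ?j = Matrix.mat (d ?j') (d ?j) (\<lambda>(r, s). if e ?j' r = (fst (e ?j s), Suc (snd (e ?j s))) then 1 else 0)"
   using j(1) unfolding M_def by (simp only: restrict_apply' lessThan_iff jj)
  show ?case
  proof (rule eq_matI)
   fix r s
   assume "r < dim_row (Matrix.mat (d ?j') (d i) (\<lambda>(r, s). if e ?j' r = (fst (e i s), snd (e i s) + Suc t) then 1 else (0 :: 'k)))"
    "s < dim_col (Matrix.mat (d ?j') (d i) (\<lambda>(r, s). if e ?j' r = (fst (e i s), snd (e i s) + Suc t) then 1 else (0 :: 'k)))"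
   then have rs: "r < d ?j'" "s < d i" by simp_all
   obtain k x where kx: "e i s = (k, x)" by fastforce
   have kxL: "k < h" "x < l k" "(v k + x) mod n = i" using eL[OF i rs(2)] unfolding kx by (simp_all add: L_def)
   have "path_mat n d M i (Suc t) $$ (r, s)
    = (\<Sum>w<d ?j. (if e ?j' r = (fst (e ?j w), Suc (snd (e ?j w))) then 1 else 0) * (if e ?j w = (k, x + t) then 1 else (0 :: 'k)))"
    using rs kx by (simp add: Suc Mj scalar_prod_def atLeast0LessThan)
   also have "\<dots> = (\<Sum>w<d ?j. if e ?j w = (k, x + t) then if e ?j' r = (k, x + Suc t) then 1 else 0 else 0)"
    by (rule sum.cong) auto
   also have "\<dots> = (if e ?j' r = (k, x + Suc t) then 1 else 0)"
   proof (cases "e ?j' r = (k, x + Suc t)")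
    case True
    have "(k, x + t) \<in> L ?j"
    proof -
     have "(v k + (x + t)) mod n = ((v k + x) mod n + t) mod n" by (simp add: mod_simps add_ac)
     then show ?thesis using eL[OF j(2) rs(1)] kxL unfolding True by (simp add: L_def)
    qed
    then obtain w0 where w0: "w0 < d ?j" "e ?j w0 = (k, x + t)" using es[OF j(1)] by blast
    have "(\<Sum>w<d ?j. if e ?j w = (k, x + t) then if e ?j' r = (k, x + Suc t) then 1 else 0 else 0)
     = (\<Sum>w<d ?j. if w = w0 then 1 else (0 :: 'k))"
     by (rule sum.cong) (use ei[OF j(1) _ w0(1)] w0(2) True in auto)
    then show ?thesis using w0(1) True by simp
   next
    case False
    show ?thesis unfolding if_not_P[OF False] by (rule sum.neutral) simp
   qed
   finally show "path_mat n d M i (Suc t) $$ (r, s)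
     = Matrix.mat (d ?j') (d i) (\<lambda>(r, s). if e ?j' r = (fst (e i s), snd (e i s) + Suc t) then 1 else 0) $$ (r, s)"
    using rs kx by simp
  qed (use Mj path_mat_closed[OF Mr i, of "Suc t"] in auto)
 qed
 have "path_mat n d M i t = 0\<^sub>m (d ((i + t) mod n)) (d i)" if i: "i < n" and t: "c i \<le> t" for i t
 proof -
  \<comment> \<open>A summand has at most \<open>c i\<close> positions from \<open>x\<close> on,
    because \<open>l k \<le> c (v k) \<le> x + c i\<close>; hence no position is left after
    \<open>c i\<close> steps.\<close>
  have "e ((i + t) mod n) r \<noteq> (fst (e i s), snd (e i s) + t)" if rs: "r < d ((i + t) mod n)" "s < d i" for r s
  proof
   obtain k x where kx: "e i s = (k, x)" by fastforce
   have kxL: "k < h" "x < l k" "(v k + x) mod n = i" using eL[OF i rs(2)] unfolding kx by (simp_all add: L_def)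
   assume "e ((i + t) mod n) r = (fst (e i s), snd (e i s) + t)"
   then have "x + t < l k" using eL[of "(i + t) mod n" r] rs n unfolding kx by (simp add: L_def)
   moreover have "c (v k) \<le> x + c ((v k + x) mod n)" by (rule kupisch_iterate[of n c "v k" x, OF kup v[OF kxL(1)]])
   ultimately show False using l[OF kxL(1)] kxL(3) t by simp
  qed
  then show ?thesis unfolding pm[OF i] by (intro eq_matI) auto
 qed
 then have "M \<in> mod_variety n I d" unfolding I_def mod_variety_iff using Mr by blast
 moreover have "path_mat n d M (v k) x \<noteq> 0\<^sub>m (d ((v k + x) mod n)) (d (v k))" if k: "k < h" "x < l k" for k x
 proof
  assume z: "path_mat n d M (v k) x = 0\<^sub>m (d ((v k + x) mod n)) (d (v k))"
  have j: "(v k + x) mod n < n" using n by simp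
  have "(k, 0) \<in> L (v k)" using k v by (simp add: L_def)
  then obtain s where s: "s < d (v k)" "e (v k) s = (k, 0)" using es[OF v[OF k(1)]] by blast
  have "(k, x) \<in> L ((v k + x) mod n)" using k by (simp add: L_def)
  then obtain r where r: "r < d ((v k + x) mod n)" "e ((v k + x) mod n) r = (k, x)" using es[OF j] by blast
  have "path_mat n d M (v k) x $$ (r, s) = 1" unfolding pm[OF v[OF k(1)]] using r s by simp
  then show False unfolding z using r s by simp
 qed
 ultimately show ?thesis by blast
qed

text \<open>Some summand passes \<open>i\<close> at a position \<open>x\<close> and has
  \<open>c i - 1\<close> further positions, so \<open>x + c i \<le> l k\<close>. On the other hand
  \<open>l k \<le> c (v k) \<le> x + c i\<close>, which forces equality.\<close>

lemma jordan_long_summand: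
 assumes M: "M \<in> mod_variety n I d" and J: "C.jordan_basis (rep_module n d M) h v l m Z" and i: "i < n"
  and nz: "path_mat n d M i (c i - 1) \<noteq> 0\<^sub>m (d ((i + (c i - 1)) mod n)) (d i)"
 obtains k x where "k < h" "(v k + x) mod n = i" "l k = x + c i"
proof -
 let ?t = "c i - 1" and ?R = "rep_module n d M"
 let ?j = "(i + ?t) mod n"
 note R = rep_left_module[OF M] and vl = C.jordan_gens[OF J]
 have j: "?j < n" using n by simp
 note pi = C.p_closed[OF i, of ?t]
 have "\<exists>r<d ?j. \<exists>s<d i. path_mat n d M i ?t $$ (r, s) \<noteq> 0"
 proof (rule ccontr)
  assume "\<not> ?thesis"
  then have "path_mat n d M i ?t = 0\<^sub>m (d ?j) (d i)"
   using path_mat_closed[OF variety_rep[OF M] i, of ?t] by (intro eq_matI) auto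
  then show False using nz by blast
 qed
 then obtain r s where rs: "r < d ?j" "s < d i" "path_mat n d M i ?t $$ (r, s) \<noteq> 0" by blast
 let ?u = "unit_rep n d (i, s)"
 let ?J = "{(k, x). k < h \<and> x < l k}"
 have cl: "p i ?t *[?R] y \<in> rep_space n d" if "y \<in> rep_space n d" for y
  by (rule lmod_smult_closed[OF R pi, unfolded rep_module_simps(1), OF that])
 have pu: "(p i ?t *[?R] ?u) ?j $ r \<noteq> 0"
  using rs(3) unfolding path_mat_unit[OF variety_rep[OF M] i rs(1,2)] p_def
   rep_smult[OF M path_elt_B[OF i] unit_rep_closed] .
 have "\<exists>k<h. \<exists>x<l k. p i ?t *[?R] (p (v k) x *[?R] m k) \<noteq> \<zero>\<^bsub>?R\<^esub>"
 proof (rule ccontr)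
  assume *: "\<not> ?thesis"
  have sa: "p i ?t *[?R] (scalar A a *[?R] y) = scalar A a *[?R] (p i ?t *[?R] y)" if "y \<in> carrier ?R" for a y
   using that pi by (metis lmod_assoc[OF R] C.scalar_closed C.scalar_comm)
  have "(p i ?t *[?R] ?u) ?j $ r = (\<Sum>be\<in>?J. Z be ?u * (p i ?t *[?R] (case be of (k, x) => p (v k) x *[?R] m k)) ?j $ r)"
  proof (rule C.k_basis_functional[where fi = "\<lambda>y. (p i ?t *[?R] y) ?j $ r", OF R C.jordan_k_basis[OF J]])
   fix y z assume yz: "y \<in> carrier ?R" "z \<in> carrier ?R"
   have yz': "p i ?t *[?R] y \<in> rep_space n d" "p i ?t *[?R] z \<in> rep_space n d" using cl yz by simp_all
   show "(p i ?t *[?R] (y +[?R] z)) ?j $ r = (p i ?t *[?R] y) ?j $ r + (p i ?t *[?R] z) ?j $ r"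
    unfolding lmod_smult_r_distr[OF R pi yz]
    using rep_spaceD[OF yz'(1) j] rep_spaceD[OF yz'(2) j] j rs(1) by (simp del: One_nat_def)
  next
   fix a y assume y: "y \<in> carrier ?R"
   then have "p i ?t *[?R] y \<in> rep_space n d" using cl by simp
   then show "(p i ?t *[?R] (scalar A a *[?R] y)) ?j $ r = a * (p i ?t *[?R] y) ?j $ r"
    unfolding sa[OF y] by (rule rep_scalar[OF M _ j rs(1)])
  qed (simp add: unit_rep_closed)
  also have "\<dots> = 0"
  proof (rule sum.neutral, rule ballI)
   fix be assume "be \<in> ?J"
   then have "p i ?t *[?R] (case be of (k, x) => p (v k) x *[?R] m k) = \<zero>\<^bsub>?R\<^esub>" using * by auto
   then show "Z be ?u * (p i ?t *[?R] (case be of (k, x) => p (v k) x *[?R] m k)) ?j $ r = 0"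
    using j rs(1) by simp
  qed
  finally show False using pu by blast
 qed
 then obtain k x where k: "k < h" "x < l k" "p i ?t *[?R] (p (v k) x *[?R] m k) \<noteq> \<zero>\<^bsub>?R\<^esub>" by blast
 then have 1: "i = (sg ^^ x) (v k)" "p (v k) (?t + x) *[?R] m k \<noteq> \<zero>\<^bsub>?R\<^esub>"
  using C.jordan_p_pm[OF J k(1) i, of ?t x] by (auto simp del: rep_module_simps split: if_splits)
 then have "?t + x < l k" using C.jordan_pm_zero[OF J k(1), of "?t + x"] by (metis not_less)
 moreover have vx: "(v k + x) mod n = i" using 1(1) sg_pow_mod[OF vl(1)[OF k(1)]] by simp
 moreover have "l k \<le> c (v k)" by (rule C.jordan_length_le[OF J k(1)])
 moreover have "c (v k) \<le> x + c ((v k + x) mod n)" by (rule kupisch_iterate[of n c "v k" x, OF kup vl(1)[OF k(1)]])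
 ultimately have "l k = x + c i" using c2[OF i] by simp
 then show ?thesis using that[OF k(1) vx] by blast
qed

lemma jordan_total_dim:
 assumes M: "M \<in> mod_variety n I d" and J: "C.jordan_basis (rep_module n d M) h v l m Z"
 shows "(\<Sum>k<h. l k) = (\<Sum>j<n. d j)"
proof -
 let ?J = "{(k, x). k < h \<and> x < l k}"
 have J': "?J = (SIGMA k:{..<h}. {..<l k})" by auto
 have fin: "finite ?J" unfolding J' by simp
 have "(\<Sum>j<n. d j) = (\<Sum>j<n. card {be\<in>?J. (v (fst be) + snd be) mod n = j})"
  by (rule sum.cong[OF refl]) (use rep_jordan_dim[OF M J] in \<open>auto intro!: arg_cong[of _ _ card]\<close>)
 also have "\<dots> = (\<Sum>j<n. \<Sum>be\<in>{be\<in>?J. (v (fst be) + snd be) mod n = j}. 1)" by simp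
 also have "\<dots> = (\<Sum>be\<in>?J. 1)"
  by (rule sum.group[OF fin]) (use n in auto)
 also have "\<dots> = (\<Sum>k<h. l k)" unfolding J' by simp
 finally show ?thesis by simp
qed

text \<open>
 The test modules: the projective at the vertex \<open>i\<close>, of length \<open>c i\<close>, plus the simple module at
 the vertex following its socle.
\<close>

definition "test_v i k = (if k = 0 then i else (i + c i) mod n)" for k :: nat
definition "test_l i k = (if k = 0 then c i else 1)" for k :: nat
definition "test_dim i = (\<lambda>j\<in>{..<n}. card {(k, x). k < 2 \<and> x < test_l i k \<and> (test_v i k + x) mod n = j})"

lemma test_dim:
 assumes "j < n"
 shows "test_dim i j = card {x. x < c i \<and> (i + x) mod n = j} + (if (i + c i) mod n = j then 1 else 0)"
proof -
 have "{x. x < (1 :: nat) \<and> ((i + c i) mod n + x) mod n = j} = (if (i + c i) mod n = j then {0} else {})"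
  by (auto simp: mod_simps)
 then show ?thesis using assms
  by (simp add: test_dim_def path_count_sum lessThan_nat_numeral numeral_2_eq_2 test_l_def test_v_def)
qed

lemma test_total_dim:
 assumes i: "i < n"
 shows "(\<Sum>j<n. test_dim i j) = c i + 1"
proof -
 have "(\<Sum>j<n. card {x. x < c i \<and> (i + x) mod n = j}) = (\<Sum>j<n. \<Sum>x\<in>{x\<in>{..<c i}. (i + x) mod n = j}. 1)"
  by (simp add: Collect_conj_eq)
 also have "\<dots> = (\<Sum>x<c i. 1)" by (rule sum.group) (use n in auto)
 finally have "(\<Sum>j<n. card {x. x < c i \<and> (i + x) mod n = j}) = c i" by simp
 moreover have "(\<Sum>j<n. if (i + c i) mod n = j then 1 else 0) = (1 :: nat)" using n by simp
 ultimately show ?thesis by (simp add: test_dim sum.distrib)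
qed

text \<open>The long summand has length \<open>x + c i\<close>, while the total dimension is
  \<open>c i + 1\<close>, so \<open>x\<close> is 0 or 1. In the first case exactly one simple
  summand remains, and the dimension vector tells its vertex; the second case is excluded by
  \<open>nd\<close>.\<close>

lemma test_jordan_basis:
 assumes M: "M \<in> mod_variety n I (test_dim i)" and i: "i < n" and nd: "\<not> n dvd c i + 1"
  and nz: "path_mat n (test_dim i) M i (c i - 1) \<noteq> 0\<^sub>m (test_dim i ((i + (c i - 1)) mod n)) (test_dim i i)"
 obtains m Z where "C.jordan_basis (rep_module n (test_dim i) M) 2 (test_v i) (test_l i) m Z"
proof -
 let ?d = "test_dim i"
 obtain h v l m Z where J: "C.jordan_basis (rep_module n ?d M) h v l m Z" by (rule rep_jordan_basis_ex[OF M])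
 note vl = C.jordan_gens[OF J]
 obtain k x where k: "k < h" "(v k + x) mod n = i" "l k = x + c i" by (rule jordan_long_summand[OF M J i nz])
 have tot: "(\<Sum>k<h. l k) = c i + 1" using jordan_total_dim[OF M J] test_total_dim[OF i] by simp
 have "(\<Sum>k<h. l k) = l k + (\<Sum>k'\<in>{..<h} - {k}. l k')" using k(1) by (simp add: sum.remove)
 then have rest: "x + (\<Sum>k'\<in>{..<h} - {k}. l k') = 1" using tot k(3) by simp
 have pos: "card K \<le> (\<Sum>k'\<in>K. l k')" if "K \<subseteq> {..<h}" for K
  using sum_mono[of K "\<lambda>_. 1" l] vl(2) that by force
 have dim: "?d j = (\<Sum>k<h. card {x. x < l k \<and> (v k + x) mod n = j})" if "j < n" for j
  using rep_jordan_dim[OF M J that] by (simp add: path_count_sum)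
 \<comment> \<open>Suppose that the module is uniserial of length \<open>c i + 1\<close>, with top
   one step before \<open>i\<close>. It has the dimension vector of the test module only if the top
   equals the vertex after the socle of the projective at \<open>i\<close>, which means that
   \<open>n\<close> divides \<open>c i + 1\<close>.\<close>
 have x: "x = 0"
 proof (rule ccontr)
  assume "x \<noteq> 0"
  then have x1: "x = 1" and z: "(\<Sum>k'\<in>{..<h} - {k}. l k') = 0" using rest by linarith+
  have "card ({..<h} - {k}) \<le> 0" using pos[of "{..<h} - {k}"] unfolding z by blast
  then have "{..<h} - {k} = {}" by (simp only: le_zero_eq card_0_eq finite_Diff finite_lessThan)
  then have h: "{..<h} = {k}" using k(1) by blast
  let ?w = "v k"
  have w: "?w < n" by (rule vl(1)[OF k(1)])
  have "?d ?w = card {y. y < Suc (c i) \<and> (?w + y) mod n = ?w}" unfolding dim[OF w] h using k(3) x1 by simp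
  \<comment> \<open>Without its top, the summand runs through the same vertices as the projective at
    \<open>i\<close>, so its dimension at \<open>?w\<close> can be compared with
    \<open>test_dim\<close>.\<close>
  also have "{y. y < Suc (c i) \<and> (?w + y) mod n = ?w} = insert 0 (Suc ` {y. y < c i \<and> (i + y) mod n = ?w})"
  proof (rule Set.set_eqI)
   fix y
   have "(?w + Suc y') mod n = (i + y') mod n" for y'
    unfolding k(2)[symmetric] x1 by (simp add: mod_simps)
   then show "y \<in> {y. y < Suc (c i) \<and> (?w + y) mod n = ?w} \<longleftrightarrow> y \<in> insert 0 (Suc ` {y. y < c i \<and> (i + y) mod n = ?w})"
    using w by (cases y) auto
  qed
  also have "card \<dots> = 1 + card {y. y < c i \<and> (i + y) mod n = ?w}" by (subst card_insert_disjoint) (auto simp: card_image)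
  finally have "(i + c i) mod n = ?w" using test_dim[OF w, of i] by (simp split: if_splits)
  then have "(?w + (c i + 1)) mod n = ?w" unfolding k(2)[symmetric] x1 by (simp add: mod_simps add_ac)
  then have "(?w + (c i + 1)) mod n = (?w + 0) mod n" using w by simp
  then have "(c i + 1) mod n = 0 mod n" by (rule nat_mod_add_cancel)
  then show False using nd by (simp add: dvd_eq_mod_eq_0)
 qed
 then have sum1: "(\<Sum>k'\<in>{..<h} - {k}. l k') = 1" using rest by simp
 have "{..<h} - {k} \<noteq> {}"
 proof
  assume "{..<h} - {k} = {}"
  then show False using sum1 by (simp only: sum.empty zero_neq_one)
 qed
 then obtain k1 where k1: "k1 < h" "k1 \<noteq> k" by auto
 have "card ({..<h} - {k}) \<le> 1" using pos[of "{..<h} - {k}"] sum1 by simp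
 then have s1: "{..<h} - {k} = {k1}" using k1 by (auto simp: card_le_Suc0_iff_eq)
 then have h: "{..<h} = {k, k1}" using k(1) by blast
 have l1: "l k1 = 1" using sum1 unfolding s1 by simp
 have w: "v k1 < n" by (rule vl(1)[OF k1(1)])
 have "{x. x < l k1 \<and> (v k1 + x) mod n = v k1} = {0}" using l1 w by auto
 then have "?d (v k1) = card {y. y < c i \<and> (i + y) mod n = v k1} + 1"
  unfolding dim[OF w] h using k1(2) k x vl(1)[OF k(1)] by simp
 then have v1: "v k1 = (i + c i) mod n" using test_dim[OF w, of i] by (simp split: if_splits)
 let ?pr = "\<lambda>t :: nat. if t = 0 then k else k1"
 have two: "{..<2 :: nat} = {0, 1}" by auto
 have "bij_betw ?pr {..<2} {..<h}" unfolding h two using k1(2) by (auto simp: bij_betw_def)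
 then have "C.jordan_basis (rep_module n ?d M) 2 (test_v i) (test_l i) (m \<circ> ?pr) (\<lambda>(k, x). Z (?pr k, x))"
  by (rule C.jordan_basis_reindex[OF J])
   (use k x l1 v1 vl(1)[OF k(1)] in \<open>auto simp: test_v_def test_l_def\<close>)
 then show ?thesis using that by blast
qed

lemma test_E_invs:
 assumes J: "C.jordan_basis M 2 (test_v i) (test_l i) m Z" and i: "i < n" and nd: "\<not> n dvd c i + 1"
 shows "E_inv A M = 0" "E_inv_minus A M \<noteq> 0"
proof -
 let ?w = "(i + c i) mod n"
 have w: "?w < n" using n by simp
 have n1: "n \<noteq> 1" using nd by auto
 have ww: "?w \<noteq> (?w + 1) mod n"
 proof
  assume "?w = (?w + 1) mod n"
  then have "(i + c i + 0) mod n = (i + c i + 1) mod n" by (simp add: mod_simps)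
  then have "0 mod n = 1 mod n" by (rule nat_mod_add_cancel)
  then show False using n n1 by (cases n) auto
 qed
 \<comment> \<open>The simple summand at \<open>?w\<close> is the nonprojective one, and a
   contribution to \<open>E\<close> needs a generator of the module at the next vertex. The
   generators sit at \<open>?w\<close> and \<open>i\<close>; \<open>ww\<close> excludes the former
   and \<open>nd\<close> the latter.\<close>
 have iw: "i \<noteq> (?w + 1) mod n"
 proof
  assume "i = (?w + 1) mod n"
  then have "(i + (c i + 1)) mod n = (i + 0) mod n" using i by (simp add: mod_simps add_ac)
  then have "(c i + 1) mod n = 0 mod n" by (rule nat_mod_add_cancel)
  then show False using nd by (simp add: dvd_eq_mod_eq_0)
 qed
 have "{(k, (k', x)). k < 2 \<and> test_l i k < c (test_v i k) \<and> k' < 2 \<and> x < test_l i k' \<and> x < test_l i k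
  \<and> (sg ^^ x) (test_v i k') = (sg ^^ test_l i k) (test_v i k)} = {}"
  using ww iw sg_def by (auto simp: test_l_def test_v_def split: if_splits)
 then show "E_inv A M = 0" using C.jordan_E_inv[OF J] by (simp only: card.empty)
 let ?S = "{(k, (k', x)). k < 2 \<and> test_l i k < c (C.tu (test_v i k)) \<and> k' < 2 \<and> x < test_l i k' \<and> x < test_l i k
  \<and> (sg ^^ (test_l i k' - 1 - x)) (test_v i k') = C.tu (test_v i k)}"
 have "sg ((sg ^^ (c i - 1)) i) = (sg ^^ Suc (c i - 1)) i" by simp
 also have "Suc (c i - 1) = c i" using c2[OF i] by simp
 also have "(sg ^^ c i) i = ?w" by (rule sg_pow_mod[OF i])
 finally have "sg ((sg ^^ (c i - 1)) i) = ?w" .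
 then have "C.tu ?w = (sg ^^ (c i - 1)) i" using C.tu(3)[OF C.sg_pow[OF i]] by metis
 moreover have "1 < c (C.tu ?w)" using c2[OF C.tu(1)[OF w]] by simp
 \<comment> \<open>This triple stands for the map from the inverse translate of the simple summand,
   which is the simple module at \<open>C.tu ?w\<close>, onto the socle of the projective
   summand.\<close>
 ultimately have "(1, (0, 0)) \<in> ?S" using c2[OF i] by (simp add: test_l_def test_v_def)
 moreover have "finite ?S"
 proof (rule finite_subset)
  show "?S \<subseteq> {..<2} \<times> {..<2} \<times> {..<c i + 1}" by (auto simp: test_l_def split: if_splits)
 qed simp
 ultimately have "card ?S \<noteq> 0" using card_0_eq[of ?S] by blast
 then show "E_inv_minus A M \<noteq> 0" unfolding C.jordan_E_inv_minus[OF J] .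
qed

end

section \<open>The open orbit of a test module and the theorem\<close>

text \<open>The entries of a path matrix are polynomial functions, by induction on the length of the
  path.\<close>

lemma zero_locus_path_mat_closed:
 assumes i: "i < n"
 shows "closedin (zariski n d) {M \<in> rep n d. path_mat n d M i l = (0\<^sub>m (d ((i + l) mod n)) (d i) :: 'k :: field mat)}"
proof -
 have ex: "\<exists>f\<in>regular_functions n d. \<forall>M\<in>rep n d. path_mat n d M i l $$ (r, s) = (f M :: 'k)"
  if "r < d ((i + l) mod n)" "s < d i" for r s l
  using that(1)
 proof (induction l arbitrary: r)
  case 0
  show ?case
   by (rule bexI[OF _ regular_functions.const[of "if r = s then 1 else 0"]]) (use 0 i that(2) in simp)
 next
  case (Suc l)
  let ?j = "(i + l) mod n" and ?j' = "(i + Suc l) mod n"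
  have j: "?j < n" "(?j + 1) mod n = ?j'" using i by (simp_all add: mod_simps)
  have "\<exists>f. \<forall>t. t < d ?j \<longrightarrow> f t \<in> regular_functions n d \<and> (\<forall>M\<in>rep n d. path_mat n d M i l $$ (t, s) = (f t M :: 'k))"
   by (rule choice) (use Suc.IH in blast)
  then obtain f where f: "\<And>t. t < d ?j ==> f t \<in> regular_functions n d"
   "\<And>t M. t < d ?j ==> M \<in> rep n d ==> path_mat n d M i l $$ (t, s) = (f t M :: 'k)" by blast
  have sum: "(\<lambda>M. \<Sum>t<N. M ?j $$ (r, t) * f t M) \<in> regular_functions n d" if "N \<le> d ?j" for N
   using that
  proof (induction N)
   case 0
   show ?case using regular_functions.const[of 0 n d] by simp
  next
   case (Suc N)
   have "(\<lambda>M. M ?j $$ (r, N)) \<in> regular_functions n d"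
    by (rule regular_functions.coord[OF j(1)]) (use Suc.prems \<open>r < d ?j'\<close> j(2) in simp_all)
   then show ?case
    unfolding sum.lessThan_Suc using Suc f(1)[of N] by (intro regular_functions.add regular_functions.mult) simp_all
  qed
  show ?case
  proof (rule bexI[OF _ sum[OF order_refl]], rule ballI)
   fix M :: "nat => 'k mat" assume M: "M \<in> rep n d"
   have c: "M ?j \<in> carrier_mat (d ?j') (d ?j)" "path_mat n d M i l \<in> carrier_mat (d ?j) (d i)"
    using repD[OF M j(1)] path_mat_closed[OF M i, of l] unfolding j(2) by blast+
   have "path_mat n d M i (Suc l) $$ (r, s) = (\<Sum>t<d ?j. M ?j $$ (r, t) * path_mat n d M i l $$ (t, s))"
    using c Suc.prems that(2) by (simp add: scalar_prod_def atLeast0LessThan)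
   then show "path_mat n d M i (Suc l) $$ (r, s) = (\<Sum>t<d ?j. M ?j $$ (r, t) * f t M)"
    using f(2)[OF _ M] by simp
  qed
 qed
 let ?S = "{..<d ((i + l) mod n)} \<times> {..<d i}"
 have "\<exists>f. \<forall>q\<in>?S. f q \<in> regular_functions n d \<and> (\<forall>M\<in>rep n d. path_mat n d M i l $$ q = (f q M :: 'k))"
 proof (rule bchoice, rule ballI)
  fix q assume "q \<in> ?S"
  then have "fst q < d ((i + l) mod n)" "snd q < d i" by auto
  from ex[OF this, unfolded prod.collapse]
  show "\<exists>y. y \<in> regular_functions n d \<and> (\<forall>M\<in>rep n d. path_mat n d M i l $$ q = (y M :: 'k))" by blast
 qed
 then obtain f where f': "\<forall>q\<in>?S. f q \<in> regular_functions n d \<and> (\<forall>M\<in>rep n d. path_mat n d M i l $$ q = (f q M :: 'k))" ..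
 have f: "f q \<in> regular_functions n d" "\<And>M. M \<in> rep n d ==> path_mat n d M i l $$ q = (f q M :: 'k)" if "q \<in> ?S" for q
  using bspec[OF f' that] by simp_all
 have "{M \<in> rep n d. path_mat n d M i l = 0\<^sub>m (d ((i + l) mod n)) (d i)} = zero_locus n d (f ` ?S)"
 proof (rule Set.set_eqI)
  fix M :: "nat => 'k mat"
  show "M \<in> {M \<in> rep n d. path_mat n d M i l = 0\<^sub>m (d ((i + l) mod n)) (d i)} \<longleftrightarrow> M \<in> zero_locus n d (f ` ?S)"
  proof (cases "M \<in> rep n d")
   case M: True
   have "path_mat n d M i l = 0\<^sub>m (d ((i + l) mod n)) (d i) \<longleftrightarrow> (\<forall>q\<in>?S. path_mat n d M i l $$ q = 0)"
    using path_mat_closed[OF M i, of l] by (auto simp: mat_eq_iff)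
   also have "\<dots> \<longleftrightarrow> (\<forall>q\<in>?S. f q M = 0)" using f(2)[OF _ M] by simp
   finally show ?thesis using M by (simp add: zero_locus_def)
  qed (simp add: zero_locus_def)
 qed
 moreover have "f ` ?S \<subseteq> regular_functions n d" using f(1) by blast
 ultimately show ?thesis unfolding closedin_zariski by blast
qed

lemma irreducible_closure:
 assumes "irreducible_set X S"
 shows "irreducible_set X (Abstract_Topology.closure_of X S)"
 by (rule irreducible_between[OF assms]) (use assms closure_of_subset[of S X] in \<open>auto simp: irreducible_set_def\<close>)

text \<open>An irreducible subset of \<open>V\<close> that meets \<open>O'\<close> is covered by
  \<open>F\<close> and the closure of \<open>O'\<close>; since it is not contained in
  \<open>F\<close>, it lies in the closure. This gives maximality of the closure and also that no
  other component meets \<open>O'\<close>.\<close>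

lemma open_irreducible_component:
 assumes O: "irreducible_set X O'" "O' \<subseteq> V" "O' = V - F" "closedin X F" and V: "closedin X V"
 shows "Abstract_Topology.closure_of X O' \<in> irreducible_components X V"
  and "\<And>C x. C \<in> irreducible_components X V ==> x \<in> C ==> x \<in> O' ==> C = Abstract_Topology.closure_of X O'"
proof -
 let ?C = "Abstract_Topology.closure_of X O'"
 have OC: "O' \<subseteq> ?C" by (rule closure_of_subset) (use O(1) in \<open>simp add: irreducible_set_def\<close>)
 have CV: "?C \<subseteq> V" by (rule closure_of_minimal[OF O(2) V])
 have irr: "irreducible_set X ?C" by (rule irreducible_closure[OF O(1)])
 have key: "C' \<subseteq> ?C" if "irreducible_set X C'" "C' \<subseteq> V" "x \<in> C'" "x \<in> O'" for C' x
 proof -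
  have "C' \<subseteq> F \<union> ?C" using that(2) O(3) OC by blast
  moreover have "\<not> C' \<subseteq> F" using that(3,4) O(3) by blast
  ultimately show ?thesis
   using that(1) O(4) closedin_closure_of[of X O'] unfolding irreducible_set_def by blast
 qed
 obtain x0 where x0: "x0 \<in> O'" using O(1) by (auto simp: irreducible_set_def)
 show "?C \<in> irreducible_components X V"
  unfolding irreducible_components_def
 proof (intro CollectI conjI CV irr allI impI, elim conjE)
  fix C' assume C': "C' \<subseteq> V" "irreducible_set X C'" "?C \<subseteq> C'"
  have "C' \<subseteq> ?C" by (rule key[OF C'(2,1) _ x0]) (use C'(3) OC x0 in blast)
  then show "C' = ?C" using C'(3) by blast
 qed
 show "C = ?C" if "C \<in> irreducible_components X V" "x \<in> C" "x \<in> O'" for C x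
 proof -
  have C: "C \<subseteq> V" "irreducible_set X C" "\<And>C'. C' \<subseteq> V ==> irreducible_set X C' ==> C \<subseteq> C' ==> C' = C"
   using that(1) by (auto simp: irreducible_components_def)
  have "C \<subseteq> ?C" by (rule key[OF C(2,1) that(2,3)])
  from C(3)[OF CV irr this] show ?thesis by simp
 qed
qed

context nakayama_quotient
begin

lemma mod_variety_closed: "closedin (zariski n d) (mod_variety n I d)"
proof -
 let ?F = "\<lambda>(i, l). {M \<in> rep n d. path_mat n d M i l = (0\<^sub>m (d ((i + l) mod n)) (d i) :: 'k mat)}"
 have "mod_variety n I d = \<Inter> (insert (rep n d) (?F ` {(i, l). i < n \<and> c i \<le> l}))"
  unfolding I_def by (auto simp: mod_variety_iff)
 moreover have "closedin (zariski n d) (\<Inter> (insert (rep n d) (?F ` {(i, l). i < n \<and> c i \<le> l})))"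
  using closedin_topspace[of "zariski n d"] by (intro closedin_Inter) (auto simp: zero_locus_path_mat_closed)
 ultimately show ?thesis by simp
qed

end

theorem Irr_tau_neq_Irr_tau_minus:
 fixes c :: "nat => nat" and I :: "(nat \<times> nat => 'k :: alg_closed_field) set"
 assumes n: "0 < n" and kup: "\<And>i. i < n ==> c i \<le> Suc (c ((i + 1) mod n))" and c2: "\<And>i. i < n ==> 2 \<le> c i"
  and I: "I = long_ideal n c" and i: "i < n" and nd: "\<not> n dvd c i + 1"
 shows "Irr_tau n I \<noteq> Irr_tau_minus n I"
proof -
 interpret N: nakayama_quotient n c "nakayama_algebra n (long_ideal n c)"
   "path_algebra n :: ('k, _) module" "long_ideal n c"
  by unfold_locales (use n kup c2 in auto)
 let ?A = "nakayama_algebra n I" and ?d = "N.test_dim i"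
 let ?X = "zariski n ?d" and ?V = "mod_variety n I ?d"
 define F where "F = {M \<in> rep n ?d. path_mat n ?d M i (c i - 1) = (0\<^sub>m (?d ((i + (c i - 1)) mod n)) (?d i) :: 'k mat)}"
 define O' where "O' = ?V - F"
 have ex: "\<exists>M\<in>mod_variety n (long_ideal n c) ?d. \<forall>k<2. \<forall>x<N.test_l i k.
   path_mat n ?d M (N.test_v i k) x \<noteq> (0\<^sub>m (?d ((N.test_v i k + x) mod n)) (?d (N.test_v i k)) :: 'k mat)"
 proof (rule N.uniserial_sum_ex)
  have j: "(i + c i) mod n < n" using n by simp
  show "N.test_v i k < n" for k using i j by (simp add: N.test_v_def)
  show "N.test_l i k \<le> c (N.test_v i k)" for k using c2[OF j] by (simp add: N.test_v_def N.test_l_def)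
 qed (simp add: N.test_dim_def)
 then obtain M0 where M0: "M0 \<in> ?V"
  "path_mat n ?d M0 i (c i - 1) \<noteq> (0\<^sub>m (?d ((i + (c i - 1)) mod n)) (?d i) :: 'k mat)"
 proof -
  assume *: "\<And>M0. M0 \<in> ?V ==>
   path_mat n ?d M0 i (c i - 1) \<noteq> (0\<^sub>m (?d ((i + (c i - 1)) mod n)) (?d i) :: 'k mat) ==> thesis"
  obtain M where M: "M \<in> mod_variety n (long_ideal n c) ?d" "\<And>k x. k < 2 ==> x < N.test_l i k ==>
   path_mat n ?d M (N.test_v i k) x \<noteq> (0\<^sub>m (?d ((N.test_v i k + x) mod n)) (?d (N.test_v i k)) :: 'k mat)"
   using ex by blast
  have v: "N.test_v i 0 = i" and l: "c i - 1 < N.test_l i 0" using c2[OF i] by (simp_all add: N.test_v_def N.test_l_def)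
  show thesis by (rule *[of M]) (use M(1) I M(2)[OF _ l, unfolded v] in simp_all)
 qed
 have M0r: "M0 \<in> rep n ?d" by (rule N.variety_rep) (use M0(1) I in simp)
 have M0O: "M0 \<in> O'" using M0 by (simp add: O'_def F_def)
 have J: "\<exists>m Z. N.C.jordan_basis (rep_module n ?d M) 2 (N.test_v i) (N.test_l i) m Z" if M: "M \<in> O'" for M
 proof -
  have "M \<in> mod_variety n (long_ideal n c) ?d" using M I by (simp add: O'_def)
  moreover have "path_mat n ?d M i (c i - 1) \<noteq> 0\<^sub>m (?d ((i + (c i - 1)) mod n)) (?d i)"
   using M N.variety_rep[of M ?d] I by (auto simp: O'_def F_def)
  ultimately show ?thesis using N.test_jordan_basis[OF _ i nd] by metis
 qed
 have orb: "O' = rep_orbit n ?d M" if M: "M \<in> O'" for M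
 proof
  have MV: "M \<in> mod_variety n (long_ideal n c) ?d" using M I by (simp add: O'_def)
  note Mr = N.variety_rep[OF MV]
  show "O' \<subseteq> rep_orbit n ?d M"
  proof
   fix M' assume M': "M' \<in> O'"
   then have MV': "M' \<in> mod_variety n (long_ideal n c) ?d" using I by (simp add: O'_def)
   obtain m Z m' Z' where
    J1: "N.C.jordan_basis (rep_module n ?d M) 2 (N.test_v i) (N.test_l i) m Z" and
    J2: "N.C.jordan_basis (rep_module n ?d M') 2 (N.test_v i) (N.test_l i) m' Z'"
    using J[OF M] J[OF M'] by blast
   show "M' \<in> rep_orbit n ?d M" by (rule N.jordan_same_orbit[OF MV J1 MV' J2])
  qed
  show "rep_orbit n ?d M \<subseteq> O'"
  proof
   fix M' assume "M' \<in> rep_orbit n ?d M"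
   then obtain g where g: "g \<in> GLd n ?d" "M' = rep_act n ?d g M" unfolding rep_orbit_act by blast
   have "M' \<in> ?V" unfolding g(2) I mod_variety_iff
    using rep_act_rep[OF g(1) Mr] path_mat_act_zero_iff[OF g(1) Mr] MV[unfolded mod_variety_iff] by blast
   moreover have "M' \<notin> F" using M path_mat_act_zero_iff[OF g(1) Mr i] Mr by (simp add: g(2) O'_def F_def)
   ultimately show "M' \<in> O'" by (simp add: O'_def)
  qed
 qed
 have Fc: "closedin ?X F" unfolding F_def by (rule zero_locus_path_mat_closed[OF i])
 have Vc: "closedin ?X ?V" unfolding I by (rule N.mod_variety_closed)
 have irr: "irreducible_set ?X O'" unfolding orb[OF M0O] by (rule orbit_closure_growth(1)[OF M0r])
 define C where "C = Abstract_Topology.closure_of ?X O'"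
 have OV: "O' \<subseteq> ?V" by (simp add: O'_def)
 have OX: "O' \<subseteq> topspace ?X" using irr by (simp add: irreducible_set_def)
 note comp = open_irreducible_component[OF irr OV O'_def Fc Vc, folded C_def]
 have CV: "C \<subseteq> ?V" using comp(1) by (simp add: irreducible_components_def)
 have OC: "O' \<subseteq> C" unfolding C_def by (rule closure_of_subset[OF OX])
 have cinv: "c_inv n I ?d M = 0" if M: "M \<in> O'" for M
 proof -
  have Mr: "M \<in> rep n ?d" by (rule N.variety_rep) (use M OV I in blast)
  \<comment> \<open>\<open>c_inv\<close> takes the union of all components through \<open>M\<close>.
    For a point of the open orbit this union is \<open>C\<close> alone, so
    \<open>orbit_closure_dim\<close> applies.\<close>
  have "{C' \<in> irreducible_components ?X ?V. M \<in> C'} = {C}" using comp M OC by blast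
  then have "mod_union n I ?d M = C" by (simp add: mod_union_def)
  then show ?thesis unfolding c_inv_def using orbit_closure_dim[OF Mr, of C] by (simp add: C_def orb[OF M])
 qed
 have E: "E_inv ?A (rep_module n ?d M) = 0" "E_inv_minus ?A (rep_module n ?d M) \<noteq> 0" if M: "M \<in> O'" for M
 proof -
  obtain m Z where J1: "N.C.jordan_basis (rep_module n ?d M) 2 (N.test_v i) (N.test_l i) m Z" using J[OF M] by blast
  show "E_inv ?A (rep_module n ?d M) = 0" "E_inv_minus ?A (rep_module n ?d M) \<noteq> 0"
   using N.test_E_invs[OF J1 i nd] I by simp_all
 qed
 have dC: "(?d, C) \<in> Irr n I" unfolding Irr_def using comp(1) by (simp add: dim_vectors_def N.test_dim_def)
 have Oopen: "openin (subtopology ?X C) O'"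
 proof -
  have "O' = C - F" using CV OC by (auto simp: O'_def)
  also have "\<dots> = C \<inter> (topspace ?X - F)" using closure_of_subset_topspace[of ?X O'] by (auto simp: C_def)
  finally show ?thesis unfolding openin_subtopology using openin_diff[OF openin_topspace Fc] by (metis Int_commute)
 qed
 have "Abstract_Topology.closure_of (subtopology ?X C) O' = C"
  unfolding closure_of_subtopology using OC by (simp add: C_def Int_absorb1)
 then have "generically ?X C (tau_regular n I ?d)"
  unfolding generically_def using Oopen cinv E(1) by (auto simp: tau_regular_def zero_enat_def intro!: exI[of _ O'])
 then have "(?d, C) \<in> Irr_tau n I" unfolding Irr_tau_def using dC by simp
 moreover have "(?d, C) \<notin> Irr_tau_minus n I"
 proof
  assume "(?d, C) \<in> Irr_tau_minus n I"
  then obtain U where U: "openin (subtopology ?X C) U" "Abstract_Topology.closure_of (subtopology ?X C) U = C"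
   "\<forall>M\<in>U. tau_minus_regular n I ?d M" by (auto simp: Irr_tau_minus_def generically_def)
  \<comment> \<open>A dense set of \<tau>-inverse regular points would meet the open orbit, where
    \<open>c_inv\<close> is 0 but \<open>E_inv_minus\<close> is not.\<close>
  have "M0 \<in> Abstract_Topology.closure_of (subtopology ?X C) U" using U(2) M0O OC by blast
  then obtain M where M: "M \<in> U" "M \<in> O'" using Oopen M0O unfolding in_closure_of by blast
  then have "c_inv n I ?d M = enat (E_inv_minus ?A (rep_module n ?d M))" using U(3) by (simp add: tau_minus_regular_def)
  then show False using cinv[OF M(2)] E(2)[OF M(2)] by (simp add: zero_enat_def)
 qed
 ultimately show ?thesis by blast
qed

text \<open>As \<open>E_inv\<close> and \<open>E_inv_minus\<close> agree at every point of the
  variety, the two regularity conditions are the same there, and no geometry of the components is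
  involved.\<close>

theorem Irr_tau_eq_Irr_tau_minus:
 fixes I :: "(nat \<times> nat => 'k :: field) set"
 assumes n: "0 < n" and L: "2 \<le> L" "n dvd L + 1" and I: "I = long_ideal n (\<lambda>_. L)"
 shows "Irr_tau n I = Irr_tau_minus n I"
proof -
 interpret N: nakayama_quotient n "\<lambda>_. L" "nakayama_algebra n (long_ideal n (\<lambda>_. L))"
   "path_algebra n :: ('k, _) module" "long_ideal n (\<lambda>_. L)"
  by unfold_locales (use n L in auto)
 have reg: "tau_regular n I d M \<longleftrightarrow> tau_minus_regular n I d M" if M: "M \<in> mod_variety n I d" for d M
 proof -
  obtain h v l m Z where J: "N.C.jordan_basis (rep_module n d M) h v l m Z"
   by (rule N.rep_jordan_basis_ex) (use M I in auto)
  have per: "(N.sg ^^ (L + 1)) j = j" if "j < n" for j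
  proof -
   have "(j + (L + 1)) mod n = j mod n" using L(2) by (metis mod_add_right_eq add_0_right dvd_imp_mod_0)
   then show ?thesis using N.sg_pow_mod[OF that, of "L + 1"] that by simp
  qed
  have "E_inv (nakayama_algebra n I) (rep_module n d M) = E_inv_minus (nakayama_algebra n I) (rep_module n d M)"
   unfolding I by (rule N.C.E_inv_eq_E_inv_minus[OF _ per J]) simp_all
  then show ?thesis by (simp add: tau_regular_def tau_minus_regular_def)
 qed
 have gen: "generically (zariski n d) C (tau_regular n I d) \<longleftrightarrow> generically (zariski n d) C (tau_minus_regular n I d)"
  if "(d, C) \<in> Irr n I" for d C
 proof -
  have "C \<subseteq> mod_variety n I d" using that by (simp add: Irr_def irreducible_components_def)
  moreover have "U \<subseteq> C" if "openin (subtopology (zariski n d) C) U" for U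
   using openin_subset[OF that] by auto
  ultimately have "(\<forall>M\<in>U. tau_regular n I d M) \<longleftrightarrow> (\<forall>M\<in>U. tau_minus_regular n I d M)"
   if "openin (subtopology (zariski n d) C) U" for U using reg that by blast
  then show ?thesis unfolding generically_def by blast
 qed
 then show ?thesis unfolding Irr_tau_def Irr_tau_minus_def by auto
qed

theorem proposition1p10:
  fixes n :: nat and I :: "(nat \<times> nat \<Rightarrow> 'k :: alg_closed_field) set"
  assumes "n \<ge> 1" and "nakayama_ideal n I"
  shows "Irr_tau n I = Irr_tau_minus n I \<longleftrightarrow>
    (\<exists>r::nat. (n = 2 \<longrightarrow> r \<ge> 1) \<and> (n = 1 \<longrightarrow> r \<ge> 2) \<and>
       I = ideal_power (path_algebra n) (arrow_ideal n) ((n - 1) + n * r))"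
proof -
 have n: "0 < n" using assms(1) by simp
 obtain c where kup: "\<And>i. i < n ==> c i \<le> Suc (c ((i + 1) mod n))" and c2: "\<And>i. i < n ==> 2 \<le> c i"
  and I: "I = long_ideal n c"
  by (rule nakayama_ideal_long_ideal[OF n assms(2)]) blast
 show ?thesis
 proof
  assume eq: "Irr_tau n I = Irr_tau_minus n I"
  have dv: "n dvd c i + 1" if "i < n" for i
   using Irr_tau_neq_Irr_tau_minus[OF n kup c2 I that] eq by blast
  \<comment> \<open>Along an arrow \<open>c\<close> can drop by at most 1. If it drops by 1 while
    both values are -1 modulo \<open>n\<close>, then \<open>n = 1\<close>, and the two vertices
    coincide.\<close>
  have step: "c i \<le> c ((i + 1) mod n)" if i: "i < n" for i
  proof (rule ccontr)
   let ?j = "(i + 1) mod n"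
   assume *: "\<not> c i \<le> c ?j"
   then have "c i = Suc (c ?j)" using kup[OF i] by simp
   moreover have "n dvd c ?j + 1" "n dvd c i + 1" using dv[OF i] dv[of ?j] n by simp_all
   ultimately have "n dvd (c i + 1) - (c ?j + 1)" by (intro dvd_diff_nat)
   then have "n = 1" using \<open>c i = Suc (c ?j)\<close> by simp
   then show False using * i by simp
  qed
  have mono: "c i \<le> c ((i + k) mod n)" if i: "i < n" for i k
  proof (induction k)
   case (Suc k)
   have "c ((i + k) mod n) \<le> c (((i + k) mod n + 1) mod n)" by (rule step) (use n in simp)
   then show ?case using Suc by (simp add: mod_simps)
  qed (use i in simp)
  \<comment> \<open>A function that never decreases around a cycle is constant: compare 0 with
    \<open>i\<close>, and go from \<open>i\<close> in \<open>n - i\<close> steps back to 0.\<close>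
  have const: "c i = c 0" if i: "i < n" for i
   using mono[OF n, of i] mono[OF i, of "n - i"] i by simp
  let ?L = "c 0"
  obtain t where t: "?L + 1 = n * t" using dv[OF n] by (auto elim: dvdE)
  then obtain r where r: "t = Suc r" by (cases t) auto
  have L: "?L = (n - 1) + n * r" using t r n by (simp add: algebra_simps)
  have "I = long_ideal n (\<lambda>_. ?L)" unfolding I by (rule long_ideal_cong) (rule const)
  then have "I = ideal_power (path_algebra n) (arrow_ideal n) ((n - 1) + n * r)"
   unfolding ideal_power_arrow_ideal[OF n] L[symmetric] .
  \<comment> \<open>The conditions on \<open>r\<close> express \<open>2 \<le> c 0\<close>; for
    \<open>n \<ge> 3\<close> this bound holds even for \<open>r = 0\<close>.\<close>
  moreover have "(n = 2 \<longrightarrow> r \<ge> 1) \<and> (n = 1 \<longrightarrow> r \<ge> 2)" using c2[OF n] L by (cases r) auto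
  ultimately show "\<exists>r::nat. (n = 2 \<longrightarrow> r \<ge> 1) \<and> (n = 1 \<longrightarrow> r \<ge> 2) \<and>
    I = ideal_power (path_algebra n) (arrow_ideal n) ((n - 1) + n * r)" by blast
 next
  assume "\<exists>r::nat. (n = 2 \<longrightarrow> r \<ge> 1) \<and> (n = 1 \<longrightarrow> r \<ge> 2) \<and>
    I = ideal_power (path_algebra n) (arrow_ideal n) ((n - 1) + n * r)"
  then obtain r where I': "I = long_ideal n (\<lambda>_. (n - 1) + n * r)"
   unfolding ideal_power_arrow_ideal[OF n] by blast
  \<comment> \<open>Comparing the two descriptions of \<open>I\<close> transfers the bound
    \<open>2 \<le> c 0\<close> to the exponent of the power of the arrow ideal.\<close>
  then have L: "c 0 = (n - 1) + n * r" using long_ideal_inj[OF I[symmetric, unfolded I'] n] by simp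
  then have "(n - 1) + n * r + 1 = n * Suc r" using n by simp
  then have "n dvd (n - 1) + n * r + 1" by simp
  then show "Irr_tau n I = Irr_tau_minus n I"
   using Irr_tau_eq_Irr_tau_minus[OF n _ _ I'] c2[OF n] L by simp
 qed
qed

end
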